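(* Let $s>2$. There is a constant $K_s>0$ such that for any real-valued $\psi_0\in H^s(\mathbb R)$ the initial value problem $$\partial_\tau\psi+\partial_\theta a(\psi,\psi)=0,\qquad \psi(\theta,0)=\psi_0(\theta),$$ where the bilinear form $a$ is defined by $$\widehat{a(\psi,\phi)}(k,\tau)=\int_{-\infty}^{+\infty}S(k-\ell,\ell)\,\hat\psi(k-\ell,\tau)\,\hat\phi(\ell,\tau)\,d\ell,\qquad S(k,\ell)=\frac{2\,|k\,\ell\,(k+\ell)|^{1/2}}{|k+\ell|+|k|+|\ell|}\ \ (S(k,\ell)=0\text{ if }k\ell=0),$$ has a unique local solution $$\psi\in C(I;H^s(\mathbb R))\cap C^1(I;H^{s-1}(\mathbb R))$$ defined on the time interval $I=(-\tau_*,\tau_* )$, where $$\tau_*=\frac{1}{K_s\,\|\psi_0\|_{L^2(\mathbb R)}^{1-2/s}\,\|\psi_0\|_{H^s(\mathbb R)}^{2/s}}.$$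
   Context: Functions $\psi(\theta,\tau)$ are real-valued, $\theta\in\mathbb R$. Fourier transform in $\theta$: $\hat\psi(k,\tau)=\frac1{2\pi}\int_{-\infty}^{+\infty}\psi(\theta,\tau)e^{-ik\theta}\,d\theta$. Norms: $\|\psi\|_{L^2(\mathbb R)}=\left(\int_{-\infty}^{+\infty}|\hat\psi(k)|^2dk\right)^{1/2}$ and $\|\psi\|_{H^s(\mathbb R)}=\left(\int_{-\infty}^{+\infty}(1+|k|^{2s})|\hat\psi(k)|^2dk\right)^{1/2}$. If $\psi_0=0$, $\tau_*$ is understood as $+\infty$. The kernel arises as $S(k,\ell)=\Lambda(k,\ell)/|k\ell(k+\ell)|^{1/2}$ with $\Lambda(k,\ell)=\frac{2|k+\ell||k||\ell|}{|k+\ell|+|k|+|\ell|}$. *)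

theory Defs
  imports "HOL-Analysis.Analysis"
begin

text \<open>
  Elements of function spaces on the real line are represented by Borel functions; two such
  functions denote the same element iff they agree almost everywhere. A function
  \<open>\<psi>(\<theta>, \<tau>)\<close> is represented by the curve \<open>\<tau> \<mapsto> \<psi> \<tau>\<close> of its time slices \<open>\<psi> \<tau> :: real \<Rightarrow> real\<close>.
\<close>

definition L2 :: "(real \<Rightarrow> 'a::{banach, second_countable_topology}) set" where
  "L2 = {f. f \<in> borel_measurable lborel \<and> integrable lborel (\<lambda>x. (norm (f x))\<^sup>2)}"

text \<open>
  The Fourier transform of an \<open>L2\<close> function (not necessarily integrable) is, as usual, the limit
  in the mean of the Fourier integrals over \<open>[-N, N]\<close>. By Plancherel's theorem this limit exists
  and is unique up to null sets; \<open>fourier\<close> selects a representative. The distance is a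
  nonnegative (possibly infinite) integral, so it cannot vanish for lack of integrability.
\<close>

definition truncated_fourier :: "(real \<Rightarrow> real) \<Rightarrow> real \<Rightarrow> real \<Rightarrow> complex" where
  "truncated_fourier f N k =
     1 / (2 * pi) * (LINT \<theta>:{-N..N}|lborel. complex_of_real (f \<theta>) * exp (- \<i> * k * \<theta>))"

definition is_fourier :: "(real \<Rightarrow> real) \<Rightarrow> (real \<Rightarrow> complex) \<Rightarrow> bool" where
  "is_fourier f g \<longleftrightarrow> g \<in> L2 \<and>
     ((\<lambda>N. \<integral>\<^sup>+ k. ennreal ((cmod (truncated_fourier f N k - g k))\<^sup>2) \<partial>lborel) \<longlongrightarrow> 0) at_top"

definition fourier :: "(real \<Rightarrow> real) \<Rightarrow> real \<Rightarrow> complex" where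
  "fourier f = (SOME g. is_fourier f g)"

definition L2_norm :: "(real \<Rightarrow> real) \<Rightarrow> real" where
  "L2_norm f = sqrt (LINT k|lborel. (cmod (fourier f k))\<^sup>2)"

definition sobolev :: "real \<Rightarrow> (real \<Rightarrow> real) set" where
  "sobolev s =
     {f \<in> L2. integrable lborel (\<lambda>k. (1 + \<bar>k\<bar> powr (2 * s)) * (cmod (fourier f k))\<^sup>2)}"

definition sobolev_norm :: "real \<Rightarrow> (real \<Rightarrow> real) \<Rightarrow> real" where
  "sobolev_norm s f =
     sqrt (LINT k|lborel. (1 + \<bar>k\<bar> powr (2 * s)) * (cmod (fourier f k))\<^sup>2)"

definition continuous_sobolev :: "real \<Rightarrow> real set \<Rightarrow> (real \<Rightarrow> real \<Rightarrow> real) \<Rightarrow> bool" where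
  "continuous_sobolev s I \<psi> \<longleftrightarrow>
     (\<forall>\<tau>\<in>I. \<psi> \<tau> \<in> sobolev s) \<and>
     (\<forall>\<tau>\<in>I. ((\<lambda>t. sobolev_norm s (\<lambda>\<theta>. \<psi> t \<theta> - \<psi> \<tau> \<theta>)) \<longlongrightarrow> 0) (at \<tau> within I))"

text \<open>
  \<open>C1_sobolev s I \<psi> \<psi>'\<close>: the curve \<open>\<psi>\<close> is continuously differentiable on \<open>I\<close> with values in
  \<open>sobolev s\<close>, and \<open>\<psi>'\<close> is its derivative in the norm of that space.
\<close>

definition C1_sobolev ::
    "real \<Rightarrow> real set \<Rightarrow> (real \<Rightarrow> real \<Rightarrow> real) \<Rightarrow> (real \<Rightarrow> real \<Rightarrow> real) \<Rightarrow> bool" where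
  "C1_sobolev s I \<psi> \<psi>' \<longleftrightarrow>
     continuous_sobolev s I \<psi> \<and> continuous_sobolev s I \<psi>' \<and>
     (\<forall>\<tau>\<in>I. ((\<lambda>t. sobolev_norm s (\<lambda>\<theta>. (\<psi> t \<theta> - \<psi> \<tau> \<theta>) / (t - \<tau>) - \<psi>' \<tau> \<theta>)) \<longlongrightarrow> 0)
              (at \<tau> within I))"

text \<open>
  Weak derivative of \<open>L2\<close> functions, tested against continuously differentiable functions of
  compact support.
\<close>

definition has_weak_deriv :: "(real \<Rightarrow> real) \<Rightarrow> (real \<Rightarrow> real) \<Rightarrow> bool" where
  "has_weak_deriv f g \<longleftrightarrow> f \<in> L2 \<and> g \<in> L2 \<and>
     (\<forall>\<phi> \<phi>'. (\<forall>x. (\<phi> has_real_derivative \<phi>' x) (at x)) \<longrightarrow> continuous_on UNIV \<phi>' \<longrightarrow>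
        (\<exists>R. \<forall>x. \<bar>x\<bar> > R \<longrightarrow> \<phi> x = 0) \<longrightarrow>
        (LINT x|lborel. f x * \<phi>' x) = - (LINT x|lborel. g x * \<phi> x))"

definition S :: "real \<Rightarrow> real \<Rightarrow> real" where
  "S k l = (if k * l = 0 then 0
            else 2 * \<bar>k * l * (k + l)\<bar> powr (1/2) / (\<bar>k + l\<bar> + \<bar>k\<bar> + \<bar>l\<bar>))"

text \<open>
  \<open>is_form_a \<psi> \<phi> w\<close>: the function \<open>w\<close> is \<open>a(\<psi>, \<phi>)\<close>, which is specified (up to null sets) by its
  Fourier transform. For \<open>\<psi>\<close>, \<open>\<phi>\<close> in \<open>sobolev s\<close> with \<open>s > 2\<close> the integral converges absolutely
  for every \<open>k\<close>.
\<close>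

definition is_form_a :: "(real \<Rightarrow> real) \<Rightarrow> (real \<Rightarrow> real) \<Rightarrow> (real \<Rightarrow> real) \<Rightarrow> bool" where
  "is_form_a \<psi> \<phi> w \<longleftrightarrow> w \<in> L2 \<and>
     (AE k in lborel. fourier w k =
        (LINT l|lborel. complex_of_real (S (k - l) l) * fourier \<psi> (k - l) * fourier \<phi> l))"

definition is_solution ::
    "real \<Rightarrow> real set \<Rightarrow> (real \<Rightarrow> real) \<Rightarrow> (real \<Rightarrow> real \<Rightarrow> real) \<Rightarrow> bool" where
  "is_solution s I \<psi>0 \<psi> \<longleftrightarrow>
     continuous_sobolev s I \<psi> \<and>
     (\<exists>\<psi>'. C1_sobolev (s - 1) I \<psi> \<psi>' \<and>
        (\<forall>\<tau>\<in>I. \<exists>w w'. is_form_a (\<psi> \<tau>) (\<psi> \<tau>) w \<and> has_weak_deriv w w' \<and>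
                 (AE \<theta> in lborel. \<psi>' \<tau> \<theta> + w' \<theta> = 0))) \<and>
     (AE \<theta> in lborel. \<psi> 0 \<theta> = \<psi>0 \<theta>)"

definition tau_star :: "real \<Rightarrow> real \<Rightarrow> (real \<Rightarrow> real) \<Rightarrow> ereal" where
  "tau_star K s \<psi>0 =
     (if AE \<theta> in lborel. \<psi>0 \<theta> = 0 then \<infinity>
      else ereal (1 / (K * L2_norm \<psi>0 powr (1 - 2 / s) * sobolev_norm s \<psi>0 powr (2 / s))))"

definition time_interval :: "real \<Rightarrow> real \<Rightarrow> (real \<Rightarrow> real) \<Rightarrow> real set" where
  "time_interval K s \<psi>0 = {\<tau>. - tau_star K s \<psi>0 < ereal \<tau> \<and> ereal \<tau> < tau_star K s \<psi>0}"

end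

theory Submission imports Defs "HOL-Probability.Probability" begin

text \<open>
  Write \<open>u\<close> for the Fourier transform of \<open>\<psi>\<close>. The equation becomes the infinite system
  \<open>u'(k) = - \<i> k \<integral> S (k - l) l u(k - l) u(l) dl\<close>, with \<open>u(- k) = cnj (u k)\<close> because \<open>\<psi>\<close> is real.
  The term looks as if it lost a derivative. It does not, for the following reason. On the plane
  \<open>p + q + r = 0\<close> the kernel \<open>S p q\<close> is invariant under all permutations of \<open>p, q, r\<close>, and it is
  bounded by the square root of the smallest of \<open>|p|, |q|, |r|\<close>. For a weight \<open>w\<close>, the derivative of
  \<open>\<integral> w|k| |u k|\<^sup>2\<close> is therefore, up to a constant factor, the integral over that plane of

    \<open>S p q (p w|p| + q w|q| + r w|r|) u(p) u(q) u(r)\<close>.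

  Since \<open>p + q + r = 0\<close>, the two large terms in the bracket nearly cancel: if \<open>w\<close> increases and grows at
  most polynomially, the bracket is at most a constant times the smallest frequency times
  \<open>sqrt (w w)\<close> at the two larger ones (\<open>weight_core\<close>). Hence \<open>|d/dt \<parallel>u\<parallel>\<^sup>2| \<le> C A(u) \<parallel>u\<parallel>\<^sup>2\<close> in the
  \<open>w\<close>-weighted norm, where \<open>A(u) = \<integral> |p|\<^bsup>3/2\<^esup> |u p| dp\<close> (\<open>energy_estimate\<close>). By Cauchy-Schwarz, \<open>A\<close>
  is finite on \<open>H\<^sup>s\<close> as \<open>s > 2\<close>, and rescaling the frequency improves this to
  \<open>A(u) \<le> C \<parallel>u\<parallel>\<^bsub>L2\<^esub>\<^bsup>1-2/s\<^esup> \<parallel>u\<parallel>\<^bsub>Hs\<^esub>\<^bsup>2/s\<^esup>\<close> (\<open>Am_interpolation\<close>). As long as neither norm has more than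
  doubled, \<open>A(u)\<close> is thus at most a fixed multiple of \<open>1/\<tau>\<^sub>*\<close>, small enough for the squared norms to
  grow at most by the factor \<open>exp 1 < 4\<close> up to time \<open>\<tau>\<^sub>*\<close>; so the norms do not double, and the
  estimate closes.

  The difference \<open>d\<close> of two solutions \<open>u, v\<close> satisfies \<open>d' = - \<i> k Q(u + v, d)\<close>, where \<open>Q\<close> is the
  bilinear convolution with kernel \<open>S\<close>. In the pairing with \<open>d\<close> the same symmetry moves the factor
  \<open>k\<close> onto \<open>u + v\<close>, which gives \<open>|d/dt \<parallel>d\<parallel>\<^sup>2| \<le> A(u + v) \<parallel>d\<parallel>\<^sup>2\<close> in \<open>L\<^sup>2\<close> (\<open>difference_estimate\<close>).
  Gronwall's inequality yields uniqueness, and also the convergence of approximations.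

  Solutions are constructed by Euler steps for the equation with all frequencies cut off at \<open>N\<close>.
  The cut-off keeps the symmetry of the kernel, so the energy estimates hold uniformly in \<open>N\<close>, and the
  quadratic error of an Euler step is harmless once the step is small depending on \<open>N\<close>. The
  difference estimate makes the approximations Cauchy in \<open>L\<^sup>2\<close>, and the bounds pass to the limit.
  Continuity in \<open>H\<^sup>s\<close> (rather than boundedness) comes from energy estimates with weights concentrated
  on high frequencies: the tail of \<open>u t\<close> is controlled by that of the initial value, uniformly in
  time. Continuous differentiability in \<open>H\<^bsup>s-1\<^esup>\<close> then follows from a mean value inequality. Negative
  times are obtained by reversing the sign of the nonlinearity.

  Plancherel's identity and the inversion formula translate between real functions and their
  transforms, and weak derivatives correspond to multiplication by \<open>\<i> k\<close>; so solutions of the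
  problem are the same as flows of the system above (\<open>solution_from_flow\<close>, \<open>flow_of_solution\<close>).
\<close>

section \<open>Square-integrable functions\<close>

definition nL2 :: "(real \<Rightarrow> complex) \<Rightarrow> real" where
  "nL2 f = sqrt (LINT x|lborel. (cmod (f x))\<^sup>2)"

lemma L2_measurable [measurable_dest]:
  "f \<in> L2 \<Longrightarrow> f \<in> borel_measurable borel"
  by (simp add: L2_def)

lemma L2_integrable: "f \<in> L2 \<Longrightarrow> integrable lborel (\<lambda>x. (norm (f x))\<^sup>2)"
  by (simp add: L2_def)

lemma L2_I: "f \<in> borel_measurable borel \<Longrightarrow> integrable lborel (\<lambda>x. (norm (f x))\<^sup>2) \<Longrightarrow> f \<in> L2"
  by (simp add: L2_def)

lemma nL2_nonneg [simp]: "0 \<le> nL2 f"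
  by (simp add: nL2_def)

lemma nL2_sq: "(nL2 f)\<^sup>2 = (LINT x|lborel. (cmod (f x))\<^sup>2)"
  by (simp add: nL2_def)

lemma nn_L2:
  assumes "f \<in> L2"
  shows "(\<integral>\<^sup>+x. ennreal ((cmod (f x))\<^sup>2) \<partial>lborel) = ennreal ((nL2 f)\<^sup>2)"
  unfolding nL2_sq by (rule nn_integral_eq_integral[OF L2_integrable[OF assms]]) simp

lemma L2_of_nn:
  assumes [measurable]: "f \<in> borel_measurable borel"
    and le: "(\<integral>\<^sup>+x. ennreal ((cmod (f x))\<^sup>2) \<partial>lborel) \<le> ennreal (c\<^sup>2)" and c: "0 \<le> c"
  shows "f \<in> L2" and "nL2 f \<le> c"
proof -
  have i: "integrable lborel (\<lambda>x. (cmod (f x))\<^sup>2)"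
    using le by (intro integrableI_bounded) (auto simp: ennreal_power le_less_trans[OF _ ennreal_less_top])
  then show f: "f \<in> L2" by (simp add: L2_def)
  have "ennreal ((nL2 f)\<^sup>2) \<le> ennreal (c\<^sup>2)" using nn_L2[OF f] le by simp
  then have "(nL2 f)\<^sup>2 \<le> c\<^sup>2" by simp
  then show "nL2 f \<le> c" using c power2_le_imp_le by blast
qed

lemma L2_bound:
  assumes "f \<in> L2" "g \<in> borel_measurable borel" "\<And>x. norm (g x) \<le> c * norm (f x)"
  shows "g \<in> L2"
proof (rule L2_I[OF assms(2)], rule Bochner_Integration.integrable_bound)
  show "integrable lborel (\<lambda>x. c\<^sup>2 * (norm (f x))\<^sup>2)" using L2_integrable[OF assms(1)] by simp
  show "(\<lambda>x. (norm (g x))\<^sup>2) \<in> borel_measurable lborel" using assms(2) by simp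
  have "norm (g x) ^ 2 \<le> (c * norm (f x))^2" for x
    using power_mono[OF assms(3), of x 2] by simp
  then show "AE x in lborel. norm ((norm (g x))\<^sup>2) \<le> norm (c\<^sup>2 * (norm (f x))\<^sup>2)"
    by (simp add: power_mult_distrib)
qed

lemma L2_cmult: "f \<in> L2 \<Longrightarrow> (\<lambda>x. (c::complex) * f x) \<in> L2"
  by (rule L2_bound[where f=f and c="cmod c"]) (auto simp: norm_mult)

lemma L2_add:
  assumes f: "(f::real\<Rightarrow>'a::{banach,second_countable_topology}) \<in> L2" and g: "g \<in> L2" shows "(\<lambda>x. f x + g x) \<in> L2"
proof (rule L2_I)
  have [measurable]: "f \<in> borel_measurable borel" "g \<in> borel_measurable borel"
    using f g by (auto simp: L2_def)
  show "(\<lambda>x. f x + g x) \<in> borel_measurable borel" by simp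
  show "integrable lborel (\<lambda>x. (norm (f x + g x))\<^sup>2)"
  proof (rule Bochner_Integration.integrable_bound)
    show "integrable lborel (\<lambda>x. 2 * (norm (f x))\<^sup>2 + 2 * (norm (g x))\<^sup>2)"
      using L2_integrable[OF f] L2_integrable[OF g] by auto
    have "(norm (f x + g x))\<^sup>2 \<le> 2 * (norm (f x))\<^sup>2 + 2 * (norm (g x))\<^sup>2" for x
    proof -
      have "(norm (f x + g x))\<^sup>2 \<le> (norm (f x) + norm (g x))\<^sup>2"
        by (intro power_mono norm_triangle_ineq) auto
      also have "\<dots> \<le> 2 * (norm (f x))\<^sup>2 + 2 * (norm (g x))\<^sup>2"
        using sum_squares_bound[of "norm (f x)" "norm (g x)"] by (simp add: power2_sum)
      finally show ?thesis .
    qed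
    then show "AE x in lborel. norm ((norm (f x + g x))\<^sup>2) \<le> norm (2 * (norm (f x))\<^sup>2 + 2 * (norm (g x))\<^sup>2)"
      by auto
  qed simp
qed

lemma L2_uminus: "f \<in> L2 \<Longrightarrow> (\<lambda>x. - f x) \<in> L2"
  by (auto simp: L2_def)

lemma L2_diff: "f \<in> L2 \<Longrightarrow> g \<in> L2 \<Longrightarrow> (\<lambda>x. f x - g x) \<in> L2"
  using L2_add[of f "\<lambda>x. - g x"] L2_uminus[of g] by simp

lemma L2_zero [simp]: "(\<lambda>x. 0) \<in> L2" by (simp add: L2_def)

lemma borel_measurable_cnj [measurable]: "cnj \<in> borel_measurable borel"
  by (intro borel_measurable_continuous_onI continuous_intros)

lemma L2_cnj: "f \<in> L2 \<Longrightarrow> (\<lambda>x. cnj (f x)) \<in> L2"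
  by (rule L2_bound[where f=f and c=1]) (auto intro!: measurable_compose[OF _ borel_measurable_cnj])

lemma L2_affine:
  assumes "(f::real\<Rightarrow>complex) \<in> L2" "c \<noteq> 0" shows "(\<lambda>x. f (t + c * x)) \<in> L2"
  using assms lborel_integrable_real_affine[of "\<lambda>x. (cmod (f x))\<^sup>2" c t] by (auto simp: L2_def)

lemma nL2_affine:
  assumes "\<bar>c\<bar> = 1" shows "nL2 (\<lambda>x. f (t + c * x)) = nL2 f"
  unfolding nL2_def
  by (subst (2) lborel_integral_real_affine[where c=c and t=t]) (use assms in auto)

lemma L2_reflect: "(f::real\<Rightarrow>complex) \<in> L2 \<Longrightarrow> (\<lambda>x. f (- x)) \<in> L2"
  using L2_affine[of f "-1" 0] by simp

lemma nL2_reflect: "nL2 (\<lambda>x. f (- x)) = nL2 f"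
  using nL2_affine[of "-1" f 0] by simp

lemma nL2_cmult: "nL2 (\<lambda>x. c * f x) = cmod c * nL2 f"
  unfolding nL2_def by (simp add: norm_mult power_mult_distrib real_sqrt_mult)

lemma nL2_minus_commute: "nL2 (\<lambda>x. f x - g x) = nL2 (\<lambda>x. g x - f x)"
  unfolding nL2_def by (simp add: norm_minus_commute)

lemma nL2_mono:
  assumes g: "g \<in> L2" and f: "f \<in> borel_measurable borel" and le: "\<And>x. cmod (f x) \<le> cmod (g x)"
  shows "nL2 f \<le> nL2 g"
  unfolding nL2_def
proof (rule real_sqrt_le_mono, rule integral_mono)
  have "f \<in> L2" using L2_bound[OF g f, of 1] le by simp
  then show "integrable lborel (\<lambda>x. (cmod (f x))\<^sup>2)" by (rule L2_integrable)
qed (use L2_integrable[OF g] le in \<open>auto intro: power_mono\<close>)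

lemma power_le_imp_le_ennreal:
  assumes "(x::ennreal)\<^sup>2 \<le> y\<^sup>2" shows "x \<le> y"
proof (rule ccontr)
  assume "\<not> x \<le> y"
  then have "y < x" by simp
  then have "y * y < x * x"
    by (cases x; cases y) (auto simp: ennreal_mult[symmetric] ennreal_mult_top ennreal_less_iff top_unique mult_strict_mono)
  then show False using assms by (simp add: power2_eq_square)
qed

text \<open>
  The version with an extended nonnegative integral does not presuppose that the product is integrable;
  it is what proves integrability.
\<close>

lemma nn_L2_Cauchy_Schwarz:
  assumes f: "f \<in> L2" and g: "g \<in> L2"
  shows "(\<integral>\<^sup>+x. ennreal (cmod (f x) * cmod (g x)) \<partial>lborel) \<le> ennreal (nL2 f * nL2 g)"
proof -
  note [measurable] = L2_measurable[OF f] L2_measurable[OF g]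
  have "(\<integral>\<^sup>+x. ennreal (cmod (f x)) * ennreal (cmod (g x)) \<partial>lborel)\<^sup>2
     \<le> (\<integral>\<^sup>+x. ennreal (cmod (f x))^2 \<partial>lborel) * (\<integral>\<^sup>+x. ennreal (cmod (g x))^2 \<partial>lborel)"
    by (rule Cauchy_Schwarz_nn_integral) auto
  also have "\<dots> = ennreal ((nL2 f * nL2 g)\<^sup>2)"
    using nn_L2[OF f] nn_L2[OF g] by (simp add: ennreal_power ennreal_mult[symmetric] power_mult_distrib)
  also have "\<dots> = ennreal (nL2 f * nL2 g) ^ 2" by (simp add: ennreal_power)
  finally have "(\<integral>\<^sup>+x. ennreal (cmod (f x)) * ennreal (cmod (g x)) \<partial>lborel) \<le> ennreal (nL2 f * nL2 g)"
    by (rule power_le_imp_le_ennreal)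
  then show ?thesis by (simp add: ennreal_mult)
qed

lemma L2_mult_integrable:
  assumes f: "f \<in> L2" and g: "(g::real\<Rightarrow>complex) \<in> L2"
  shows "integrable lborel (\<lambda>x. f x * g x)"
proof -
  note [measurable] = L2_measurable[OF f] L2_measurable[OF g]
  show ?thesis using nn_L2_Cauchy_Schwarz[OF f g]
    by (intro integrableI_bounded) (auto simp: norm_mult le_less_trans[OF _ ennreal_less_top])
qed

lemma L2_Cauchy_Schwarz_norm:
  assumes f: "f \<in> L2" and g: "(g::real\<Rightarrow>complex) \<in> L2"
  shows "(LINT x|lborel. cmod (f x) * cmod (g x)) \<le> nL2 f * nL2 g"
proof -
  have "integrable lborel (\<lambda>x. cmod (f x) * cmod (g x))"
    using integrable_norm[OF L2_mult_integrable[OF f g]] by (simp add: norm_mult)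
  from nn_integral_eq_integral[OF this] nn_L2_Cauchy_Schwarz[OF f g] show ?thesis
    by (simp add: ennreal_le_iff)
qed

lemma L2_Cauchy_Schwarz:
  assumes f: "f \<in> L2" and g: "(g::real\<Rightarrow>complex) \<in> L2"
  shows "cmod (LINT x|lborel. f x * g x) \<le> nL2 f * nL2 g"
  using integral_norm_bound[of lborel "\<lambda>x. f x * g x"] L2_Cauchy_Schwarz_norm[OF f g] by (simp add: norm_mult)

text \<open>
  The first-order term of the squared norm along a line. All energy estimates, for Euler steps as
  well as for the derivative of a flow, bound the inner product that appears here.
\<close>

lemma nL2_add_sq:
  assumes f: "f \<in> L2" and g: "g \<in> L2"
  shows "(nL2 (\<lambda>x. f x + g x))\<^sup>2 = (nL2 f)\<^sup>2 + 2 * Re (LINT x|lborel. g x * cnj (f x)) + (nL2 g)\<^sup>2"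
proof -
  have i: "integrable lborel (\<lambda>x. g x * cnj (f x))" by (intro L2_mult_integrable L2_cnj f g)
  have e: "(cmod (a + b))\<^sup>2 = (cmod a)\<^sup>2 + (2 * Re (b * cnj a) + (cmod b)\<^sup>2)" for a b
    by (simp only: cmod_power2 Re_complex_of_real plus_complex.sel complex_cnj times_complex.sel) (simp add: power2_eq_square algebra_simps)
  have ir: "integrable lborel (\<lambda>x. Re (g x * cnj (f x)))" by (rule integrable_Re[OF i])
  have "(LINT x|lborel. (cmod (f x + g x))\<^sup>2) = (LINT x|lborel. (cmod (f x))\<^sup>2 + (2 * Re (g x * cnj (f x)) + (cmod (g x))\<^sup>2))"
    by (simp only: e)
  also have "\<dots> = (LINT x|lborel. (cmod (f x))\<^sup>2) + (LINT x|lborel. (2 * Re (g x * cnj (f x)) + (cmod (g x))\<^sup>2))"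
    by (intro Bochner_Integration.integral_add Bochner_Integration.integrable_add L2_integrable f g
         integrable_mult_right ir)
  also have "(LINT x|lborel. (2 * Re (g x * cnj (f x)) + (cmod (g x))\<^sup>2))
      = (LINT x|lborel. 2 * Re (g x * cnj (f x))) + (LINT x|lborel. (cmod (g x))\<^sup>2)"
    by (intro Bochner_Integration.integral_add L2_integrable g integrable_mult_right ir)
  also have "(LINT x|lborel. 2 * Re (g x * cnj (f x))) = 2 * Re (LINT x|lborel. g x * cnj (f x))"
    using i by (simp only: integral_mult_right_zero integral_Re)
  finally show ?thesis by (simp add: nL2_sq)
qed

lemma nL2_cnj [simp]: "nL2 (\<lambda>x. cnj (f x)) = nL2 f" by (simp add: nL2_def)

lemma nL2_triangle:
  assumes f: "f \<in> L2" and g: "g \<in> L2"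
  shows "nL2 (\<lambda>x. f x + g x) \<le> nL2 f + nL2 g"
proof (rule power2_le_imp_le)
  have "Re (LINT x|lborel. g x * cnj (f x)) \<le> nL2 g * nL2 f"
    using order_trans[OF complex_Re_le_cmod L2_Cauchy_Schwarz[OF g L2_cnj[OF f]]] by simp
  then show "(nL2 (\<lambda>x. f x + g x))\<^sup>2 \<le> (nL2 f + nL2 g)\<^sup>2"
    by (simp add: nL2_add_sq[OF f g] power2_sum algebra_simps)
qed (simp add: add_nonneg_nonneg)

lemma nL2_triangle_diff:
  assumes "f \<in> L2" "g \<in> L2" "h \<in> L2"
  shows "nL2 (\<lambda>x. f x - h x) \<le> nL2 (\<lambda>x. f x - g x) + nL2 (\<lambda>x. g x - h x)"
  using nL2_triangle[OF L2_diff[OF assms(1,2)] L2_diff[OF assms(2,3)]] by simp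

lemma nL2_triangle_minus:
  assumes f: "f \<in> L2" and g: "g \<in> L2"
  shows "nL2 (\<lambda>x. f x - g x) \<le> nL2 f + nL2 g"
  using nL2_triangle[OF f L2_uminus[OF g]] by (simp add: nL2_def)

lemma nL2_rev_triangle:
  assumes f: "f \<in> L2" and g: "g \<in> L2"
  shows "\<bar>nL2 f - nL2 g\<bar> \<le> nL2 (\<lambda>x. f x - g x)"
  using nL2_triangle[OF L2_diff[OF f g] g] nL2_triangle[OF L2_diff[OF g f] f] nL2_minus_commute[of f g]
  by simp

lemma nL2_cong_AE:
  assumes "AE x in lborel. f x = g x" "f \<in> borel_measurable borel" "g \<in> borel_measurable borel"
  shows "nL2 f = nL2 g"
  unfolding nL2_def using assms by (intro arg_cong[where f=sqrt] integral_cong_AE) auto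

lemma L2_cong_AE:
  assumes "AE x in lborel. f x = g x" "(f::real\<Rightarrow>'a::{banach,second_countable_topology}) \<in> L2" "g \<in> borel_measurable borel"
  shows "g \<in> L2"
proof (rule L2_I[OF assms(3)])
  have [measurable]: "f \<in> borel_measurable borel" using assms(2) by (simp add: L2_def)
  show "integrable lborel (\<lambda>x. (norm (g x))\<^sup>2)"
    by (rule integrable_cong_AE_imp[OF L2_integrable[OF assms(2)]]) (use assms in auto)
qed

lemma nL2_0_AE:
  assumes f: "f \<in> L2" and 0: "nL2 f = 0" shows "AE x in lborel. f x = 0"
proof -
  have "(LINT x|lborel. (cmod (f x))\<^sup>2) = 0" using 0 nL2_sq[of f] by simp
  then have "AE x in lborel. (cmod (f x))\<^sup>2 = 0"
    using integral_nonneg_eq_0_iff_AE[OF L2_integrable[OF f]] by simp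
  then show ?thesis by simp
qed

lemma L2_lim_unique:
  assumes f: "\<And>n. f n \<in> L2" and g: "g \<in> L2" and h: "h \<in> L2"
    and fg: "(\<lambda>n. nL2 (\<lambda>x. f n x - g x)) \<longlonglongrightarrow> 0" and fh: "(\<lambda>n. nL2 (\<lambda>x. f n x - h x)) \<longlonglongrightarrow> 0"
  shows "AE x in lborel. g x = h x"
proof -
  have "nL2 (\<lambda>x. g x - h x) \<le> nL2 (\<lambda>x. f n x - g x) + nL2 (\<lambda>x. f n x - h x)" for n
    using nL2_triangle_diff[OF g f[of n] h] nL2_minus_commute[of g "f n"] by simp
  then have "nL2 (\<lambda>x. g x - h x) \<le> 0 + 0"
    by (intro LIMSEQ_le_const[OF tendsto_add[OF fg fh]]) auto
  then have "nL2 (\<lambda>x. g x - h x) = 0" using nL2_nonneg[of "\<lambda>x. g x - h x"] by linarith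
  then show ?thesis using nL2_0_AE[OF L2_diff[OF g h]] by simp
qed

text \<open>
  By Fatou's lemma the series of absolute values of the increments is square-integrable, hence finite almost
  everywhere; so the sequence converges pointwise, and the tails of the series bound the distance to the
  limit.
\<close>

lemma L2_complete_fast:
  assumes f: "\<And>n. f n \<in> L2" and c: "\<And>n. nL2 (\<lambda>x. f (Suc n) x - f n x) \<le> (1/2)^n"
  shows "\<exists>g\<in>L2. \<forall>n. nL2 (\<lambda>x. f n x - g x) \<le> 2 * (1/2)^n"
proof -
  have [measurable]: "f n \<in> borel_measurable borel" for n using f L2_measurable by blast
  define d where "d n x = f (Suc n) x - f n x" for n x
  have d2: "d n \<in> L2" for n unfolding d_def[abs_def] using f by (intro L2_diff)
  have [measurable]: "d n \<in> borel_measurable borel" for n using d2 L2_measurable by blast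
  have dn: "nL2 (d n) \<le> (1/2)^n" for n using c unfolding d_def[abs_def] .
  have absd: "(\<lambda>x. complex_of_real (cmod (d n x))) \<in> L2" for n
    by (rule L2_bound[OF d2[of n], where c=1]) auto
  have part2: "(\<lambda>x. \<Sum>i<m. complex_of_real (cmod (d (i+n) x))) \<in> L2 \<and> nL2 (\<lambda>x. \<Sum>i<m. complex_of_real (cmod (d (i+n) x))) \<le> 2*(1/2)^n - (1/2)^(n+m) * 2" for m n
  proof (induction m)
    case 0 then show ?case by (simp add: nL2_def)
  next
    case (Suc m)
    have "nL2 (\<lambda>x. complex_of_real (cmod (d (m+n) x))) = nL2 (d (m+n))" by (simp add: nL2_def)
    then have "nL2 (\<lambda>x. complex_of_real (cmod (d (m+n) x))) \<le> (1/2)^(n+m)" using dn[of "m+n"] by (simp add: add.commute)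
    with nL2_triangle[OF conjunct1[OF Suc] absd[of "m+n"]] Suc
    have "nL2 (\<lambda>x. \<Sum>i<Suc m. complex_of_real (cmod (d (i+n) x))) \<le> 2*(1/2)^n - (1/2)^(n+m) * 2 + (1/2)^(n+m)"
      by simp
    then show ?case using L2_add[OF conjunct1[OF Suc] absd[of "m+n"]] by simp
  qed
  have nnsum: "(\<integral>\<^sup>+x. (\<Sum>i. ennreal (cmod (d (i+n) x)))^2 \<partial>lborel) \<le> ennreal ((2*(1/2)^n)\<^sup>2)" for n
  proof -
    have "(\<integral>\<^sup>+x. (\<Sum>i. ennreal (cmod (d (i+n) x)))^2 \<partial>lborel) = (\<integral>\<^sup>+x. liminf (\<lambda>m. (\<Sum>i<m. ennreal (cmod (d (i+n) x)))^2) \<partial>lborel)"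
    proof (rule nn_integral_cong)
      fix x
      have "(\<lambda>m. (\<Sum>i<m. ennreal (cmod (d (i+n) x)))^2) \<longlonglongrightarrow> (\<Sum>i. ennreal (cmod (d (i+n) x)))^2"
      proof -
        have L: "(\<lambda>m. \<Sum>i<m. ennreal (cmod (d (i+n) x))) \<longlonglongrightarrow> (\<Sum>i. ennreal (cmod (d (i+n) x)))"
          by (rule summable_LIMSEQ) simp
        show ?thesis unfolding power2_eq_square
          by (rule tendsto_mult_ennreal[OF L L]) auto
      qed
      then show "(\<Sum>i. ennreal (cmod (d (i+n) x)))^2 = liminf (\<lambda>m. (\<Sum>i<m. ennreal (cmod (d (i+n) x)))^2)"
        by (simp add: lim_imp_Liminf)
    qed
    also have "\<dots> \<le> liminf (\<lambda>m. \<integral>\<^sup>+x. (\<Sum>i<m. ennreal (cmod (d (i+n) x)))^2 \<partial>lborel)"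
      by (rule nn_integral_liminf) simp
    also have "\<dots> \<le> ennreal ((2*(1/2)^n)\<^sup>2)"
    proof -
      have bd: "(\<integral>\<^sup>+x. (\<Sum>i<m. ennreal (cmod (d (i+n) x)))^2 \<partial>lborel) \<le> ennreal ((2*(1/2)^n)\<^sup>2)" for m
      proof -
      have "(\<integral>\<^sup>+x. (\<Sum>i<m. ennreal (cmod (d (i+n) x)))^2 \<partial>lborel) = (\<integral>\<^sup>+x. ennreal ((cmod (\<Sum>i<m. complex_of_real (cmod (d (i+n) x))))\<^sup>2) \<partial>lborel)"
      proof (rule nn_integral_cong)
        fix x
        have "(\<Sum>i<m. ennreal (cmod (d (i+n) x))) = ennreal (\<Sum>i<m. cmod (d (i+n) x))" by (rule sum_ennreal) simp
        moreover have "cmod (\<Sum>i<m. complex_of_real (cmod (d (i+n) x))) = (\<Sum>i<m. cmod (d (i+n) x))"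
          by (simp only: of_real_sum[symmetric] norm_of_real) (simp add: sum_nonneg)
        ultimately show "(\<Sum>i<m. ennreal (cmod (d (i+n) x)))^2 = ennreal ((cmod (\<Sum>i<m. complex_of_real (cmod (d (i+n) x))))\<^sup>2)"
          by (simp only: ennreal_power sum_nonneg norm_ge_zero)
      qed
      also have "\<dots> = ennreal ((nL2 (\<lambda>x. \<Sum>i<m. complex_of_real (cmod (d (i+n) x))))\<^sup>2)"
        by (rule nn_L2[OF conjunct1[OF part2]])
      also have "\<dots> \<le> ennreal ((2*(1/2)^n)\<^sup>2)"
      proof -
        have "nL2 (\<lambda>x. \<Sum>i<m. complex_of_real (cmod (d (i+n) x))) \<le> 2*(1/2)^n"
        proof -
          have "0 \<le> (1/2::real)^(n+m)" by simp
          with part2[of n m] show ?thesis by linarith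
        qed
        then show ?thesis by (intro ennreal_leI power_mono) auto
      qed
      finally show ?thesis .
      qed
      show ?thesis
        using Liminf_mono[of "\<lambda>m. \<integral>\<^sup>+x. (\<Sum>i<m. ennreal (cmod (d (i+n) x)))^2 \<partial>lborel" "\<lambda>_. ennreal ((2*(1/2)^n)\<^sup>2)" sequentially] bd
        by (simp add: Liminf_const)
    qed
    finally show ?thesis .
  qed
  have "(\<integral>\<^sup>+x. (\<Sum>i. ennreal (cmod (d i x)))^2 \<partial>lborel) \<noteq> \<infinity>"
    using nnsum[of 0] by (auto simp: top_unique)
  then have "AE x in lborel. (\<Sum>i. ennreal (cmod (d i x)))^2 \<noteq> \<infinity>"
    by (intro nn_integral_PInf_AE) auto
  then have AEs: "AE x in lborel. (\<lambda>n. f n x) \<longlonglongrightarrow> lim (\<lambda>n. f n x) \<and> (\<forall>n. ennreal (cmod (f n x - lim (\<lambda>n. f n x))) \<le> (\<Sum>i. ennreal (cmod (d (i+n) x))))"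
  proof eventually_elim
    fix x assume "(\<Sum>i. ennreal (cmod (d i x)))^2 \<noteq> \<infinity>"
    then have ne: "(\<Sum>i. ennreal (cmod (d i x))) \<noteq> \<top>" by (auto simp: power2_eq_square)
    have sm: "summable (\<lambda>i. cmod (d i x))"
      by (rule summable_suminf_not_top[OF _ ne]) simp
    then have sd: "summable (\<lambda>i. d i x)" by (rule summable_norm_cancel)
    have "(\<lambda>n. f 0 x + (\<Sum>i<n. d i x)) \<longlonglongrightarrow> f 0 x + (\<Sum>i. d i x)"
      by (intro tendsto_intros summable_LIMSEQ sd)
    moreover have "f 0 x + (\<Sum>i<n. d i x) = f n x" for n unfolding d_def sum_lessThan_telescope[of "\<lambda>i. f i x" n] by simp
    ultimately have L: "(\<lambda>n. f n x) \<longlonglongrightarrow> f 0 x + (\<Sum>i. d i x)" by simp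
    then have le: "lim (\<lambda>n. f n x) = f 0 x + (\<Sum>i. d i x)" by (rule limI)
    have "ennreal (cmod (f n x - lim (\<lambda>n. f n x))) \<le> (\<Sum>i. ennreal (cmod (d (i+n) x)))" for n
    proof -
      have "f n x = f 0 x + (\<Sum>i<n. d i x)" unfolding d_def sum_lessThan_telescope[of "\<lambda>i. f i x" n] by simp
      then have "f n x - lim (\<lambda>n. f n x) = - (\<Sum>i. d (i+n) x)"
        using suminf_minus_initial_segment[OF sd, of n] le by simp
      then have "cmod (f n x - lim (\<lambda>n. f n x)) \<le> (\<Sum>i. cmod (d (i+n) x))"
        using summable_norm[of "\<lambda>i. d (i+n) x"] summable_ignore_initial_segment[OF sm, of n] by simp
      then show ?thesis using summable_ignore_initial_segment[OF sm, of n]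
        by (subst suminf_ennreal2) (auto intro: ennreal_leI)
    qed
    with L le show "(\<lambda>n. f n x) \<longlonglongrightarrow> lim (\<lambda>n. f n x) \<and> (\<forall>n. ennreal (cmod (f n x - lim (\<lambda>n. f n x))) \<le> (\<Sum>i. ennreal (cmod (d (i+n) x))))"
      by simp
  qed
  define g where "g x = lim (\<lambda>n. f n x)" for x
  have [measurable]: "g \<in> borel_measurable borel" unfolding g_def by measurable
  have D: "(\<lambda>x. f n x - g x) \<in> L2 \<and> nL2 (\<lambda>x. f n x - g x) \<le> 2 * (1/2)^n" for n
  proof -
    have "(\<integral>\<^sup>+x. ennreal ((cmod (f n x - g x))\<^sup>2) \<partial>lborel) \<le> (\<integral>\<^sup>+x. (\<Sum>i. ennreal (cmod (d (i+n) x)))^2 \<partial>lborel)"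
    proof (rule nn_integral_mono_AE, use AEs in eventually_elim)
      fix x assume "(\<lambda>n. f n x) \<longlonglongrightarrow> lim (\<lambda>n. f n x) \<and> (\<forall>n. ennreal (cmod (f n x - lim (\<lambda>n. f n x))) \<le> (\<Sum>i. ennreal (cmod (d (i+n) x))))"
      then have "(ennreal (cmod (f n x - g x)))^2 \<le> (\<Sum>i. ennreal (cmod (d (i+n) x)))^2"
        unfolding g_def by (intro power_mono_ennreal) blast
      then show "ennreal ((cmod (f n x - g x))\<^sup>2) \<le> (\<Sum>i. ennreal (cmod (d (i+n) x)))^2"
        by (simp only: ennreal_power norm_ge_zero)
    qed
    also note nnsum
    finally show ?thesis using L2_of_nn[of "\<lambda>x. f n x - g x" "2*(1/2)^n"] by simp
  qed
  have "g \<in> L2" using L2_diff[OF f[of 0] conjunct1[OF D[of 0]]] by simp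
  then show ?thesis using D by blast
qed

text \<open>
  Riesz-Fischer: a Cauchy sequence has a subsequence with geometrically decaying increments, and a
  Cauchy sequence converges as soon as one of its subsequences does.
\<close>

lemma L2_complete:
  assumes f: "\<And>n. f n \<in> L2" and c: "\<And>e. e > 0 \<Longrightarrow> \<exists>M. \<forall>m\<ge>M. \<forall>n\<ge>M. nL2 (\<lambda>x. f m x - f n x) < e"
  shows "\<exists>g\<in>L2. (\<lambda>n. nL2 (\<lambda>x. f n x - g x)) \<longlonglongrightarrow> 0"
proof -
  have "\<forall>k. \<exists>M. \<forall>m\<ge>M. \<forall>n\<ge>M. nL2 (\<lambda>x. f m x - f n x) < (1/2)^(k::nat)" using c by simp
  from choice[OF this] obtain M0 where M0': "\<forall>k. \<forall>m\<ge>M0 k. \<forall>n\<ge>M0 k. nL2 (\<lambda>x. f m x - f n x) < (1/2)^(k::nat)"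
    by blast
  then have M0: "m \<ge> M0 k \<Longrightarrow> n \<ge> M0 k \<Longrightarrow> nL2 (\<lambda>x. f m x - f n x) < (1/2)^(k::nat)" for m n k by blast
  (* Partial sums of the thresholds are thresholds, too, and increase with k. *)
  define M where "M k = (\<Sum>i\<le>k. M0 i)" for k :: nat
  have M: "M k \<ge> M0 k" for k unfolding M_def by (rule member_le_sum) auto
  have MS: "M (Suc k) \<ge> M k" for k unfolding M_def by simp
  have "\<exists>g\<in>L2. \<forall>k. nL2 (\<lambda>x. f (M k) x - g x) \<le> 2 * (1/2)^k"
  proof (rule L2_complete_fast)
    fix k
    show "nL2 (\<lambda>x. f (M (Suc k)) x - f (M k) x) \<le> (1/2)^k"
      using M0[of k "M (Suc k)" "M k"] M[of k] MS[of k] by simp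
  qed (rule f)
  then obtain g where g: "g \<in> L2" and gk: "\<And>k. nL2 (\<lambda>x. f (M k) x - g x) \<le> 2 * (1/2)^k" by blast
  have "(\<lambda>n. nL2 (\<lambda>x. f n x - g x)) \<longlonglongrightarrow> 0"
  proof (rule LIMSEQ_I)
    fix r :: real assume r: "0 < r"
    obtain k where k: "(1/2::real)^k < r/3" using real_arch_pow_inv[of "r/3" "1/2"] r by auto
    have "norm (nL2 (\<lambda>x. f n x - g x) - 0) < r" if n: "n \<ge> M k" for n
    proof -
      have "nL2 (\<lambda>x. f n x - f (M k) x) < (1/2)^k" using M0[of k n "M k"] M[of k] n by simp
      then show ?thesis using nL2_triangle_diff[OF f[of n] f[of "M k"] g] gk[of k] k by simp
    qed
    then show "\<exists>no. \<forall>n\<ge>no. norm (nL2 (\<lambda>x. f n x - g x) - 0) < r" by blast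
  qed
  then show ?thesis using g by blast
qed

section \<open>Continuity of translations in the mean\<close>

lemma nL2_dominated:
  assumes w: "(w::real\<Rightarrow>complex) \<in> L2" and [measurable]: "\<And>n. f n \<in> borel_measurable borel" "g \<in> borel_measurable borel"
    and lim: "AE x in lborel. (\<lambda>n. f n x) \<longlonglongrightarrow> g x"
    and le: "\<And>n. AE x in lborel. cmod (f n x - g x) \<le> cmod (w x)"
  shows "(\<lambda>n. nL2 (\<lambda>x. f n x - g x)) \<longlonglongrightarrow> 0"
proof -
  have "(\<lambda>n. LINT x|lborel. (cmod (f n x - g x))\<^sup>2) \<longlonglongrightarrow> (LINT x|(lborel::real measure). 0)"
  proof (rule integral_dominated_convergence)
    show "integrable lborel (\<lambda>x. (cmod (w x))\<^sup>2)" by (rule L2_integrable[OF w])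
    show "AE x in lborel. (\<lambda>n. (cmod (f n x - g x))\<^sup>2) \<longlonglongrightarrow> 0"
      using lim
    proof eventually_elim
      fix x assume "(\<lambda>n. f n x) \<longlonglongrightarrow> g x"
      then have "(\<lambda>n. f n x - g x) \<longlonglongrightarrow> 0" by (simp add: LIM_zero)
      then show "(\<lambda>n. (cmod (f n x - g x))\<^sup>2) \<longlonglongrightarrow> 0"
        using tendsto_power[OF tendsto_norm, of "\<lambda>n. f n x - g x" 0 sequentially 2] by simp
    qed
    show "AE x in lborel. norm ((cmod (f n x - g x))\<^sup>2) \<le> (cmod (w x))\<^sup>2" for n
      using le[of n] by eventually_elim (simp add: power_mono)
  qed simp_all
  then have "(\<lambda>n. sqrt (LINT x|lborel. (cmod (f n x - g x))\<^sup>2)) \<longlonglongrightarrow> sqrt 0"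
    by (intro tendsto_real_sqrt) simp
  then show ?thesis by (simp add: nL2_def)
qed

text \<open>
  The radial retraction of the plane onto the disc of radius \<open>m\<close>.
\<close>

definition clip :: "real \<Rightarrow> complex \<Rightarrow> complex" where "clip m z = z /\<^sub>R max 1 (cmod z / m)"

lemma clip_le: "m > 0 \<Longrightarrow> cmod (clip m z) \<le> m"
  unfolding clip_def by (auto simp: max_def field_simps)

lemma clip_le2: "cmod (clip m z) \<le> cmod z"
proof -
  have "cmod z * 1 \<le> cmod z * max 1 (cmod z / m)" by (intro mult_left_mono) auto
  then show ?thesis unfolding clip_def by (auto simp: field_simps max_def)
qed

lemma clip_cont: "m > 0 \<Longrightarrow> continuous_on A (clip m)"
  unfolding clip_def[abs_def]
  by (intro continuous_intros) (auto simp: max_def split: if_splits)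

lemma clip_eq: "cmod z \<le> m \<Longrightarrow> m > 0 \<Longrightarrow> clip m z = z"
  by (simp add: clip_def max_def)

text \<open>
  A continuous cut-off function: one on \<open>[- m, m]\<close>, zero outside \<open>[- m - 1, m + 1]\<close>.
\<close>

definition hat :: "real \<Rightarrow> real \<Rightarrow> real" where "hat m x = max 0 (min 1 (m + 1 - \<bar>x\<bar>))"

lemma hat_bounds: "0 \<le> hat m x" "hat m x \<le> 1" by (auto simp: hat_def)
lemma hat_cont: "continuous_on A (hat m)" unfolding hat_def[abs_def] by (intro continuous_intros)
lemma hat_eq1: "\<bar>x\<bar> \<le> m \<Longrightarrow> hat m x = 1" by (simp add: hat_def)
lemma hat_eq0: "\<bar>x\<bar> \<ge> m + 1 \<Longrightarrow> hat m x = 0" by (simp add: hat_def)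

lemma L2_bounded_support:
  assumes [measurable]: "f \<in> borel_measurable borel" and le: "\<And>x. cmod (f x) \<le> c" and "\<And>x. \<bar>x\<bar> > R \<Longrightarrow> f x = 0"
  shows "f \<in> L2"
proof (rule L2_I)
  show "integrable lborel (\<lambda>x. (cmod (f x))\<^sup>2)"
  proof (rule Bochner_Integration.integrable_bound)
    show "integrable lborel (\<lambda>x. c\<^sup>2 * indicator {-R..R} x)"
      by (intro integrable_mult_right integrable_real_indicator) (auto simp: emeasure_lborel_Icc_eq)
    have "(cmod (f x))\<^sup>2 \<le> norm (c\<^sup>2 * indicator {-R..R} x)" for x
      using assms(3)[of x] power_mono[OF le[of x], of 2] by (cases "\<bar>x\<bar> \<le> R") (auto simp: indicator_def)
    then show "AE x in lborel. norm ((cmod (f x))\<^sup>2) \<le> norm (c\<^sup>2 * indicator {-R..R} x)" by simp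
  qed simp
qed simp

text \<open>
  A measurable function is an almost everywhere limit of continuous functions. Clipping values and
  support turns this into convergence in the mean, in two stages: the function itself by its clipped
  version, and that by clipped continuous functions.
\<close>

lemma L2_continuous_approx:
  assumes f: "f \<in> L2" and e: "e > 0"
  shows "\<exists>g R c. continuous_on UNIV g \<and> (\<forall>x. cmod (g x) \<le> c) \<and> (\<forall>x. \<bar>x\<bar> > R \<longrightarrow> g x = 0) \<and> nL2 (\<lambda>x. f x - g x) < e"
proof -
  note [measurable] = L2_measurable[OF f]
  have "f \<in> borel_measurable lebesgue" by (rule measurable_completion) simp
  then have "f measurable_on UNIV" by (rule lebesgue_measurable_imp_measurable_on) simp
  then obtain N g where N: "negligible N" and gc: "\<And>n. continuous_on UNIV (g n)"
    and gl: "\<And>x. x \<notin> N \<Longrightarrow> (\<lambda>n. g (n::nat) x) \<longlonglongrightarrow> f x"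
    unfolding measurable_on_def by auto
  have "AE x in lebesgue. x \<notin> N" using N negligible_iff_null_sets AE_not_in by blast
  then have AEN: "AE x in lborel. x \<notin> N" by (simp add: AE_completion_iff)
  have [measurable]: "g n \<in> borel_measurable borel" for n using gc by (rule borel_measurable_continuous_onI)
  have cm[measurable]: "m > 0 \<Longrightarrow> clip m \<in> borel_measurable borel" for m using clip_cont by (rule borel_measurable_continuous_onI)
  have hm[measurable]: "hat m \<in> borel_measurable borel" for m using hat_cont by (rule borel_measurable_continuous_onI)
  define h where "h m x = complex_of_real (hat m x) * clip m (f x)" for m x
  have hmeas: "h (Suc n) \<in> borel_measurable borel" for n unfolding h_def[abs_def]
    using measurable_compose[OF _ cm[of "Suc n"], of f borel] by simp
  have "(\<lambda>n. nL2 (\<lambda>x. h (Suc n) x - f x)) \<longlonglongrightarrow> 0"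
  proof (rule nL2_dominated[where w="\<lambda>x. 2 * f x"])
    show "(\<lambda>x. 2 * f x) \<in> L2" by (rule L2_cmult[OF f])
    show "AE x in lborel. (\<lambda>n. h (real (Suc n)) x) \<longlonglongrightarrow> f x"
    proof (rule AE_I2)
      fix x
      obtain k :: nat where k: "real k \<ge> max \<bar>x\<bar> (cmod (f x))" using real_arch_simple by blast
      have "h (Suc n) x = f x" if "n \<ge> k" for n
        using that k unfolding h_def by (subst hat_eq1, simp, subst clip_eq) auto
      then show "(\<lambda>n. h (real (Suc n)) x) \<longlonglongrightarrow> f x"
        by (intro tendsto_eventually) (auto simp: eventually_sequentially)
    qed
    have "cmod (h (Suc n) x - f x) \<le> cmod (2 * f x)" for n x
    proof -
      have "cmod (h (Suc n) x) \<le> 1 * cmod (f x)"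
        unfolding h_def norm_mult by (intro mult_mono clip_le2) (use hat_bounds[of "Suc n" x] in auto)
      then show ?thesis using norm_triangle_ineq4[of "h (Suc n) x" "f x"] by (simp add: norm_mult)
    qed
    then show "AE x in lborel. cmod (h (Suc n) x - f x) \<le> cmod (2 * f x)" for n by simp
  qed (use hmeas in simp_all)
  then obtain n where n: "nL2 (\<lambda>x. h (Suc n) x - f x) < e/2"
    using e by (metis (mono_tags, lifting) LIMSEQ_D half_gt_zero le_refl norm_conv_dist dist_0_norm diff_zero real_norm_def abs_of_nonneg nL2_nonneg)
  define m where "m = real (Suc n)"
  have m: "m > 0" by (simp add: m_def)
  define q where "q j x = complex_of_real (hat m x) * clip m (g j x)" for j x
  have qm[measurable]: "q j \<in> borel_measurable borel" for j unfolding q_def[abs_def]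
    using measurable_compose[OF _ cm[OF m], of "g j" borel] by simp
  have qb: "cmod (q j x) \<le> 1 * m" for j x unfolding q_def norm_mult
    by (intro mult_mono clip_le m) (use hat_bounds[of m x] m in auto)
  have hb: "cmod (h m x) \<le> 1 * m" for x unfolding h_def norm_mult
    by (intro mult_mono clip_le m) (use hat_bounds[of m x] m in auto)
  have q0: "\<bar>x\<bar> > m+1 \<Longrightarrow> q j x = 0" for j x using hat_eq0[of m x] by (simp add: q_def)
  have h0: "\<bar>x\<bar> > m+1 \<Longrightarrow> h m x = 0" for x using hat_eq0[of m x] by (simp add: h_def)
  have q2: "q j \<in> L2" for j by (rule L2_bounded_support[OF qm qb q0])
  have h2: "h m \<in> L2" using hmeas[of n] by (intro L2_bounded_support[OF _ hb h0]) (auto simp: m_def)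
  have "(\<lambda>j. nL2 (\<lambda>x. q j x - h m x)) \<longlonglongrightarrow> 0"
  proof (rule nL2_dominated[where w="\<lambda>x. complex_of_real (2 * m) * indicator {-(m+1)..m+1} x"])
    show "(\<lambda>x. complex_of_real (2 * m) * indicator {-(m+1)..m+1} x) \<in> L2"
      by (rule L2_bounded_support[where c="2*m" and R="m+1"]) (use m in \<open>auto simp: indicator_def norm_mult\<close>)
    show "AE x in lborel. (\<lambda>n. q n x) \<longlonglongrightarrow> h m x"
      using AEN
    proof eventually_elim
      fix x assume "x \<notin> N"
      have "isCont (clip m) (f x)" using clip_cont[OF m, of UNIV] by (simp add: continuous_on_eq_continuous_at)
      then show "(\<lambda>n. q n x) \<longlonglongrightarrow> h m x" unfolding q_def h_def
        by (intro tendsto_intros isCont_tendsto_compose[OF _ gl[OF \<open>x \<notin> N\<close>]])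
    qed
    have "cmod (q j x - h m x) \<le> cmod (complex_of_real (2 * m) * indicator {-(m+1)..m+1} x)" for j x
      using norm_triangle_ineq4[of "q j x" "h m x"] qb[of j x] hb[of x] q0[of x j] h0[of x] m
      by (cases "\<bar>x\<bar> \<le> m + 1") (auto simp: indicator_def norm_mult)
    then show "AE x in lborel. cmod (q j x - h m x) \<le> cmod (complex_of_real (2 * m) * indicator {-(m+1)..m+1} x)" for j
      by simp
  qed (use hmeas[of n] in \<open>auto simp: m_def\<close>)
  then obtain j where j: "nL2 (\<lambda>x. q j x - h m x) < e/2"
    using e by (metis (mono_tags, lifting) LIMSEQ_D half_gt_zero le_refl norm_conv_dist dist_0_norm diff_zero real_norm_def abs_of_nonneg nL2_nonneg)
  have "nL2 (\<lambda>x. f x - q j x) < e"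
    using nL2_triangle_diff[OF f h2 q2[of j]] j n nL2_minus_commute[of "q j" "h m"] nL2_minus_commute[of f "h m"] m_def by simp
  moreover have "continuous_on UNIV (q j)" unfolding q_def[abs_def]
    by (intro continuous_intros hat_cont continuous_on_compose2[OF clip_cont[OF m, of UNIV] gc]) auto
  ultimately show ?thesis using qb q0 by blast
qed

text \<open>
  Clear for continuous functions of compact support by dominated convergence; in general by density,
  since translations are isometries.
\<close>

lemma L2_translation_continuous_seq:
  assumes f: "f \<in> L2" and z: "z \<longlonglongrightarrow> 0"
  shows "(\<lambda>n. nL2 (\<lambda>x. f (x + z n) - f x)) \<longlonglongrightarrow> 0"
proof (rule LIMSEQ_I)
  fix e :: real assume e: "0 < e"
  from L2_continuous_approx[OF f, of "e/3"] e obtain g R c where g: "continuous_on UNIV g"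
    and gb: "\<And>x. cmod (g x) \<le> c" and gR: "\<And>x. \<bar>x\<bar> > R \<Longrightarrow> g x = 0" and fg: "nL2 (\<lambda>x. f x - g x) < e/3" by auto
  have [measurable]: "g \<in> borel_measurable borel" using g by (rule borel_measurable_continuous_onI)
  have g2: "g \<in> L2" by (rule L2_bounded_support[OF _ gb gR]) auto
  have c0: "c \<ge> 0" using gb[of 0] norm_ge_zero order_trans by blast
  obtain D where D: "\<And>n. \<bar>z n\<bar> \<le> D" using convergent_imp_Bseq[of z] z unfolding convergent_def Bseq_def by auto
  have lim: "(\<lambda>n. nL2 (\<lambda>x. g (x + z n) - g x)) \<longlonglongrightarrow> 0"
  proof (rule nL2_dominated[where w="\<lambda>x. complex_of_real (2 * c) * indicator {-(R+D)..R+D} x"])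
    show "(\<lambda>x. complex_of_real (2 * c) * indicator {-(R+D)..R+D} x) \<in> L2"
      by (rule L2_bounded_support[where c="2*c" and R="R+D"]) (use c0 in \<open>auto simp: indicator_def norm_mult\<close>)
    show "AE x in lborel. (\<lambda>n. g (x + z n)) \<longlonglongrightarrow> g x"
    proof (rule AE_I2)
      fix x
      have "isCont g (x + 0)" using g by (simp add: continuous_on_eq_continuous_at)
      then show "(\<lambda>n. g (x + z n)) \<longlonglongrightarrow> g x" using isCont_tendsto_compose[OF _ tendsto_add[OF tendsto_const[of x] z], of g] by simp
    qed
    have "cmod (g (x + z n) - g x) \<le> cmod (complex_of_real (2 * c) * indicator {-(R+D)..R+D} x)" for n x
      using norm_triangle_ineq4[of "g (x + z n)" "g x"] gb[of "x + z n"] gb[of x] gR[of x] gR[of "x + z n"] c0 D[of n]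
      by (cases "\<bar>x\<bar> \<le> R + D") (auto simp: indicator_def norm_mult)
    then show "AE x in lborel. cmod (g (x + z n) - g x) \<le> cmod (complex_of_real (2 * c) * indicator {-(R+D)..R+D} x)" for n by simp
  qed simp_all
  then obtain M where M: "\<And>n. n \<ge> M \<Longrightarrow> nL2 (\<lambda>x. g (x + z n) - g x) < e/3" using LIMSEQ_D[OF lim, of "e/3"] e by auto
  have "norm (nL2 (\<lambda>x. f (x + z n) - f x) - 0) < e" if "n \<ge> M" for n
  proof -
    have t: "h \<in> L2 \<Longrightarrow> (\<lambda>x. h (x + z n)) \<in> L2" for h :: "real \<Rightarrow> complex" using L2_affine[of h 1 "z n"] by (simp add: add.commute)
    have "nL2 (\<lambda>x. f (x + z n) - g (x + z n)) = nL2 (\<lambda>x. f x - g x)"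
      using nL2_affine[of 1 "\<lambda>x. f x - g x" "z n"] by (simp add: add.commute)
    then show ?thesis
      using nL2_triangle_diff[OF t[OF f] t[OF g2] f] nL2_triangle_diff[OF t[OF g2] g2 f] fg M[OF that] nL2_minus_commute[of f g] by simp
  qed
  then show "\<exists>no. \<forall>n\<ge>no. norm (nL2 (\<lambda>x. f (x + z n) - f x) - 0) < e" by blast
qed

section \<open>Plancherel's identity\<close>

text \<open>
  The Fourier integral without the factor \<open>1/(2\<pi>)\<close>; meaningful for integrable \<open>f\<close> only.
\<close>

definition ftI :: "(real \<Rightarrow> complex) \<Rightarrow> real \<Rightarrow> complex" where
  "ftI f k = (LINT x|lborel. f x * exp (- \<i> * k * x))"

lemma ftI_measurable [measurable]: assumes [measurable]: "f \<in> borel_measurable borel" shows "ftI f \<in> borel_measurable borel"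
  unfolding ftI_def[abs_def] by measurable

lemma exp_unit: "cmod (exp (- \<i> * complex_of_real k * complex_of_real x)) = 1"
  by (simp add: norm_exp_eq_Re)

lemma ftI_integrable:
  assumes f: "integrable lborel f" shows "integrable lborel (\<lambda>x. f x * exp (- \<i> * complex_of_real k * complex_of_real x))"
proof (rule Bochner_Integration.integrable_bound[OF f])
  note [measurable] = borel_measurable_integrable[OF f]
  show "(\<lambda>x. f x * exp (- \<i> * complex_of_real k * complex_of_real x)) \<in> borel_measurable lborel" by measurable
  show "AE x in lborel. cmod (f x * exp (- \<i> * complex_of_real k * complex_of_real x)) \<le> cmod (f x)"
    unfolding norm_mult exp_unit by simp
qed

lemma ftI_diff: "integrable lborel f \<Longrightarrow> integrable lborel g \<Longrightarrow> ftI (\<lambda>x. f x - g x) k = ftI f k - ftI g k"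
  unfolding ftI_def left_diff_distrib by (rule Bochner_Integration.integral_diff) (rule ftI_integrable, assumption)+

lemma ftI_bound: "cmod (ftI f k) \<le> (LINT x|lborel. cmod (f x))"
  unfolding ftI_def using integral_norm_bound[of lborel "\<lambda>x. f x * exp (- \<i> * k * x)"] by (simp add: norm_mult exp_unit)

lemma integrable_prod_mult:
  fixes f g :: "real \<Rightarrow> complex"
  assumes f: "integrable lborel f" and g: "integrable lborel g"
  shows "integrable (lborel \<Otimes>\<^sub>M lborel) (\<lambda>(x, y). f x * g y)"
proof (rule lborel_pair.Fubini_integrable)
  note [measurable] = borel_measurable_integrable[OF f] borel_measurable_integrable[OF g]
  show "(\<lambda>(x, y). f x * g y) \<in> borel_measurable (lborel \<Otimes>\<^sub>M lborel)" by measurable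
  show "integrable lborel (\<lambda>x. LINT y|lborel. norm (case (x, y) of (x, y) \<Rightarrow> f x * g y))"
    using f by (simp add: norm_mult)
  show "AE x in lborel. integrable lborel (\<lambda>y. case (x, y) of (x, y) \<Rightarrow> f x * g y)" using g by simp
qed

text \<open>
  The Gaussian is, up to scaling, its own Fourier transform; this is the characteristic function of the
  standard normal distribution.
\<close>

lemma gauss_ft:
  assumes e: "e > 0"
  shows "integrable lborel (\<lambda>k. exp (- (e*k)\<^sup>2/2))" (is ?A)
   and "(LINT k|lborel. complex_of_real (exp (- (e*k)\<^sup>2/2)) * exp (- \<i> * k * z)) = complex_of_real (sqrt (2*pi) / e * exp (- (z/e)\<^sup>2/2))" (is ?B)
proof -
  have nd: "exp (- y\<^sup>2/2) = sqrt (2*pi) * std_normal_density y" for y :: real by (simp add: std_normal_density_def)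
  have "integrable lborel (\<lambda>y::real. exp (- y\<^sup>2/2))" unfolding nd by simp
  from lborel_integrable_real_affine[OF this, of e 0] show ?A using e by simp
  have "(LINT k|lborel. complex_of_real (exp (- (e*k)\<^sup>2/2)) * exp (- \<i> * k * z))
     = (LINT k|lborel. (\<lambda>y. complex_of_real (exp (- y\<^sup>2/2)) * exp (- \<i> * (y/e) * z)) (0 + e * k))"
    using e by simp
  also have "\<dots> = (1/e) *\<^sub>R (LINT y|lborel. complex_of_real (exp (- y\<^sup>2/2)) * exp (- \<i> * (y/e) * z))"
    using lborel_integral_real_affine[of e "\<lambda>y. complex_of_real (exp (- y\<^sup>2/2)) * exp (- \<i> * (y/e) * z)" 0] e by simp
  also have "(LINT y|lborel. complex_of_real (exp (- y\<^sup>2/2)) * exp (- \<i> * (y/e) * z))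
      = (LINT y|lborel. complex_of_real (sqrt (2*pi)) * (std_normal_density y *\<^sub>R exp (\<i> * ((-z/e) * y))))"
    unfolding nd
  proof (rule Bochner_Integration.integral_cong)
    fix y :: real
    have "- \<i> * (y/e) * z = \<i> * ((-z/e) * y)" by (simp add: field_simps)
    then have E: "exp (- \<i> * (y/e) * z) = exp (\<i> * ((-z/e) * y))" by (rule arg_cong)
    show "complex_of_real (sqrt (2*pi) * std_normal_density y) * exp (- \<i> * (y/e) * z) = complex_of_real (sqrt (2*pi)) * (std_normal_density y *\<^sub>R exp (\<i> * ((-z/e) * y)))"
      unfolding E scaleR_conv_of_real of_real_mult by (simp only: mult.assoc)
  qed simp
  also have "\<dots> = complex_of_real (sqrt (2*pi)) * char std_normal_distribution (-z/e)"
    unfolding char_def integral_mult_right_zero by (subst integral_density) (auto simp: mult_ac)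
  also have "char std_normal_distribution (-z/e) = complex_of_real (exp (- (z/e)\<^sup>2/2))"
    by (simp add: char_std_normal_distribution)
  finally show ?B by (simp add: scaleR_conv_of_real)
qed

text \<open>
  Inversion at the origin, regularised by a Gaussian: by Fubini, averaging the transform against a
  wide Gaussian averages the function against a narrow one.
\<close>

lemma ftI_gauss:
  assumes A: "integrable lborel A" and e: "e > 0"
  shows "(LINT k|lborel. ftI A k * complex_of_real (exp (- (e*k)\<^sup>2/2))) = complex_of_real (2*pi) * (LINT y|lborel. std_normal_density y *\<^sub>R A (e * y))"
proof -
  define G where "G k = complex_of_real (exp (- (e*k)\<^sup>2/2))" for k
  note [measurable] = borel_measurable_integrable[OF A]
  have G: "integrable lborel G" unfolding G_def[abs_def] using gauss_ft(1)[OF e] by (rule integrable_of_real)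
  have [measurable]: "G \<in> borel_measurable borel" using borel_measurable_integrable[OF G] by simp
  have i: "integrable (lborel \<Otimes>\<^sub>M lborel) (\<lambda>(k, x). G k * A x * exp (- \<i> * k * x))"
    by (rule Bochner_Integration.integrable_bound[OF integrable_prod_mult[OF G A]]) (auto simp: norm_mult exp_unit split_beta)
  have "(LINT k|lborel. ftI A k * G k) = (LINT k|lborel. (LINT x|lborel. G k * A x * exp (- \<i> * k * x)))"
    unfolding ftI_def integral_mult_left_zero[symmetric]
    by (intro Bochner_Integration.integral_cong refl) (simp only: mult_ac)
  also have "\<dots> = (LINT x|lborel. (LINT k|lborel. G k * A x * exp (- \<i> * k * x)))"
    by (rule lborel_pair.Fubini_integral[OF i, symmetric])
  also have "\<dots> = (LINT x|lborel. A x * complex_of_real (sqrt (2*pi) / e * exp (- (x/e)\<^sup>2/2)))"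
  proof (rule Bochner_Integration.integral_cong)
    fix x :: real
    have "(LINT k|lborel. G k * A x * exp (- \<i> * k * x)) = A x * (LINT k|lborel. G k * exp (- \<i> * k * x))"
      by (subst integral_mult_right_zero[symmetric]) (simp add: mult_ac)
    then show "(LINT k|lborel. G k * A x * exp (- \<i> * k * x)) = A x * complex_of_real (sqrt (2*pi) / e * exp (- (x/e)\<^sup>2/2))"
      unfolding G_def gauss_ft(2)[OF e] .
  qed simp
  also have "\<dots> = e *\<^sub>R (LINT y|lborel. A (e*y) * complex_of_real (sqrt (2*pi) / e * exp (- y\<^sup>2/2)))"
    by (subst lborel_integral_real_affine[where c=e and t=0]) (use e in auto)
  also have "\<dots> = (LINT y|lborel. complex_of_real (2*pi) * (std_normal_density y *\<^sub>R A (e * y)))"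
  proof (subst integral_scaleR_right[symmetric], rule Bochner_Integration.integral_cong)
    fix y :: real
    have "sqrt (2*pi) = 2*pi / sqrt(2*pi)" by (simp add: field_simps)
    then have "e * (sqrt (2*pi) / e * exp (- y\<^sup>2/2)) = 2*pi * std_normal_density y" using e
      by (simp add: std_normal_density_def field_simps)
    then have "complex_of_real e * complex_of_real (sqrt (2*pi) / e * exp (- y\<^sup>2/2)) = complex_of_real (2*pi) * complex_of_real (std_normal_density y)"
      by (simp only: of_real_mult[symmetric])
    then have "A (e*y) * (complex_of_real e * complex_of_real (sqrt (2*pi) / e * exp (- y\<^sup>2/2))) = A (e*y) * (complex_of_real (2*pi) * complex_of_real (std_normal_density y))"
      by (simp only:)
    then show "e *\<^sub>R (A (e*y) * complex_of_real (sqrt (2*pi) / e * exp (- y\<^sup>2/2))) = complex_of_real (2*pi) * (std_normal_density y *\<^sub>R A (e * y))"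
      unfolding scaleR_conv_of_real by (simp only: mult_ac)
  qed simp
  also have "\<dots> = complex_of_real (2*pi) * (LINT y|lborel. std_normal_density y *\<^sub>R A (e * y))"
    by (rule integral_mult_right_zero)
  finally show ?thesis by (simp add: G_def)
qed

text \<open>
  The autocorrelation \<open>A z = \<integral> f(x + z) cnj (f x) dx\<close> is integrable, is continuous at the origin
  because translation is continuous in the mean, and has transform \<open>|ftI f|\<^sup>2\<close>. Inversion at the origin
  gives \<open>\<integral> |ftI f|\<^sup>2 = 2\<pi> A 0\<close>; as the transform is nonnegative, Fatou's lemma supplies its
  integrability when the Gaussian regularisation is removed.
\<close>

lemma ftI_plancherel:
  assumes f2: "f \<in> L2" and f1: "integrable lborel f"
  shows "ftI f \<in> L2" and "(nL2 (ftI f))\<^sup>2 = 2 * pi * (nL2 f)\<^sup>2"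
proof -
  note [measurable] = L2_measurable[OF f2]
  define A where "A z = (LINT x|lborel. f (x + z) * cnj (f x))" for z
  have [measurable]: "A \<in> borel_measurable borel" unfolding A_def[abs_def] by measurable
  have tr: "(\<lambda>x. f (x + z)) \<in> L2" for z using L2_affine[OF f2, of 1 z] by (simp add: add.commute)
  have tr1: "integrable lborel (\<lambda>x. f (x + z))" for z using lborel_integrable_real_affine[OF f1, of 1 z] by (simp add: add.commute)
  have ntr: "nL2 (\<lambda>x. f (x + z)) = nL2 f" for z using nL2_affine[of 1 f z] by (simp add: add.commute)
  have Ab: "cmod (A z) \<le> (nL2 f)\<^sup>2" for z
    unfolding A_def using L2_Cauchy_Schwarz[OF tr[of z] L2_cnj[OF f2]] by (simp add: ntr power2_eq_square)
  have A0: "A 0 = complex_of_real ((nL2 f)\<^sup>2)"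
    unfolding A_def nL2_sq by (simp only: integral_complex_of_real[symmetric] complex_norm_square) simp
  have Ac: "(\<lambda>n. A (z n)) \<longlonglongrightarrow> A 0" if z: "z \<longlonglongrightarrow> 0" for z :: "nat \<Rightarrow> real"
  proof (rule LIM_zero_cancel)
    have le: "cmod (A (z n) - A 0) \<le> nL2 (\<lambda>x. f (x + z n) - f x) * nL2 f" for n
    proof -
      have "A (z n) - A 0 = (LINT x|lborel. (f (x + z n) - f x) * cnj (f x))"
        unfolding A_def using L2_mult_integrable[OF tr[of "z n"] L2_cnj[OF f2]] L2_mult_integrable[OF f2 L2_cnj[OF f2]]
        by (simp add: left_diff_distrib)
      then show ?thesis using L2_Cauchy_Schwarz[OF L2_diff[OF tr[of "z n"] f2] L2_cnj[OF f2]] by simp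
    qed
    have "(\<lambda>n. nL2 (\<lambda>x. f (x + z n) - f x) * nL2 f) \<longlonglongrightarrow> 0 * nL2 f"
      by (intro tendsto_mult L2_translation_continuous_seq f2 z tendsto_const)
    then show "(\<lambda>n. A (z n) - A 0) \<longlonglongrightarrow> 0"
      by (intro Lim_null_comparison[OF always_eventually[rule_format, OF le]]) simp
  qed
  have prod: "integrable (lborel \<Otimes>\<^sub>M lborel) (\<lambda>(x, z). cnj (f x) * f (x + z))"
  proof (rule lborel_pair.Fubini_integrable)
    show "(\<lambda>(x, z). cnj (f x) * f (x + z)) \<in> borel_measurable (lborel \<Otimes>\<^sub>M lborel)" by measurable
    have "(LINT y|lborel. cmod (f (x + y))) = (LINT y|lborel. cmod (f y))" for x
      by (subst (2) lborel_integral_real_affine[where c=1 and t=x]) auto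
    then show "integrable lborel (\<lambda>x. LINT y|lborel. norm (case (x, y) of (x, z) \<Rightarrow> cnj (f x) * f (x + z)))"
      using f1 by (simp add: norm_mult)
    show "AE x in lborel. integrable lborel (\<lambda>y. case (x, y) of (x, z) \<Rightarrow> cnj (f x) * f (x + z))"
      using tr1 by (simp add: add.commute)
  qed
  have A1: "integrable lborel A"
    using lborel_pair.integrable_snd[OF prod] unfolding A_def[abs_def] by (simp add: mult.commute)
  have ft: "ftI A k = complex_of_real ((cmod (ftI f k))\<^sup>2)" for k
  proof -
    have pi: "integrable (lborel \<Otimes>\<^sub>M lborel) (\<lambda>(x, z). cnj (f x) * f (x + z) * exp (- \<i> * k * z))"
      by (rule Bochner_Integration.integrable_bound[OF prod]) (auto simp: norm_mult exp_unit split_beta)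
    have "ftI A k = (LINT z|lborel. (LINT x|lborel. cnj (f x) * f (x + z) * exp (- \<i> * k * z)))"
      unfolding ftI_def A_def integral_mult_left_zero[symmetric]
      by (intro Bochner_Integration.integral_cong refl) (simp only: mult_ac)
    also have "\<dots> = (LINT x|lborel. (LINT z|lborel. cnj (f x) * f (x + z) * exp (- \<i> * k * z)))"
      by (rule lborel_pair.Fubini_integral[OF pi])
    also have "\<dots> = (LINT x|lborel. cnj (f x * exp (- \<i> * k * x)) * ftI f k)"
    proof (rule Bochner_Integration.integral_cong)
      fix x :: real
      have "ftI f k = (LINT z|lborel. f (x + z) * exp (- \<i> * k * (x + z)))"
        unfolding ftI_def by (subst lborel_integral_real_affine[where c=1 and t=x]) auto
      then have "cnj (f x * exp (- \<i> * k * x)) * ftI f k = (LINT z|lborel. cnj (f x * exp (- \<i> * k * x)) * (f (x + z) * exp (- \<i> * k * (x + z))))"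
        by simp
      also have "\<dots> = (LINT z|lborel. cnj (f x) * f (x + z) * exp (- \<i> * k * z))"
      proof (rule Bochner_Integration.integral_cong)
        fix z :: real
        have 1: "exp (\<i> * k * x) * exp (- \<i> * k * (x + z)) = exp (- \<i> * k * z)"
          by (simp add: exp_add[symmetric] algebra_simps)
        have 2: "cnj (exp (- \<i> * k * x)) = exp (\<i> * k * x)" by (simp add: exp_cnj)
        show "cnj (f x * exp (- \<i> * k * x)) * (f (x + z) * exp (- \<i> * k * (x + z))) = cnj (f x) * f (x + z) * exp (- \<i> * k * z)"
          unfolding complex_cnj_mult 2 1[symmetric] by (simp only: mult_ac)
      qed simp
      finally show "(LINT z|lborel. cnj (f x) * f (x + z) * exp (- \<i> * k * z)) = cnj (f x * exp (- \<i> * k * x)) * ftI f k" by simp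
    qed simp
    also have "\<dots> = cnj (ftI f k) * ftI f k"
      unfolding ftI_def by (simp only: integral_mult_left_zero Bochner_Integration.integral_cnj)
    finally show ?thesis by (simp only: complex_norm_square mult.commute)
  qed
  define e where "e n = inverse (real (Suc n))" for n
  have e0: "e n > 0" for n by (simp add: e_def)
  have el: "e \<longlonglongrightarrow> 0" unfolding e_def using LIMSEQ_inverse_real_of_nat by simp
  have "(\<lambda>n. complex_of_real (2*pi) * (LINT y|lborel. std_normal_density y *\<^sub>R A (e n * y))) \<longlonglongrightarrow> complex_of_real (2*pi) * (LINT y|lborel. std_normal_density y *\<^sub>R A 0)"
  proof (intro tendsto_mult tendsto_const integral_dominated_convergence)
    show "integrable lborel (\<lambda>y. std_normal_density y * (nL2 f)\<^sup>2)" by simp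
    show "AE y in lborel. (\<lambda>n. std_normal_density y *\<^sub>R A (e n * y)) \<longlonglongrightarrow> std_normal_density y *\<^sub>R A 0"
    proof (rule AE_I2)
      fix y :: real
      have "(\<lambda>n. e n * y) \<longlonglongrightarrow> 0" using tendsto_mult_left_zero[OF el] .
      then show "(\<lambda>n. std_normal_density y *\<^sub>R A (e n * y)) \<longlonglongrightarrow> std_normal_density y *\<^sub>R A 0"
        by (intro tendsto_intros Ac)
    qed
    show "AE y in lborel. norm (std_normal_density y *\<^sub>R A (e n * y)) \<le> std_normal_density y * (nL2 f)\<^sup>2" for n
      using Ab by (auto intro!: mult_left_mono)
  qed simp_all
  also have "(LINT y|lborel. std_normal_density y *\<^sub>R A 0) = A 0" by (simp add: integral_scaleR_left)
  finally have "(\<lambda>n. LINT k|lborel. ftI A k * complex_of_real (exp (- (e n*k)\<^sup>2/2))) \<longlonglongrightarrow> complex_of_real (2*pi) * A 0"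
    unfolding ftI_gauss[OF A1 e0] .
  then have "(\<lambda>n. LINT k|lborel. complex_of_real ((cmod (ftI f k))\<^sup>2 * exp (- (e n*k)\<^sup>2/2))) \<longlonglongrightarrow> complex_of_real (2*pi * (nL2 f)\<^sup>2)"
    unfolding ft A0 by simp
  then have lim: "(\<lambda>n. LINT k|lborel. (cmod (ftI f k))\<^sup>2 * exp (- (e n*k)\<^sup>2/2)) \<longlonglongrightarrow> 2*pi * (nL2 f)\<^sup>2"
    unfolding integral_complex_of_real tendsto_of_real_iff .
  have gi: "integrable lborel (\<lambda>k. (cmod (ftI f k))\<^sup>2 * exp (- (e n*k)\<^sup>2/2))" for n
  proof (rule Bochner_Integration.integrable_bound)
    show "integrable lborel (\<lambda>k. (LINT x|lborel. cmod (f x))\<^sup>2 * exp (- (e n*k)\<^sup>2/2))" using gauss_ft(1)[OF e0[of n]] by simp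
    show "AE k in lborel. norm ((cmod (ftI f k))\<^sup>2 * exp (- (e n*k)\<^sup>2/2)) \<le> norm ((LINT x|lborel. cmod (f x))\<^sup>2 * exp (- (e n*k)\<^sup>2/2))"
      by (auto simp: norm_mult intro!: mult_right_mono power_mono ftI_bound)
  qed simp
  have gl: "(\<lambda>n. (cmod (ftI f k))\<^sup>2 * exp (- (e n*k)\<^sup>2/2)) \<longlonglongrightarrow> (cmod (ftI f k))\<^sup>2" for k
  proof -
    have "(\<lambda>n. (cmod (ftI f k))\<^sup>2 * exp (- (e n*k)\<^sup>2/2)) \<longlonglongrightarrow> (cmod (ftI f k))\<^sup>2 * exp (- (0*k)\<^sup>2/2)"
      by (intro tendsto_intros el) auto
    then show ?thesis by simp
  qed
  have "(\<integral>\<^sup>+k. ennreal ((cmod (ftI f k))\<^sup>2) \<partial>lborel) = (\<integral>\<^sup>+k. liminf (\<lambda>n. ennreal ((cmod (ftI f k))\<^sup>2 * exp (- (e n*k)\<^sup>2/2))) \<partial>lborel)"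
    using gl by (intro nn_integral_cong lim_imp_Liminf[symmetric]) auto
  also have "\<dots> \<le> liminf (\<lambda>n. \<integral>\<^sup>+k. ennreal ((cmod (ftI f k))\<^sup>2 * exp (- (e n*k)\<^sup>2/2)) \<partial>lborel)"
    by (rule nn_integral_liminf) simp
  also have "\<dots> = liminf (\<lambda>n. ennreal (LINT k|lborel. (cmod (ftI f k))\<^sup>2 * exp (- (e n*k)\<^sup>2/2)))"
    by (subst nn_integral_eq_integral[OF gi]) auto
  also have "\<dots> = ennreal (2*pi * (nL2 f)\<^sup>2)"
    using lim by (intro lim_imp_Liminf) auto
  finally have fin: "(\<integral>\<^sup>+k. ennreal ((cmod (ftI f k))\<^sup>2) \<partial>lborel) \<le> ennreal ((sqrt (2*pi) * nL2 f)\<^sup>2)"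
    by (simp add: power_mult_distrib)
  show f2h: "ftI f \<in> L2" using L2_of_nn(1)[OF _ fin] by simp
  have "(\<lambda>n. LINT k|lborel. (cmod (ftI f k))\<^sup>2 * exp (- (e n*k)\<^sup>2/2)) \<longlonglongrightarrow> (LINT k|lborel. (cmod (ftI f k))\<^sup>2)"
  proof (rule integral_dominated_convergence)
    show "integrable lborel (\<lambda>k. (cmod (ftI f k))\<^sup>2)" by (rule L2_integrable[OF f2h])
    show "AE k in lborel. norm ((cmod (ftI f k))\<^sup>2 * exp (- (e n*k)\<^sup>2/2)) \<le> (cmod (ftI f k))\<^sup>2" for n
      by (auto simp: norm_mult intro!: mult_left_le)
  qed (use gl in auto)
  with lim show "(nL2 (ftI f))\<^sup>2 = 2 * pi * (nL2 f)\<^sup>2" unfolding nL2_sq[of "ftI f"] using LIMSEQ_unique by blast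
qed

section \<open>The Fourier transform on square-integrable functions\<close>

definition cut :: "real \<Rightarrow> (real \<Rightarrow> complex) \<Rightarrow> real \<Rightarrow> complex" where
  "cut N f x = (if \<bar>x\<bar> \<le> N then f x else 0)"

lemma cut_measurable [measurable]:
  assumes [measurable]: "f \<in> borel_measurable borel" shows "cut N f \<in> borel_measurable borel"
  unfolding cut_def[abs_def] by measurable

lemma cut_L2: assumes "f \<in> L2" shows "cut N f \<in> L2"
  by (rule L2_bound[OF assms, where c=1]) (use L2_measurable[OF assms] in \<open>auto simp: cut_def\<close>)

lemma cut_integrable: assumes f: "f \<in> L2" shows "integrable lborel (cut N f)"
proof -
  have "(\<lambda>x. indicator {-N..N} x :: complex) \<in> L2"
    by (rule L2_bounded_support[where c=1 and R=N]) (auto simp: indicator_def)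
  from L2_mult_integrable[OF this f] show ?thesis
    by (rule back_subst[of "integrable lborel"]) (auto simp: cut_def indicator_def fun_eq_iff)
qed

lemma cut_tendsto:
  assumes f: "f \<in> L2" shows "((\<lambda>N. nL2 (\<lambda>x. cut N f x - f x)) \<longlongrightarrow> 0) at_top"
proof (rule tendsto_at_topI_sequentially)
  fix X :: "nat \<Rightarrow> real" assume X: "filterlim X at_top sequentially"
  note [measurable] = L2_measurable[OF f]
  show "(\<lambda>n. nL2 (\<lambda>x. cut (X n) f x - f x)) \<longlonglongrightarrow> 0"
  proof (rule nL2_dominated[OF f])
    show "AE x in lborel. (\<lambda>n. cut (X n) f x) \<longlonglongrightarrow> f x"
    proof (rule AE_I2)
      fix x
      have "eventually (\<lambda>n. X n \<ge> \<bar>x\<bar>) sequentially" using X by (simp add: filterlim_at_top)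
      then have "eventually (\<lambda>n. cut (X n) f x = f x) sequentially" by eventually_elim (simp add: cut_def)
      then show "(\<lambda>n. cut (X n) f x) \<longlonglongrightarrow> f x" by (rule tendsto_eventually)
    qed
  qed (auto simp: cut_def)
qed

text \<open>
  The transform of a square-integrable function as a relation, because it is determined only up to
  null sets.
\<close>

definition is_FT :: "(real \<Rightarrow> complex) \<Rightarrow> (real \<Rightarrow> complex) \<Rightarrow> bool" where
  "is_FT f g \<longleftrightarrow> f \<in> L2 \<and> g \<in> L2 \<and> ((\<lambda>N. nL2 (\<lambda>k. ftI (cut N f) k - g k)) \<longlongrightarrow> 0) at_top"

lemma is_FT_L2: "is_FT f g \<Longrightarrow> f \<in> L2" "is_FT f g \<Longrightarrow> g \<in> L2" by (auto simp: is_FT_def)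

lemma ftI_L2_diff:
  assumes "f \<in> L2" "integrable lborel f" "g \<in> L2" "integrable lborel g"
  shows "nL2 (\<lambda>k. ftI f k - ftI g k) = sqrt (2*pi) * nL2 (\<lambda>x. f x - g x)"
proof -
  have "(\<lambda>k. ftI f k - ftI g k) = ftI (\<lambda>x. f x - g x)" using ftI_diff[OF assms(2,4)] by auto
  moreover have "nL2 (ftI (\<lambda>x. f x - g x)) = sqrt ((nL2 (ftI (\<lambda>x. f x - g x)))\<^sup>2)" by simp
  ultimately show ?thesis
    using ftI_plancherel(2)[OF L2_diff[OF assms(1,3)] Bochner_Integration.integrable_diff[OF assms(2,4)]]
    by (simp add: real_sqrt_mult)
qed

lemma ftI_L2: "f \<in> L2 \<Longrightarrow> integrable lborel f \<Longrightarrow> ftI f \<in> L2"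
  by (rule ftI_plancherel(1))

lemma is_FT_ftI:
  assumes "f \<in> L2" "integrable lborel f" shows "is_FT f (ftI f)"
  unfolding is_FT_def
  using assms ftI_L2_diff[OF cut_L2[OF assms(1)] cut_integrable[OF assms(1)] assms]
    tendsto_mult_right_zero[OF cut_tendsto[OF assms(1)], of "sqrt (2*pi)"]
  by (auto simp: ftI_L2)

lemma tendsto_real_seq: "(f \<longlongrightarrow> l) at_top \<Longrightarrow> (\<lambda>n. f (real n)) \<longlonglongrightarrow> l"
  by (rule filterlim_compose[OF _ filterlim_real_sequentially])

text \<open>
  By Plancherel's identity the transforms of the truncations are Cauchy.
\<close>

lemma is_FT_exists:
  assumes f: "f \<in> L2" shows "\<exists>g. is_FT f g"
proof -
  let ?F = "\<lambda>N. ftI (cut N f)"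
  have F2: "?F N \<in> L2" for N using f by (intro ftI_L2 cut_L2 cut_integrable)
  have d: "nL2 (\<lambda>k. ?F N k - ?F M k) = sqrt (2*pi) * nL2 (\<lambda>x. cut N f x - cut M f x)" for N M
    using f by (intro ftI_L2_diff cut_L2 cut_integrable)
  have tri: "nL2 (\<lambda>x. cut N f x - cut M f x) \<le> nL2 (\<lambda>x. cut N f x - f x) + nL2 (\<lambda>x. cut M f x - f x)" for N M
    using nL2_triangle_diff[OF cut_L2[OF f] f cut_L2[OF f]] nL2_minus_commute[of f] by metis
  have s2: "sqrt (2*pi) > 0" by simp
  have "\<exists>g\<in>L2. (\<lambda>n. nL2 (\<lambda>k. ?F (real n) k - g k)) \<longlonglongrightarrow> 0"
  proof (rule L2_complete)
    fix e :: real assume e: "e > 0"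
    define e' where "e' = e / sqrt (2*pi) / 2"
    have "e' > 0" using e s2 by (simp add: e'_def)
    then obtain M where M: "\<And>n. n \<ge> M \<Longrightarrow> nL2 (\<lambda>x. cut (real n) f x - f x) < e'"
      using LIMSEQ_D[OF tendsto_real_seq[OF cut_tendsto[OF f]], of e'] by auto
    have "nL2 (\<lambda>x. ?F (real m) x - ?F (real n) x) < e" if "m \<ge> M" "n \<ge> M" for m n
    proof -
      have "nL2 (\<lambda>x. cut (real m) f x - cut (real n) f x) < e / sqrt (2*pi)"
        using tri[of m n] M[OF that(1)] M[OF that(2)] unfolding e'_def by linarith
      then show ?thesis unfolding d using s2 by (simp add: pos_less_divide_eq mult.commute)
    qed
    then show "\<exists>M. \<forall>m\<ge>M. \<forall>n\<ge>M. nL2 (\<lambda>x. ?F (real m) x - ?F (real n) x) < e" by blast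
  qed (rule F2)
  then obtain g where g: "g \<in> L2" and gl: "(\<lambda>n. nL2 (\<lambda>k. ?F (real n) k - g k)) \<longlonglongrightarrow> 0" by blast
  have b: "nL2 (\<lambda>k. ?F N k - g k) \<le> sqrt (2*pi) * nL2 (\<lambda>x. cut N f x - f x)" for N
  proof (rule LIMSEQ_le_const)
    show "(\<lambda>n. sqrt (2*pi) * (nL2 (\<lambda>x. cut N f x - f x) + nL2 (\<lambda>x. cut (real n) f x - f x)) + nL2 (\<lambda>k. ?F (real n) k - g k))
       \<longlonglongrightarrow> sqrt (2*pi) * nL2 (\<lambda>x. cut N f x - f x)"
    proof -
      have "(\<lambda>n. sqrt (2*pi) * (nL2 (\<lambda>x. cut N f x - f x) + nL2 (\<lambda>x. cut (real n) f x - f x)) + nL2 (\<lambda>k. ?F (real n) k - g k))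
       \<longlonglongrightarrow> sqrt (2*pi) * (nL2 (\<lambda>x. cut N f x - f x) + 0) + 0"
        by (intro tendsto_intros gl tendsto_real_seq[OF cut_tendsto[OF f]])
      then show ?thesis by simp
    qed
    have "nL2 (\<lambda>k. ?F N k - g k) \<le> sqrt (2*pi) * (nL2 (\<lambda>x. cut N f x - f x) + nL2 (\<lambda>x. cut (real n) f x - f x)) + nL2 (\<lambda>k. ?F (real n) k - g k)" for n
    proof -
      have "sqrt (2*pi) * nL2 (\<lambda>x. cut N f x - cut (real n) f x) \<le> sqrt (2*pi) * (nL2 (\<lambda>x. cut N f x - f x) + nL2 (\<lambda>x. cut (real n) f x - f x))"
        by (rule mult_left_mono[OF tri]) simp
      then show ?thesis using nL2_triangle_diff[OF F2[of N] F2[of n] g] unfolding d by linarith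
    qed
    then show "\<exists>M. \<forall>n\<ge>M. nL2 (\<lambda>k. ?F N k - g k) \<le> sqrt (2*pi) * (nL2 (\<lambda>x. cut N f x - f x) + nL2 (\<lambda>x. cut (real n) f x - f x)) + nL2 (\<lambda>k. ?F (real n) k - g k)"
      by blast
  qed
  have "((\<lambda>N. nL2 (\<lambda>k. ?F N k - g k)) \<longlongrightarrow> 0) at_top"
    by (rule tendsto_sandwich[OF _ _ tendsto_const tendsto_mult_right_zero[OF cut_tendsto[OF f], of "sqrt (2*pi)"]])
       (use b in auto)
  then show ?thesis using f g unfolding is_FT_def by blast
qed

lemma is_FT_seq:
  assumes "is_FT f g" shows "(\<lambda>n. nL2 (\<lambda>k. ftI (cut (real n) f) k - g k)) \<longlonglongrightarrow> 0"
  using assms tendsto_real_seq unfolding is_FT_def by blast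

lemma is_FT_unique:
  assumes "is_FT f g" "is_FT f h" shows "AE k in lborel. g k = h k"
  by (rule L2_lim_unique[OF _ _ _ is_FT_seq[OF assms(1)] is_FT_seq[OF assms(2)]])
     (use assms in \<open>auto simp: is_FT_def intro!: ftI_L2 cut_L2 cut_integrable\<close>)

lemma nL2_tendsto:
  assumes "\<And>n. f n \<in> L2" "g \<in> L2" "(\<lambda>n. nL2 (\<lambda>k. f n k - g k)) \<longlonglongrightarrow> 0"
  shows "(\<lambda>n. nL2 (f n)) \<longlonglongrightarrow> nL2 g"
proof (rule LIM_zero_cancel, rule Lim_null_comparison[OF always_eventually[rule_format] assms(3)])
  show "norm (nL2 (f n) - nL2 g) \<le> nL2 (\<lambda>k. f n k - g k)" for n
    using nL2_rev_triangle[OF assms(1,2)] by simp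
qed

lemma is_FT_norm:
  assumes "is_FT f g" shows "nL2 g = sqrt (2*pi) * nL2 f"
proof -
  have f: "f \<in> L2" and g: "g \<in> L2" using assms by (auto simp: is_FT_def)
  have e: "nL2 (ftI (cut N f)) = sqrt (2*pi) * nL2 (cut N f)" for N
  proof -
    have "nL2 (ftI (cut N f)) = sqrt ((nL2 (ftI (cut N f)))\<^sup>2)" by simp
    then show ?thesis using ftI_plancherel(2)[OF cut_L2[OF f] cut_integrable[OF f], of N]
      by (simp add: real_sqrt_mult)
  qed
  have "(\<lambda>n. sqrt (2*pi) * nL2 (cut (real n) f)) \<longlonglongrightarrow> sqrt (2*pi) * nL2 f"
    by (intro tendsto_mult tendsto_const nL2_tendsto cut_L2 f tendsto_real_seq[OF cut_tendsto])
  moreover have "(\<lambda>n. nL2 (ftI (cut (real n) f))) \<longlonglongrightarrow> nL2 g"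
    by (intro nL2_tendsto is_FT_seq assms g ftI_L2 cut_L2 cut_integrable f)
  ultimately show ?thesis unfolding e by (metis LIMSEQ_unique)
qed

lemma is_FT_lin:
  assumes 1: "is_FT f g" and 2: "is_FT f' g'"
  shows "is_FT (\<lambda>x. a * f x + b * f' x) (\<lambda>k. a * g k + b * g' k)"
proof -
  have f: "f \<in> L2" and g: "g \<in> L2" and f': "f' \<in> L2" and g': "g' \<in> L2"
    and l: "((\<lambda>N. nL2 (\<lambda>k. ftI (cut N f) k - g k)) \<longlongrightarrow> 0) at_top"
    and l': "((\<lambda>N. nL2 (\<lambda>k. ftI (cut N f') k - g' k)) \<longlongrightarrow> 0) at_top"
    using assms by (auto simp: is_FT_def)
  have e: "ftI (cut N (\<lambda>x. a * f x + b * f' x)) k = a * ftI (cut N f) k + b * ftI (cut N f') k" for N k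
  proof -
    have "ftI (cut N (\<lambda>x. a * f x + b * f' x)) k = (LINT x|lborel. a * (cut N f x * exp (- \<i> * k * x)) + b * (cut N f' x * exp (- \<i> * k * x)))"
      unfolding ftI_def by (intro Bochner_Integration.integral_cong) (auto simp: cut_def algebra_simps)
    also have "\<dots> = a * ftI (cut N f) k + b * ftI (cut N f') k"
      unfolding ftI_def
    proof (subst Bochner_Integration.integral_add)
      show "integrable lborel (\<lambda>x. a * (cut N f x * exp (- \<i> * k * x)))" "integrable lborel (\<lambda>x. b * (cut N f' x * exp (- \<i> * k * x)))"
        by (rule integrable_mult_right ftI_integrable cut_integrable f f')+
    qed (simp only: integral_mult_right_zero)
    finally show ?thesis .
  qed
  have t': "norm (nL2 (\<lambda>k. ftI (cut N (\<lambda>x. a * f x + b * f' x)) k - (a * g k + b * g' k)))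
     \<le> cmod a * nL2 (\<lambda>k. ftI (cut N f) k - g k) + cmod b * nL2 (\<lambda>k. ftI (cut N f') k - g' k)" for N
  proof -
    have x: "(\<lambda>k. ftI (cut N f) k - g k) \<in> L2" "(\<lambda>k. ftI (cut N f') k - g' k) \<in> L2"
      using f f' g g' by (auto intro!: L2_diff ftI_L2 cut_L2 cut_integrable)
    show ?thesis using nL2_triangle[OF L2_cmult[OF x(1), of a] L2_cmult[OF x(2), of b]]
      unfolding e nL2_cmult by (simp add: algebra_simps)
  qed
  have "((\<lambda>N. cmod a * nL2 (\<lambda>k. ftI (cut N f) k - g k) + cmod b * nL2 (\<lambda>k. ftI (cut N f') k - g' k)) \<longlongrightarrow> cmod a * 0 + cmod b * 0) at_top"
    by (intro tendsto_intros l l')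
  then have "((\<lambda>N. nL2 (\<lambda>k. ftI (cut N (\<lambda>x. a * f x + b * f' x)) k - (a * g k + b * g' k))) \<longlongrightarrow> 0) at_top"
    by (intro Lim_null_comparison[OF always_eventually[rule_format, OF t']]) simp
  then show ?thesis unfolding is_FT_def using f f' g g' by (auto intro!: L2_add L2_cmult)
qed

lemma is_FT_diff: "is_FT f g \<Longrightarrow> is_FT f' g' \<Longrightarrow> is_FT (\<lambda>x. f x - f' x) (\<lambda>k. g k - g' k)"
  using is_FT_lin[of f g f' g' 1 "-1"] by simp

lemma is_FT_cong:
  assumes 1: "is_FT f g" and f: "AE x in lborel. f x = f' x" "f' \<in> borel_measurable borel"
    and g: "AE x in lborel. g x = g' x" "g' \<in> borel_measurable borel"
  shows "is_FT f' g'"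
proof -
  have f2: "f \<in> L2" "g \<in> L2" using 1 by (auto simp: is_FT_def)
  note [measurable] = L2_measurable[OF f2(1)] L2_measurable[OF f2(2)] f(2) g(2)
  have "ftI (cut N f) k = ftI (cut N f') k" for N k
    unfolding ftI_def by (rule integral_cong_AE) (use f(1) in \<open>auto simp: cut_def\<close>)
  then have "nL2 (\<lambda>k. ftI (cut N f) k - g k) = nL2 (\<lambda>k. ftI (cut N f') k - g' k)" for N
    by (intro nL2_cong_AE) (use g(1) in auto)
  then show ?thesis using 1 L2_cong_AE[OF f(1) f2(1) f(2)] L2_cong_AE[OF g(1) f2(2) g(2)]
    unfolding is_FT_def by simp
qed

lemma L2_inner_tendsto:
  assumes f: "\<And>n. f n \<in> L2" "f' \<in> L2" and g: "\<And>n. g n \<in> L2" "(g'::real\<Rightarrow>complex) \<in> L2"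
    and lf: "(\<lambda>n. nL2 (\<lambda>x. f n x - f' x)) \<longlonglongrightarrow> 0" and lg: "(\<lambda>n. nL2 (\<lambda>x. g n x - g' x)) \<longlonglongrightarrow> 0"
  shows "(\<lambda>n. LINT x|lborel. f n x * g n x) \<longlonglongrightarrow> (LINT x|lborel. f' x * g' x)"
proof (rule LIM_zero_cancel)
  have le: "norm ((LINT x|lborel. f n x * g n x) - (LINT x|lborel. f' x * g' x)) \<le> nL2 (\<lambda>x. f n x - f' x) * nL2 (g n) + nL2 f' * nL2 (\<lambda>x. g n x - g' x)" for n
  proof -
    have i: "integrable lborel (\<lambda>x. f n x * g n x)" "integrable lborel (\<lambda>x. f' x * g' x)" "integrable lborel (\<lambda>x. f' x * g n x)"
      using f g by (auto intro!: L2_mult_integrable)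
    have "(LINT x|lborel. f n x * g n x) - (LINT x|lborel. f' x * g' x) = (LINT x|lborel. (f n x - f' x) * g n x) + (LINT x|lborel. f' x * (g n x - g' x))"
      using i by (simp add: algebra_simps)
    then show ?thesis
      using norm_triangle_mono[OF L2_Cauchy_Schwarz[OF L2_diff[OF f(1)[of n] f(2)] g(1)[of n]] L2_Cauchy_Schwarz[OF f(2) L2_diff[OF g(1)[of n] g(2)]]] by simp
  qed
  have "(\<lambda>n. nL2 (\<lambda>x. f n x - f' x) * nL2 (g n) + nL2 f' * nL2 (\<lambda>x. g n x - g' x)) \<longlonglongrightarrow> 0 * nL2 g' + nL2 f' * 0"
    by (intro tendsto_intros lf lg nL2_tendsto g)
  then show "(\<lambda>n. (LINT x|lborel. f n x * g n x) - (LINT x|lborel. f' x * g' x)) \<longlonglongrightarrow> 0"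
    by (intro Lim_null_comparison[OF always_eventually[rule_format, OF le]]) simp
qed

text \<open>
  Fubini's theorem, as the exponential is symmetric in frequency and position.
\<close>

lemma ftI_mult_formula:
  assumes f: "integrable lborel f" and g: "integrable lborel g"
  shows "(LINT k|lborel. ftI f k * g k) = (LINT x|lborel. f x * ftI g x)"
proof -
  note [measurable] = borel_measurable_integrable[OF f] borel_measurable_integrable[OF g]
  have i: "integrable (lborel \<Otimes>\<^sub>M lborel) (\<lambda>(k, x). g k * f x * exp (- \<i> * k * x))"
    by (rule Bochner_Integration.integrable_bound[OF integrable_prod_mult[OF g f]]) (auto simp: norm_mult exp_unit split_beta)
  have "(LINT k|lborel. ftI f k * g k) = (LINT k|lborel. (LINT x|lborel. g k * f x * exp (- \<i> * k * x)))"
    unfolding ftI_def integral_mult_left_zero[symmetric]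
    by (intro Bochner_Integration.integral_cong refl) (simp only: mult_ac)
  also have "\<dots> = (LINT x|lborel. (LINT k|lborel. g k * f x * exp (- \<i> * k * x)))"
    by (rule lborel_pair.Fubini_integral[OF i, symmetric])
  also have "\<dots> = (LINT x|lborel. f x * ftI g x)"
    unfolding ftI_def integral_mult_right_zero[symmetric]
    by (intro Bochner_Integration.integral_cong refl) (simp only: mult_ac)
  finally show ?thesis .
qed

lemma is_FT_mult_formula:
  assumes 1: "is_FT f F" and 2: "is_FT g G"
  shows "(LINT k|lborel. F k * g k) = (LINT x|lborel. f x * G x)"
proof (rule LIMSEQ_unique)
  note L = is_FT_L2[OF 1] is_FT_L2[OF 2]
  note C = cut_L2[OF L(1)] cut_L2[OF L(3)] cut_integrable[OF L(1)] cut_integrable[OF L(3)]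
  show "(\<lambda>n. LINT k|lborel. ftI (cut (real n) f) k * cut (real n) g k) \<longlonglongrightarrow> (LINT k|lborel. F k * g k)"
    by (intro L2_inner_tendsto L C ftI_L2 is_FT_seq[OF 1] tendsto_real_seq[OF cut_tendsto[OF L(3)]])
  show "(\<lambda>n. LINT k|lborel. ftI (cut (real n) f) k * cut (real n) g k) \<longlonglongrightarrow> (LINT k|lborel. f k * G k)"
    unfolding ftI_mult_formula[OF C(3,4)]
    by (intro L2_inner_tendsto L C ftI_L2 is_FT_seq[OF 2] tendsto_real_seq[OF cut_tendsto[OF L(1)]])
qed

lemma is_FT_cnj:
  assumes 1: "is_FT f F" shows "is_FT (\<lambda>x. cnj (f x)) (\<lambda>k. cnj (F (- k)))"
proof -
  have e: "ftI (cut N (\<lambda>x. cnj (f x))) k = cnj (ftI (cut N f) (- k))" for N k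
  proof -
    have "cnj (ftI (cut N f) (- k)) = (LINT x|lborel. cnj (cut N f x * exp (- \<i> * complex_of_real (- k) * complex_of_real x)))"
      unfolding ftI_def by (rule Bochner_Integration.integral_cnj[symmetric])
    also have "\<dots> = ftI (cut N (\<lambda>x. cnj (f x))) k" unfolding ftI_def
      by (intro Bochner_Integration.integral_cong) (auto simp: cut_def exp_cnj)
    finally show ?thesis by simp
  qed
  have "nL2 (\<lambda>k. ftI (cut N (\<lambda>x. cnj (f x))) k - cnj (F (- k))) = nL2 (\<lambda>k. ftI (cut N f) k - F k)" for N
    using nL2_reflect[of "\<lambda>k. ftI (cut N f) k - F k"] unfolding e nL2_def
    by (simp flip: complex_cnj_diff)
  then show ?thesis using 1 unfolding is_FT_def by (auto intro!: L2_cnj L2_reflect)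
qed

text \<open>
  The transform \<open>F\<close> of the candidate \<open>G(- x)/(2\<pi>)\<close> has the same norm as \<open>g\<close>, and by the multiplication
  formula the inner product of \<open>F\<close> and \<open>g\<close> is the square of that norm; hence \<open>F = g\<close>.
\<close>

lemma is_FT_inverse:
  assumes 1: "is_FT g G" shows "is_FT (\<lambda>x. complex_of_real (1/(2*pi)) * G (- x)) g"
proof -
  let ?f = "\<lambda>x. complex_of_real (1/(2*pi)) * G (- x)"
  note L = is_FT_L2[OF 1]
  have f: "?f \<in> L2" by (intro L2_cmult L2_reflect L)
  then obtain F where F: "is_FT ?f F" using is_FT_exists by blast
  have F2: "F \<in> L2" using is_FT_L2[OF F] by simp
  have nf: "nL2 ?f = 1/(2*pi) * (sqrt (2*pi) * nL2 g)"
    unfolding nL2_cmult nL2_reflect is_FT_norm[OF 1] norm_of_real by simp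
  have s: "sqrt (2*pi) * sqrt (2*pi) = 2*pi" by simp
  have nF: "nL2 F = nL2 g" unfolding is_FT_norm[OF F] nf using s by (simp add: field_simps)
  have "(LINT k|lborel. F k * cnj (g k)) = (LINT x|lborel. ?f x * cnj (G (- x)))"
    by (rule is_FT_mult_formula[OF F is_FT_cnj[OF 1]])
  also have "\<dots> = complex_of_real (1/(2*pi)) * complex_of_real (LINT x|lborel. (cmod (G (- x)))\<^sup>2)"
    unfolding integral_complex_of_real[symmetric] complex_norm_square
    by (simp add: mult.assoc)
  also have "(LINT x|lborel. (cmod (G (- x)))\<^sup>2) = (nL2 G)\<^sup>2" using nL2_reflect[of G] nL2_sq[of "\<lambda>x. G (- x)"] by simp
  also have "(nL2 G)\<^sup>2 = 2*pi*(nL2 g)\<^sup>2" unfolding is_FT_norm[OF 1] by (simp add: power_mult_distrib)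
  finally have ip: "(LINT k|lborel. F k * cnj (g k)) = complex_of_real ((nL2 g)\<^sup>2)" by simp
  have "(nL2 (\<lambda>k. - g k + F k))\<^sup>2 = (nL2 (\<lambda>k. - g k))\<^sup>2 + 2 * Re (LINT k|lborel. F k * cnj (- g k)) + (nL2 F)\<^sup>2"
    by (rule nL2_add_sq[OF L2_uminus[OF L(1)] F2])
  also have "nL2 (\<lambda>k. - g k) = nL2 g" by (simp add: nL2_def)
  also have "(LINT k|lborel. F k * cnj (- g k)) = - complex_of_real ((nL2 g)\<^sup>2)" using ip by simp
  finally have "nL2 (\<lambda>k. F k - g k) = 0" using nF by simp
  then have "AE k in lborel. F k = g k" using nL2_0_AE[OF L2_diff[OF F2 L(1)]] by simp
  then show ?thesis using is_FT_cong[OF F _ L2_measurable[OF f] _ L2_measurable[OF L(1)]] by simp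
qed

lemma is_FT_inj:
  assumes "is_FT f F" "is_FT g G" "AE k in lborel. F k = G k" shows "AE x in lborel. f x = g x"
proof -
  note L = is_FT_L2[OF assms(1)] is_FT_L2[OF assms(2)]
  have "nL2 (\<lambda>k. F k - G k) = nL2 (\<lambda>k. 0)"
    using assms(3) L2_measurable[OF L(2)] L2_measurable[OF L(4)] by (intro nL2_cong_AE) auto
  then have "nL2 (\<lambda>x. f x - g x) = 0" using is_FT_norm[OF is_FT_diff[OF assms(1,2)]] by (simp add: nL2_def)
  then show ?thesis using nL2_0_AE[OF L2_diff[OF L(1,3)]] by simp
qed

section \<open>Fourier transforms of real functions\<close>

abbreviation cr :: "(real \<Rightarrow> real) \<Rightarrow> real \<Rightarrow> complex" where "cr f \<equiv> \<lambda>x. complex_of_real (f x)"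

lemma cr_L2: "cr f \<in> L2 \<longleftrightarrow> f \<in> L2"
proof
  assume "cr f \<in> L2"
  then have m: "cr f \<in> borel_measurable borel" and i: "integrable lborel (\<lambda>x. (norm (f x))\<^sup>2)"
    by (auto simp: L2_def)
  have "(\<lambda>x. Re (cr f x)) \<in> borel_measurable borel" by (rule measurable_compose[OF m]) simp
  with i show "f \<in> L2" by (simp add: L2_def)
qed (auto simp: L2_def)

text \<open>
  The normalisation with \<open>1/(2\<pi>)\<close> in front of the integral, for real functions.
\<close>

definition is_F :: "(real \<Rightarrow> real) \<Rightarrow> (real \<Rightarrow> complex) \<Rightarrow> bool" where
  "is_F f g \<longleftrightarrow> is_FT (cr f) (\<lambda>k. complex_of_real (2*pi) * g k)"

lemma truncated_fourier_eq: "truncated_fourier f N k = complex_of_real (1/(2*pi)) * ftI (cut N (cr f)) k"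
proof -
  have "ftI (cut N (cr f)) k = (LINT \<theta>:{-N..N}|lborel. complex_of_real (f \<theta>) * exp (- \<i> * k * \<theta>))"
    unfolding ftI_def set_lebesgue_integral_def
    by (intro Bochner_Integration.integral_cong) (auto simp: cut_def indicator_def)
  then show ?thesis unfolding truncated_fourier_def by simp
qed

lemma is_F_L2: "is_F f g \<Longrightarrow> f \<in> L2" "is_F f g \<Longrightarrow> g \<in> L2"
proof -
  assume "is_F f g"
  then have 1: "cr f \<in> L2" "(\<lambda>k. complex_of_real (2*pi) * g k) \<in> L2" by (auto simp: is_F_def is_FT_def)
  show "f \<in> L2" using 1(1) by (simp add: cr_L2)
  show "g \<in> L2" using L2_cmult[OF 1(2), of "complex_of_real (1/(2*pi))"] by (simp add: field_simps)
qed

lemma trunc_diff: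
  assumes "f \<in> L2" "g \<in> L2"
  shows "(\<integral>\<^sup>+ k. ennreal ((cmod (truncated_fourier f N k - g k))\<^sup>2) \<partial>lborel) =
      ennreal ((1/(2*pi) * nL2 (\<lambda>k. ftI (cut N (cr f)) k - complex_of_real (2*pi) * g k))\<^sup>2)"
proof -
  have "truncated_fourier f N k - g k = complex_of_real (1/(2*pi)) * (ftI (cut N (cr f)) k - complex_of_real (2*pi) * g k)" for k
    by (simp add: truncated_fourier_eq algebra_simps)
  moreover have "(\<lambda>k. complex_of_real (1/(2*pi)) * (ftI (cut N (cr f)) k - complex_of_real (2*pi) * g k)) \<in> L2"
    using assms by (intro L2_cmult L2_diff ftI_L2 cut_L2 cut_integrable) (auto simp: cr_L2)
  from nn_L2[OF this] have "(\<integral>\<^sup>+ k. ennreal ((cmod (complex_of_real (1/(2*pi)) * (ftI (cut N (cr f)) k - complex_of_real (2*pi) * g k)))\<^sup>2) \<partial>lborel)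
     = ennreal ((1/(2*pi) * nL2 (\<lambda>k. ftI (cut N (cr f)) k - complex_of_real (2*pi) * g k))\<^sup>2)"
    unfolding nL2_cmult norm_of_real by simp
  ultimately show ?thesis by simp
qed

text \<open>
  Connects the extended nonnegative distance in the definition of the Fourier transform with the
  norm: both sides of the limit are squares of the same finite number up to a constant.
\<close>

lemma is_fourier_iff:
  assumes f: "f \<in> L2" shows "is_fourier f g \<longleftrightarrow> is_F f g"
proof -
  have *: "((\<lambda>N. \<integral>\<^sup>+ k. ennreal ((cmod (truncated_fourier f N k - g k))\<^sup>2) \<partial>lborel) \<longlongrightarrow> 0) at_top \<longleftrightarrow>
     ((\<lambda>N. nL2 (\<lambda>k. ftI (cut N (cr f)) k - complex_of_real (2*pi) * g k)) \<longlongrightarrow> 0) at_top" if g: "g \<in> L2"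
  proof -
    let ?n = "\<lambda>N. nL2 (\<lambda>k. ftI (cut N (cr f)) k - complex_of_real (2*pi) * g k)"
    have "((\<lambda>N. ennreal ((1/(2*pi) * ?n N)\<^sup>2)) \<longlongrightarrow> ennreal 0) at_top \<longleftrightarrow> ((\<lambda>N. (1/(2*pi) * ?n N)\<^sup>2) \<longlongrightarrow> 0) at_top"
      by (rule tendsto_ennreal_iff) auto
    also have "\<dots> \<longleftrightarrow> (?n \<longlongrightarrow> 0) at_top"
    proof
      assume "((\<lambda>N. (1/(2*pi) * ?n N)\<^sup>2) \<longlongrightarrow> 0) at_top"
      from tendsto_real_sqrt[OF this] have "((\<lambda>N. 1/(2*pi) * ?n N) \<longlongrightarrow> 0) at_top" by simp
      from tendsto_mult_right_zero[OF this, of "2*pi"] show "(?n \<longlongrightarrow> 0) at_top" by simp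
    next
      assume "(?n \<longlongrightarrow> 0) at_top"
      from tendsto_power[OF tendsto_mult_right_zero[OF this, of "1/(2*pi)"], of 2]
      show "((\<lambda>N. (1/(2*pi) * ?n N)\<^sup>2) \<longlongrightarrow> 0) at_top" by simp
    qed
    finally show ?thesis unfolding trunc_diff[OF f g] by simp
  qed
  show ?thesis
  proof
    assume "is_fourier f g"
    then show "is_F f g" using * f by (auto simp: is_fourier_def is_F_def is_FT_def cr_L2 L2_cmult)
  next
    assume "is_F f g"
    then show "is_fourier f g" using * is_F_L2[of f g] by (auto simp: is_fourier_def is_F_def is_FT_def)
  qed
qed

lemma is_F_exists: assumes "f \<in> L2" shows "\<exists>g. is_F f g"
proof -
  obtain G where "is_FT (cr f) G" using is_FT_exists assms cr_L2 by blast
  then have "is_F f (\<lambda>k. complex_of_real (1/(2*pi)) * G k)" unfolding is_F_def by (simp add: field_simps)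
  then show ?thesis by blast
qed

lemma is_F_fourier: assumes "f \<in> L2" shows "is_F f (fourier f)"
  using is_F_exists[OF assms] unfolding fourier_def is_fourier_iff[OF assms] by (rule someI_ex)

lemma is_F_unique: assumes "is_F f g" "is_F f h" shows "AE k in lborel. g k = h k"
proof -
  have "AE k in lborel. complex_of_real (2*pi) * g k = complex_of_real (2*pi) * h k"
    using is_FT_unique assms unfolding is_F_def by blast
  then show ?thesis by simp
qed

lemma fourier_eq: "is_F f g \<Longrightarrow> AE k in lborel. fourier f k = g k"
  using is_F_unique is_F_fourier is_F_L2 by blast

lemma fourier_L2: "f \<in> L2 \<Longrightarrow> fourier f \<in> L2"
  using is_F_fourier is_F_L2 by blast

lemma is_F_lin:
  assumes "is_F f F" "is_F g G"
  shows "is_F (\<lambda>x. a * f x + b * g x) (\<lambda>k. complex_of_real a * F k + complex_of_real b * G k)"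
  using is_FT_lin[OF assms[unfolded is_F_def], of "complex_of_real a" "complex_of_real b"]
  unfolding is_F_def by (simp add: algebra_simps)

lemma is_F_cong:
  assumes "is_F f g" "AE x in lborel. f x = f' x" "f' \<in> borel_measurable borel"
    "AE x in lborel. g x = g' x" "g' \<in> borel_measurable borel"
  shows "is_F f' g'"
  using is_FT_cong[OF assms(1)[unfolded is_F_def], of "cr f'" "\<lambda>k. complex_of_real (2*pi) * g' k"] assms(2-)
  unfolding is_F_def by auto

lemma is_F_inj:
  assumes "is_F f F" "is_F g G" "AE k in lborel. F k = G k" shows "AE x in lborel. f x = g x"
  using is_FT_inj[OF assms(1,2)[unfolded is_F_def]] assms(3) by auto

lemma is_F_herm:
  assumes "is_F f F" shows "AE k in lborel. F (- k) = cnj (F k)"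
proof -
  have "AE k in lborel. cnj (complex_of_real (2*pi) * F (- k)) = complex_of_real (2*pi) * F k"
  proof (rule is_FT_unique)
    show "is_FT (cr f) (\<lambda>k. cnj (complex_of_real (2*pi) * F (- k)))"
      using is_FT_cnj[OF assms[unfolded is_F_def]] by simp
    show "is_FT (cr f) (\<lambda>k. complex_of_real (2*pi) * F k)" using assms unfolding is_F_def .
  qed
  then show ?thesis
  proof eventually_elim
    fix k assume "cnj (complex_of_real (2*pi) * F (- k)) = complex_of_real (2*pi) * F k"
    then have "cnj (F (- k)) = F k" by simp
    then show "F (- k) = cnj (F k)" by (metis complex_cnj_cnj)
  qed
qed

text \<open>
  A transform with Hermitian symmetry comes from a real function: the preimage and its complex
  conjugate have the same transform.
\<close>

lemma is_F_surj:
  assumes g: "g \<in> L2" and h: "\<And>k. g (- k) = cnj (g k)" shows "\<exists>f. is_F f g"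
proof -
  have g': "(\<lambda>k. complex_of_real (2*pi) * g k) \<in> L2" by (rule L2_cmult[OF g])
  then obtain G where "is_FT (\<lambda>k. complex_of_real (2*pi) * g k) G" using is_FT_exists by blast
  from is_FT_inverse[OF this] obtain f where f: "is_FT f (\<lambda>k. complex_of_real (2*pi) * g k)" by blast
  have "is_FT (\<lambda>x. cnj (f x)) (\<lambda>k. complex_of_real (2*pi) * g k)"
    using is_FT_cnj[OF f] h by simp
  from is_FT_inj[OF f this] have "AE x in lborel. f x = cnj (f x)" by simp
  then have "AE x in lborel. f x = cr (\<lambda>x. Re (f x)) x"
    by eventually_elim (metis Reals_cnj_iff complex_is_Real_iff complex_eq_iff Im_complex_of_real Re_complex_of_real)
  moreover have "cr (\<lambda>x. Re (f x)) \<in> borel_measurable borel" using L2_measurable[OF is_FT_L2(1)[OF f]] by simp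
  ultimately have "is_F (\<lambda>x. Re (f x)) g" unfolding is_F_def
    using is_FT_cong[OF f] L2_measurable[OF g'] by simp
  then show ?thesis by blast
qed

section \<open>Weak derivatives as Fourier multipliers\<close>

lemma cont_supp_L2:
  fixes f :: "real \<Rightarrow> complex"
  assumes c: "continuous_on UNIV f" and s: "\<And>x. \<bar>x\<bar> > R \<Longrightarrow> f x = 0"
  shows "f \<in> L2" "integrable lborel f"
proof -
  have "compact (f ` {-\<bar>R\<bar>..\<bar>R\<bar>})" by (intro compact_continuous_image continuous_on_subset[OF c]) auto
  then obtain B where B: "\<And>x. x \<in> {-\<bar>R\<bar>..\<bar>R\<bar>} \<Longrightarrow> cmod (f x) \<le> B"
    using compact_imp_bounded bounded_iff by (metis imageI)
  have "cmod (f x) \<le> max B 0" for x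
  proof (cases "\<bar>x\<bar> \<le> \<bar>R\<bar>")
    case True then show ?thesis using B[of x] by (auto simp: abs_le_iff)
  next
    case False then show ?thesis using s[of x] by auto
  qed
  then show f2: "f \<in> L2" by (rule L2_bounded_support[OF borel_measurable_continuous_onI[OF c] _ s])
  have "cut R f = f" using s by (auto simp: cut_def fun_eq_iff)
  then show "integrable lborel f" using cut_integrable[OF f2, of R] by simp
qed

lemma integral_deriv_compact_support:
  fixes f :: "real \<Rightarrow> complex"
  assumes d: "\<And>x. (f has_vector_derivative f' x) (at x)" and c: "continuous_on UNIV f'"
    and s: "\<And>x. \<bar>x\<bar> > R \<Longrightarrow> f x = 0"
  shows "(LINT x|lborel. f' x) = 0" and "\<And>x. \<bar>x\<bar> > R \<Longrightarrow> f' x = 0"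
proof -
  show s': "f' x = 0" if "\<bar>x\<bar> > R" for x
  proof -
    have "open {y. R < \<bar>y\<bar>}" by (intro open_Collect_less continuous_intros)
    have "((\<lambda>x. 0::complex) has_vector_derivative f' x) (at x)"
      by (rule has_vector_derivative_transform_within_open[OF d \<open>open {y. R < \<bar>y\<bar>}\<close>]) (use that s in auto)
    then show ?thesis using vector_derivative_unique_at has_vector_derivative_const by blast
  qed
  define a where "a = \<bar>R\<bar> + 1"
  have "has_bochner_integral lborel (\<lambda>x. indicator {-a..a} x *\<^sub>R f' x) (f a - f (-a))"
    by (rule has_bochner_integral_FTC_Icc) (auto simp: a_def intro!: has_vector_derivative_at_within d continuous_on_subset[OF c])
  moreover have "(\<lambda>x. indicator {-a..a} x *\<^sub>R f' x) = f'"
    using s' by (fastforce simp: fun_eq_iff indicator_def a_def)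
  moreover have "f a = 0" "f (-a) = 0" using s by (auto simp: a_def)
  ultimately show "(LINT x|lborel. f' x) = 0" by (simp add: has_bochner_integral_iff)
qed

lemma ftI_deriv:
  fixes f :: "real \<Rightarrow> complex"
  assumes d: "\<And>x. (f has_vector_derivative f' x) (at x)" and c: "continuous_on UNIV f'"
    and s: "\<And>x. \<bar>x\<bar> > R \<Longrightarrow> f x = 0"
  shows "ftI f' k = \<i> * k * ftI f k"
proof -
  have cf: "continuous_on UNIV f" by (intro continuous_at_imp_continuous_on ballI has_vector_derivative_continuous[OF d])
  let ?e = "\<lambda>x. exp (- \<i> * complex_of_real k * complex_of_real x)"
  have de: "(?e has_vector_derivative (- \<i> * k) * ?e x) (at x)" for x
  proof -
    have "((\<lambda>z. exp (- \<i> * complex_of_real k * z)) has_field_derivative (- \<i> * k) * ?e x) (at (complex_of_real x))"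
      by (auto intro!: derivative_eq_intros)
    from has_vector_derivative_real_field[OF this] show ?thesis by (simp add: o_def)
  qed
  have "((\<lambda>x. f x * ?e x) has_vector_derivative f x * ((- \<i> * k) * ?e x) + f' x * ?e x) (at x)" for x
    by (rule has_vector_derivative_mult[OF d de])
  then have "(LINT x|lborel. f x * ((- \<i> * k) * ?e x) + f' x * ?e x) = 0"
    by (rule integral_deriv_compact_support(1)[where R=R]) (use s in \<open>auto intro!: continuous_intros c cf\<close>)
  moreover have "(LINT x|lborel. f x * ((- \<i> * k) * ?e x) + f' x * ?e x) = (LINT x|lborel. (- \<i> * k) * (f x * ?e x)) + (LINT x|lborel. f' x * ?e x)"
  proof (subst Bochner_Integration.integral_add[symmetric])
    show "integrable lborel (\<lambda>x. (- \<i> * k) * (f x * ?e x))"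
      by (rule integrable_mult_right ftI_integrable cont_supp_L2(2)[OF cf s])+
    show "integrable lborel (\<lambda>x. f' x * ?e x)"
      by (rule ftI_integrable cont_supp_L2(2)[OF c integral_deriv_compact_support(2)[OF d c s]] | assumption)+
  qed (simp only: mult_ac)
  ultimately have "(- \<i> * k) * ftI f k + ftI f' k = 0" unfolding ftI_def by (simp only: integral_mult_right_zero)
  then show ?thesis by (simp add: add_eq_0_iff)
qed

text \<open>
  The pairing of \<open>w\<close> with a test function is, by the multiplication formula, the pairing of the
  transforms, where differentiating the test function means multiplying by \<open>\<i> k\<close>.
\<close>

lemma weak_deriv_of_fourier:
  assumes w: "is_F w W" and w': "is_F w' (\<lambda>k. \<i> * complex_of_real k * W k)"
  shows "has_weak_deriv w w'"
  unfolding has_weak_deriv_def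
proof (intro conjI allI impI)
  show "w \<in> L2" "w' \<in> L2" using w w' is_F_L2 by auto
  fix \<phi> \<phi>' :: "real \<Rightarrow> real"
  assume d: "\<forall>x. (\<phi> has_real_derivative \<phi>' x) (at x)" and c: "continuous_on UNIV \<phi>'" and s: "\<exists>R. \<forall>x. \<bar>x\<bar> > R \<longrightarrow> \<phi> x = 0"
  obtain R where R: "\<And>x. \<bar>x\<bar> > R \<Longrightarrow> \<phi> x = 0" using s by blast
  have d': "(cr \<phi> has_vector_derivative cr \<phi>' x) (at x)" for x
    using d has_vector_derivative_of_real by (metis has_real_derivative_iff_has_vector_derivative)
  have c': "continuous_on UNIV (cr \<phi>')" using c by (intro continuous_intros)
  have R': "\<bar>x\<bar> > R \<Longrightarrow> cr \<phi> x = 0" for x using R by simp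
  have cf: "continuous_on UNIV (cr \<phi>)" by (intro continuous_at_imp_continuous_on ballI has_vector_derivative_continuous[OF d'])
  have 1: "is_FT (cr \<phi>) (ftI (cr \<phi>))" by (intro is_FT_ftI cont_supp_L2[OF cf R'])
  have 2: "is_FT (cr \<phi>') (ftI (cr \<phi>'))"
    by (intro is_FT_ftI cont_supp_L2[OF c' integral_deriv_compact_support(2)[OF d' c' R']])
  have inv: "is_FT (\<lambda>k. G (- k)) (cr u)" if "is_F u G" for u G
    using is_FT_inverse[OF that[unfolded is_F_def]] by simp
  have "(LINT x|lborel. cr w x * cr \<phi>' x) = (LINT k|lborel. W (- k) * ftI (cr \<phi>') k)"
    by (rule is_FT_mult_formula[OF inv[OF w] 2])
  also have "\<dots> = (LINT k|lborel. - ((\<i> * complex_of_real (- k) * W (- k)) * ftI (cr \<phi>) k))"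
    by (simp add: ftI_deriv[OF d' c' R'] mult_ac)
  also have "\<dots> = - (LINT k|lborel. (\<i> * complex_of_real (- k) * W (- k)) * ftI (cr \<phi>) k)"
    by (rule Bochner_Integration.integral_minus)
  also have "(LINT k|lborel. (\<i> * complex_of_real (- k) * W (- k)) * ftI (cr \<phi>) k) = (LINT x|lborel. cr w' x * cr \<phi> x)"
    by (rule is_FT_mult_formula[OF inv[OF w'] 1, symmetric])
  finally have "complex_of_real (LINT x|lborel. w x * \<phi>' x) = complex_of_real (- (LINT x|lborel. w' x * \<phi> x))"
    unfolding of_real_mult[symmetric] integral_complex_of_real by simp
  then show "(LINT x|lborel. w x * \<phi>' x) = - (LINT x|lborel. w' x * \<phi> x)" unfolding of_real_eq_iff .
qed

text \<open>
  A continuously differentiable function of compact support with value one at the origin; its dilations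
  serve as cut-offs.
\<close>

definition bump :: "real \<Rightarrow> real" where "bump x = (max 0 (1 - x\<^sup>2))\<^sup>2"
definition bump' :: "real \<Rightarrow> real" where "bump' x = - 4 * x * max 0 (1 - x\<^sup>2)"

lemma deriv_pos_part_sq: "((\<lambda>y. (max 0 y)\<^sup>2) has_real_derivative 2 * max 0 y) (at y)" for y :: real
proof (cases y "0::real" rule: linorder_cases)
  case less
  have "((\<lambda>y. 0::real) has_real_derivative 2 * max 0 y) (at y)" using less by (auto intro!: derivative_eq_intros)
  then show ?thesis by (rule has_field_derivative_transform_within[where d="-y"]) (use less in \<open>auto simp: dist_real_def max_def\<close>)
next
  case equal
  have "((\<lambda>h. ((max 0 (0+h))\<^sup>2 - (max 0 0)\<^sup>2) / h) \<longlongrightarrow> 0) (at (0::real))"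
  proof (rule Lim_null_comparison)
    show "\<forall>\<^sub>F h in at 0. norm (((max 0 (0+h))\<^sup>2 - (max 0 (0::real))\<^sup>2) / h) \<le> \<bar>h\<bar>"
      by (auto simp: max_def power2_eq_square eventually_at_filter)
    show "((\<lambda>h. \<bar>h\<bar>) \<longlongrightarrow> 0) (at (0::real))" by (rule tendsto_rabs_zero) (rule tendsto_ident_at)
  qed
  then show ?thesis using equal by (simp add: DERIV_def)
next
  case greater
  have "((\<lambda>y. y\<^sup>2) has_real_derivative 2 * max 0 y) (at y)" using greater by (auto intro!: derivative_eq_intros)
  then show ?thesis by (rule has_field_derivative_transform_within[where d="y"]) (use greater in \<open>auto simp: dist_real_def max_def\<close>)
qed

lemma bump_deriv: "(bump has_real_derivative bump' x) (at x)"
proof -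
  have "((\<lambda>x. 1 - x\<^sup>2) has_real_derivative - (2 * x)) (at x)" by (auto intro!: derivative_eq_intros)
  from DERIV_chain2[OF deriv_pos_part_sq this] show ?thesis unfolding bump_def[abs_def] bump'_def by (simp add: mult_ac)
qed

lemma bump_facts:
  "\<bar>bump x\<bar> \<le> 1" "\<bar>x\<bar> > 1 \<Longrightarrow> bump x = 0" "\<bar>x\<bar> > 1 \<Longrightarrow> bump' x = 0" "\<bar>bump' x\<bar> \<le> 4" "bump 0 = 1"
proof -
  have big: "\<bar>x\<bar> > 1 \<Longrightarrow> max 0 (1 - x\<^sup>2) = 0"
    using power_strict_mono[of 1 "\<bar>x\<bar>" 2] by simp
  have m: "0 \<le> max 0 (1 - x\<^sup>2)" "max 0 (1 - x\<^sup>2) \<le> 1" by auto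
  show "\<bar>bump x\<bar> \<le> 1" unfolding bump_def using power_le_one[OF m, of 2] by simp
  show "\<bar>x\<bar> > 1 \<Longrightarrow> bump x = 0" "\<bar>x\<bar> > 1 \<Longrightarrow> bump' x = 0" using big unfolding bump_def bump'_def by simp_all
  show "\<bar>bump' x\<bar> \<le> 4"
  proof (cases "\<bar>x\<bar> > 1")
    case False
    then have "\<bar>x\<bar> * max 0 (1 - x\<^sup>2) \<le> 1 * 1" by (intro mult_mono m) auto
    then show ?thesis using m by (simp add: bump'_def abs_mult)
  qed (use \<open>\<bar>x\<bar> > 1 \<Longrightarrow> bump' x = 0\<close> in auto)
  show "bump 0 = 1" by (simp add: bump_def)
qed

lemma bump_cont: "continuous_on UNIV bump" "continuous_on UNIV bump'"
  unfolding bump_def[abs_def] bump'_def[abs_def] by (intro continuous_intros)+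

lemma weak_deriv_complex_test:
  assumes wd: "has_weak_deriv w w'"
    and d: "\<And>x. (f has_vector_derivative f' x) (at x)" and c: "continuous_on UNIV f'"
    and s: "\<And>x. \<bar>x\<bar> > R \<Longrightarrow> f x = (0::complex)"
  shows "(LINT x|lborel. cr w x * f' x) = - (LINT x|lborel. cr w' x * f x)"
proof -
  have w: "w \<in> L2" "w' \<in> L2" and t: "\<And>\<phi> \<phi>'. (\<forall>x. (\<phi> has_real_derivative \<phi>' x) (at x)) \<Longrightarrow> continuous_on UNIV \<phi>' \<Longrightarrow>
        (\<exists>R. \<forall>x. \<bar>x\<bar> > R \<longrightarrow> \<phi> x = 0) \<Longrightarrow>
        (LINT x|lborel. w x * \<phi>' x) = - (LINT x|lborel. w' x * \<phi> x)"
    using wd unfolding has_weak_deriv_def by blast+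
  have cf: "continuous_on UNIV f" by (intro continuous_at_imp_continuous_on ballI has_vector_derivative_continuous[OF d])
  have f2: "f \<in> L2" "f' \<in> L2"
    by (rule cont_supp_L2[OF cf s], assumption, rule cont_supp_L2[OF c integral_deriv_compact_support(2)[OF d c s]])
  have i: "integrable lborel (\<lambda>x. cr w x * f' x)" "integrable lborel (\<lambda>x. cr w' x * f x)"
    using w f2 by (auto intro!: L2_mult_integrable simp: cr_L2)
  have dR: "((\<lambda>x. Re (f x)) has_real_derivative Re (f' x)) (at x)" for x
    using bounded_linear.has_vector_derivative[OF bounded_linear_Re d[of x]] by (simp add: has_real_derivative_iff_has_vector_derivative)
  have dI: "((\<lambda>x. Im (f x)) has_real_derivative Im (f' x)) (at x)" for x
    using bounded_linear.has_vector_derivative[OF bounded_linear_Im d[of x]] by (simp add: has_real_derivative_iff_has_vector_derivative)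
  have "(LINT x|lborel. w x * Re (f' x)) = - (LINT x|lborel. w' x * Re (f x))"
    by (rule t) (use dR s in \<open>auto intro!: continuous_intros c exI[of _ R]\<close>)
  moreover have "(LINT x|lborel. w x * Im (f' x)) = - (LINT x|lborel. w' x * Im (f x))"
    by (rule t) (use dI s in \<open>auto intro!: continuous_intros c exI[of _ R]\<close>)
  ultimately show ?thesis
    using integral_Re[OF i(1)] integral_Re[OF i(2)] integral_Im[OF i(1)] integral_Im[OF i(2)]
    by (intro complex_eqI) simp_all
qed

text \<open>
  The function \<open>exp (- \<i> k x)\<close> is not an admissible test function, so it is multiplied by the bump
  dilated by \<open>n + 1\<close>. The derivative of the dilated bump has size \<open>O(1/n)\<close> and drops out in the limit. The
  limit is taken in \<open>L\<^sup>2\<close> over bounded frequencies, where multiplication by \<open>k\<close> is continuous.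
\<close>

lemma fourier_of_weak_deriv:
  assumes wd: "has_weak_deriv w w'"
  shows "AE k in lborel. fourier w' k = \<i> * complex_of_real k * fourier w k"
proof -
  have w: "w \<in> L2" "w' \<in> L2" using wd unfolding has_weak_deriv_def by blast+
  have cw: "cr w \<in> L2" "cr w' \<in> L2" using w by (auto simp: cr_L2)
  note [measurable] = L2_measurable[OF cw(1)] L2_measurable[OF cw(2)]
  obtain W W' where W: "is_FT (cr w) W" and W': "is_FT (cr w') W'" using is_FT_exists cw by blast
  note L = is_FT_L2(2)[OF W] is_FT_L2(2)[OF W']
  note [measurable] = L2_measurable[OF L(1)] L2_measurable[OF L(2)]
  define r where "r n = inverse (real (Suc n))" for n
  have r: "0 < r n" "r n \<le> 1" for n by (auto simp: r_def field_simps)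
  have rl: "r \<longlonglongrightarrow> 0" unfolding r_def using LIMSEQ_inverse_real_of_nat by simp
  have [measurable]: "bump \<in> borel_measurable borel" "bump' \<in> borel_measurable borel"
    using bump_cont borel_measurable_continuous_onI by blast+
  define u where "u n x = complex_of_real (bump (r n * x))" for n x
  define u' where "u' n x = complex_of_real (r n * bump' (r n * x))" for n x
  have um[measurable]: "u n \<in> borel_measurable borel" "u' n \<in> borel_measurable borel" for n
    unfolding u_def[abs_def] u'_def[abs_def] by measurable
  have ub: "cmod (u n x) \<le> 1" "cmod (u' n x) \<le> 4 * r n" "cmod (u' n x) \<le> 4" for n x
    using bump_facts(1,4)[of "r n * x"] r[of n] mult_mono[of "r n" 1 "\<bar>bump' (r n * x)\<bar>" 4] by (auto simp: u_def u'_def norm_mult)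
  have us: "u n x = 0" "u' n x = 0" if "\<bar>x\<bar> > real (Suc n)" for n x
  proof -
    have "\<bar>r n * x\<bar> > 1" using that r[of n] by (simp add: abs_mult r_def field_simps)
    then show "u n x = 0" "u' n x = 0" using bump_facts by (simp_all add: u_def u'_def)
  qed
  have L2u: "(\<lambda>x. f x * u n x) \<in> L2" "(\<lambda>x. f x * u' n x) \<in> L2" if "f \<in> L2" for f n
  proof -
    note [measurable] = L2_measurable[OF that]
    show "(\<lambda>x. f x * u n x) \<in> L2"
      by (rule L2_bound[OF that, where c=1]) (use ub in \<open>auto simp: norm_mult intro!: mult_left_le\<close>)
    show "(\<lambda>x. f x * u' n x) \<in> L2"
    proof (rule L2_bound[OF that, where c=4])
      show "cmod (f x * u' n x) \<le> 4 * cmod (f x)" for x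
        using mult_left_mono[OF ub(3)[of n x], of "cmod (f x)"] by (simp add: norm_mult)
    qed simp
  qed
  have intu: "integrable lborel (\<lambda>x. f x * u n x)" "integrable lborel (\<lambda>x. f x * u' n x)" if "f \<in> L2" for f n
  proof -
    have "cut (real (Suc n)) (\<lambda>x. f x * u n x) = (\<lambda>x. f x * u n x)" "cut (real (Suc n)) (\<lambda>x. f x * u' n x) = (\<lambda>x. f x * u' n x)"
      using us by (auto simp: cut_def fun_eq_iff simp del: of_nat_Suc)
    then show "integrable lborel (\<lambda>x. f x * u n x)" "integrable lborel (\<lambda>x. f x * u' n x)"
      using cut_integrable[OF L2u(1)[OF that]] cut_integrable[OF L2u(2)[OF that]] by metis+
  qed
  let ?b = "\<lambda>n. ftI (\<lambda>x. cr w x * u n x)" and ?a = "\<lambda>n. ftI (\<lambda>x. cr w' x * u n x)" and ?c = "\<lambda>n. ftI (\<lambda>x. cr w x * u' n x)"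
  have id: "?a n k = \<i> * k * ?b n k - ?c n k" for n k
  proof -
    let ?e = "\<lambda>x. exp (- \<i> * complex_of_real k * complex_of_real x)"
    have de: "(?e has_vector_derivative (- \<i> * k) * ?e x) (at x)" for x
    proof -
      have "((\<lambda>z. exp (- \<i> * complex_of_real k * z)) has_field_derivative (- \<i> * k) * ?e x) (at (complex_of_real x))"
        by (auto intro!: derivative_eq_intros)
      from has_vector_derivative_real_field[OF this] show ?thesis by (simp add: o_def)
    qed
    have du: "(u n has_vector_derivative u' n x) (at x)" for x
    proof -
      have "((\<lambda>x. r n * x) has_real_derivative r n) (at x)" by (auto intro!: derivative_eq_intros)
      from DERIV_chain2[OF bump_deriv this] have "((\<lambda>x. bump (r n * x)) has_real_derivative r n * bump' (r n * x)) (at x)"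
        by (simp add: mult.commute)
      then show ?thesis unfolding u_def[abs_def] u'_def
        using has_vector_derivative_of_real by (metis has_real_derivative_iff_has_vector_derivative)
    qed
    have dd: "((\<lambda>x. u n x * ?e x) has_vector_derivative u n x * ((- \<i> * k) * ?e x) + u' n x * ?e x) (at x)" for x
      by (rule has_vector_derivative_mult[OF du de])
    have cu: "continuous_on UNIV (u n)" "continuous_on UNIV (u' n)"
      unfolding u_def[abs_def] u'_def[abs_def]
      by (intro continuous_intros continuous_on_compose2[OF bump_cont(1)] continuous_on_compose2[OF bump_cont(2)]; simp)+
    have "(LINT x|lborel. cr w x * (u n x * ((- \<i> * k) * ?e x) + u' n x * ?e x)) = - (LINT x|lborel. cr w' x * (u n x * ?e x))"
      by (rule weak_deriv_complex_test[OF wd dd, where R="real (Suc n)"])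
         (use us(1) in \<open>auto intro!: continuous_intros cu simp del: of_nat_Suc\<close>)
    moreover have "(LINT x|lborel. cr w x * (u n x * ((- \<i> * k) * ?e x) + u' n x * ?e x)) = (LINT x|lborel. (- \<i> * k) * (cr w x * u n x * ?e x)) + (LINT x|lborel. cr w x * u' n x * ?e x)"
    proof (subst Bochner_Integration.integral_add[symmetric])
      show "integrable lborel (\<lambda>x. (- \<i> * k) * (cr w x * u n x * ?e x))" "integrable lborel (\<lambda>x. cr w x * u' n x * ?e x)"
        by (rule integrable_mult_right ftI_integrable intu cw)+
    qed (simp only: distrib_left mult_ac)
    ultimately have "(- \<i> * k) * ?b n k + ?c n k = - ?a n k" unfolding ftI_def by (simp only: integral_mult_right_zero mult.assoc)
    then show ?thesis by (simp add: algebra_simps)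
  qed
  have conv: "(\<lambda>n. nL2 (\<lambda>k. ftI (\<lambda>x. f x * u n x) k - F k)) \<longlonglongrightarrow> 0" if f: "is_FT f F" for f F
  proof -
    note f2 = is_FT_L2(1)[OF f]
    note [measurable] = L2_measurable[OF f2]
    have e: "nL2 (\<lambda>k. ftI (\<lambda>x. f x * u n x) k - F k) = sqrt (2*pi) * nL2 (\<lambda>x. f x * u n x - f x)" for n
      by (rule is_FT_norm[OF is_FT_diff[OF is_FT_ftI[OF L2u(1)[OF f2] intu(1)[OF f2]] f]])
    have "(\<lambda>n. nL2 (\<lambda>x. f x * u n x - f x)) \<longlonglongrightarrow> 0"
    proof (rule nL2_dominated[where w="\<lambda>x. 2 * f x"])
      show "(\<lambda>x. 2 * f x) \<in> L2" by (rule L2_cmult[OF f2])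
      show "AE x in lborel. (\<lambda>n. f x * u n x) \<longlonglongrightarrow> f x"
      proof (rule AE_I2)
        fix x
        have "isCont bump (0 * x)" using bump_cont(1) by (simp add: continuous_on_eq_continuous_at)
        from isCont_tendsto_compose[OF this tendsto_mult[OF rl tendsto_const[of x]]]
        have "(\<lambda>n. bump (r n * x)) \<longlonglongrightarrow> 1" by (simp add: bump_facts)
        then have "(\<lambda>n. f x * u n x) \<longlonglongrightarrow> f x * complex_of_real 1" unfolding u_def by (intro tendsto_intros)
        then show "(\<lambda>n. f x * u n x) \<longlonglongrightarrow> f x" by simp
      qed
      have "cmod (f x * u n x - f x) \<le> cmod (2 * f x)" for n x
        using norm_triangle_ineq4[of "f x * u n x" "f x"] mult_left_mono[OF ub(1)[of n x], of "cmod (f x)"] by (simp add: norm_mult)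
      then show "AE x in lborel. cmod (f x * u n x - f x) \<le> cmod (2 * f x)" for n by simp
    qed simp_all
    then show ?thesis unfolding e by (rule tendsto_mult_right_zero)
  qed
  have cl: "(\<lambda>n. nL2 (?c n)) \<longlonglongrightarrow> 0"
  proof (rule Lim_null_comparison[OF always_eventually[rule_format]])
    show "norm (nL2 (?c n)) \<le> sqrt (2*pi) * (4 * r n * nL2 (cr w))" for n
    proof -
      have "nL2 (?c n) = sqrt (2*pi) * nL2 (\<lambda>x. cr w x * u' n x)"
        by (rule is_FT_norm[OF is_FT_ftI[OF L2u(2) intu(2)]]) (use cw in auto)
      moreover have "nL2 (\<lambda>x. cr w x * u' n x) \<le> nL2 (\<lambda>x. complex_of_real (4 * r n) * cr w x)"
      proof (rule nL2_mono[OF L2_cmult[OF cw(1)]])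
        show "cmod (cr w x * u' n x) \<le> cmod (complex_of_real (4 * r n) * cr w x)" for x
          using mult_left_mono[OF ub(2)[of n x], of "\<bar>w x\<bar>"] r[of n] by (simp add: norm_mult mult_ac)
      qed simp
      ultimately show ?thesis using r[of n] unfolding nL2_cmult norm_of_real by simp
    qed
    have "(\<lambda>n. sqrt (2*pi) * (4 * r n * nL2 (cr w))) \<longlonglongrightarrow> sqrt (2*pi) * (4 * 0 * nL2 (cr w))" by (intro tendsto_intros rl)
    then show "(\<lambda>n. sqrt (2*pi) * (4 * r n * nL2 (cr w))) \<longlonglongrightarrow> 0" by simp
  qed
  have z: "AE k in lborel. cut (real M) (\<lambda>k. W' k - \<i> * k * W k) k = 0" for M :: nat
  proof -
    let ?D = "cut (real M) (\<lambda>k. W' k - \<i> * k * W k)"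
    have mu: "cut (real M) (\<lambda>k. \<i> * k * f k) \<in> L2 \<and> nL2 (cut (real M) (\<lambda>k. \<i> * k * f k)) \<le> M * nL2 f" if f: "f \<in> L2" for f
    proof -
      note [measurable] = L2_measurable[OF f]
      have le: "cmod (cut (real M) (\<lambda>k. \<i> * k * f k) k) \<le> M * cmod (f k)" for k
        by (auto simp: cut_def norm_mult intro!: mult_right_mono)
      have "nL2 (cut (real M) (\<lambda>k. \<i> * k * f k)) \<le> nL2 (\<lambda>k. complex_of_real M * f k)"
        by (rule nL2_mono[OF L2_cmult[OF f]]) (use le in \<open>auto simp: norm_mult\<close>)
      then show ?thesis using L2_bound[OF f _ le] by (simp add: nL2_cmult)
    qed
    have ab: "?a n \<in> L2" "?b n \<in> L2" "?c n \<in> L2" for n using L2u intu cw by (auto intro!: ftI_L2)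
    have D: "?D = (\<lambda>k. (cut (real M) (\<lambda>k. W' k - ?a n k) k + cut (real M) (\<lambda>k. \<i> * k * (?b n k - W k)) k) - cut (real M) (?c n) k)" for n
      by (rule ext) (auto simp: cut_def id algebra_simps)
    have cc: "nL2 (cut (real M) f) \<le> nL2 f" if "f \<in> L2" for f
      by (rule nL2_mono[OF that]) (use L2_measurable[OF that] in \<open>auto simp: cut_def\<close>)
    have bd: "nL2 ?D \<le> nL2 (\<lambda>k. ?a n k - W' k) + M * nL2 (\<lambda>k. ?b n k - W k) + nL2 (?c n)" for n
    proof -
      have d: "(\<lambda>k. W' k - ?a n k) \<in> L2" "(\<lambda>k. ?b n k - W k) \<in> L2" using ab L by (auto intro!: L2_diff)
      have s: "(\<lambda>k. cut (real M) (\<lambda>k. W' k - ?a n k) k + cut (real M) (\<lambda>k. \<i> * k * (?b n k - W k)) k) \<in> L2"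
        by (rule L2_add[OF cut_L2[OF d(1)] conjunct1[OF mu[OF d(2)]]])
      have "nL2 ?D \<le> nL2 (\<lambda>k. cut (real M) (\<lambda>k. W' k - ?a n k) k + cut (real M) (\<lambda>k. \<i> * k * (?b n k - W k)) k) + nL2 (cut (real M) (?c n))"
        unfolding D[of n] by (rule nL2_triangle_minus[OF s cut_L2[OF ab(3)]])
      also have "nL2 (\<lambda>k. cut (real M) (\<lambda>k. W' k - ?a n k) k + cut (real M) (\<lambda>k. \<i> * k * (?b n k - W k)) k) \<le> nL2 (cut (real M) (\<lambda>k. W' k - ?a n k)) + nL2 (cut (real M) (\<lambda>k. \<i> * k * (?b n k - W k)))"
        by (rule nL2_triangle[OF cut_L2[OF d(1)] conjunct1[OF mu[OF d(2)]]])
      also have "nL2 (cut (real M) (\<lambda>k. W' k - ?a n k)) \<le> nL2 (\<lambda>k. ?a n k - W' k)" using cc[OF d(1)] nL2_minus_commute by metis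
      also have "nL2 (cut (real M) (\<lambda>k. \<i> * k * (?b n k - W k))) \<le> M * nL2 (\<lambda>k. ?b n k - W k)" using mu[OF d(2)] by blast
      also have "nL2 (cut (real M) (?c n)) \<le> nL2 (?c n)" by (rule cc[OF ab(3)])
      finally show ?thesis by simp
    qed
    have "(\<lambda>n. nL2 (\<lambda>k. ?a n k - W' k) + M * nL2 (\<lambda>k. ?b n k - W k) + nL2 (?c n)) \<longlonglongrightarrow> 0 + real M * 0 + 0"
      by (intro tendsto_intros conv W W' cl)
    then have "nL2 ?D \<le> 0 + real M * 0 + 0" by (rule LIMSEQ_le_const) (use bd in blast)
    then have "nL2 ?D = 0" using nL2_nonneg[of ?D] by linarith
    moreover have "?D \<in> L2" using L2_diff[OF cut_L2[OF L(2), of M] conjunct1[OF mu[OF L(1)]]]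
      by (rule back_subst[of "\<lambda>f. f \<in> L2"]) (auto simp: cut_def)
    ultimately show ?thesis using nL2_0_AE by blast
  qed
  then have "AE k in lborel. \<forall>M::nat. cut (real M) (\<lambda>k. W' k - \<i> * k * W k) k = 0" by (simp add: AE_all_countable)
  then have E: "AE k in lborel. W' k = \<i> * k * W k"
  proof eventually_elim
    fix k assume a: "\<forall>M::nat. cut (real M) (\<lambda>k. W' k - \<i> * k * W k) k = 0"
    obtain M :: nat where "\<bar>k\<bar> \<le> M" using real_arch_simple by blast
    with a[rule_format, of M] show "W' k = \<i> * k * W k" by (simp add: cut_def)
  qed
  have "AE k in lborel. complex_of_real (2*pi) * fourier w k = W k"
    by (rule is_FT_unique[OF is_F_fourier[OF w(1), unfolded is_F_def] W])
  moreover have "AE k in lborel. complex_of_real (2*pi) * fourier w' k = W' k"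
    by (rule is_FT_unique[OF is_F_fourier[OF w(2), unfolded is_F_def] W'])
  ultimately show ?thesis using E
  proof eventually_elim
    fix k assume 1: "complex_of_real (2*pi) * fourier w k = W k" "complex_of_real (2*pi) * fourier w' k = W' k" "W' k = \<i> * k * W k"
    then have "complex_of_real (2*pi) * fourier w' k = complex_of_real (2*pi) * (\<i> * k * fourier w k)"
      by (simp add: mult_ac)
    then show "fourier w' k = \<i> * complex_of_real k * fourier w k" by (subst (asm) mult_cancel_left) simp
  qed
qed

section \<open>The kernel and its bilinear form\<close>

lemma S_eq: "S p q = 2 * sqrt \<bar>p * q * (p + q)\<bar> / (\<bar>p + q\<bar> + \<bar>p\<bar> + \<bar>q\<bar>)"
  unfolding S_def by (auto simp: powr_half_sqrt)

lemma S_nonneg: "0 \<le> S p q" unfolding S_eq by simp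
lemma S_comm: "S p q = S q p"
proof -
  have "p * q * (p + q) = q * p * (q + p)" "\<bar>p + q\<bar> + \<bar>p\<bar> + \<bar>q\<bar> = \<bar>q + p\<bar> + \<bar>q\<bar> + \<bar>p\<bar>"
    by (simp_all add: add.commute)
  then show ?thesis unfolding S_eq by (simp only:)
qed

text \<open>
  With \<open>S_comm\<close> this gives invariance under all permutations of \<open>p\<close>, \<open>q\<close>, \<open>r = - p - q\<close>.
\<close>

lemma S_rot: "S p (- p - q) = S p q"
proof -
  have "\<bar>p * (- p - q) * (p + (- p - q))\<bar> = \<bar>p * q * (p + q)\<bar>"
    by (simp add: abs_mult add.commute abs_minus_commute[of "- p" q])
  moreover have "\<bar>p + (- p - q)\<bar> + \<bar>p\<bar> + \<bar>- p - q\<bar> = \<bar>p + q\<bar> + \<bar>p\<bar> + \<bar>q\<bar>" by simp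
  ultimately show ?thesis unfolding S_eq by metis
qed
lemma S_neg: "S (- p) (- q) = S p q"
proof -
  have "\<bar>- p + - q\<bar> = \<bar>p + q\<bar>" by simp
  then show ?thesis unfolding S_eq by (simp add: abs_mult)
qed

text \<open>
  The arithmetic-geometric mean inequality for the other two frequencies \<open>q\<close> and \<open>p + q\<close>; by symmetry the
  kernel is bounded by the square root of each of the three.
\<close>

lemma S_le1: "S p q \<le> sqrt \<bar>p\<bar>"
proof (cases "p = 0")
  case False
  have "2 * sqrt (\<bar>q\<bar> * \<bar>p + q\<bar>) \<le> \<bar>q\<bar> + \<bar>p + q\<bar>" using arith_geo_mean_sqrt[of "\<bar>q\<bar>" "\<bar>p + q\<bar>"] by simp
  then have "sqrt \<bar>p\<bar> * (2 * sqrt (\<bar>q\<bar> * \<bar>p + q\<bar>)) \<le> sqrt \<bar>p\<bar> * (\<bar>p + q\<bar> + \<bar>p\<bar> + \<bar>q\<bar>)"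
    by (intro mult_left_mono) auto
  moreover have "2 * sqrt \<bar>p * q * (p + q)\<bar> = sqrt \<bar>p\<bar> * (2 * sqrt (\<bar>q\<bar> * \<bar>p + q\<bar>))"
    by (simp add: abs_mult real_sqrt_mult)
  moreover have "\<bar>p + q\<bar> + \<bar>p\<bar> + \<bar>q\<bar> > 0" using False by simp
  ultimately show ?thesis unfolding S_eq by (simp add: pos_divide_le_eq)
qed (simp add: S_def)

lemma S_le2: "S p q \<le> sqrt \<bar>q\<bar>" using S_le1[of q p] by (simp add: S_comm)
lemma S_le3: "S p q \<le> sqrt \<bar>p + q\<bar>"
proof -
  have "S p q = S (- p - q) p" using S_rot[of p q] S_comm by simp
  also have "\<dots> \<le> sqrt \<bar>- p - q\<bar>" by (rule S_le1)
  also have "\<bar>- p - q\<bar> = \<bar>p + q\<bar>" by simp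
  finally show ?thesis .
qed

text \<open>
  All three frequencies are restricted to \<open>P\<close>, not only the output, so that the truncated kernel has the
  same symmetries as \<open>S\<close>.
\<close>

definition SP :: "real set \<Rightarrow> real \<Rightarrow> real \<Rightarrow> real" where
  "SP P p q = (if p \<in> P \<and> q \<in> P \<and> p + q \<in> P then S p q else 0)"

definition symset :: "real set \<Rightarrow> bool" where
  "symset P \<longleftrightarrow> P \<in> sets borel \<and> (\<forall>x. x \<in> P \<longrightarrow> - x \<in> P)"

lemma symset_minus: "symset P \<Longrightarrow> - x \<in> P \<longleftrightarrow> x \<in> P"
  unfolding symset_def by (metis minus_minus)
lemma symset_UNIV: "symset UNIV" by (simp add: symset_def)
lemma symset_Icc: "symset {-N..N}" by (auto simp: symset_def)

lemma SP_UNIV: "SP UNIV p q = S p q" by (simp add: SP_def)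
lemma SP_nonneg: "0 \<le> SP P p q" by (simp add: SP_def S_nonneg)
lemma SP_le_S: "SP P p q \<le> S p q" by (simp add: SP_def S_nonneg)
lemma SP_le: "SP P p q \<le> sqrt \<bar>p\<bar>" "SP P p q \<le> sqrt \<bar>q\<bar>" "SP P p q \<le> sqrt \<bar>p + q\<bar>"
  using SP_le_S S_le1 S_le2 S_le3 order_trans by blast+
lemma SP_comm: "SP P p q = SP P q p" by (simp add: SP_def S_comm add.commute conj_ac)
lemma SP_rot: assumes "symset P" shows "SP P p (- p - q) = SP P p q"
proof -
  have "- p - q \<in> P \<longleftrightarrow> p + q \<in> P" using symset_minus[OF assms, of "p + q"] by simp
  moreover have "p + (- p - q) \<in> P \<longleftrightarrow> q \<in> P" using symset_minus[OF assms, of q] by simp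
  ultimately show ?thesis unfolding SP_def S_rot by auto
qed
lemma SP_neg: assumes "symset P" shows "SP P (- p) (- q) = SP P p q"
proof -
  have "- p + - q \<in> P \<longleftrightarrow> p + q \<in> P" using symset_minus[OF assms, of "p + q"] by simp
  then show ?thesis unfolding SP_def S_neg symset_minus[OF assms] by simp
qed

lemma S_measurable [measurable]:
  assumes [measurable]: "f \<in> borel_measurable M" "g \<in> borel_measurable M"
  shows "(\<lambda>x. S (f x) (g x)) \<in> borel_measurable M"
  unfolding S_eq by measurable

lemma SP_measurable [measurable]:
  assumes P: "symset P" and [measurable]: "f \<in> borel_measurable M" "g \<in> borel_measurable M"
  shows "(\<lambda>x. SP P (f x) (g x)) \<in> borel_measurable M"
proof -
  have [measurable]: "P \<in> sets borel" using P by (simp add: symset_def)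
  show ?thesis unfolding SP_def by measurable
qed

text \<open>
  The transform of \<open>a(\<psi>, \<phi>)\<close> in terms of the transforms, with frequencies restricted to \<open>P\<close>.
\<close>

definition Q :: "real set \<Rightarrow> (real \<Rightarrow> complex) \<Rightarrow> (real \<Rightarrow> complex) \<Rightarrow> real \<Rightarrow> complex" where
  "Q P u v k = (LINT l|lborel. complex_of_real (SP P (k - l) l) * u (k - l) * v l)"

lemma Q_measurable [measurable]:
  assumes P: "symset P" and [measurable]: "u \<in> borel_measurable borel" "v \<in> borel_measurable borel"
  shows "Q P u v \<in> borel_measurable borel"
proof -
  note [measurable] = SP_measurable[OF P]
  show ?thesis unfolding Q_def[abs_def] by measurable
qed

lemma L2_conv_factor:
  assumes "(u::real\<Rightarrow>complex) \<in> L2" shows "(\<lambda>l. u (k - l)) \<in> L2" "nL2 (\<lambda>l. u (k - l)) = nL2 u"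
  using L2_affine[OF assms, of "-1" k] nL2_affine[of "-1" u k] by auto

lemma Q_integrable:
  assumes P: "symset P" and u: "u \<in> L2" and v: "v \<in> L2"
  shows "integrable lborel (\<lambda>l. complex_of_real (SP P (k - l) l) * u (k - l) * v l)"
proof (rule Bochner_Integration.integrable_bound)
  note [measurable] = SP_measurable[OF P] L2_measurable[OF u] L2_measurable[OF v]
  show "integrable lborel (\<lambda>l. complex_of_real (sqrt \<bar>k\<bar>) * (u (k - l) * v l))"
    by (intro integrable_mult_right L2_mult_integrable L2_conv_factor u v)
  show "(\<lambda>l. complex_of_real (SP P (k - l) l) * u (k - l) * v l) \<in> borel_measurable lborel" by measurable
  have "cmod (complex_of_real (SP P (k - l) l) * u (k - l) * v l) \<le> cmod (complex_of_real (sqrt \<bar>k\<bar>) * (u (k - l) * v l))" for l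
  proof -
    have "\<bar>SP P (k - l) l\<bar> \<le> sqrt \<bar>k\<bar>" using SP_le(3)[of P "k - l" l] SP_nonneg[of P "k - l" l] by simp
    then show ?thesis by (simp add: norm_mult mult.assoc mult_right_mono)
  qed
  then show "AE l in lborel. cmod (complex_of_real (SP P (k - l) l) * u (k - l) * v l) \<le> cmod (complex_of_real (sqrt \<bar>k\<bar>) * (u (k - l) * v l))" by simp
qed

lemma Q_bound:
  assumes P: "symset P" and u: "u \<in> L2" and v: "v \<in> L2"
  shows "cmod (Q P u v k) \<le> sqrt \<bar>k\<bar> * (nL2 u * nL2 v)"
proof -
  have i: "integrable lborel (\<lambda>l. cmod (u (k - l)) * cmod (v l))"
    using integrable_norm[OF L2_mult_integrable[OF L2_conv_factor(1)[OF u] v]] by (simp add: norm_mult)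
  have "cmod (Q P u v k) \<le> (LINT l|lborel. cmod (complex_of_real (SP P (k - l) l) * u (k - l) * v l))"
    unfolding Q_def by (rule integral_norm_bound)
  also have "\<dots> \<le> (LINT l|lborel. sqrt \<bar>k\<bar> * (cmod (u (k - l)) * cmod (v l)))"
  proof (rule integral_mono)
    show "integrable lborel (\<lambda>l. cmod (complex_of_real (SP P (k - l) l) * u (k - l) * v l))"
      by (intro integrable_norm Q_integrable P u v)
    show "integrable lborel (\<lambda>l. sqrt \<bar>k\<bar> * (cmod (u (k - l)) * cmod (v l)))" using i by (rule integrable_mult_right)
    fix l
    have "\<bar>SP P (k - l) l\<bar> \<le> sqrt \<bar>k\<bar>" using SP_le(3)[of P "k - l" l] SP_nonneg[of P "k - l" l] by simp
    then show "cmod (complex_of_real (SP P (k - l) l) * u (k - l) * v l) \<le> sqrt \<bar>k\<bar> * (cmod (u (k - l)) * cmod (v l))"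
      by (simp add: norm_mult mult.assoc mult_right_mono)
  qed
  also have "\<dots> = sqrt \<bar>k\<bar> * (LINT l|lborel. cmod (u (k - l)) * cmod (v l))" by simp
  also have "\<dots> \<le> sqrt \<bar>k\<bar> * (nL2 u * nL2 v)"
    using L2_Cauchy_Schwarz_norm[OF L2_conv_factor(1)[OF u] v] L2_conv_factor(2)[OF u] by (intro mult_left_mono) auto
  finally show ?thesis .
qed

lemma Q_comm:
  "Q P u v k = Q P v u k"
  unfolding Q_def by (subst lborel_integral_real_affine[where c="-1" and t=k]) (auto simp: SP_comm mult_ac)

lemma Q_diff_right:
  assumes P: "symset P" and u: "u \<in> L2" and v: "v \<in> L2" and v': "v' \<in> L2"
  shows "Q P u (\<lambda>x. v x - v' x) k = Q P u v k - Q P u v' k"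
  unfolding Q_def using Q_integrable[OF P u v, of k] Q_integrable[OF P u v', of k] by (simp add: right_diff_distrib)

lemma Q_add_left:
  assumes P: "symset P" and u: "u \<in> L2" and v: "v \<in> L2" and v': "v' \<in> L2"
  shows "Q P (\<lambda>x. v x + v' x) u k = Q P v u k + Q P v' u k"
proof -
  have "Q P u (\<lambda>x. v x + v' x) k = Q P u v k + Q P u v' k"
    unfolding Q_def using Q_integrable[OF P u v, of k] Q_integrable[OF P u v', of k] by (simp add: distrib_left)
  then show ?thesis using Q_comm[of P _ u] by simp
qed

text \<open>
  \<open>u\<^sup>2 - v\<^sup>2 = (u + v) (u - v)\<close> for the commutative product \<open>Q\<close>.
\<close>

lemma Q_sq_diff:
  assumes P: "symset P" and u: "u \<in> L2" and v: "v \<in> L2"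
  shows "Q P u u k - Q P v v k = Q P (\<lambda>x. u x + v x) (\<lambda>x. u x - v x) k"
  using Q_add_left[OF P L2_diff[OF u v] u v] Q_diff_right[OF P u u v] Q_diff_right[OF P v u v] Q_comm[of P u v k] by simp

lemma Q_cong_AE:
  assumes P: "symset P" and u: "AE x in lborel. u x = u' x" and v: "AE x in lborel. v x = v' x"
    and [measurable]: "u \<in> borel_measurable borel" "u' \<in> borel_measurable borel" "v \<in> borel_measurable borel" "v' \<in> borel_measurable borel"
  shows "Q P u v k = Q P u' v' k"
proof -
  note [measurable] = SP_measurable[OF P]
  have "Measurable.pred borel (\<lambda>x. u x = u' x)" by measurable
  from AE_borel_affine[OF _ this u, of "-1" k] have "AE l in lborel. u (k - l) = u' (k - l)" by simp
  with v have "AE l in lborel. complex_of_real (SP P (k - l) l) * u (k - l) * v l = complex_of_real (SP P (k - l) l) * u' (k - l) * v' l"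
    by eventually_elim simp
  then show ?thesis unfolding Q_def by (intro integral_cong_AE) auto
qed

text \<open>
  The symmetry of transforms of real functions, imposed at every frequency and not just almost
  everywhere.
\<close>

definition herm :: "(real \<Rightarrow> complex) \<Rightarrow> bool" where "herm u \<longleftrightarrow> (\<forall>k. u (- k) = cnj (u k))"

lemma Q_herm:
  assumes P: "symset P" and u: "herm u" and v: "herm v" shows "herm (Q P u v)"
  unfolding herm_def
proof
  fix k
  have "Q P u v (- k) = (LINT l|lborel. complex_of_real (SP P (- k - (- l)) (- l)) * u (- k - (- l)) * v (- l))"
    unfolding Q_def by (subst lborel_integral_real_affine[where c="-1" and t=0]) auto
  also have "\<dots> = (LINT l|lborel. cnj (complex_of_real (SP P (k - l) l) * u (k - l) * v l))"
  proof (rule Bochner_Integration.integral_cong)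
    fix l
    have 1: "- k - - l = - (k - l)" by simp
    show "complex_of_real (SP P (- k - - l) (- l)) * u (- k - - l) * v (- l) = cnj (complex_of_real (SP P (k - l) l) * u (k - l) * v l)"
      unfolding 1 SP_neg[OF P] u[unfolded herm_def, rule_format] v[unfolded herm_def, rule_format] by simp
  qed simp
  also have "\<dots> = cnj (Q P u v k)" unfolding Q_def by (rule Bochner_Integration.integral_cnj)
  finally show "Q P u v (- k) = cnj (Q P u v k)" .
qed

section \<open>Young's inequality\<close>

text \<open>
  The trilinear form behind the energy estimates: one factor in \<open>L\<^sup>1\<close>, two in \<open>L\<^sup>2\<close>.
\<close>

lemma nn_triple_product:
  fixes a :: "real \<Rightarrow> ennreal"
  assumes [measurable]: "a \<in> borel_measurable borel" and b: "b \<in> L2" and c: "c \<in> L2"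
  shows "(\<integral>\<^sup>+p. \<integral>\<^sup>+q. a p * ennreal (cmod (b q) * cmod (c (- p - q))) \<partial>lborel \<partial>lborel) \<le> (\<integral>\<^sup>+p. a p \<partial>lborel) * ennreal (nL2 b * nL2 c)"
proof -
  note [measurable] = L2_measurable[OF b] L2_measurable[OF c]
  have "(\<integral>\<^sup>+q. ennreal (cmod (b q) * cmod (c (- p - q))) \<partial>lborel) \<le> ennreal (nL2 b * nL2 c)" for p
    using nn_L2_Cauchy_Schwarz[OF b L2_conv_factor(1)[OF c, of "- p"]] L2_conv_factor(2)[OF c, of "- p"] by simp
  then have "(\<integral>\<^sup>+p. a p * (\<integral>\<^sup>+q. ennreal (cmod (b q) * cmod (c (- p - q))) \<partial>lborel) \<partial>lborel) \<le> (\<integral>\<^sup>+p. a p * ennreal (nL2 b * nL2 c) \<partial>lborel)"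
    by (intro nn_integral_mono mult_left_mono) auto
  then show ?thesis by (simp add: nn_integral_cmult nn_integral_multc)
qed

text \<open>
  Young's inequality \<open>\<parallel>a * b\<parallel> \<le> \<parallel>a\<parallel>\<^sub>1 \<parallel>b\<parallel>\<close>, by Cauchy-Schwarz with respect to the measure with density
  \<open>a (k - l)\<close>.
\<close>

lemma nn_Young:
  fixes a :: "real \<Rightarrow> ennreal"
  assumes [measurable]: "a \<in> borel_measurable borel" and b: "b \<in> L2"
  shows "(\<integral>\<^sup>+k. (\<integral>\<^sup>+l. a (k - l) * ennreal (cmod (b l)) \<partial>lborel)\<^sup>2 \<partial>lborel) \<le> ((\<integral>\<^sup>+p. a p \<partial>lborel) * ennreal (nL2 b))\<^sup>2"
proof -
  note [measurable] = L2_measurable[OF b]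
  let ?A = "\<integral>\<^sup>+p. a p \<partial>lborel"
  show ?thesis
  proof (cases "?A = \<top>")
    case True
    show ?thesis
    proof (cases "nL2 b = 0")
      case True
      then have "AE l in lborel. b l = 0" using nL2_0_AE[OF b] by simp
      then have "(\<integral>\<^sup>+l. a (k - l) * ennreal (cmod (b l)) \<partial>lborel) = (\<integral>\<^sup>+l. 0 \<partial>(lborel::real measure))" for k
        by (intro nn_integral_cong_AE) auto
      then show ?thesis by simp
    next
      case False
      then have "ennreal (nL2 b) \<noteq> 0" using nL2_nonneg[of b] by simp
      then show ?thesis using \<open>?A = \<top>\<close> by (simp add: ennreal_top_mult power2_eq_square)
    qed
  next
    case fin: False
    have tr: "(\<integral>\<^sup>+l. a (k - l) \<partial>lborel) = ?A" for k
      by (subst nn_integral_real_affine[where c="-1" and t=k]) auto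
    have tr2: "(\<integral>\<^sup>+k. a (k - l) \<partial>lborel) = ?A" for l
      by (subst nn_integral_real_affine[where c=1 and t=l]) auto
    have "(\<integral>\<^sup>+l. a (k - l) * ennreal (cmod (b l)) \<partial>lborel)\<^sup>2 \<le> ?A * (\<integral>\<^sup>+l. a (k - l) * ennreal ((cmod (b l))\<^sup>2) \<partial>lborel)" for k
    proof -
      define m where "m l = a (k - l)" for l
      have [measurable]: "m \<in> borel_measurable borel" unfolding m_def[abs_def] by measurable
      define M where "M = density lborel m"
      have "(\<integral>\<^sup>+l. 1 * ennreal (cmod (b l)) \<partial>M)\<^sup>2 \<le> (\<integral>\<^sup>+l. 1^2 \<partial>M) * (\<integral>\<^sup>+l. (ennreal (cmod (b l)))^2 \<partial>M)"
        by (rule Cauchy_Schwarz_nn_integral) (auto simp: M_def)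
      moreover have "(\<integral>\<^sup>+l. (1::ennreal)^2 \<partial>M) = ?A"
        unfolding M_def by (subst nn_integral_density) (auto simp: m_def tr)
      moreover have "(\<integral>\<^sup>+l. (ennreal (cmod (b l)))^2 \<partial>M) = (\<integral>\<^sup>+l. a (k - l) * ennreal ((cmod (b l))\<^sup>2) \<partial>lborel)"
        unfolding M_def by (subst nn_integral_density) (auto simp: m_def ennreal_power)
      moreover have "(\<integral>\<^sup>+l. 1 * ennreal (cmod (b l)) \<partial>M) = (\<integral>\<^sup>+l. a (k - l) * ennreal (cmod (b l)) \<partial>lborel)"
        unfolding M_def by (subst nn_integral_density) (auto simp: m_def)
      ultimately show ?thesis by simp
    qed
    then have "(\<integral>\<^sup>+k. (\<integral>\<^sup>+l. a (k - l) * ennreal (cmod (b l)) \<partial>lborel)\<^sup>2 \<partial>lborel) \<le> (\<integral>\<^sup>+k. ?A * (\<integral>\<^sup>+l. a (k - l) * ennreal ((cmod (b l))\<^sup>2) \<partial>lborel) \<partial>lborel)"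
      by (rule nn_integral_mono)
    also have "\<dots> = ?A * (\<integral>\<^sup>+k. \<integral>\<^sup>+l. a (k - l) * ennreal ((cmod (b l))\<^sup>2) \<partial>lborel \<partial>lborel)"
      by (rule nn_integral_cmult) measurable
    also have "(\<integral>\<^sup>+k. \<integral>\<^sup>+l. a (k - l) * ennreal ((cmod (b l))\<^sup>2) \<partial>lborel \<partial>lborel) = (\<integral>\<^sup>+l. \<integral>\<^sup>+k. a (k - l) * ennreal ((cmod (b l))\<^sup>2) \<partial>lborel \<partial>lborel)"
      by (rule lborel_pair.Fubini'[symmetric]) measurable
    also have "\<dots> = (\<integral>\<^sup>+l. ?A * ennreal ((cmod (b l))\<^sup>2) \<partial>lborel)"
      by (subst nn_integral_multc) (auto simp: tr2)
    also have "\<dots> = ?A * ennreal ((nL2 b)\<^sup>2)" by (subst nn_integral_cmult) (auto simp: nn_L2[OF b])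
    finally show ?thesis by (simp only: power_mult_distrib power2_eq_square ennreal_mult[OF nL2_nonneg nL2_nonneg] mult_ac)
  qed
qed

section \<open>Measure-preserving changes of variables\<close>

abbreviation LL :: "(real \<times> real) measure" where "LL \<equiv> lborel \<Otimes>\<^sub>M lborel"

lemma distr_preserving:
  assumes T[measurable]: "T \<in> measurable LL LL"
   and eq: "\<And>f. f \<in> borel_measurable LL \<Longrightarrow> (\<integral>\<^sup>+z. f (T z) \<partial>LL) = (\<integral>\<^sup>+z. f z \<partial>LL)"
  shows "distr LL LL T = LL"
proof (rule measure_eqI)
  fix A assume A0: "A \<in> sets (distr LL LL T)"
  then have A: "A \<in> sets LL" by (simp only: sets_distr)
  have "emeasure (distr LL LL T) A = (\<integral>\<^sup>+z. indicator A (T z) \<partial>LL)"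
  proof -
    have "emeasure (distr LL LL T) A = (\<integral>\<^sup>+z. indicator A z \<partial>distr LL LL T)" by (rule nn_integral_indicator[OF A0, symmetric])
    also have "\<dots> = (\<integral>\<^sup>+z. indicator A (T z) \<partial>LL)" by (rule nn_integral_distr[OF T]) (simp only: measurable_distr_eq1 borel_measurable_indicator[OF A])
    finally show ?thesis .
  qed
  also have "\<dots> = (\<integral>\<^sup>+z. indicator A z \<partial>LL)" by (rule eq[OF borel_measurable_indicator[OF A]])
  finally show "emeasure (distr LL LL T) A = emeasure LL A" unfolding nn_integral_indicator[OF A] .
qed simp

lemma LL_preserving:
  fixes f :: "real \<times> real \<Rightarrow> 'a::{banach, second_countable_topology}"
  assumes T[measurable]: "T \<in> measurable LL LL" and d: "distr LL LL T = LL" and f: "integrable LL f"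
  shows "integrable LL (\<lambda>z. f (T z))" "(LINT z|LL. f (T z)) = (LINT z|LL. f z)"
proof -
  note [measurable] = borel_measurable_integrable[OF f]
  have "integrable (distr LL LL T) f" using f d by simp
  then show "integrable LL (\<lambda>z. f (T z))" by (subst (asm) integrable_distr_eq) auto
  have "(LINT z|distr LL LL T. f z) = (LINT z|LL. f (T z))" by (rule integral_distr) measurable
  then show "(LINT z|LL. f (T z)) = (LINT z|LL. f z)" using d by simp
qed

lemma shear_measurable: "(\<lambda>z. (fst z - snd z, snd z)) \<in> measurable LL LL" by measurable
lemma rot_measurable: "(\<lambda>z. (fst z, - fst z - snd z)) \<in> measurable LL LL" by measurable
lemma swap_measurable: "(\<lambda>z. (snd z, fst z)) \<in> measurable LL LL" by measurable

lemma shear_nn: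
  assumes [measurable]: "f \<in> borel_measurable LL"
  shows "(\<integral>\<^sup>+z. f (fst z - snd z, snd z) \<partial>LL) = (\<integral>\<^sup>+z. f z \<partial>LL)"
proof -
  have "(\<integral>\<^sup>+z. f (fst z - snd z, snd z) \<partial>LL) = (\<integral>\<^sup>+l. \<integral>\<^sup>+k. f (k - l, l) \<partial>lborel \<partial>lborel)"
    by (subst lborel_pair.nn_integral_snd[symmetric]) auto
  also have "\<dots> = (\<integral>\<^sup>+l. \<integral>\<^sup>+k. f (k, l) \<partial>lborel \<partial>lborel)"
  proof (rule nn_integral_cong)
    fix l :: real
    show "(\<integral>\<^sup>+k. f (k - l, l) \<partial>lborel) = (\<integral>\<^sup>+k. f (k, l) \<partial>lborel)"
      by (subst nn_integral_real_affine[where c=1 and t=l and f="\<lambda>k. f (k - l, l)"]) auto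
  qed
  also have "\<dots> = (\<integral>\<^sup>+z. f z \<partial>LL)" by (rule lborel_pair.nn_integral_snd) simp
  finally show ?thesis .
qed

lemma rot_nn:
  assumes [measurable]: "f \<in> borel_measurable LL"
  shows "(\<integral>\<^sup>+z. f (fst z, - fst z - snd z) \<partial>LL) = (\<integral>\<^sup>+z. f z \<partial>LL)"
proof -
  have "(\<integral>\<^sup>+z. f (fst z, - fst z - snd z) \<partial>LL) = (\<integral>\<^sup>+p. \<integral>\<^sup>+q. f (p, - p - q) \<partial>lborel \<partial>lborel)"
    by (subst lborel.nn_integral_fst[symmetric]) auto
  also have "\<dots> = (\<integral>\<^sup>+p. \<integral>\<^sup>+q. f (p, q) \<partial>lborel \<partial>lborel)"
  proof (rule nn_integral_cong)
    fix p :: real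
    show "(\<integral>\<^sup>+q. f (p, - p - q) \<partial>lborel) = (\<integral>\<^sup>+q. f (p, q) \<partial>lborel)"
      by (subst nn_integral_real_affine[where c="-1" and t="- p" and f="\<lambda>q. f (p, q)"]) auto
  qed
  also have "\<dots> = (\<integral>\<^sup>+z. f z \<partial>LL)" by (rule lborel.nn_integral_fst) simp
  finally show ?thesis .
qed

lemma swap_nn:
  assumes [measurable]: "f \<in> borel_measurable LL"
  shows "(\<integral>\<^sup>+z. f (snd z, fst z) \<partial>LL) = (\<integral>\<^sup>+z. f z \<partial>LL)"
proof -
  have "(\<integral>\<^sup>+z. f (snd z, fst z) \<partial>LL) = (\<integral>\<^sup>+p. \<integral>\<^sup>+q. f (q, p) \<partial>lborel \<partial>lborel)"
    by (subst lborel.nn_integral_fst[symmetric]) auto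
  also have "\<dots> = (\<integral>\<^sup>+z. f z \<partial>LL)" by (rule lborel_pair.nn_integral_snd) simp
  finally show ?thesis .
qed

text \<open>
  Replaces the output frequency \<open>k = p + q\<close> by the input frequency \<open>p\<close>.
\<close>

lemma LL_shear:
  fixes f :: "real \<times> real \<Rightarrow> 'a::{banach, second_countable_topology}"
  assumes f: "integrable LL f"
  shows "integrable LL (\<lambda>z. f (fst z - snd z, snd z))" "(LINT z|LL. f (fst z - snd z, snd z)) = (LINT z|LL. f z)"
proof -
  have "distr LL LL (\<lambda>z. (fst z - snd z, snd z)) = LL" by (rule distr_preserving[OF shear_measurable shear_nn])
  from LL_preserving[OF shear_measurable this f]
  show "integrable LL (\<lambda>z. f (fst z - snd z, snd z))" "(LINT z|LL. f (fst z - snd z, snd z)) = (LINT z|LL. f z)" .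
qed

text \<open>
  Exchanges \<open>q\<close> and \<open>r = - p - q\<close>. With \<open>LL_swap\<close> it generates all permutations of the three frequencies
  on the plane \<open>p + q + r = 0\<close>, parametrised by \<open>(p, q)\<close>.
\<close>

lemma LL_rot:
  fixes f :: "real \<times> real \<Rightarrow> 'a::{banach, second_countable_topology}"
  assumes f: "integrable LL f"
  shows "integrable LL (\<lambda>z. f (fst z, - fst z - snd z))" "(LINT z|LL. f (fst z, - fst z - snd z)) = (LINT z|LL. f z)"
proof -
  have "distr LL LL (\<lambda>z. (fst z, - fst z - snd z)) = LL" by (rule distr_preserving[OF rot_measurable rot_nn])
  from LL_preserving[OF rot_measurable this f]
  show "integrable LL (\<lambda>z. f (fst z, - fst z - snd z))" "(LINT z|LL. f (fst z, - fst z - snd z)) = (LINT z|LL. f z)" .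
qed

lemma LL_swap:
  fixes f :: "real \<times> real \<Rightarrow> 'a::{banach, second_countable_topology}"
  assumes f: "integrable LL f"
  shows "integrable LL (\<lambda>z. f (snd z, fst z))" "(LINT z|LL. f (snd z, fst z)) = (LINT z|LL. f z)"
proof -
  have "distr LL LL (\<lambda>z. (snd z, fst z)) = LL" by (rule distr_preserving[OF swap_measurable swap_nn])
  from LL_preserving[OF swap_measurable this f]
  show "integrable LL (\<lambda>z. f (snd z, fst z))" "(LINT z|LL. f (snd z, fst z)) = (LINT z|LL. f z)" .
qed

section \<open>Weights and energy estimates\<close>

text \<open>
  A nondecreasing weight for which \<open>w x / x\<^sup>a\<close> is nonincreasing, written without division. The two
  conditions are stable under products and bound the growth of \<open>w\<close> from \<open>x\<close> to \<open>2 x\<close>.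
\<close>

definition weight :: "nat \<Rightarrow> (real \<Rightarrow> real) \<Rightarrow> bool" where
  "weight a w \<longleftrightarrow> w \<in> borel_measurable borel \<and> (\<forall>x\<ge>0. 0 \<le> w x) \<and>
     (\<forall>x y. 0 \<le> x \<longrightarrow> x \<le> y \<longrightarrow> w x \<le> w y \<and> w y * x ^ a \<le> w x * y ^ a)"

lemma integral_norm_le:
  fixes f :: "'a \<Rightarrow> complex"
  assumes "integrable M f" "integrable M g" "\<And>x. cmod (f x) \<le> g x"
  shows "cmod (LINT x|M. f x) \<le> (LINT x|M. g x)"
  by (rule order_trans[OF integral_norm_bound integral_mono]) (use assms in auto)

lemma power_diff_le: "0 \<le> (x::real) \<Longrightarrow> x \<le> y \<Longrightarrow> y ^ Suc n - x ^ Suc n \<le> real (Suc n) * y ^ n * (y - x)"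
proof (induction n)
  case (Suc n)
  have "y ^ Suc (Suc n) - x ^ Suc (Suc n) = y * (y ^ Suc n - x ^ Suc n) + x ^ Suc n * (y - x)" by (simp add: algebra_simps)
  also have "\<dots> \<le> y * (real (Suc n) * y ^ n * (y - x)) + y ^ Suc n * (y - x)"
    using Suc by (intro add_mono mult_left_mono mult_right_mono power_mono) auto
  also have "\<dots> = real (Suc (Suc n)) * y ^ Suc n * (y - x)" by (simp add: algebra_simps)
  finally show ?case .
qed simp

text \<open>
  The substitute for \<open>(x w)' \<le> (a + 1) w\<close>, for weights that need not be differentiable.
\<close>

lemma weight_increment:
  assumes w: "weight a w" and x: "0 \<le> x" "x \<le> y"
  shows "y * w y - x * w x \<le> real (a + 1) * (y - x) * w y"
proof (cases "y = 0")
  case False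
  then have y: "y > 0" using x by simp
  have w0: "0 \<le> w y" using w x unfolding weight_def by auto
  have "w y * x ^ a \<le> w x * y ^ a" using w x unfolding weight_def by auto
  from mult_left_mono[OF this x(1)] have 1: "w y * x ^ Suc a \<le> x * w x * y ^ a" by (simp add: mult_ac)
  have "y ^ a * (y * w y - x * w x) = w y * y ^ Suc a - x * w x * y ^ a" by (simp add: algebra_simps)
  also have "\<dots> \<le> w y * (y ^ Suc a - x ^ Suc a)" using 1 by (simp add: algebra_simps)
  also have "\<dots> \<le> w y * (real (Suc a) * y ^ a * (y - x))" by (intro mult_left_mono power_diff_le x w0)
  also have "\<dots> = y ^ a * (real (a + 1) * (y - x) * w y)" by (simp add: mult_ac)
  finally show ?thesis using y by simp
qed (use x in simp)

lemma weight_double: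
  assumes w: "weight a w" and x: "0 \<le> x" "x \<le> y" "y \<le> 2 * x"
  shows "w y \<le> 2 ^ a * (sqrt (w x) * sqrt (w y))"
proof -
  have wx: "0 \<le> w x" "w x \<le> w y" using w x unfolding weight_def by auto
  have "w y \<le> 2 ^ a * w x"
  proof (cases "x = 0")
    case True then have "y = x" using x by simp
    then show ?thesis using wx mult_right_mono[of 1 "2^a" "w x"] by simp
  next
    case False
    then have xp: "x ^ a > 0" using x by simp
    have "w y * x ^ a \<le> w x * y ^ a" using w x unfolding weight_def by auto
    also have "\<dots> \<le> w x * (2 * x) ^ a" using x wx by (intro mult_left_mono power_mono) auto
    also have "\<dots> = 2 ^ a * w x * x ^ a" by (simp add: power_mult_distrib)
    finally show ?thesis using xp by simp
  qed
  then have "sqrt (w y) \<le> sqrt (2 ^ a * w x)" by (rule real_sqrt_le_mono)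
  also have "\<dots> = sqrt (2 ^ a) * sqrt (w x)" by (rule real_sqrt_mult)
  also have "sqrt (2 ^ a) \<le> 2 ^ a"
  proof (rule real_le_lsqrt)
    have "(2::real)^a * 1 \<le> 2^a * 2^a" by (intro mult_left_mono) auto
    then show "2 ^ a \<le> ((2::real) ^ a)\<^sup>2" by (simp add: power2_eq_square)
  qed simp
  finally have "sqrt (w y) \<le> 2 ^ a * sqrt (w x)" using wx by (simp add: mult_right_mono)
  then have "sqrt (w y) * sqrt (w y) \<le> 2 ^ a * sqrt (w x) * sqrt (w y)" using wx by (intro mult_right_mono) auto
  then show ?thesis using wx by (simp add: mult.assoc)
qed

text \<open>
  The two larger frequencies have opposite signs and differ in modulus by the smallest one, so their
  contributions cancel up to an increment of \<open>x w x\<close> over an interval of length \<open>|p|\<close>. The ratio of their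
  moduli is at most two, which allows \<open>w|r|\<close> to be split evenly between them.
\<close>

lemma weight_core:
  assumes w: "weight a w" and s: "p + q + r = 0" and o: "\<bar>p\<bar> \<le> \<bar>q\<bar>" "\<bar>q\<bar> \<le> \<bar>r\<bar>"
  shows "\<bar>p * w \<bar>p\<bar> + q * w \<bar>q\<bar> + r * w \<bar>r\<bar>\<bar> \<le> real (a + 2) * 2 ^ a * (\<bar>p\<bar> * (sqrt (w \<bar>q\<bar>) * sqrt (w \<bar>r\<bar>)))"
proof -
  have r: "\<bar>r\<bar> = \<bar>p\<bar> + \<bar>q\<bar>" using s o by arith
  have wp: "0 \<le> w \<bar>p\<bar>" "w \<bar>p\<bar> \<le> w \<bar>q\<bar>" "w \<bar>q\<bar> \<le> w \<bar>r\<bar>" using w o unfolding weight_def by auto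
  have sg: "(0 \<le> q \<and> r \<le> 0) \<or> (q \<le> 0 \<and> 0 \<le> r)" using s o by arith
  have mono: "\<bar>q\<bar> * w \<bar>q\<bar> \<le> \<bar>r\<bar> * w \<bar>r\<bar>" using o wp by (intro mult_mono) auto
  have e: "\<bar>q * w \<bar>q\<bar> + r * w \<bar>r\<bar>\<bar> = \<bar>r\<bar> * w \<bar>r\<bar> - \<bar>q\<bar> * w \<bar>q\<bar>"
    using sg
  proof
    assume a: "0 \<le> q \<and> r \<le> 0"
    then have "q * w \<bar>q\<bar> + r * w \<bar>r\<bar> = - (\<bar>r\<bar> * w \<bar>r\<bar> - \<bar>q\<bar> * w \<bar>q\<bar>)" by (simp add: abs_if)
    then show ?thesis using mono by linarith
  next
    assume a: "q \<le> 0 \<and> 0 \<le> r"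
    then have "q * w \<bar>q\<bar> + r * w \<bar>r\<bar> = \<bar>r\<bar> * w \<bar>r\<bar> - \<bar>q\<bar> * w \<bar>q\<bar>" by (cases "q = 0") (simp_all add: abs_if)
    then show ?thesis using mono by linarith
  qed
  have "\<bar>q * w \<bar>q\<bar> + r * w \<bar>r\<bar>\<bar> \<le> real (a + 1) * \<bar>p\<bar> * w \<bar>r\<bar>"
    unfolding e using weight_increment[OF w, of "\<bar>q\<bar>" "\<bar>r\<bar>"] o r by simp
  moreover have "\<bar>p * w \<bar>p\<bar>\<bar> \<le> \<bar>p\<bar> * w \<bar>r\<bar>" using wp by (simp add: abs_mult mult_left_mono)
  moreover have "real (a + 1) * \<bar>p\<bar> * w \<bar>r\<bar> + \<bar>p\<bar> * w \<bar>r\<bar> = real (a + 2) * \<bar>p\<bar> * w \<bar>r\<bar>" by (simp add: algebra_simps)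
    moreover have "\<bar>p * w \<bar>p\<bar> + q * w \<bar>q\<bar> + r * w \<bar>r\<bar>\<bar> \<le> \<bar>p * w \<bar>p\<bar>\<bar> + \<bar>q * w \<bar>q\<bar> + r * w \<bar>r\<bar>\<bar>" by linarith
  ultimately have "\<bar>p * w \<bar>p\<bar> + q * w \<bar>q\<bar> + r * w \<bar>r\<bar>\<bar> \<le> real (a + 2) * \<bar>p\<bar> * w \<bar>r\<bar>" by linarith
  also have "\<dots> \<le> real (a + 2) * \<bar>p\<bar> * (2 ^ a * (sqrt (w \<bar>q\<bar>) * sqrt (w \<bar>r\<bar>)))"
    using weight_double[OF w, of "\<bar>q\<bar>" "\<bar>r\<bar>"] o r by (intro mult_left_mono) auto
  finally show ?thesis by (simp add: mult_ac)
qed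

lemma weight_nonneg: "weight a w \<Longrightarrow> 0 \<le> w \<bar>x\<bar>" by (simp add: weight_def)

text \<open>
  Which of the three frequencies is the smallest depends on the point; bounding by the sum over all three
  choices makes the estimate symmetric, so that each choice contributes the same integral.
\<close>

lemma weight_sym3:
  assumes w: "weight a w" and s: "p + q + r = 0"
  defines "B \<equiv> real (a + 2) * 2 ^ a"
  shows "SP P p q * \<bar>p * w \<bar>p\<bar> + q * w \<bar>q\<bar> + r * w \<bar>r\<bar>\<bar> \<le> B *
    (\<bar>p\<bar> * sqrt \<bar>p\<bar> * (sqrt (w \<bar>q\<bar>) * sqrt (w \<bar>r\<bar>)) + \<bar>q\<bar> * sqrt \<bar>q\<bar> * (sqrt (w \<bar>p\<bar>) * sqrt (w \<bar>r\<bar>)) + \<bar>r\<bar> * sqrt \<bar>r\<bar> * (sqrt (w \<bar>p\<bar>) * sqrt (w \<bar>q\<bar>)))"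
    (is "_ \<le> B * (?tp + ?tq + ?tr)")
proof -
  have B: "B \<ge> 0" unfolding B_def by simp
  have S: "SP P p q \<le> sqrt \<bar>p\<bar>" "SP P p q \<le> sqrt \<bar>q\<bar>" "SP P p q \<le> sqrt \<bar>r\<bar>"

  proof -
    have "\<bar>r\<bar> = \<bar>p + q\<bar>" using s by arith
    then show "SP P p q \<le> sqrt \<bar>p\<bar>" "SP P p q \<le> sqrt \<bar>q\<bar>" "SP P p q \<le> sqrt \<bar>r\<bar>" using SP_le[of P p q] by simp_all
  qed
  note W = weight_nonneg[OF w]
  have n: "0 \<le> ?tp" "0 \<le> ?tq" "0 \<le> ?tr" using W by auto
  have c: "SP P p q * \<bar>p * w \<bar>p\<bar> + q * w \<bar>q\<bar> + r * w \<bar>r\<bar>\<bar> \<le> B * (\<bar>x\<bar> * sqrt \<bar>x\<bar> * (sqrt (w \<bar>y\<bar>) * sqrt (w \<bar>z\<bar>)))"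
    if "\<bar>p * w \<bar>p\<bar> + q * w \<bar>q\<bar> + r * w \<bar>r\<bar>\<bar> \<le> B * (\<bar>x\<bar> * (sqrt (w \<bar>y\<bar>) * sqrt (w \<bar>z\<bar>)))" "SP P p q \<le> sqrt \<bar>x\<bar>" for x y z
  proof -
    have "SP P p q * \<bar>p * w \<bar>p\<bar> + q * w \<bar>q\<bar> + r * w \<bar>r\<bar>\<bar> \<le> sqrt \<bar>x\<bar> * (B * (\<bar>x\<bar> * (sqrt (w \<bar>y\<bar>) * sqrt (w \<bar>z\<bar>))))"
      by (intro mult_mono that) (use SP_nonneg in auto)
    then show ?thesis by (simp add: mult_ac)
  qed
  note core = weight_core[OF w, folded B_def]
  (* One case for each order of the three moduli; every case is weight_core for a permutation
     of the frequencies. *)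
  have main: "SP P p q * \<bar>p * w \<bar>p\<bar> + q * w \<bar>q\<bar> + r * w \<bar>r\<bar>\<bar> \<le> B * ?tp \<or> SP P p q * \<bar>p * w \<bar>p\<bar> + q * w \<bar>q\<bar> + r * w \<bar>r\<bar>\<bar> \<le> B * ?tq \<or> SP P p q * \<bar>p * w \<bar>p\<bar> + q * w \<bar>q\<bar> + r * w \<bar>r\<bar>\<bar> \<le> B * ?tr"
  proof -
    consider "\<bar>p\<bar> \<le> \<bar>q\<bar>" "\<bar>q\<bar> \<le> \<bar>r\<bar>" | "\<bar>p\<bar> \<le> \<bar>r\<bar>" "\<bar>r\<bar> \<le> \<bar>q\<bar>" | "\<bar>q\<bar> \<le> \<bar>p\<bar>" "\<bar>p\<bar> \<le> \<bar>r\<bar>" | "\<bar>q\<bar> \<le> \<bar>r\<bar>" "\<bar>r\<bar> \<le> \<bar>p\<bar>" | "\<bar>r\<bar> \<le> \<bar>p\<bar>" "\<bar>p\<bar> \<le> \<bar>q\<bar>" | "\<bar>r\<bar> \<le> \<bar>q\<bar>" "\<bar>q\<bar> \<le> \<bar>p\<bar>"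
      by linarith
    then show ?thesis
    proof cases
      case 1
      have "p + q + r = 0" using s by simp
      from c[OF core[OF this 1]] S show ?thesis by blast
    next
      case 2
      have e1: "p * w \<bar>p\<bar> + r * w \<bar>r\<bar> + q * w \<bar>q\<bar> = p * w \<bar>p\<bar> + q * w \<bar>q\<bar> + r * w \<bar>r\<bar>" by simp
      have e2: "sqrt (w \<bar>r\<bar>) * sqrt (w \<bar>q\<bar>) = sqrt (w \<bar>q\<bar>) * sqrt (w \<bar>r\<bar>)" by simp
      have "p + r + q = 0" using s by simp
      from c[OF core[OF this 2, unfolded e1 e2]] S show ?thesis by blast
    next
      case 3
      have e1: "q * w \<bar>q\<bar> + p * w \<bar>p\<bar> + r * w \<bar>r\<bar> = p * w \<bar>p\<bar> + q * w \<bar>q\<bar> + r * w \<bar>r\<bar>" by simp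
      have "q + p + r = 0" using s by simp
      from c[OF core[OF this 3, unfolded e1]] S show ?thesis by blast
    next
      case 4
      have e1: "q * w \<bar>q\<bar> + r * w \<bar>r\<bar> + p * w \<bar>p\<bar> = p * w \<bar>p\<bar> + q * w \<bar>q\<bar> + r * w \<bar>r\<bar>" by simp
      have e2: "sqrt (w \<bar>r\<bar>) * sqrt (w \<bar>p\<bar>) = sqrt (w \<bar>p\<bar>) * sqrt (w \<bar>r\<bar>)" by simp
      have "q + r + p = 0" using s by simp
      from c[OF core[OF this 4, unfolded e1 e2]] S show ?thesis by blast
    next
      case 5
      have e1: "r * w \<bar>r\<bar> + p * w \<bar>p\<bar> + q * w \<bar>q\<bar> = p * w \<bar>p\<bar> + q * w \<bar>q\<bar> + r * w \<bar>r\<bar>" by simp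
      have "r + p + q = 0" using s by simp
      from c[OF core[OF this 5, unfolded e1]] S show ?thesis by blast
    next
      case 6
      have e1: "r * w \<bar>r\<bar> + q * w \<bar>q\<bar> + p * w \<bar>p\<bar> = p * w \<bar>p\<bar> + q * w \<bar>q\<bar> + r * w \<bar>r\<bar>" by simp
      have e2: "sqrt (w \<bar>q\<bar>) * sqrt (w \<bar>p\<bar>) = sqrt (w \<bar>p\<bar>) * sqrt (w \<bar>q\<bar>)" by simp
      have "r + q + p = 0" using s by simp
      from c[OF core[OF this 6, unfolded e1 e2]] S show ?thesis by blast
    qed
  qed
  have "B * ?tp \<le> B * (?tp + ?tq + ?tr)" "B * ?tq \<le> B * (?tp + ?tq + ?tr)" "B * ?tr \<le> B * (?tp + ?tq + ?tr)"
    using B n by (auto intro!: mult_left_mono)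
  with main show ?thesis using order_trans by blast
qed

text \<open>
  The trilinear estimate on the plane of \<open>(p, q)\<close>, with integrability.
\<close>

lemma tri_integrable:
  assumes a: "integrable lborel \<alpha>" and a0: "\<And>p. 0 \<le> \<alpha> p" and b: "b \<in> L2" and c: "c \<in> L2"
  shows "integrable LL (\<lambda>z. \<alpha> (fst z) * (cmod (b (snd z)) * cmod (c (- fst z - snd z))))"
    "(LINT z|LL. \<alpha> (fst z) * (cmod (b (snd z)) * cmod (c (- fst z - snd z)))) \<le> (LINT p|lborel. \<alpha> p) * (nL2 b * nL2 c)"
proof -
  note [measurable] = borel_measurable_integrable[OF a] L2_measurable[OF b] L2_measurable[OF c]
  let ?f = "\<lambda>z. \<alpha> (fst z) * (cmod (b (snd z)) * cmod (c (- fst z - snd z)))"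
  have m: "?f \<in> borel_measurable LL" by measurable
  have ia: "(\<integral>\<^sup>+p. ennreal (\<alpha> p) \<partial>lborel) = ennreal (LINT p|lborel. \<alpha> p)" using a a0 by (intro nn_integral_eq_integral) auto
  have "(\<integral>\<^sup>+z. ennreal (?f z) \<partial>LL) = (\<integral>\<^sup>+p. \<integral>\<^sup>+q. ennreal (\<alpha> p) * ennreal (cmod (b q) * cmod (c (- p - q))) \<partial>lborel \<partial>lborel)"
    by (subst lborel.nn_integral_fst[symmetric]) (auto simp: ennreal_mult a0)
  also have "\<dots> \<le> (\<integral>\<^sup>+p. ennreal (\<alpha> p) \<partial>lborel) * ennreal (nL2 b * nL2 c)" by (intro nn_triple_product b c) measurable
  also have "\<dots> = ennreal ((LINT p|lborel. \<alpha> p) * (nL2 b * nL2 c))"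
    unfolding ia using a0 by (intro ennreal_mult[symmetric]) (auto intro!: integral_nonneg_AE)
  finally have le: "(\<integral>\<^sup>+z. ennreal (?f z) \<partial>LL) \<le> ennreal ((LINT p|lborel. \<alpha> p) * (nL2 b * nL2 c))" .
  show i: "integrable LL ?f"
  proof (rule integrableI_bounded[OF m])
    have "(\<integral>\<^sup>+z. ennreal (norm (?f z)) \<partial>LL) = (\<integral>\<^sup>+z. ennreal (?f z) \<partial>LL)" using a0 by (intro nn_integral_cong) (simp add: abs_mult)
    then show "(\<integral>\<^sup>+z. ennreal (norm (?f z)) \<partial>LL) < \<infinity>" using le by (simp add: le_less_trans[OF _ ennreal_less_top])
  qed
  have "ennreal (LINT z|LL. ?f z) = (\<integral>\<^sup>+z. ennreal (?f z) \<partial>LL)" using a0 by (intro nn_integral_eq_integral[symmetric] i) auto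
  with le have "ennreal (LINT z|LL. ?f z) \<le> ennreal ((LINT p|lborel. \<alpha> p) * (nL2 b * nL2 c))" by simp
  moreover have "0 \<le> (LINT p|lborel. \<alpha> p) * (nL2 b * nL2 c)" using a0 by (auto intro!: integral_nonneg_AE mult_nonneg_nonneg)
  ultimately show "(LINT z|LL. ?f z) \<le> (LINT p|lborel. \<alpha> p) * (nL2 b * nL2 c)" by (simp add: ennreal_le_iff)
qed

text \<open>
  Fubini's theorem: testing \<open>Q\<close> against a function of the output frequency \<open>k = p + q\<close> is an integral over
  the input frequencies \<open>p\<close> and \<open>q\<close>.
\<close>

lemma Q_pairing:
  assumes i: "integrable LL (\<lambda>z. H (fst z + snd z) * (complex_of_real (SP P (fst z) (snd z)) * f (fst z) * g (snd z)))"
  shows "integrable lborel (\<lambda>k. H k * Q P f g k)"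
    "(LINT k|lborel. H k * Q P f g k) = (LINT z|LL. H (fst z + snd z) * (complex_of_real (SP P (fst z) (snd z)) * f (fst z) * g (snd z)))"
proof -
  let ?f = "\<lambda>z. H (fst z + snd z) * (complex_of_real (SP P (fst z) (snd z)) * f (fst z) * g (snd z))"
  have i': "integrable LL (\<lambda>z. ?f (fst z - snd z, snd z))" by (rule LL_shear(1)[OF i])
  have e: "(LINT l|lborel. ?f (fst (k, l) - snd (k, l), snd (k, l))) = H k * Q P f g k" for k
    unfolding Q_def by (subst integral_mult_right_zero[symmetric]) simp
  show "integrable lborel (\<lambda>k. H k * Q P f g k)"
    using lborel_pair.integrable_fst'[OF i'] unfolding e .
  show "(LINT k|lborel. H k * Q P f g k) = (LINT z|LL. ?f z)"
    using lborel_pair.integral_fst'[OF i'] unfolding e LL_shear(2)[OF i] .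
qed

text \<open>
  Chosen so that \<open>nL2 (wn w u)\<close> is the norm of \<open>u\<close> in the space with weight \<open>w\<close>.
\<close>

definition wn :: "(real \<Rightarrow> real) \<Rightarrow> (real \<Rightarrow> complex) \<Rightarrow> real \<Rightarrow> complex" where
  "wn w u k = complex_of_real (sqrt (w \<bar>k\<bar>)) * u k"

text \<open>
  The quantity that controls the growth of all norms: the cancellation in \<open>weight_core\<close> leaves one power of
  the smallest frequency, and the kernel contributes its square root.
\<close>

definition Am :: "(real \<Rightarrow> complex) \<Rightarrow> real" where
  "Am u = (LINT p|lborel. \<bar>p\<bar> * sqrt \<bar>p\<bar> * cmod (u p))"

text \<open>
  The real part of the integral is half the time derivative of the squared \<open>w\<close>-norm. As an integral over
  \<open>p + q + r = 0\<close> its integrand is \<open>r w|r|\<close> times a symmetric function, so it may be averaged over the three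
  frequencies; the average is bounded by \<open>weight_sym3\<close>. The bound on the frequencies makes the three
  terms of the average separately integrable; the estimate itself is uniform in \<open>N\<close>.
\<close>

lemma energy_estimate:
  assumes P: "symset P" "P \<subseteq> {-N..N}" and w: "weight a w" and u2: "u \<in> L2" and h: "herm u"
    and wu: "wn w u \<in> L2" and A: "integrable lborel (\<lambda>p. \<bar>p\<bar> * sqrt \<bar>p\<bar> * cmod (u p))"
  shows "cmod (LINT k|lborel. (complex_of_real (w \<bar>k\<bar>) * (- \<i> * complex_of_real k) * cnj (u k)) * Q P u u k)
     \<le> real (a + 2) * 2 ^ a * (Am u * (nL2 (wn w u))\<^sup>2)"
proof -
  note [measurable] = L2_measurable[OF u2] SP_measurable[OF P(1)] L2_measurable[OF wu]
  have [measurable]: "w \<in> borel_measurable borel" using w by (simp add: weight_def)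
  have Pm[measurable]: "P \<in> sets borel" using P by (simp add: symset_def)
  have W: "0 \<le> w \<bar>x\<bar>" for x by (rule weight_nonneg[OF w])
  have hu: "u (- k) = cnj (u k)" for k using h by (simp add: herm_def)
  define \<Phi> where "\<Phi> z = complex_of_real (SP P (fst z) (snd z)) * (u (fst z) * u (snd z) * u (- fst z - snd z))" for z
  define \<theta>0 where "\<theta>0 z = complex_of_real (fst z * w \<bar>fst z\<bar>) * \<Phi> z" for z
  define \<theta>1 where "\<theta>1 z = complex_of_real (snd z * w \<bar>snd z\<bar>) * \<Phi> z" for z
  define \<theta>2 where "\<theta>2 z = complex_of_real ((- fst z - snd z) * w \<bar>- fst z - snd z\<bar>) * \<Phi> z" for z
  have swap\<Phi>: "\<Phi> (snd z, fst z) = \<Phi> z" for z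
  proof -
    have "u (- snd z - fst z) = u (- fst z - snd z)" by (rule arg_cong) simp
    then show ?thesis unfolding \<Phi>_def by (simp add: SP_comm[of P "snd z"])
  qed
  have rot\<Phi>: "\<Phi> (fst z, - fst z - snd z) = \<Phi> z" for z
  proof -
    have "- fst z - (- fst z - snd z) = snd z" by simp
    then show ?thesis unfolding \<Phi>_def by (simp add: SP_rot[OF P(1)] mult_ac)
  qed
  have s1: "\<theta>0 (snd z, fst z) = \<theta>1 z" for z unfolding \<theta>0_def \<theta>1_def swap\<Phi> by simp
  have s2: "\<theta>1 (fst z, - fst z - snd z) = \<theta>2 z" for z unfolding \<theta>1_def \<theta>2_def rot\<Phi> by simp
  define N' where "N' = max N 0"
  have N': "P \<subseteq> {-N'..N'}" "N' \<ge> 0" using P(2) by (auto simp: N'_def)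
  have ci: "integrable lborel (\<lambda>p. cmod (cut N' u p))" by (intro integrable_norm cut_integrable u2)
  (* Here the truncation is used: the factor with the weight is bounded for bounded
     frequencies. *)
  have i0: "integrable LL \<theta>0"
  proof (rule Bochner_Integration.integrable_bound)
    show "integrable LL (\<lambda>z. (N' * w N' * sqrt N') * (cmod (cut N' u (fst z)) * (cmod (u (snd z)) * cmod (u (- fst z - snd z)))))"
      by (rule integrable_mult_right, rule tri_integrable(1)[OF ci _ u2 u2]) simp
    show "\<theta>0 \<in> borel_measurable LL" unfolding \<theta>0_def[abs_def] \<Phi>_def by measurable
    have "norm (\<theta>0 z) \<le> norm ((N' * w N' * sqrt N') * (cmod (cut N' u (fst z)) * (cmod (u (snd z)) * cmod (u (- fst z - snd z)))))" for z
    proof (cases "fst z \<in> P")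
      case True
      then have "fst z \<in> {-N'..N'}" using N'(1) by blast
      then have p: "\<bar>fst z\<bar> \<le> N'" by auto
      have wN: "w \<bar>fst z\<bar> \<le> w N'" using w p unfolding weight_def by auto
      have wN0: "0 \<le> w N'" using w N' unfolding weight_def by auto
      have "SP P (fst z) (snd z) \<le> sqrt N'" using SP_le(1)[of P "fst z" "snd z"] p real_sqrt_le_mono order_trans by blast
      then have "\<bar>fst z\<bar> * w \<bar>fst z\<bar> * SP P (fst z) (snd z) \<le> N' * w N' * sqrt N'"
        using p wN W wN0 N' SP_nonneg by (intro mult_mono) auto
      then have "\<bar>fst z\<bar> * w \<bar>fst z\<bar> * SP P (fst z) (snd z) * (cmod (u (fst z)) * (cmod (u (snd z)) * cmod (u (- fst z - snd z)))) \<le> N' * w N' * sqrt N' * (cmod (u (fst z)) * (cmod (u (snd z)) * cmod (u (- fst z - snd z))))"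
        by (rule mult_right_mono) simp
      then show ?thesis using p W wN0 N' SP_nonneg[of P] unfolding \<theta>0_def \<Phi>_def by (simp add: cut_def norm_mult abs_mult mult_ac)
    next
      case False
      then show ?thesis by (simp add: \<theta>0_def \<Phi>_def SP_def)
    qed
    then show "AE z in LL. norm (\<theta>0 z) \<le> norm ((N' * w N' * sqrt N') * (cmod (cut N' u (fst z)) * (cmod (u (snd z)) * cmod (u (- fst z - snd z)))))"
      by simp
  qed
  have i1: "integrable LL \<theta>1" and e1: "(LINT z|LL. \<theta>1 z) = (LINT z|LL. \<theta>0 z)"
    using LL_swap[OF i0] unfolding s1 by auto
  have i2: "integrable LL \<theta>2" and e2: "(LINT z|LL. \<theta>2 z) = (LINT z|LL. \<theta>1 z)"
    using LL_rot[OF i1] unfolding s2 by auto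
  define v where "v = wn w u"
  define T0 where "T0 z = \<bar>fst z\<bar> * sqrt \<bar>fst z\<bar> * cmod (u (fst z)) * (cmod (v (snd z)) * cmod (v (- fst z - snd z)))" for z
  define T1 where "T1 z = \<bar>snd z\<bar> * sqrt \<bar>snd z\<bar> * cmod (u (snd z)) * (cmod (v (fst z)) * cmod (v (- fst z - snd z)))" for z
  define T2 where "T2 z = \<bar>- fst z - snd z\<bar> * sqrt \<bar>- fst z - snd z\<bar> * cmod (u (- fst z - snd z)) * (cmod (v (fst z)) * cmod (v (snd z)))" for z
  have t1: "T0 (snd z, fst z) = T1 z" for z
  proof -
    have "v (- snd z - fst z) = v (- fst z - snd z)" by (rule arg_cong) simp
    then show ?thesis unfolding T0_def T1_def by simp
  qed
  have t2: "T1 (fst z, - fst z - snd z) = T2 z" for z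
  proof -
    have "- fst z - (- fst z - snd z) = snd z" by simp
    then show ?thesis unfolding T1_def T2_def by simp
  qed
  have j0: "integrable LL T0" and f0: "(LINT z|LL. T0 z) \<le> Am u * (nL2 v * nL2 v)"
    unfolding T0_def[abs_def] Am_def v_def using tri_integrable[OF A _ wu wu] by auto
  have j1: "integrable LL T1" and f1: "(LINT z|LL. T1 z) = (LINT z|LL. T0 z)"
    using LL_swap[OF j0] unfolding t1 by auto
  have j2: "integrable LL T2" and f2: "(LINT z|LL. T2 z) = (LINT z|LL. T1 z)"
    using LL_rot[OF j1] unfolding t2 by auto
  let ?B = "real (a + 2) * 2 ^ a"
  have pt: "cmod (\<theta>0 z + \<theta>1 z + \<theta>2 z) \<le> ?B * (T0 z + T1 z + T2 z)" for z
  proof -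
    obtain p q where z: "z = (p, q)" by fastforce
    define r where "r = - p - q"
    have vv: "cmod (v x) = sqrt (w \<bar>x\<bar>) * cmod (u x)" for x unfolding v_def wn_def by (simp add: norm_mult W)
    have "\<theta>0 z + \<theta>1 z + \<theta>2 z = complex_of_real (SP P p q * (p * w \<bar>p\<bar> + q * w \<bar>q\<bar> + r * w \<bar>r\<bar>)) * (u p * u q * u r)"
      unfolding \<theta>0_def \<theta>1_def \<theta>2_def \<Phi>_def z fst_conv snd_conv r_def[symmetric] by (simp add: algebra_simps)
    then have "cmod (\<theta>0 z + \<theta>1 z + \<theta>2 z) = SP P p q * \<bar>p * w \<bar>p\<bar> + q * w \<bar>q\<bar> + r * w \<bar>r\<bar>\<bar> * (cmod (u p) * cmod (u q) * cmod (u r))"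
      by (simp only: norm_mult norm_of_real abs_mult abs_of_nonneg[OF SP_nonneg])
    also have "\<dots> \<le> ?B * (\<bar>p\<bar> * sqrt \<bar>p\<bar> * (sqrt (w \<bar>q\<bar>) * sqrt (w \<bar>r\<bar>)) + \<bar>q\<bar> * sqrt \<bar>q\<bar> * (sqrt (w \<bar>p\<bar>) * sqrt (w \<bar>r\<bar>)) + \<bar>r\<bar> * sqrt \<bar>r\<bar> * (sqrt (w \<bar>p\<bar>) * sqrt (w \<bar>q\<bar>))) * (cmod (u p) * cmod (u q) * cmod (u r))"
      by (rule mult_right_mono[OF weight_sym3[OF w]]) (simp_all add: r_def)
    also have "\<dots> = ?B * (T0 z + T1 z + T2 z)"
      unfolding T0_def T1_def T2_def z fst_conv snd_conv r_def[symmetric] vv by (simp add: algebra_simps)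
    finally show ?thesis .
  qed
  (* The three integrals agree, because the changes of variables permute the frequencies. *)
  have "3 * (LINT z|LL. \<theta>2 z) = (LINT z|LL. \<theta>0 z + \<theta>1 z + \<theta>2 z)"
    using i0 i1 i2 e1 e2 by simp
  then have "3 * cmod (LINT z|LL. \<theta>2 z) = cmod (LINT z|LL. \<theta>0 z + \<theta>1 z + \<theta>2 z)"
    by (metis norm_mult norm_numeral)
  also have "\<dots> \<le> (LINT z|LL. ?B * (T0 z + T1 z + T2 z))"
    by (rule integral_norm_le) (use i0 i1 i2 j0 j1 j2 pt in auto)
  also have "\<dots> = ?B * (3 * (LINT z|LL. T0 z))"
    using j0 j1 j2 f1 f2 by simp
  also have "\<dots> \<le> ?B * (3 * (Am u * (nL2 v * nL2 v)))" by (intro mult_left_mono f0) auto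
  also have "\<dots> = 3 * (?B * (Am u * (nL2 v)\<^sup>2))" by (simp only: power2_eq_square mult_ac)
  finally have m: "cmod (LINT z|LL. \<theta>2 z) \<le> ?B * (Am u * (nL2 v)\<^sup>2)" by simp
  have H: "(complex_of_real (w \<bar>fst z + snd z\<bar>) * (- \<i> * complex_of_real (fst z + snd z)) * cnj (u (fst z + snd z))) * (complex_of_real (SP P (fst z) (snd z)) * u (fst z) * u (snd z)) = \<i> * \<theta>2 z" for z
  proof -
    have "cnj (u (fst z + snd z)) = u (- fst z - snd z)" using hu[of "fst z + snd z"] by simp
    moreover have "\<bar>- fst z - snd z\<bar> = \<bar>fst z + snd z\<bar>" by simp
    ultimately show ?thesis unfolding \<theta>2_def \<Phi>_def by (simp add: algebra_simps)
  qed
  have "(LINT k|lborel. (complex_of_real (w \<bar>k\<bar>) * (- \<i> * complex_of_real k) * cnj (u k)) * Q P u u k) = (LINT z|LL. \<i> * \<theta>2 z)"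
    by (subst Q_pairing(2)) (use i2 in \<open>simp_all only: H integrable_mult_right\<close>)
  then show ?thesis using m by (simp add: norm_mult v_def)
qed

text \<open>
  Only the two factors \<open>d\<close> are interchangeable here, and averaging over them replaces \<open>r\<close> by
  \<open>(q + r)/2 = - p/2\<close>: the derivative falls on \<open>f\<close>.
\<close>

lemma difference_estimate:
  assumes f2: "f \<in> L2" and d2: "d \<in> L2" and hd: "herm d"
    and kd: "(\<lambda>k. complex_of_real k * d k) \<in> L2"
    and A: "integrable lborel (\<lambda>p. \<bar>p\<bar> * sqrt \<bar>p\<bar> * cmod (f p))"
    and A1: "integrable lborel (\<lambda>p. sqrt \<bar>p\<bar> * cmod (f p))"
  shows "2 * cmod (LINT k|lborel. (- \<i> * complex_of_real k) * cnj (d k) * Q UNIV f d k) \<le> Am f * (nL2 d)\<^sup>2"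
proof -
  note [measurable] = L2_measurable[OF f2] L2_measurable[OF d2] SP_measurable[OF symset_UNIV]
  have hu: "d (- k) = cnj (d k)" for k using hd by (simp add: herm_def)
  define \<Phi> where "\<Phi> z = complex_of_real (SP UNIV (fst z) (snd z)) * (f (fst z) * (d (snd z) * d (- fst z - snd z)))" for z
  define \<theta>r where "\<theta>r z = complex_of_real (- fst z - snd z) * \<Phi> z" for z
  define \<theta>q where "\<theta>q z = complex_of_real (snd z) * \<Phi> z" for z
  have rot\<Phi>: "\<Phi> (fst z, - fst z - snd z) = \<Phi> z" for z
  proof -
    have "- fst z - (- fst z - snd z) = snd z" by simp
    then show ?thesis unfolding \<Phi>_def by (simp add: SP_rot[OF symset_UNIV] mult_ac)
  qed
  have s: "\<theta>r (fst z, - fst z - snd z) = \<theta>q z" for z unfolding \<theta>r_def \<theta>q_def rot\<Phi> by simp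
  have ir: "integrable LL \<theta>r"
  proof (rule Bochner_Integration.integrable_bound)
    show "integrable LL (\<lambda>z. sqrt \<bar>fst z\<bar> * cmod (f (fst z)) * (cmod (d (snd z)) * cmod (complex_of_real (- fst z - snd z) * d (- fst z - snd z))))"
      by (rule tri_integrable(1)[OF A1 _ d2 kd]) simp
    show "\<theta>r \<in> borel_measurable LL" unfolding \<theta>r_def[abs_def] \<Phi>_def by measurable
    have "norm (\<theta>r z) \<le> norm (sqrt \<bar>fst z\<bar> * cmod (f (fst z)) * (cmod (d (snd z)) * cmod (complex_of_real (- fst z - snd z) * d (- fst z - snd z))))" for z
    proof -
      have "norm (\<theta>r z) = SP UNIV (fst z) (snd z) * (cmod (f (fst z)) * (cmod (d (snd z)) * cmod (complex_of_real (- fst z - snd z) * d (- fst z - snd z))))"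
        unfolding \<theta>r_def \<Phi>_def by (simp only: norm_mult norm_of_real abs_of_nonneg[OF SP_nonneg] mult_ac)
      also have "\<dots> \<le> sqrt \<bar>fst z\<bar> * (cmod (f (fst z)) * (cmod (d (snd z)) * cmod (complex_of_real (- fst z - snd z) * d (- fst z - snd z))))"
        by (intro mult_right_mono SP_le(1)) simp
      finally show ?thesis by (simp only: mult.assoc) simp
    qed
    then show "AE z in LL. norm (\<theta>r z) \<le> norm (sqrt \<bar>fst z\<bar> * cmod (f (fst z)) * (cmod (d (snd z)) * cmod (complex_of_real (- fst z - snd z) * d (- fst z - snd z))))"
      by simp
  qed
  have iq: "integrable LL \<theta>q" and eq: "(LINT z|LL. \<theta>q z) = (LINT z|LL. \<theta>r z)"
    using LL_rot[OF ir] unfolding s by auto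
  define T where "T z = \<bar>fst z\<bar> * sqrt \<bar>fst z\<bar> * cmod (f (fst z)) * (cmod (d (snd z)) * cmod (d (- fst z - snd z)))" for z
  have j: "integrable LL T" and jT: "(LINT z|LL. T z) \<le> Am f * (nL2 d * nL2 d)"
    unfolding T_def[abs_def] Am_def using tri_integrable[OF A _ d2 d2] by auto
  have pt: "cmod (\<theta>r z + \<theta>q z) \<le> T z" for z
  proof -
    have "\<theta>r z + \<theta>q z = complex_of_real (- fst z) * \<Phi> z" unfolding \<theta>r_def \<theta>q_def by (simp add: algebra_simps)
    then have "cmod (\<theta>r z + \<theta>q z) = SP UNIV (fst z) (snd z) * (\<bar>fst z\<bar> * (cmod (f (fst z)) * (cmod (d (snd z)) * cmod (d (- fst z - snd z)))))"
      unfolding \<Phi>_def by (simp only: norm_mult norm_of_real abs_of_nonneg[OF SP_nonneg] abs_minus_cancel mult_ac)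
    also have "\<dots> \<le> sqrt \<bar>fst z\<bar> * (\<bar>fst z\<bar> * (cmod (f (fst z)) * (cmod (d (snd z)) * cmod (d (- fst z - snd z)))))"
      by (intro mult_right_mono SP_le(1)) simp
    finally show ?thesis unfolding T_def by (simp only: mult_ac)
  qed
  have "2 * (LINT z|LL. \<theta>r z) = (LINT z|LL. \<theta>r z + \<theta>q z)" using ir iq eq by simp
  then have "2 * cmod (LINT z|LL. \<theta>r z) = cmod (LINT z|LL. \<theta>r z + \<theta>q z)" by (metis norm_mult norm_numeral)
  also have "\<dots> \<le> (LINT z|LL. T z)" by (rule integral_norm_le) (use ir iq j pt in auto)
  finally have m: "2 * cmod (LINT z|LL. \<theta>r z) \<le> Am f * (nL2 d)\<^sup>2" using jT by (simp add: power2_eq_square)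
  have H: "(- \<i> * complex_of_real (fst z + snd z)) * cnj (d (fst z + snd z)) * (complex_of_real (SP UNIV (fst z) (snd z)) * f (fst z) * d (snd z)) = \<i> * \<theta>r z" for z
  proof -
    have "cnj (d (fst z + snd z)) = d (- fst z - snd z)" using hu[of "fst z + snd z"] by simp
    then show ?thesis unfolding \<theta>r_def \<Phi>_def by (simp add: algebra_simps)
  qed
  have "(LINT k|lborel. (- \<i> * complex_of_real k) * cnj (d k) * Q UNIV f d k) = (LINT z|LL. \<i> * \<theta>r z)"
    by (subst Q_pairing(2)) (use ir in \<open>simp_all only: H integrable_mult_right\<close>)
  then show ?thesis using m by (simp add: norm_mult)
qed

text \<open>
  The kernel bound says that the weight \<open>m\<close> falls on one of the two factors while the other one only needs
  half a derivative in \<open>L\<^sup>1\<close>; then Young's inequality applies to both terms.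
\<close>

lemma bilinear_L2:
  assumes km[measurable]: "(\<lambda>z. \<kappa> (fst z) (snd z)) \<in> borel_measurable LL"
    and kb: "\<And>k l. \<bar>\<kappa> k l\<bar> \<le> C * (m (k - l) * sqrt \<bar>l\<bar> + sqrt \<bar>k - l\<bar> * m l)" and C: "0 \<le> C" and m0: "\<And>x. 0 \<le> m x"
    and u: "(\<lambda>k. complex_of_real (m k) * u k) \<in> L2" and v: "(\<lambda>k. complex_of_real (m k) * v k) \<in> L2"
    and um[measurable]: "u \<in> borel_measurable borel" "v \<in> borel_measurable borel"
    and su: "integrable lborel (\<lambda>p. sqrt \<bar>p\<bar> * cmod (u p))" and sv: "integrable lborel (\<lambda>p. sqrt \<bar>p\<bar> * cmod (v p))"
  defines "G \<equiv> \<lambda>k. LINT l|lborel. complex_of_real (\<kappa> k l) * u (k - l) * v l"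
  shows "G \<in> L2" "nL2 G \<le> 2 * C * (nL2 (\<lambda>k. complex_of_real (m k) * u k) * (LINT p|lborel. sqrt \<bar>p\<bar> * cmod (v p)) + (LINT p|lborel. sqrt \<bar>p\<bar> * cmod (u p)) * nL2 (\<lambda>k. complex_of_real (m k) * v k))"
proof -
  let ?mu = "\<lambda>k. complex_of_real (m k) * u k" and ?mv = "\<lambda>k. complex_of_real (m k) * v k"
  let ?su = "LINT p|lborel. sqrt \<bar>p\<bar> * cmod (u p)" and ?sv = "LINT p|lborel. sqrt \<bar>p\<bar> * cmod (v p)"
  note [measurable] = L2_measurable[OF u] L2_measurable[OF v]
  have [measurable]: "G \<in> borel_measurable borel" unfolding G_def by measurable
  define a where "a p = ennreal (sqrt \<bar>p\<bar> * cmod (v p))" for p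
  define b where "b p = ennreal (sqrt \<bar>p\<bar> * cmod (u p))" for p
  have [measurable]: "a \<in> borel_measurable borel" "b \<in> borel_measurable borel" unfolding a_def[abs_def] b_def[abs_def] by measurable
  have s0: "0 \<le> ?su" "0 \<le> ?sv" by (auto intro!: integral_nonneg_AE)
  have ia: "(\<integral>\<^sup>+p. a p \<partial>lborel) = ennreal ?sv" "(\<integral>\<^sup>+p. b p \<partial>lborel) = ennreal ?su"
    unfolding a_def b_def by (intro nn_integral_eq_integral su sv; simp)+
  define g1 where "g1 k = (\<integral>\<^sup>+l. a (k - l) * ennreal (cmod (?mu l)) \<partial>lborel)" for k
  define g2 where "g2 k = (\<integral>\<^sup>+l. b (k - l) * ennreal (cmod (?mv l)) \<partial>lborel)" for k
  have [measurable]: "g1 \<in> borel_measurable borel" "g2 \<in> borel_measurable borel" unfolding g1_def[abs_def] g2_def[abs_def] by measurable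
  have [measurable]: "(\<lambda>l. complex_of_real (m (k - l)) * u (k - l)) \<in> borel_measurable borel" for k
    by (rule measurable_compose[OF _ L2_measurable[OF u], of "\<lambda>l. k - l"]) measurable
  have G: "ennreal (cmod (G k)) \<le> ennreal C * (g1 k + g2 k)" for k
  proof -
    have "ennreal (cmod (G k)) \<le> (\<integral>\<^sup>+l. ennreal (cmod (complex_of_real (\<kappa> k l) * u (k - l) * v l)) \<partial>lborel)"

    proof (cases "integrable lborel (\<lambda>l. complex_of_real (\<kappa> k l) * u (k - l) * v l)")
      case True then show ?thesis unfolding G_def by (rule integral_norm_bound_ennreal)
    qed (simp add: not_integrable_integral_eq G_def)
    also have "\<dots> \<le> (\<integral>\<^sup>+l. ennreal C * (ennreal (cmod (?mu (k - l))) * a l + b (k - l) * ennreal (cmod (?mv l))) \<partial>lborel)"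
    proof (rule nn_integral_mono)
      fix l
      have "cmod (complex_of_real (\<kappa> k l) * u (k - l) * v l) = \<bar>\<kappa> k l\<bar> * (cmod (u (k - l)) * cmod (v l))" by (simp add: norm_mult)
      also have "\<dots> \<le> C * (m (k - l) * sqrt \<bar>l\<bar> + sqrt \<bar>k - l\<bar> * m l) * (cmod (u (k - l)) * cmod (v l))"
        by (intro mult_right_mono kb) simp
      also have "\<dots> = C * (cmod (?mu (k - l)) * (sqrt \<bar>l\<bar> * cmod (v l)) + sqrt \<bar>k - l\<bar> * cmod (u (k - l)) * cmod (?mv l))"
        using m0 by (simp add: norm_mult algebra_simps)
      finally have "ennreal (cmod (complex_of_real (\<kappa> k l) * u (k - l) * v l)) \<le> ennreal (C * (cmod (?mu (k - l)) * (sqrt \<bar>l\<bar> * cmod (v l)) + sqrt \<bar>k - l\<bar> * cmod (u (k - l)) * cmod (?mv l)))"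
        by (rule ennreal_leI)
      also have "\<dots> = ennreal C * (ennreal (cmod (?mu (k - l)) * (sqrt \<bar>l\<bar> * cmod (v l))) + ennreal (sqrt \<bar>k - l\<bar> * cmod (u (k - l)) * cmod (?mv l)))"
        by (subst ennreal_mult[OF C], simp, subst ennreal_plus, simp_all)
      also have "ennreal (cmod (?mu (k - l)) * (sqrt \<bar>l\<bar> * cmod (v l))) = ennreal (cmod (?mu (k - l))) * a l"
        unfolding a_def by (rule ennreal_mult) simp_all
      also have "ennreal (sqrt \<bar>k - l\<bar> * cmod (u (k - l)) * cmod (?mv l)) = b (k - l) * ennreal (cmod (?mv l))"
        unfolding b_def by (rule ennreal_mult) simp_all
      finally show "ennreal (cmod (complex_of_real (\<kappa> k l) * u (k - l) * v l)) \<le> ennreal C * (ennreal (cmod (?mu (k - l))) * a l + b (k - l) * ennreal (cmod (?mv l)))" .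
    qed
    also have "\<dots> = ennreal C * ((\<integral>\<^sup>+l. ennreal (cmod (?mu (k - l))) * a l \<partial>lborel) + g2 k)"
    proof -
      have m1: "(\<lambda>l. ennreal (cmod (?mu (k - l))) * a l) \<in> borel_measurable lborel" by measurable
      have m2: "(\<lambda>l. b (k - l) * ennreal (cmod (?mv l))) \<in> borel_measurable lborel" by measurable
      show ?thesis unfolding g2_def
        by (simp only: nn_integral_cmult[OF borel_measurable_add[OF m1 m2]] nn_integral_add[OF m1 m2])
    qed
    also have "(\<integral>\<^sup>+l. ennreal (cmod (?mu (k - l))) * a l \<partial>lborel) = g1 k"
    proof -
      have m: "(\<lambda>l. a (k - l) * ennreal (cmod (?mu l))) \<in> borel_measurable borel" by measurable
      have "g1 k = ennreal \<bar>-1\<bar> * (\<integral>\<^sup>+l. a (k - (k + (-1) * l)) * ennreal (cmod (?mu (k + (-1) * l))) \<partial>lborel)"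
        unfolding g1_def by (rule nn_integral_real_affine[OF m]) simp
      also have "\<dots> = (\<integral>\<^sup>+l. ennreal (cmod (?mu (k - l))) * a l \<partial>lborel)"
        by (simp add: mult.commute)
      finally show ?thesis by simp
    qed
    finally show ?thesis .
  qed
  define X where "X = nL2 ?mu * ?sv + ?su * nL2 ?mv"
  have X0: "0 \<le> X" unfolding X_def using s0 by simp
  have n1: "(\<integral>\<^sup>+k. (g1 k)\<^sup>2 \<partial>lborel) \<le> ennreal (X\<^sup>2)"
  proof -
    have "(\<integral>\<^sup>+k. (g1 k)\<^sup>2 \<partial>lborel) \<le> (ennreal ?sv * ennreal (nL2 ?mu))\<^sup>2" unfolding g1_def ia(1)[symmetric] by (rule nn_Young[OF _ u]) measurable
    also have "\<dots> = ennreal ((?sv * nL2 ?mu)\<^sup>2)" using s0 by (simp only: ennreal_mult[OF s0(2) nL2_nonneg, symmetric]) (simp add: ennreal_power)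
    also have "\<dots> \<le> ennreal (X\<^sup>2)" unfolding X_def using s0 by (intro ennreal_leI power_mono) (auto simp: mult.commute)
    finally show ?thesis .
  qed
  have n2: "(\<integral>\<^sup>+k. (g2 k)\<^sup>2 \<partial>lborel) \<le> ennreal (X\<^sup>2)"
  proof -
    have "(\<integral>\<^sup>+k. (g2 k)\<^sup>2 \<partial>lborel) \<le> (ennreal ?su * ennreal (nL2 ?mv))\<^sup>2" unfolding g2_def ia(2)[symmetric] by (rule nn_Young[OF _ v]) measurable
    also have "\<dots> = ennreal ((?su * nL2 ?mv)\<^sup>2)" using s0 by (simp only: ennreal_mult[OF s0(1) nL2_nonneg, symmetric]) (simp add: ennreal_power)
    also have "\<dots> \<le> ennreal (X\<^sup>2)" unfolding X_def using s0 by (intro ennreal_leI power_mono) auto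
    finally show ?thesis .
  qed
  have sq: "(x + y)\<^sup>2 \<le> 2 * (x\<^sup>2 + y\<^sup>2)" for x y :: ennreal
  proof (cases "x = \<top> \<or> y = \<top>")
    case True then show ?thesis by (auto simp: power2_eq_square ennreal_mult_top)
  next
    case False
    then obtain x' y' where xy: "x = ennreal x'" "0 \<le> x'" "y = ennreal y'" "0 \<le> y'" by (metis ennreal_cases)
    have "(x' + y')\<^sup>2 \<le> 2 * (x'\<^sup>2 + y'\<^sup>2)" using sum_squares_bound[of x' y'] by (simp add: power2_sum)
    then have le: "ennreal ((x' + y')\<^sup>2) \<le> ennreal (2 * (x'\<^sup>2 + y'\<^sup>2))" by (rule ennreal_leI)
    have "(x + y)\<^sup>2 = ennreal ((x' + y')\<^sup>2)"
      unfolding xy(1,3) using xy(2,4) by (simp only: ennreal_plus[symmetric] ennreal_power add_nonneg_nonneg)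
    moreover have "2 * (x\<^sup>2 + y\<^sup>2) = ennreal 2 * (ennreal (x'\<^sup>2) + ennreal (y'\<^sup>2))"
      unfolding xy(1,3) using xy(2,4) by (simp only: ennreal_power ennreal_numeral)
    moreover have "\<dots> = ennreal (2 * (x'\<^sup>2 + y'\<^sup>2))"
      by (simp only: ennreal_plus[OF zero_le_power2 zero_le_power2, symmetric]) (rule ennreal_mult[symmetric], simp_all)
    ultimately show ?thesis using le by simp
  qed
  have "(\<integral>\<^sup>+k. ennreal ((cmod (G k))\<^sup>2) \<partial>lborel) \<le> (\<integral>\<^sup>+k. (ennreal C)\<^sup>2 * (2 * ((g1 k)\<^sup>2 + (g2 k)\<^sup>2)) \<partial>lborel)"
  proof (rule nn_integral_mono)
    fix k
    have "ennreal ((cmod (G k))\<^sup>2) = (ennreal (cmod (G k)))\<^sup>2" by (simp add: ennreal_power)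
    also have "\<dots> \<le> (ennreal C * (g1 k + g2 k))\<^sup>2" by (rule power_mono_ennreal[OF G])
    also have "\<dots> = (ennreal C)\<^sup>2 * (g1 k + g2 k)\<^sup>2" by (rule power_mult_distrib)
    also have "\<dots> \<le> (ennreal C)\<^sup>2 * (2 * ((g1 k)\<^sup>2 + (g2 k)\<^sup>2))" by (intro mult_left_mono sq) simp
    finally show "ennreal ((cmod (G k))\<^sup>2) \<le> (ennreal C)\<^sup>2 * (2 * ((g1 k)\<^sup>2 + (g2 k)\<^sup>2))" .
  qed
  also have "\<dots> = (ennreal C)\<^sup>2 * (2 * ((\<integral>\<^sup>+k. (g1 k)\<^sup>2 \<partial>lborel) + (\<integral>\<^sup>+k. (g2 k)\<^sup>2 \<partial>lborel)))"
  proof -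
    have m1: "(\<lambda>k. (g1 k)\<^sup>2) \<in> borel_measurable lborel" by measurable
    have m2: "(\<lambda>k. (g2 k)\<^sup>2) \<in> borel_measurable lborel" by measurable
    have m3: "(\<lambda>k. 2 * ((g1 k)\<^sup>2 + (g2 k)\<^sup>2)) \<in> borel_measurable lborel" by measurable
    show ?thesis
      by (simp only: nn_integral_cmult[OF m3] nn_integral_cmult[OF borel_measurable_add[OF m1 m2]] nn_integral_add[OF m1 m2])
  qed
  also have "\<dots> \<le> (ennreal C)\<^sup>2 * (2 * (ennreal (X\<^sup>2) + ennreal (X\<^sup>2)))" by (intro mult_left_mono add_mono n1 n2) auto
  also have "\<dots> = ennreal ((2 * C * X)\<^sup>2)"
  proof -
    have "(ennreal C)\<^sup>2 * (2 * (ennreal (X\<^sup>2) + ennreal (X\<^sup>2))) = ennreal (C\<^sup>2) * (ennreal 2 * ennreal (X\<^sup>2 + X\<^sup>2))"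
      using C by (simp only: ennreal_power ennreal_plus[symmetric] zero_le_power2 ennreal_numeral)
    also have "\<dots> = ennreal (C\<^sup>2 * (2 * (X\<^sup>2 + X\<^sup>2)))" by (simp only: ennreal_mult zero_le_power2 add_nonneg_nonneg zero_le_numeral mult_nonneg_nonneg)
    also have "C\<^sup>2 * (2 * (X\<^sup>2 + X\<^sup>2)) = (2 * C * X)\<^sup>2" by (simp add: power2_eq_square)
    finally show ?thesis .
  qed
  finally have "(\<integral>\<^sup>+k. ennreal ((cmod (G k))\<^sup>2) \<partial>lborel) \<le> ennreal ((2 * C * X)\<^sup>2)" .
  from L2_of_nn[OF _ this] show "G \<in> L2" "nL2 G \<le> 2 * C * X" using C X0 by auto
qed

section \<open>Sobolev norms on the Fourier side\<close>

text \<open>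
  The weight of the squared \<open>H\<^sup>s\<close> norm.
\<close>

definition hw :: "real \<Rightarrow> real \<Rightarrow> real" where "hw s x = 1 + \<bar>x\<bar> powr (2 * s)"

lemma hw_ge1: "1 \<le> hw s x" by (simp add: hw_def)
lemma hw_abs [simp]: "hw s \<bar>x\<bar> = hw s x" by (simp add: hw_def)
lemma hw_measurable [measurable]: "hw s \<in> borel_measurable borel" unfolding hw_def[abs_def] by measurable
lemma hw_nonneg [simp]: "0 \<le> hw s x" using hw_ge1[of s x] by linarith

lemma weightI:
  assumes "w \<in> borel_measurable borel" "\<And>x. 0 \<le> x \<Longrightarrow> 0 \<le> w x" "\<And>x y. 0 \<le> x \<Longrightarrow> x \<le> y \<Longrightarrow> w x \<le> w y"
    "\<And>x y. 0 < x \<Longrightarrow> x \<le> y \<Longrightarrow> w y * x ^ a \<le> w x * y ^ a" "a > 0"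
  shows "weight a w"
  unfolding weight_def
proof (intro conjI allI impI assms(1) assms(2) assms(3))
  fix x y :: real assume 1: "0 \<le> x" "x \<le> y"
  show "w y * x ^ a \<le> w x * y ^ a"
  proof (cases "x = 0")
    case True then show ?thesis using assms(2)[of 0] assms(5) 1 by (simp add: zero_power)
  qed (use assms(4) 1 in auto)
qed

lemma weight_hw:
  assumes "0 < s" "2 * s \<le> real a" shows "weight a (hw s)"
proof (rule weightI)
  show "a > 0" using assms by (cases a) auto
  fix x y :: real
  show "0 \<le> x \<Longrightarrow> x \<le> y \<Longrightarrow> hw s x \<le> hw s y" using assms by (auto simp: hw_def intro!: powr_mono2)
  assume xy: "0 < x" "x \<le> y"
  then have y: "0 < y" by simp
  have "x powr (a - 2 * s) \<le> y powr (a - 2 * s)" using xy assms by (intro powr_mono2) auto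
  then have "(x powr (2 * s) * y powr (2 * s)) * x powr (a - 2 * s) \<le> (x powr (2 * s) * y powr (2 * s)) * y powr (a - 2 * s)"
    by (intro mult_left_mono) auto
  moreover have "x powr (2 * s) * x powr (a - 2 * s) = x ^ a" "y powr (2 * s) * y powr (a - 2 * s) = y ^ a"
    using xy y by (simp_all add: powr_add[symmetric] powr_realpow)
  ultimately have "y powr (2 * s) * x ^ a \<le> x powr (2 * s) * y ^ a" by (metis mult.assoc mult.commute)
  moreover have "x ^ a \<le> y ^ a" using xy by (intro power_mono) auto
  ultimately show "hw s y * x ^ a \<le> hw s x * y ^ a" using xy y by (simp add: hw_def distrib_right)
qed auto

lemma weight_one: "weight a (\<lambda>_. 1)"
  unfolding weight_def by (auto intro!: power_mono)

lemma weight_mult: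
  assumes v: "weight a v" and w: "weight b w" shows "weight (a + b) (\<lambda>x. v x * w x)"
  unfolding weight_def
proof (intro conjI allI impI)
  have [measurable]: "v \<in> borel_measurable borel" "w \<in> borel_measurable borel" using v w by (auto simp: weight_def)
  show "(\<lambda>x. v x * w x) \<in> borel_measurable borel" by measurable
  show "0 \<le> x \<Longrightarrow> 0 \<le> v x * w x" for x using v w by (auto simp: weight_def)
  fix x y :: real assume xy: "0 \<le> x" "x \<le> y"
  have f: "0 \<le> v x" "0 \<le> w x" "0 \<le> v y" "0 \<le> w y" "v x \<le> v y" "w x \<le> w y" "v y * x ^ a \<le> v x * y ^ a" "w y * x ^ b \<le> w x * y ^ b"
    using v w xy by (auto simp: weight_def)
  show "v x * w x \<le> v y * w y" using f by (intro mult_mono) auto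
  have "(v y * x ^ a) * (w y * x ^ b) \<le> (v x * y ^ a) * (w x * y ^ b)" using f xy by (intro mult_mono f(7,8)) auto
  then show "v y * w y * x ^ (a + b) \<le> v x * w x * y ^ (a + b)" by (simp add: power_add mult_ac)
qed

text \<open>
  One above \<open>R\<close>, and pointwise small for large \<open>R\<close>: multiplied with a weight it measures the high-frequency
  tail, and being a weight itself it is compatible with the energy estimates, unlike a sharp cut-off.
\<close>

definition tailw :: "real \<Rightarrow> real \<Rightarrow> real" where "tailw R x = min 1 (x / R)"

lemma weight_tailw: assumes R: "R > 0" shows "weight 1 (tailw R)"
proof (rule weightI)
  show "tailw R \<in> borel_measurable borel" unfolding tailw_def[abs_def] by measurable
  fix x y :: real
  show "0 \<le> x \<Longrightarrow> 0 \<le> tailw R x" using R by (simp add: tailw_def)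
  show "0 \<le> x \<Longrightarrow> x \<le> y \<Longrightarrow> tailw R x \<le> tailw R y" unfolding tailw_def using R by (intro min.mono divide_right_mono) auto
  assume xy: "0 < x" "x \<le> y"
  show "tailw R y * x ^ 1 \<le> tailw R x * y ^ 1"
  proof (cases "x \<le> R")
    case True
    then have "tailw R x * y = x / R * y" using R by (simp add: tailw_def min_def)
    moreover have "tailw R y * x \<le> y / R * x" unfolding tailw_def using xy by (intro mult_right_mono) auto
    ultimately show ?thesis by (simp add: mult.commute)
  next
    case False
    then have "tailw R x = 1" using R by (simp add: tailw_def)
    moreover have "tailw R y * x \<le> 1 * x" unfolding tailw_def using xy by (intro mult_right_mono) auto
    then have "tailw R y * x \<le> y" using xy by linarith
    ultimately show ?thesis by simp
  qed
qed simp

text \<open>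
  Membership in \<open>H\<^sup>s\<close> and its norm, for functions of the frequency.
\<close>

definition inH :: "real \<Rightarrow> (real \<Rightarrow> complex) \<Rightarrow> bool" where "inH s u \<longleftrightarrow> u \<in> L2 \<and> wn (hw s) u \<in> L2"
definition Hn :: "real \<Rightarrow> (real \<Rightarrow> complex) \<Rightarrow> real" where "Hn s u = nL2 (wn (hw s) u)"

lemma wn_measurable [measurable]:
  assumes [measurable]: "w \<in> borel_measurable borel" "u \<in> borel_measurable borel" shows "wn w u \<in> borel_measurable borel"
  unfolding wn_def[abs_def] by measurable

lemma wn_add: "wn w (\<lambda>x. u x + v x) = (\<lambda>x. wn w u x + wn w v x)" by (auto simp: wn_def algebra_simps)
lemma wn_diff: "wn w (\<lambda>x. u x - v x) = (\<lambda>x. wn w u x - wn w v x)" by (auto simp: wn_def algebra_simps)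
lemma wn_cmult: "wn w (\<lambda>x. c * u x) = (\<lambda>x. c * wn w u x)" by (auto simp: wn_def)

lemma Hn_nonneg [simp]: "0 \<le> Hn s u" by (simp add: Hn_def)
lemma inH_L2: "inH s u \<Longrightarrow> u \<in> L2" by (simp add: inH_def)
lemma inH_add: "inH s u \<Longrightarrow> inH s v \<Longrightarrow> inH s (\<lambda>x. u x + v x)" by (auto simp: inH_def wn_add intro!: L2_add)
lemma inH_diff: "inH s u \<Longrightarrow> inH s v \<Longrightarrow> inH s (\<lambda>x. u x - v x)" by (auto simp: inH_def wn_diff intro!: L2_diff)
lemma inH_cmult: "inH s u \<Longrightarrow> inH s (\<lambda>x. c * u x)" by (auto simp: inH_def wn_cmult intro!: L2_cmult)
lemma Hn_add: "inH s u \<Longrightarrow> inH s v \<Longrightarrow> Hn s (\<lambda>x. u x + v x) \<le> Hn s u + Hn s v"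
  unfolding Hn_def wn_add by (auto simp: inH_def intro!: nL2_triangle)
lemma Hn_cmult: "Hn s (\<lambda>x. c * u x) = cmod c * Hn s u" unfolding Hn_def wn_cmult nL2_cmult ..

text \<open>
  The constant is squared because \<open>wn\<close> involves the square root of the weight.
\<close>

lemma wn_mono:
  assumes v: "wn v u \<in> L2" and u: "u \<in> borel_measurable borel" and w: "w \<in> borel_measurable borel"
    and le: "\<And>x. 0 \<le> x \<Longrightarrow> 0 \<le> w x \<and> w x \<le> c\<^sup>2 * v x" and c: "0 \<le> c"
  shows "wn w u \<in> L2" "nL2 (wn w u) \<le> c * nL2 (wn v u)"
proof -
  note [measurable] = u w
  have b: "cmod (wn w u x) \<le> c * cmod (wn v u x)" for x
  proof -
    have "sqrt (w \<bar>x\<bar>) \<le> sqrt (c\<^sup>2 * v \<bar>x\<bar>)" using le[of "\<bar>x\<bar>"] by simp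
    also have "\<dots> = c * sqrt (v \<bar>x\<bar>)" using c by (simp add: real_sqrt_mult)
    finally have "\<bar>sqrt (w \<bar>x\<bar>)\<bar> * cmod (u x) \<le> c * \<bar>sqrt (v \<bar>x\<bar>)\<bar> * cmod (u x)"
      using le[of "\<bar>x\<bar>"] c by (intro mult_right_mono) (auto intro: order_trans[OF _ mult_left_mono[OF abs_ge_self]])
    then show ?thesis by (simp add: wn_def norm_mult mult.assoc)
  qed
  show "wn w u \<in> L2" by (rule L2_bound[OF v _ b]) measurable
  have "nL2 (wn w u) \<le> nL2 (\<lambda>x. complex_of_real c * wn v u x)"
    by (rule nL2_mono[OF L2_cmult[OF v]]) (use b c in \<open>auto simp: norm_mult\<close>)
  then show "nL2 (wn w u) \<le> c * nL2 (wn v u)" using c by (simp add: nL2_cmult)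
qed

lemma wn_one: "wn (\<lambda>_. 1) u = u" by (simp add: wn_def fun_eq_iff)

lemma nL2_le_Hn: assumes "inH s u" shows "nL2 u \<le> Hn s u"
  using wn_mono(2)[of "hw s" u "\<lambda>_. 1" 1] assms hw_ge1 L2_measurable[of u]
  by (auto simp: inH_def Hn_def wn_one)

lemma powr_le_hw:
  assumes "0 \<le> t" "t \<le> s" shows "\<bar>x\<bar> powr (2 * t) \<le> hw s x"
proof (cases "\<bar>x\<bar> \<le> 1")
  case True
  have "\<bar>x\<bar> powr (2 * t) \<le> 1 powr (2 * t)" using True assms by (intro powr_mono2) auto
  then show ?thesis using hw_ge1[of s x] by simp
next
  case False
  then have "\<bar>x\<bar> powr (2 * t) \<le> \<bar>x\<bar> powr (2 * s)" using assms by (intro powr_mono) auto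
  then show ?thesis by (simp add: hw_def)
qed

lemma hw_mono: assumes "0 \<le> t" "t \<le> s" shows "hw t x \<le> 2 * hw s x"
proof -
  have aux: "1 + a \<le> 2 * (1 + X)" if "a \<le> 1 + X" "0 \<le> X" for a X :: real using that by simp
  show ?thesis using aux[OF powr_le_hw[OF assms, of x, unfolded hw_def] powr_ge_zero] unfolding hw_def .
qed

lemma pow4_le_hw: assumes "2 \<le> s" shows "\<bar>x\<bar> ^ 4 \<le> hw s x" "\<bar>x\<bar> ^ 2 \<le> hw s x"
proof -
  have "\<bar>x\<bar> powr (2 * 2) = \<bar>x\<bar> ^ 4" "\<bar>x\<bar> powr (2 * 1) = \<bar>x\<bar> ^ 2" by (cases "x = 0"; simp add: powr_numeral)+
  then show "\<bar>x\<bar> ^ 4 \<le> hw s x" "\<bar>x\<bar> ^ 2 \<le> hw s x" using powr_le_hw[of 2 s x] powr_le_hw[of 1 s x] assms by simp_all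
qed

lemma integrable_powr_tail:
  assumes e: "e < -1" shows "integrable lborel (\<lambda>x::real. x powr e * indicator {1..} x)"
proof (rule integrableI_bounded)
  have "(\<integral>\<^sup>+x. ennreal (x powr e) * indicator {1..} x \<partial>lborel) = ennreal (0 - 1 powr (e + 1) / (e + 1))"
  proof (rule nn_integral_FTC_atLeast[where F="\<lambda>x. x powr (e + 1) / (e + 1)" and T=0 and a=1])
    show "((\<lambda>x. x powr (e + 1) / (e + 1)) \<longlongrightarrow> 0) at_top"
      using tendsto_divide[OF tendsto_neg_powr[OF _ filterlim_ident] tendsto_const, of "e + 1" "e + 1"] e by simp
    show "DERIV (\<lambda>x. x powr (e + 1) / (e + 1)) x :> x powr e" if "1 \<le> x" for x
      using that e by (auto intro!: derivative_eq_intros)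
  qed auto
  moreover have "(\<integral>\<^sup>+x. ennreal (norm (x powr e * indicator {1..} x)) \<partial>lborel) = (\<integral>\<^sup>+x. ennreal (x powr e) * indicator {1..} (x::real) \<partial>lborel)"
    by (intro nn_integral_cong) (auto simp: indicator_def)
  ultimately show "(\<integral>\<^sup>+x. ennreal (norm (x powr e * indicator {1..} (x::real))) \<partial>lborel) < \<infinity>" by simp
qed measurable

text \<open>
  The density for which Cauchy-Schwarz bounds \<open>(1 + |k|\<^bsup>3/2\<^esup>) |u k|\<close> in \<open>L\<^sup>1\<close> by the \<open>H\<^sup>s\<close> norm of \<open>u\<close>.
\<close>

definition gJ :: "real \<Rightarrow> real \<Rightarrow> complex" where "gJ s x = complex_of_real ((1 + \<bar>x\<bar> * sqrt \<bar>x\<bar>) / sqrt (hw s x))"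

text \<open>
  The square decays like \<open>|x|\<^bsup>3-2s\<^esup>\<close>, which is integrable exactly for \<open>s > 2\<close>.
\<close>

lemma gJ_L2: assumes s: "s > 2" shows "gJ s \<in> L2"
proof (rule L2_I)
  show "gJ s \<in> borel_measurable borel" unfolding gJ_def[abs_def] by measurable
  let ?t = "\<lambda>x::real. x powr (3 - 2 * s) * indicator {1..} x"
  have t: "integrable lborel ?t" using s by (intro integrable_powr_tail) simp
  have t': "integrable lborel (\<lambda>x. ?t (- x))" using lborel_integrable_real_affine[OF t, of "-1" 0] by simp
  have ind: "integrable lborel (indicator {-1..1} :: real \<Rightarrow> real)"
    by (intro integrable_real_indicator) auto
  show "integrable lborel (\<lambda>x. (norm (gJ s x))\<^sup>2)"
  proof (rule Bochner_Integration.integrable_bound)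
    show "integrable lborel (\<lambda>x. 4 * indicator {-1..1} x + 4 * (?t x + ?t (- x)))"
      by (intro Bochner_Integration.integrable_add integrable_mult_right t t' ind)
    show "(\<lambda>x. (norm (gJ s x))\<^sup>2) \<in> borel_measurable lborel" unfolding gJ_def[abs_def] by measurable
    have "(norm (gJ s x))\<^sup>2 \<le> 4 * indicator {-1..1} x + 4 * (?t x + ?t (- x))" for x
    proof -
      have n: "(norm (gJ s x))\<^sup>2 = (1 + \<bar>x\<bar> * sqrt \<bar>x\<bar>)\<^sup>2 / hw s x"
        unfolding gJ_def norm_of_real power2_abs power_divide by simp
      show ?thesis
      proof (cases "\<bar>x\<bar> \<le> 1")
        case True
        have "\<bar>x\<bar> * sqrt \<bar>x\<bar> \<le> 1 * 1" using True by (intro mult_mono) auto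
        then have "(1 + \<bar>x\<bar> * sqrt \<bar>x\<bar>)\<^sup>2 \<le> 2\<^sup>2" by (intro power_mono) auto
        then have "(norm (gJ s x))\<^sup>2 \<le> 4 / 1" unfolding n using hw_ge1[of s x] by (intro frac_le) auto
        moreover have "x \<in> {-1..1}" using True by auto
        moreover have "0 \<le> 4 * (?t x + ?t (- x))" by simp
        ultimately show ?thesis by (simp del: mult_nonneg_nonneg add: add_increasing2)
      next
        case False
        then have x: "1 < \<bar>x\<bar>" by simp
        then have "1 * 1 \<le> \<bar>x\<bar> * sqrt \<bar>x\<bar>" by (intro mult_mono) auto
        then have "(1 + \<bar>x\<bar> * sqrt \<bar>x\<bar>)\<^sup>2 \<le> (2 * (\<bar>x\<bar> * sqrt \<bar>x\<bar>))\<^sup>2" by (intro power_mono) auto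
        also have "\<dots> = 4 * (\<bar>x\<bar>\<^sup>2 * (sqrt \<bar>x\<bar>)\<^sup>2)" by (simp only: power_mult_distrib) simp
        also have "\<dots> = 4 * \<bar>x\<bar> ^ 3"
          by (simp only: real_sqrt_pow2[OF abs_ge_zero]) (simp only: power2_eq_square power3_eq_cube mult.assoc)
        also have "\<bar>x\<bar> ^ 3 = \<bar>x\<bar> powr 3" using x by (simp add: powr_numeral)
        finally have "(norm (gJ s x))\<^sup>2 \<le> (4 * \<bar>x\<bar> powr 3) / \<bar>x\<bar> powr (2 * s)" unfolding n using x
          by (intro frac_le) (auto simp: hw_def)
        also have "\<dots> = 4 * \<bar>x\<bar> powr (3 - 2 * s)" using x by (simp add: powr_diff)
        also have "\<bar>x\<bar> powr (3 - 2 * s) \<le> ?t x + ?t (- x)" using x by (cases "0 \<le> x") (auto simp: indicator_def)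
        finally show ?thesis using x by (simp add: indicator_def)
      qed
    qed
    then show "AE x in lborel. norm ((norm (gJ s x))\<^sup>2) \<le> norm (4 * indicator {-1..1} x + 4 * (?t x + ?t (- x)))"
      by (auto intro!: AE_I2 order_trans[OF _ abs_ge_self])
  qed
qed

text \<open>
  One is added to make the constant positive.
\<close>

definition cJ :: "real \<Rightarrow> real" where "cJ s = nL2 (gJ s) + 1"
lemma cJ_pos: "cJ s > 0" "cJ s \<ge> 1" unfolding cJ_def using nL2_nonneg[of "gJ s"] by linarith+

lemma H_L1:
  assumes s: "s > 2" and u: "inH s u"
  shows "integrable lborel (\<lambda>p. (1 + \<bar>p\<bar> * sqrt \<bar>p\<bar>) * cmod (u p))"
    "(LINT p|lborel. (1 + \<bar>p\<bar> * sqrt \<bar>p\<bar>) * cmod (u p)) \<le> cJ s * Hn s u"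
proof -
  have w: "wn (hw s) u \<in> L2" using u by (simp add: inH_def)
  have e: "cmod (gJ s p) * cmod (wn (hw s) u p) = (1 + \<bar>p\<bar> * sqrt \<bar>p\<bar>) * cmod (u p)" for p
  proof -
    have "sqrt (hw s p) > 0" using hw_ge1[of s p] by simp
    then show ?thesis unfolding gJ_def wn_def norm_mult norm_of_real by simp
  qed
  show "integrable lborel (\<lambda>p. (1 + \<bar>p\<bar> * sqrt \<bar>p\<bar>) * cmod (u p))"
    using integrable_norm[OF L2_mult_integrable[OF gJ_L2[OF s] w]] unfolding norm_mult e .
  have "(LINT p|lborel. (1 + \<bar>p\<bar> * sqrt \<bar>p\<bar>) * cmod (u p)) \<le> nL2 (gJ s) * Hn s u"
    using L2_Cauchy_Schwarz_norm[OF gJ_L2[OF s] w] unfolding e Hn_def .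
  also have "\<dots> \<le> cJ s * Hn s u" unfolding cJ_def by (intro mult_right_mono) auto
  finally show "(LINT p|lborel. (1 + \<bar>p\<bar> * sqrt \<bar>p\<bar>) * cmod (u p)) \<le> cJ s * Hn s u" .
qed

lemma H_L1_dom:
  assumes s: "s > 2" and u: "inH s u" and m[measurable]: "m \<in> borel_measurable borel" and le: "\<And>p. 0 \<le> m p \<and> m p \<le> 1 + \<bar>p\<bar> * sqrt \<bar>p\<bar>"
  shows "integrable lborel (\<lambda>p. m p * cmod (u p))" "(LINT p|lborel. m p * cmod (u p)) \<le> cJ s * Hn s u"
proof -
  note [measurable] = L2_measurable[OF inH_L2[OF u]]
  have b: "m p * cmod (u p) \<le> (1 + \<bar>p\<bar> * sqrt \<bar>p\<bar>) * cmod (u p)" for p using le by (intro mult_right_mono) auto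
  show i: "integrable lborel (\<lambda>p. m p * cmod (u p))"
  proof (rule Bochner_Integration.integrable_bound[OF H_L1(1)[OF s u]])
    show "(\<lambda>p. m p * cmod (u p)) \<in> borel_measurable lborel" by measurable
    show "AE p in lborel. norm (m p * cmod (u p)) \<le> norm ((1 + \<bar>p\<bar> * sqrt \<bar>p\<bar>) * cmod (u p))"
      using b le by (intro AE_I2) (simp add: abs_mult)
  qed
  show "(LINT p|lborel. m p * cmod (u p)) \<le> cJ s * Hn s u"
    by (rule order_trans[OF integral_mono[OF i H_L1(1)[OF s u] b] H_L1(2)[OF s u]])
qed

lemma sqrt_le_L1w: "sqrt \<bar>p\<bar> \<le> 1 + \<bar>p\<bar> * sqrt \<bar>p\<bar>"
proof (cases "\<bar>p\<bar> \<le> 1")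
  case True then have "sqrt \<bar>p\<bar> \<le> 1" by simp
  moreover have "0 \<le> \<bar>p\<bar> * sqrt \<bar>p\<bar>" by simp
  ultimately show ?thesis by linarith
next
  case False
  then have "1 * sqrt \<bar>p\<bar> \<le> \<bar>p\<bar> * sqrt \<bar>p\<bar>" by (intro mult_right_mono) auto
  then show ?thesis by linarith
qed

lemma H_half:
  assumes s: "s > 2" and u: "inH s u"
  shows "integrable lborel (\<lambda>p. sqrt \<bar>p\<bar> * cmod (u p))" "(LINT p|lborel. sqrt \<bar>p\<bar> * cmod (u p)) \<le> cJ s * Hn s u"
  by (rule H_L1_dom[OF s u]; use sqrt_le_L1w in simp)+

lemma H_Am:
  assumes s: "s > 2" and u: "inH s u"
  shows "integrable lborel (\<lambda>p. \<bar>p\<bar> * sqrt \<bar>p\<bar> * cmod (u p))" "Am u \<le> cJ s * Hn s u"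
  unfolding Am_def by (rule H_L1_dom[OF s u]; simp)+

lemma Am_nonneg: "0 \<le> Am u" unfolding Am_def by (auto intro!: integral_nonneg_AE)

text \<open>
  \<open>H_Am\<close> is applied to the dilated function \<open>v k = u(\<rho> k)\<close>. With \<open>\<rho>\<^sup>s = \<beta>/\<alpha>\<close> the two parts of the
  \<open>H\<^sup>s\<close> norm of \<open>v\<close> are balanced, and undoing the dilation produces the exponents. Bounds \<open>\<alpha>\<close>, \<open>\<beta>\<close>
  replace the norms themselves so that no case distinction for \<open>u = 0\<close> is needed.
\<close>

lemma Am_interpolation:
  assumes s: "s > 2" and u: "inH s u" and \<alpha>: "0 < \<alpha>" "nL2 u \<le> \<alpha>" and \<beta>: "0 < \<beta>" "Hn s u \<le> \<beta>"
  shows "Am u \<le> cJ s * sqrt 2 * (\<alpha> powr (1 - 2/s) * \<beta> powr (2/s))"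
proof -
  (* This dilation makes the bounds for the two parts of the Sobolev norm of v equal. *)
  define \<rho> where "\<rho> = (\<beta> / \<alpha>) powr (1/s)"
  have \<rho>: "\<rho> > 0" using \<alpha> \<beta> by (simp add: \<rho>_def)
  have \<rho>2: "\<rho> powr 2 = (\<beta> / \<alpha>) powr (2/s)" unfolding \<rho>_def using s by (simp add: powr_powr)
  have \<rho>s: "\<rho> powr (2 * s) = (\<beta> / \<alpha>)\<^sup>2" unfolding \<rho>_def using s \<alpha> \<beta> by (simp add: powr_powr powr_numeral)
  have u2: "u \<in> L2" and wu: "wn (hw s) u \<in> L2" using u by (auto simp: inH_def)
  note [measurable] = L2_measurable[OF u2]
  define v where "v k = u (\<rho> * k)" for k
  have [measurable]: "v \<in> borel_measurable borel" unfolding v_def[abs_def] by measurable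
  have v2: "v \<in> L2" using L2_affine[OF u2, of \<rho> 0] \<rho> unfolding v_def[abs_def] by simp
  define c where "c = max 1 (1 / \<rho> powr s)"
  have c1: "1 \<le> c" "1 / \<rho> powr s \<le> c" by (auto simp: c_def)
  have nv: "(nL2 v)\<^sup>2 = (nL2 u)\<^sup>2 / \<rho>"
    unfolding nL2_sq v_def using lborel_integral_real_affine[of \<rho> "\<lambda>x. (cmod (u x))\<^sup>2" 0] \<rho> by (simp add: field_simps)
  have iw: "integrable lborel (\<lambda>k. hw s k * (cmod (u k))\<^sup>2)"
    using L2_integrable[OF wu] by (simp add: wn_def norm_mult power_mult_distrib)
  have Hu: "(Hn s u)\<^sup>2 = (LINT k|lborel. hw s k * (cmod (u k))\<^sup>2)"
    unfolding Hn_def nL2_sq by (simp add: wn_def norm_mult power_mult_distrib)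
  have pt: "hw s k * (cmod (v k))\<^sup>2 \<le> (cmod (u (0 + \<rho> * k)))\<^sup>2 + 1 / \<rho> powr (2 * s) * (hw s (0 + \<rho> * k) * (cmod (u (0 + \<rho> * k)))\<^sup>2)" for k
  proof -
    have "\<bar>\<rho> * k\<bar> powr (2 * s) = \<rho> powr (2 * s) * \<bar>k\<bar> powr (2 * s)" using \<rho> by (simp add: abs_mult powr_mult)
    then have "hw s k \<le> 1 + 1 / \<rho> powr (2 * s) * hw s (\<rho> * k)" using \<rho> by (simp add: hw_def field_simps)
    from mult_right_mono[OF this, of "(cmod (v k))\<^sup>2"] show ?thesis by (simp add: v_def distrib_right mult.assoc)
  qed
  have i1: "integrable lborel (\<lambda>k. (cmod (u (0 + \<rho> * k)))\<^sup>2)"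
    by (rule lborel_integrable_real_affine[OF L2_integrable[OF u2]]) (use \<rho> in auto)
  have i2: "integrable lborel (\<lambda>k. hw s (0 + \<rho> * k) * (cmod (u (0 + \<rho> * k)))\<^sup>2)"
    using lborel_integrable_real_affine[OF iw, of \<rho> 0] \<rho> by simp
  have i3: "integrable lborel (\<lambda>k. (cmod (u (0 + \<rho> * k)))\<^sup>2 + 1 / \<rho> powr (2 * s) * (hw s (0 + \<rho> * k) * (cmod (u (0 + \<rho> * k)))\<^sup>2))"
    by (intro Bochner_Integration.integrable_add integrable_mult_right i1 i2)
  have iv: "integrable lborel (\<lambda>k. hw s k * (cmod (v k))\<^sup>2)"
  proof (rule Bochner_Integration.integrable_bound[OF i3])
    show "(\<lambda>k. hw s k * (cmod (v k))\<^sup>2) \<in> borel_measurable lborel" by measurable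
    show "AE k in lborel. norm (hw s k * (cmod (v k))\<^sup>2) \<le> norm ((cmod (u (0 + \<rho> * k)))\<^sup>2 + 1 / \<rho> powr (2 * s) * (hw s (0 + \<rho> * k) * (cmod (u (0 + \<rho> * k)))\<^sup>2))"
      using pt by (intro AE_I2) (auto simp: abs_mult intro: order_trans[OF _ abs_ge_self])
  qed
  have vH: "inH s v"
    unfolding inH_def
  proof (intro conjI v2 L2_I)
    show "integrable lborel (\<lambda>k. (norm (wn (hw s) v k))\<^sup>2)" using iv by (simp add: wn_def norm_mult power_mult_distrib)
  qed measurable
  have "(Hn s v)\<^sup>2 = (LINT k|lborel. hw s k * (cmod (v k))\<^sup>2)"
    unfolding Hn_def nL2_sq by (simp add: wn_def norm_mult power_mult_distrib)
  also have "\<dots> \<le> (LINT k|lborel. (cmod (u (0 + \<rho> * k)))\<^sup>2 + 1 / \<rho> powr (2 * s) * (hw s (0 + \<rho> * k) * (cmod (u (0 + \<rho> * k)))\<^sup>2))"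
    by (rule integral_mono[OF iv i3 pt])
  also have "\<dots> = (LINT k|lborel. (cmod (u (0 + \<rho> * k)))\<^sup>2) + 1 / \<rho> powr (2 * s) * (LINT k|lborel. hw s (0 + \<rho> * k) * (cmod (u (0 + \<rho> * k)))\<^sup>2)"
    using i1 i2 by simp
  also have "(LINT k|lborel. (cmod (u (0 + \<rho> * k)))\<^sup>2) = (nL2 u)\<^sup>2 / \<rho>" using nv unfolding nL2_sq v_def by simp
  also have "(LINT k|lborel. hw s (0 + \<rho> * k) * (cmod (u (0 + \<rho> * k)))\<^sup>2) = (Hn s u)\<^sup>2 / \<rho>"
    unfolding Hu using lborel_integral_real_affine[of \<rho> "\<lambda>k. hw s k * (cmod (u k))\<^sup>2" 0] \<rho> by (simp add: field_simps)
  also have "(nL2 u)\<^sup>2 / \<rho> + 1 / \<rho> powr (2 * s) * ((Hn s u)\<^sup>2 / \<rho>) \<le> \<alpha>\<^sup>2 / \<rho> + 1 / \<rho> powr (2 * s) * (\<beta>\<^sup>2 / \<rho>)"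
    using \<alpha> \<beta> \<rho> by (intro add_mono mult_left_mono divide_right_mono power_mono) auto
  also have "\<dots> = 2 * \<alpha>\<^sup>2 / \<rho>" unfolding \<rho>s using \<alpha> \<beta> \<rho> by (simp add: field_simps)
  finally have "Hn s v \<le> sqrt (2 * \<alpha>\<^sup>2 / \<rho>)" by (rule real_le_rsqrt)
  also have "\<dots> = sqrt 2 * \<alpha> / sqrt \<rho>" using \<alpha> by (simp add: real_sqrt_mult real_sqrt_divide)
  finally have Hv: "Hn s v \<le> sqrt 2 * \<alpha> / sqrt \<rho>" .
  have sq: "\<rho> * sqrt \<rho> * \<rho> / sqrt \<rho> = \<rho> powr 2" using \<rho> by (simp add: powr_numeral power2_eq_square)
  have "Am u = \<rho> * (LINT p|lborel. \<bar>\<rho> * p\<bar> * sqrt \<bar>\<rho> * p\<bar> * cmod (u (\<rho> * p)))"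
    unfolding Am_def using lborel_integral_real_affine[of \<rho> "\<lambda>p. \<bar>p\<bar> * sqrt \<bar>p\<bar> * cmod (u p)" 0] \<rho> by simp
  also have "(LINT p|lborel. \<bar>\<rho> * p\<bar> * sqrt \<bar>\<rho> * p\<bar> * cmod (u (\<rho> * p))) = (LINT p|lborel. (\<rho> * sqrt \<rho>) * (\<bar>p\<bar> * sqrt \<bar>p\<bar> * cmod (v p)))"
    using \<rho> by (intro Bochner_Integration.integral_cong) (auto simp: v_def abs_mult real_sqrt_mult)
  also have "\<dots> = \<rho> * sqrt \<rho> * Am v" unfolding Am_def by simp
  also have "\<rho> * (\<rho> * sqrt \<rho> * Am v) \<le> \<rho> * (\<rho> * sqrt \<rho> * (cJ s * (sqrt 2 * \<alpha> / sqrt \<rho>)))"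
    using \<rho> cJ_pos[of s] by (intro mult_left_mono order_trans[OF H_Am(2)[OF s vH] mult_left_mono[OF Hv]]) auto
  also have "\<dots> = cJ s * sqrt 2 * (\<rho> powr 2 * \<alpha>)" unfolding sq[symmetric] by (simp add: mult_ac)
  also have "\<rho> powr 2 * \<alpha> = \<alpha> powr (1 - 2/s) * \<beta> powr (2/s)"
  proof -
    have "\<rho> powr 2 * \<alpha> = \<beta> powr (2/s) / \<alpha> powr (2/s) * \<alpha> powr 1" unfolding \<rho>2 using \<alpha> \<beta> by (simp add: powr_divide)
    also have "\<dots> = \<beta> powr (2/s) * (\<alpha> powr 1 / \<alpha> powr (2/s))" by simp
    also have "\<alpha> powr 1 / \<alpha> powr (2/s) = \<alpha> powr (1 - 2/s)" by (rule powr_diff[symmetric])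
    finally show ?thesis by (simp add: mult.commute)
  qed
  finally show ?thesis .
qed

section \<open>Sobolev bounds for the nonlinearity\<close>

definition mH :: "real \<Rightarrow> real \<Rightarrow> real" where "mH s x = sqrt (hw s x)"

lemma wn_mH: "wn (hw s) u = (\<lambda>k. complex_of_real (mH s k) * u k)" by (auto simp: wn_def mH_def)

lemma bilinear_H:
  assumes s: "s > 2" and u: "inH s u" and v: "inH s v"
    and km: "(\<lambda>z. \<kappa> (fst z) (snd z)) \<in> borel_measurable LL"
    and kb: "\<And>k l. \<bar>\<kappa> k l\<bar> \<le> C * (mH s (k - l) * sqrt \<bar>l\<bar> + sqrt \<bar>k - l\<bar> * mH s l)" and C: "0 \<le> C"
  shows "(\<lambda>k. LINT l|lborel. complex_of_real (\<kappa> k l) * u (k - l) * v l) \<in> L2"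
    "nL2 (\<lambda>k. LINT l|lborel. complex_of_real (\<kappa> k l) * u (k - l) * v l) \<le> 4 * C * cJ s * (Hn s u * Hn s v)"
proof -
  have u': "(\<lambda>k. complex_of_real (mH s k) * u k) \<in> L2" and v': "(\<lambda>k. complex_of_real (mH s k) * v k) \<in> L2"
    using u v unfolding inH_def wn_mH by auto
  have m0: "0 \<le> mH s x" for x by (simp add: mH_def)
  note b = bilinear_L2[OF km kb C m0 u' v' L2_measurable[OF inH_L2[OF u]] L2_measurable[OF inH_L2[OF v]] H_half(1)[OF s u] H_half(1)[OF s v]]
  show "(\<lambda>k. LINT l|lborel. complex_of_real (\<kappa> k l) * u (k - l) * v l) \<in> L2" by (rule b(1))
  have "nL2 (\<lambda>k. LINT l|lborel. complex_of_real (\<kappa> k l) * u (k - l) * v l) \<le> 2 * C * (Hn s u * (LINT p|lborel. sqrt \<bar>p\<bar> * cmod (v p)) + (LINT p|lborel. sqrt \<bar>p\<bar> * cmod (u p)) * Hn s v)"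
    using b(2) unfolding Hn_def wn_mH .
  also have "\<dots> \<le> 2 * C * (Hn s u * (cJ s * Hn s v) + (cJ s * Hn s u) * Hn s v)"
    using C by (intro mult_left_mono add_mono mult_right_mono H_half(2)[OF s u] H_half(2)[OF s v]) auto
  also have "\<dots> = 4 * C * cJ s * (Hn s u * Hn s v)" by (simp add: algebra_simps)
  finally show "nL2 (\<lambda>k. LINT l|lborel. complex_of_real (\<kappa> k l) * u (k - l) * v l) \<le> 4 * C * cJ s * (Hn s u * Hn s v)" .
qed

lemma abs_le_twice_max:
  fixes k l :: real
  shows "\<bar>l\<bar> \<le> \<bar>k - l\<bar> \<Longrightarrow> \<bar>k\<bar> \<le> 2 * \<bar>k - l\<bar>" "\<bar>k - l\<bar> \<le> \<bar>l\<bar> \<Longrightarrow> \<bar>k\<bar> \<le> 2 * \<bar>l\<bar>"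
  using abs_triangle_ineq[of "k - l" l] by simp_all

text \<open>
  The larger of the two input frequencies carries the weight, the smaller one the square root from
  the kernel.
\<close>

lemma kernel_split:
  assumes SPn: "0 \<le> \<sigma>" "\<sigma> \<le> sqrt \<bar>p\<bar>" "\<sigma> \<le> sqrt \<bar>q\<bar>" and g: "0 \<le> g" "0 \<le> C"
    and gp: "\<bar>q\<bar> \<le> \<bar>p\<bar> \<Longrightarrow> g \<le> C * mH s p" and gq: "\<bar>p\<bar> \<le> \<bar>q\<bar> \<Longrightarrow> g \<le> C * mH s q"
  shows "g * \<sigma> \<le> C * (mH s p * sqrt \<bar>q\<bar> + sqrt \<bar>p\<bar> * mH s q)"
proof -
  have m0: "0 \<le> mH s x" for x by (simp add: mH_def)
  have n: "0 \<le> C * (mH s p * sqrt \<bar>q\<bar>)" "0 \<le> C * (sqrt \<bar>p\<bar> * mH s q)" using m0 g by auto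
  show ?thesis
  proof (cases "\<bar>q\<bar> \<le> \<bar>p\<bar>")
    case True
    have "g * \<sigma> \<le> (C * mH s p) * sqrt \<bar>q\<bar>" using gp[OF True] SPn g m0 by (intro mult_mono) auto
    then show ?thesis using n by (simp add: distrib_left mult.assoc)
  next
    case False
    have "g * \<sigma> \<le> (C * mH s q) * sqrt \<bar>p\<bar>" using gq False SPn g m0 by (intro mult_mono) auto
    then show ?thesis using n by (simp add: distrib_left mult_ac)
  qed
qed

definition cF :: "real \<Rightarrow> real" where "cF s = 4 * sqrt (2 * 2 powr (2 * s)) * cJ s"
lemma cF_nonneg: "0 \<le> cF s" unfolding cF_def using cJ_pos[of s] by simp

text \<open>
  One derivative is lost: \<open>k\<close> together with the weight of \<open>H\<^bsup>s-1\<^esup>\<close> amounts to the weight of \<open>H\<^sup>s\<close> at the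
  output frequency, which is at most twice the larger input frequency.
\<close>

lemma Q_H_bound:
  assumes s: "s > 2" and P: "symset P" and u: "inH s u" and v: "inH s v"
  shows "wn (hw (s - 1)) (\<lambda>k. complex_of_real k * Q P u v k) \<in> L2"
    "Hn (s - 1) (\<lambda>k. complex_of_real k * Q P u v k) \<le> cF s * (Hn s u * Hn s v)"
proof -
  define \<kappa> where "\<kappa> k l = sqrt (hw (s - 1) k) * k * SP P (k - l) l" for k l
  note [measurable] = SP_measurable[OF P]
  have e: "wn (hw (s - 1)) (\<lambda>k. complex_of_real k * Q P u v k) = (\<lambda>k. LINT l|lborel. complex_of_real (\<kappa> k l) * u (k - l) * v l)"
  proof
    fix k
    have "wn (hw (s - 1)) (\<lambda>k. complex_of_real k * Q P u v k) k = complex_of_real (sqrt (hw (s - 1) k) * k) * Q P u v k"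
      by (simp add: wn_def)
    also have "\<dots> = (LINT l|lborel. complex_of_real (sqrt (hw (s - 1) k) * k) * (complex_of_real (SP P (k - l) l) * u (k - l) * v l))"
      unfolding Q_def by (rule integral_mult_right_zero[symmetric])
    also have "\<dots> = (LINT l|lborel. complex_of_real (\<kappa> k l) * u (k - l) * v l)"
      by (intro Bochner_Integration.integral_cong) (auto simp: \<kappa>_def mult.assoc)
    finally show "wn (hw (s - 1)) (\<lambda>k. complex_of_real k * Q P u v k) k = (LINT l|lborel. complex_of_real (\<kappa> k l) * u (k - l) * v l)" .
  qed
  have km: "(\<lambda>z. \<kappa> (fst z) (snd z)) \<in> borel_measurable LL" unfolding \<kappa>_def by measurable
  define C where "C = sqrt (2 * 2 powr (2 * s))"
  have C: "0 \<le> C" by (simp add: C_def)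
  have g: "sqrt (hw (s - 1) k) * \<bar>k\<bar> \<le> C * mH s p" if "\<bar>k\<bar> \<le> 2 * \<bar>p\<bar>" for k p
  proof -
    have "\<bar>k\<bar> powr 2 * \<bar>k\<bar> powr (2 * (s - 1)) = \<bar>k\<bar> powr (2 * s)" by (subst powr_add[symmetric]) (simp add: algebra_simps)
    then have "hw (s - 1) k * k\<^sup>2 = k\<^sup>2 + \<bar>k\<bar> powr (2 * s)" by (simp add: hw_def algebra_simps powr_numeral)
    also have "\<dots> \<le> 2 * hw s k" using pow4_le_hw(2)[of s k] s by (simp add: hw_def)
    also have "hw s k \<le> 2 powr (2 * s) * hw s p"
    proof -
      have "\<bar>k\<bar> powr (2 * s) \<le> (2 * \<bar>p\<bar>) powr (2 * s)" using that s by (intro powr_mono2) auto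
      also have "\<dots> = 2 powr (2 * s) * \<bar>p\<bar> powr (2 * s)" by (simp add: powr_mult)
      finally show ?thesis using ge_one_powr_ge_zero[of 2 "2 * s"] s by (simp add: hw_def distrib_left)
    qed
    finally have "hw (s - 1) k * k\<^sup>2 \<le> (2 * 2 powr (2 * s)) * hw s p" by simp
    from real_sqrt_le_mono[OF this] show ?thesis unfolding C_def mH_def by (simp only: real_sqrt_mult real_sqrt_abs)
  qed
  have kb: "\<bar>\<kappa> k l\<bar> \<le> C * (mH s (k - l) * sqrt \<bar>l\<bar> + sqrt \<bar>k - l\<bar> * mH s l)" for k l
  proof -
    have "\<bar>\<kappa> k l\<bar> = (sqrt (hw (s - 1) k) * \<bar>k\<bar>) * SP P (k - l) l" unfolding \<kappa>_def using SP_nonneg[of P "k - l" l] by (simp add: abs_mult)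
    also have "\<dots> \<le> C * (mH s (k - l) * sqrt \<bar>l\<bar> + sqrt \<bar>k - l\<bar> * mH s l)"
    proof (rule kernel_split[OF SP_nonneg SP_le(1,2) _ C])
      show "sqrt (hw (s - 1) k) * \<bar>k\<bar> \<le> C * mH s (k - l)" if "\<bar>l\<bar> \<le> \<bar>k - l\<bar>" by (rule g[OF abs_le_twice_max(1)[OF that]])
      show "sqrt (hw (s - 1) k) * \<bar>k\<bar> \<le> C * mH s l" if "\<bar>k - l\<bar> \<le> \<bar>l\<bar>" by (rule g[OF abs_le_twice_max(2)[OF that]])
    qed simp
    finally show ?thesis .
  qed
  show "wn (hw (s - 1)) (\<lambda>k. complex_of_real k * Q P u v k) \<in> L2"
    unfolding e by (rule bilinear_H(1)[OF s u v km kb C])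
  have "Hn (s - 1) (\<lambda>k. complex_of_real k * Q P u v k) \<le> 4 * C * cJ s * (Hn s u * Hn s v)"
    unfolding Hn_def[of "s - 1"] e by (rule bilinear_H(2)[OF s u v km kb C])
  then show "Hn (s - 1) (\<lambda>k. complex_of_real k * Q P u v k) \<le> cF s * (Hn s u * Hn s v)" by (simp add: cF_def C_def)
qed

text \<open>
  If the truncation removes the interaction, the larger input frequency is at least \<open>N/2\<close>. There
  \<open>|k|\<close> is at most \<open>4/N\<close> times the square of that frequency, and two derivatives are available in \<open>H\<^sup>s\<close>.
\<close>

lemma Q_remainder:
  assumes s: "s > 2" and N: "N > 0" and u: "inH s u"
  shows "(\<lambda>k. complex_of_real k * (Q UNIV u u k - Q {-N..N} u u k)) \<in> L2"
    "nL2 (\<lambda>k. complex_of_real k * (Q UNIV u u k - Q {-N..N} u u k)) \<le> 16 * cJ s / N * (Hn s u)\<^sup>2"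
proof -
  define \<sigma> where "\<sigma> p q = SP UNIV p q - SP {-N..N} p q" for p q
  define \<kappa> where "\<kappa> k l = k * \<sigma> (k - l) l" for k l
  note [measurable] = SP_measurable[OF symset_UNIV] SP_measurable[OF symset_Icc]
  have u2: "u \<in> L2" using u by (rule inH_L2)
  have e: "complex_of_real k * (Q UNIV u u k - Q {-N..N} u u k) = (LINT l|lborel. complex_of_real (\<kappa> k l) * u (k - l) * u l)" for k
  proof -
    have "Q UNIV u u k - Q {-N..N} u u k = (LINT l|lborel. complex_of_real (SP UNIV (k - l) l) * u (k - l) * u l - complex_of_real (SP {-N..N} (k - l) l) * u (k - l) * u l)"
      unfolding Q_def by (rule Bochner_Integration.integral_diff[symmetric]; rule Q_integrable; simp add: symset_UNIV symset_Icc u2)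
    then have "complex_of_real k * (Q UNIV u u k - Q {-N..N} u u k) = (LINT l|lborel. complex_of_real k * (complex_of_real (SP UNIV (k - l) l) * u (k - l) * u l - complex_of_real (SP {-N..N} (k - l) l) * u (k - l) * u l))"
      by (simp only: integral_mult_right_zero)
    also have "\<dots> = (LINT l|lborel. complex_of_real (\<kappa> k l) * u (k - l) * u l)"
      by (intro Bochner_Integration.integral_cong) (auto simp: \<kappa>_def \<sigma>_def algebra_simps)
    finally show ?thesis .
  qed
  have km: "(\<lambda>z. \<kappa> (fst z) (snd z)) \<in> borel_measurable LL" unfolding \<kappa>_def \<sigma>_def by measurable
  have C: "0 \<le> 4 / N" using N by simp
  have \<sigma>0: "0 \<le> \<sigma> p q" "\<sigma> p q \<le> S p q" for p q by (auto simp: \<sigma>_def SP_def S_nonneg)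
  have kb: "\<bar>\<kappa> k l\<bar> \<le> 4 / N * (mH s (k - l) * sqrt \<bar>l\<bar> + sqrt \<bar>k - l\<bar> * mH s l)" for k l
  proof (cases "\<bar>k\<bar> \<le> N \<and> \<bar>k - l\<bar> \<le> N \<and> \<bar>l\<bar> \<le> N")
    case True
    then have "\<sigma> (k - l) l = 0" by (auto simp: \<sigma>_def SP_def abs_le_iff)
    then show ?thesis using C by (simp add: \<kappa>_def mH_def)
  next
    case False
    have g: "\<bar>k\<bar> \<le> 4 / N * mH s p" if "\<bar>k\<bar> \<le> 2 * \<bar>p\<bar>" "N \<le> 2 * \<bar>p\<bar>" for p
    proof -
      have "sqrt (\<bar>p\<bar> ^ 4) \<le> mH s p" unfolding mH_def using pow4_le_hw(1)[of s p] s by simp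
      moreover have "sqrt (\<bar>p\<bar> ^ 4) = \<bar>p\<bar> * \<bar>p\<bar>" by (rule real_sqrt_unique) (auto simp: power2_eq_square power4_eq_xxxx)
      ultimately have "\<bar>p\<bar> * \<bar>p\<bar> \<le> mH s p" by simp
      then have "4 / N * (\<bar>p\<bar> * \<bar>p\<bar>) \<le> 4 / N * mH s p" using C by (rule mult_left_mono)
      moreover have "\<bar>k\<bar> \<le> 4 / N * (\<bar>p\<bar> * \<bar>p\<bar>)"
      proof -
        have "\<bar>k\<bar> * N \<le> (2 * \<bar>p\<bar>) * (2 * \<bar>p\<bar>)" using that N by (intro mult_mono) auto
        then show ?thesis using N by (simp add: field_simps)
      qed
      ultimately show ?thesis by linarith
    qed
    have "\<bar>\<kappa> k l\<bar> = \<bar>k\<bar> * \<sigma> (k - l) l" unfolding \<kappa>_def using \<sigma>0(1)[of "k - l" l] by (simp add: abs_mult)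
    also have "\<dots> \<le> 4 / N * (mH s (k - l) * sqrt \<bar>l\<bar> + sqrt \<bar>k - l\<bar> * mH s l)"
    proof (rule kernel_split[OF \<sigma>0(1)])
      show "\<sigma> (k - l) l \<le> sqrt \<bar>k - l\<bar>" "\<sigma> (k - l) l \<le> sqrt \<bar>l\<bar>"
        using \<sigma>0(2)[of "k - l" l] S_le1[of "k - l" l] S_le2[of "k - l" l] by linarith+
      have F: "\<bar>k\<bar> > N \<or> \<bar>k - l\<bar> > N \<or> \<bar>l\<bar> > N" using False by auto
      have half: "N \<le> 2 * b" if "a \<le> 2 * b" "c \<le> b" "0 \<le> b" "N < a \<or> N < b \<or> N < c" for a b c :: real
        using that by auto
      show "\<bar>k\<bar> \<le> 4 / N * mH s (k - l)" if "\<bar>l\<bar> \<le> \<bar>k - l\<bar>"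
      proof (rule g)
        show "\<bar>k\<bar> \<le> 2 * \<bar>k - l\<bar>" by (rule abs_le_twice_max(1)[OF that])
        show "N \<le> 2 * \<bar>k - l\<bar>" using half[OF abs_le_twice_max(1)[OF that] that abs_ge_zero] F by blast
      qed
      show "\<bar>k\<bar> \<le> 4 / N * mH s l" if "\<bar>k - l\<bar> \<le> \<bar>l\<bar>"
      proof (rule g)
        show "\<bar>k\<bar> \<le> 2 * \<bar>l\<bar>" by (rule abs_le_twice_max(2)[OF that])
        show "N \<le> 2 * \<bar>l\<bar>" using half[OF abs_le_twice_max(2)[OF that] that abs_ge_zero] F by blast
      qed
    qed (use C in auto)
    finally show ?thesis .
  qed
  show "(\<lambda>k. complex_of_real k * (Q UNIV u u k - Q {-N..N} u u k)) \<in> L2"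
    unfolding e by (rule bilinear_H(1)[OF s u u km kb C])
  have "nL2 (\<lambda>k. complex_of_real k * (Q UNIV u u k - Q {-N..N} u u k)) \<le> 4 * (4 / N) * cJ s * (Hn s u * Hn s u)"
    unfolding e by (rule bilinear_H(2)[OF s u u km kb C])
  then show "nL2 (\<lambda>k. complex_of_real k * (Q UNIV u u k - Q {-N..N} u u k)) \<le> 16 * cJ s / N * (Hn s u)\<^sup>2"
    by (simp add: power2_eq_square)
qed

section \<open>The truncated Euler scheme\<close>

text \<open>
  The right-hand side of the equation; \<open>\<sigma> = 1\<close> is the equation itself and \<open>\<sigma> = -1\<close> the equation
  with time reversed.
\<close>

definition Fq :: "real \<Rightarrow> real set \<Rightarrow> (real \<Rightarrow> complex) \<Rightarrow> real \<Rightarrow> complex" where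
  "Fq \<sigma> P u k = complex_of_real \<sigma> * (- \<i>) * (complex_of_real k * Q P u u k)"

lemma Fq_measurable [measurable]:
  assumes P: "symset P" and [measurable]: "u \<in> borel_measurable borel" shows "Fq \<sigma> P u \<in> borel_measurable borel"
proof -
  note [measurable] = Q_measurable[OF P]
  show ?thesis unfolding Fq_def[abs_def] by measurable
qed

lemma Fq_herm: assumes "symset P" "herm u" shows "herm (Fq \<sigma> P u)"
  using Q_herm[OF assms(1,2,2)] unfolding herm_def Fq_def by simp

lemma inH_I: assumes "u \<in> borel_measurable borel" "wn (hw t) u \<in> L2" shows "inH t u"
  using assms wn_mono(1)[OF assms(2,1), of "\<lambda>_. 1" 1] hw_ge1 unfolding inH_def wn_one by auto

lemma Fq_H:
  assumes s: "s > 2" and P: "symset P" and u: "inH s u" and \<sigma>: "\<bar>\<sigma>\<bar> = 1"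
  shows "inH (s - 1) (Fq \<sigma> P u)" "Hn (s - 1) (Fq \<sigma> P u) \<le> cF s * (Hn s u)\<^sup>2"
proof -
  have e: "Fq \<sigma> P u = (\<lambda>k. (complex_of_real \<sigma> * (- \<i>)) * (complex_of_real k * Q P u u k))" by (simp add: Fq_def[abs_def])
  note [measurable] = Q_measurable[OF P] L2_measurable[OF inH_L2[OF u]]
  have "inH (s - 1) (\<lambda>k. complex_of_real k * Q P u u k)"
    by (rule inH_I[OF _ Q_H_bound(1)[OF s P u u]]) measurable
  then show "inH (s - 1) (Fq \<sigma> P u)" unfolding e by (rule inH_cmult)
  show "Hn (s - 1) (Fq \<sigma> P u) \<le> cF s * (Hn s u)\<^sup>2"
    using Q_H_bound(2)[OF s P u u] \<sigma> unfolding e Hn_cmult by (simp add: norm_mult power2_eq_square)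
qed

lemma Fq_diff:
  assumes P: "symset P" and u: "u \<in> L2" and v: "v \<in> L2"
  shows "Fq \<sigma> P u k - Fq \<sigma> P v k = (complex_of_real \<sigma> * (- \<i>)) * (complex_of_real k * Q P (\<lambda>x. u x + v x) (\<lambda>x. u x - v x) k)"
  unfolding Q_sq_diff[OF assms, symmetric] Fq_def by (simp add: algebra_simps)

lemma Fq_diff_H:
  assumes s: "s > 2" and P: "symset P" and u: "inH s u" and v: "inH s v" and \<sigma>: "\<bar>\<sigma>\<bar> = 1"
  shows "Hn (s - 1) (\<lambda>k. Fq \<sigma> P u k - Fq \<sigma> P v k) \<le> cF s * ((Hn s u + Hn s v) * Hn s (\<lambda>x. u x - v x))"
proof -
  have "Hn (s - 1) (\<lambda>k. Fq \<sigma> P u k - Fq \<sigma> P v k) = Hn (s - 1) (\<lambda>k. complex_of_real k * Q P (\<lambda>x. u x + v x) (\<lambda>x. u x - v x) k)"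
    unfolding Fq_diff[OF P inH_L2[OF u] inH_L2[OF v]] Hn_cmult using \<sigma> by (simp add: norm_mult)
  also have "\<dots> \<le> cF s * (Hn s (\<lambda>x. u x + v x) * Hn s (\<lambda>x. u x - v x))"
    by (rule Q_H_bound(2)[OF s P inH_add[OF u v] inH_diff[OF u v]])
  also have "\<dots> \<le> cF s * ((Hn s u + Hn s v) * Hn s (\<lambda>x. u x - v x))"
    using cF_nonneg by (intro mult_left_mono mult_right_mono Hn_add u v) auto
  finally show ?thesis .
qed

text \<open>
  At a fixed frequency the nonlinearity is continuous already in \<open>L\<^sup>2\<close>; this identifies the limit of the
  scheme frequency by frequency.
\<close>

lemma Fq_diff_pointwise:
  assumes P: "symset P" and u: "u \<in> L2" and v: "v \<in> L2" and \<sigma>: "\<bar>\<sigma>\<bar> = 1"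
  shows "cmod (Fq \<sigma> P u k - Fq \<sigma> P v k) \<le> \<bar>k\<bar> * sqrt \<bar>k\<bar> * ((nL2 u + nL2 v) * nL2 (\<lambda>x. u x - v x))"
proof -
  have "cmod (Fq \<sigma> P u k - Fq \<sigma> P v k) = \<bar>k\<bar> * cmod (Q P (\<lambda>x. u x + v x) (\<lambda>x. u x - v x) k)"
    unfolding Fq_diff[OF P u v] using \<sigma> by (simp add: norm_mult)
  also have "\<dots> \<le> \<bar>k\<bar> * (sqrt \<bar>k\<bar> * (nL2 (\<lambda>x. u x + v x) * nL2 (\<lambda>x. u x - v x)))"
    by (intro mult_left_mono Q_bound P L2_add L2_diff u v) simp
  also have "\<dots> \<le> \<bar>k\<bar> * (sqrt \<bar>k\<bar> * ((nL2 u + nL2 v) * nL2 (\<lambda>x. u x - v x)))"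
    by (intro mult_left_mono mult_right_mono nL2_triangle u v) auto
  finally show ?thesis by (simp add: mult.assoc)
qed

lemma nL2_bounded_support:
  assumes m: "f \<in> borel_measurable borel" and le: "\<And>x. cmod (f x) \<le> c" and z: "\<And>x. \<bar>x\<bar> > R \<Longrightarrow> f x = 0" and R: "0 \<le> R"
  shows "nL2 f \<le> sqrt (2 * R) * c"
proof -
  have f2: "f \<in> L2" by (rule L2_bounded_support[OF m le z])
  have c0: "0 \<le> c" using le[of 0] norm_ge_zero order_trans by blast
  have "(nL2 f)\<^sup>2 \<le> (LINT x|lborel. c\<^sup>2 * indicator {-R..R} x)"
    unfolding nL2_sq
  proof (rule integral_mono[OF L2_integrable[OF f2]])
    show "integrable lborel (\<lambda>x. c\<^sup>2 * indicator {-R..R} x)"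
      by (intro integrable_mult_right integrable_real_indicator) (auto simp: emeasure_lborel_Icc_eq)
    fix x
    show "(cmod (f x))\<^sup>2 \<le> c\<^sup>2 * indicator {-R..R} x"
      using z[of x] power_mono[OF le[of x], of 2] by (cases "\<bar>x\<bar> \<le> R") (auto simp: indicator_def)
  qed
  also have "\<dots> = c\<^sup>2 * (2 * R)" using R by simp
  finally have "nL2 f \<le> sqrt (c\<^sup>2 * (2 * R))" by (rule real_le_rsqrt)
  then show ?thesis using c0 by (simp add: real_sqrt_mult mult.commute)
qed

definition cN :: "real \<Rightarrow> real \<Rightarrow> real" where "cN s N = sqrt (2 * N) * (sqrt (hw s N) * (N * sqrt N))"

text \<open>
  The truncated nonlinearity maps \<open>L\<^sup>2\<close> into \<open>H\<^sup>s\<close>, with a constant that grows with \<open>N\<close>. It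
  measures the quadratic error of an Euler step, and is compensated by the choice of the step size.
\<close>

lemma Fq_trunc:
  assumes N: "0 \<le> N" and s: "s > 0" and u: "u \<in> L2" and \<sigma>: "\<bar>\<sigma>\<bar> = 1"
    and wm[measurable]: "w \<in> borel_measurable borel" and w: "\<And>x. 0 \<le> x \<Longrightarrow> 0 \<le> w x \<and> w x \<le> hw s x"
  shows "wn w (Fq \<sigma> {-N..N} u) \<in> L2" "nL2 (wn w (Fq \<sigma> {-N..N} u)) \<le> cN s N * (nL2 u)\<^sup>2"
proof -
  note [measurable] = L2_measurable[OF u] Fq_measurable[OF symset_Icc]
  have m: "wn w (Fq \<sigma> {-N..N} u) \<in> borel_measurable borel" by measurable
  have z: "wn w (Fq \<sigma> {-N..N} u) k = 0" if "\<bar>k\<bar> > N" for k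
  proof -
    have "SP {-N..N} (k - l) l = 0" for l using that by (auto simp: SP_def)
    then show ?thesis by (simp add: wn_def Fq_def Q_def)
  qed
  have b: "cmod (wn w (Fq \<sigma> {-N..N} u) k) \<le> sqrt (hw s N) * (N * sqrt N) * (nL2 u)\<^sup>2" for k
  proof (cases "\<bar>k\<bar> \<le> N")
    case True
    have "w \<bar>k\<bar> \<le> hw s N" using w[of "\<bar>k\<bar>"] True s by (auto simp: hw_def intro!: order_trans[OF conjunct2[OF w[of "\<bar>k\<bar>"]]] powr_mono2)
    then have 1: "sqrt (w \<bar>k\<bar>) \<le> sqrt (hw s N)" by simp
    have "cmod (Q {-N..N} u u k) \<le> sqrt \<bar>k\<bar> * (nL2 u * nL2 u)" by (rule Q_bound[OF symset_Icc u u])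
    also have "\<dots> \<le> sqrt N * (nL2 u * nL2 u)" using True by (intro mult_right_mono) auto
    finally have 2: "\<bar>k\<bar> * cmod (Q {-N..N} u u k) \<le> N * (sqrt N * (nL2 u * nL2 u))" using True by (intro mult_mono) auto
    have "sqrt (w \<bar>k\<bar>) * (\<bar>k\<bar> * cmod (Q {-N..N} u u k)) \<le> sqrt (hw s N) * (N * (sqrt N * (nL2 u * nL2 u)))"
      by (rule mult_mono[OF 1 2]) (use w[of "\<bar>k\<bar>"] in auto)
    then show ?thesis unfolding wn_def Fq_def using \<sigma> w[of "\<bar>k\<bar>"] by (simp add: norm_mult power2_eq_square mult_ac)
  qed (use z N in simp)
  show "wn w (Fq \<sigma> {-N..N} u) \<in> L2" by (rule L2_bounded_support[OF m b z])
  show "nL2 (wn w (Fq \<sigma> {-N..N} u)) \<le> cN s N * (nL2 u)\<^sup>2"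
    using nL2_bounded_support[OF m b z N] unfolding cN_def by (simp add: mult.assoc)
qed

lemma cN_nonneg: "0 \<le> N \<Longrightarrow> 0 \<le> cN s N" unfolding cN_def by simp

text \<open>
  The first-order term of the squared norm is the energy estimate, the second-order term the crude bound
  \<open>Fq_trunc\<close>.
\<close>

lemma step_energy:
  assumes N: "0 \<le> N" and s: "s > 2" and u: "inH s u" and hu: "herm u" and \<sigma>: "\<bar>\<sigma>\<bar> = 1" and h: "0 \<le> h"
    and w: "weight a w" and wle: "\<And>x. 0 \<le> x \<Longrightarrow> w x \<le> hw s x"
  defines "V \<equiv> \<lambda>k. u k + complex_of_real h * Fq \<sigma> {-N..N} u k"
  shows "wn w V \<in> L2"
    "(nL2 (wn w V))\<^sup>2 \<le> (1 + h * (2 * (real (a + 2) * 2 ^ a) * Am u)) * (nL2 (wn w u))\<^sup>2 + h\<^sup>2 * (cN s N * (nL2 u)\<^sup>2)\<^sup>2"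
proof -
  note u2 = inH_L2[OF u]
  have wm[measurable]: "w \<in> borel_measurable borel" using w by (simp add: weight_def)
  have w': "0 \<le> x \<Longrightarrow> 0 \<le> w x \<and> w x \<le> hw s x" for x using w wle by (auto simp: weight_def)
  have wu: "wn w u \<in> L2"
    by (rule wn_mono(1)[of "hw s" u w 1]) (use u w' L2_measurable[OF u2] in \<open>auto simp: inH_def\<close>)
  have F2: "wn w (Fq \<sigma> {-N..N} u) \<in> L2" by (rule Fq_trunc(1)[OF N _ u2 \<sigma> wm w']) (use s in auto)
  have Fb: "nL2 (wn w (Fq \<sigma> {-N..N} u)) \<le> cN s N * (nL2 u)\<^sup>2" by (rule Fq_trunc(2)[OF N _ u2 \<sigma> wm w']) (use s in auto)
  let ?g = "\<lambda>k. complex_of_real h * wn w (Fq \<sigma> {-N..N} u) k"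
  have g2: "?g \<in> L2" by (rule L2_cmult[OF F2])
  have V: "wn w V = (\<lambda>k. wn w u k + ?g k)" unfolding V_def wn_add wn_cmult ..
  show "wn w V \<in> L2" unfolding V by (rule L2_add[OF wu g2])
  let ?E = "LINT k|lborel. (complex_of_real (w \<bar>k\<bar>) * (- \<i> * complex_of_real k) * cnj (u k)) * Q {-N..N} u u k"
  have W: "0 \<le> w \<bar>x\<bar>" for x by (rule weight_nonneg[OF w])
  have ip: "(LINT k|lborel. ?g k * cnj (wn w u k)) = complex_of_real (h * \<sigma>) * ?E"
  proof -
    have "?g k * cnj (wn w u k) = complex_of_real (h * \<sigma>) * ((complex_of_real (w \<bar>k\<bar>) * (- \<i> * complex_of_real k) * cnj (u k)) * Q {-N..N} u u k)" for k
    proof -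
      have "complex_of_real (sqrt (w \<bar>k\<bar>)) * complex_of_real (sqrt (w \<bar>k\<bar>)) = complex_of_real (w \<bar>k\<bar>)"
        unfolding of_real_mult[symmetric] using W[of k] by simp
      then show ?thesis unfolding wn_def Fq_def by (simp add: mult_ac)
    qed
    then show ?thesis by (simp only: integral_mult_right_zero)
  qed
  have E: "cmod ?E \<le> real (a + 2) * 2 ^ a * (Am u * (nL2 (wn w u))\<^sup>2)"
    by (rule energy_estimate[OF symset_Icc subset_refl w u2 hu wu H_Am(1)[OF s u]])
  have "Re (complex_of_real (h * \<sigma>) * ?E) \<le> cmod (complex_of_real (h * \<sigma>) * ?E)" by (rule complex_Re_le_cmod)
  also have "\<dots> = h * cmod ?E" using h \<sigma> by (simp add: norm_mult abs_mult)
  also have "\<dots> \<le> h * (real (a + 2) * 2 ^ a * (Am u * (nL2 (wn w u))\<^sup>2))" by (rule mult_left_mono[OF E h])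
  finally have r: "Re (LINT k|lborel. ?g k * cnj (wn w u k)) \<le> h * (real (a + 2) * 2 ^ a * (Am u * (nL2 (wn w u))\<^sup>2))" unfolding ip .
  have ng: "(nL2 ?g)\<^sup>2 \<le> h\<^sup>2 * (cN s N * (nL2 u)\<^sup>2)\<^sup>2"
    unfolding nL2_cmult power_mult_distrib[symmetric] using h Fb by (intro power_mono mult_mono) auto
  have "(nL2 (wn w V))\<^sup>2 \<le> (nL2 (wn w u))\<^sup>2 + 2 * (h * (real (a + 2) * 2 ^ a * (Am u * (nL2 (wn w u))\<^sup>2))) + h\<^sup>2 * (cN s N * (nL2 u)\<^sup>2)\<^sup>2"
    unfolding V nL2_add_sq[OF wu g2] using r ng by linarith
  then show "(nL2 (wn w V))\<^sup>2 \<le> (1 + h * (2 * (real (a + 2) * 2 ^ a) * Am u)) * (nL2 (wn w u))\<^sup>2 + h\<^sup>2 * (cN s N * (nL2 u)\<^sup>2)\<^sup>2"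
    by (simp add: algebra_simps)
qed

text \<open>
  A polynomial growth exponent that suits the \<open>H\<^sup>s\<close> weight even after multiplication with a tail weight,
  which has growth exponent one.
\<close>

definition weight_exp :: "real \<Rightarrow> nat" where "weight_exp s = nat \<lceil>2 * s\<rceil> + 1"

text \<open>
  Large enough that \<open>\<gamma>\<close> below bounds the growth rate of the squared norms while the \<open>L\<^sup>2\<close> and \<open>H\<^sup>s\<close>
  norms are at most twice their initial values.
\<close>

definition KS :: "real \<Rightarrow> real" where "KS s = 4 * (real (weight_exp s + 2) * 2 ^ weight_exp s) * (cJ s * sqrt 2)"

lemma KS_pos: "KS s > 0" unfolding KS_def using cJ_pos[of s] by simp

fun euler_iterate :: "real \<Rightarrow> real \<Rightarrow> real \<Rightarrow> (real \<Rightarrow> complex) \<Rightarrow> nat \<Rightarrow> real \<Rightarrow> complex" where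
  "euler_iterate \<sigma> N h u0 0 = u0"
| "euler_iterate \<sigma> N h u0 (Suc j) = (\<lambda>k. euler_iterate \<sigma> N h u0 j k + complex_of_real h * Fq \<sigma> {-N..N} (euler_iterate \<sigma> N h u0 j) k)"

locale euler =
  fixes s \<sigma> :: real and u0 :: "real \<Rightarrow> complex"
  assumes s: "s > 2" and \<sigma>: "\<bar>\<sigma>\<bar> = 1" and hu0: "herm u0" and u0: "inH s u0" and u0n: "nL2 u0 > 0"
begin

text \<open>
  \<open>\<gamma>\<close> bounds the exponential growth rate of the squared norms, and \<open>T = 1/\<gamma>\<close> is the time \<open>\<tau>\<^sub>*\<close>.
\<close>

definition "\<alpha> = nL2 u0"
definition "\<beta> = Hn s u0"
definition "T = 1 / (KS s * \<alpha> powr (1 - 2/s) * \<beta> powr (2/s))"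
definition "\<gamma> = KS s * \<alpha> powr (1 - 2/s) * \<beta> powr (2/s)"

lemma ab: "0 < \<alpha>" "\<alpha> \<le> \<beta>" "0 < \<beta>"
  using u0n nL2_le_Hn[OF u0] unfolding \<alpha>_def \<beta>_def by linarith+

lemma \<gamma>: "0 < \<gamma>" "0 < T" "\<gamma> * T = 1"
  unfolding \<gamma>_def T_def using ab KS_pos[of s] by (auto simp: field_simps)

text \<open>
  The bootstrap hypothesis: no norm has more than doubled.
\<close>

definition good :: "(real \<Rightarrow> complex) \<Rightarrow> bool" where
  "good v \<longleftrightarrow> herm v \<and> inH s v \<and> nL2 v \<le> 2 * \<alpha> \<and> Hn s v \<le> 2 * \<beta>"

text \<open>
  The two exponents of the interpolation inequality add up to one, so doubling both norms doubles the
  bound.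
\<close>

lemma good_Am: assumes v: "good v" shows "2 * (real (weight_exp s + 2) * 2 ^ weight_exp s) * Am v \<le> \<gamma>"
proof -
  have "Am v \<le> cJ s * sqrt 2 * ((2*\<alpha>) powr (1 - 2/s) * (2*\<beta>) powr (2/s))"
    using v ab by (intro Am_interpolation s) (auto simp: good_def)
  also have "(2*\<alpha>) powr (1 - 2/s) * (2*\<beta>) powr (2/s) = (2 powr (1 - 2/s) * 2 powr (2/s)) * (\<alpha> powr (1 - 2/s) * \<beta> powr (2/s))"
    using ab by (simp add: powr_mult mult_ac)
  also have "(2::real) powr (1 - 2/s) * 2 powr (2/s) = 2" by (simp add: powr_add[symmetric])
  finally have "2 * (real (weight_exp s + 2) * 2 ^ weight_exp s) * Am v \<le> 2 * (real (weight_exp s + 2) * 2 ^ weight_exp s) * (cJ s * sqrt 2 * (2 * (\<alpha> powr (1 - 2/s) * \<beta> powr (2/s))))"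
    by (intro mult_left_mono) auto
  also have "\<dots> = \<gamma>" unfolding \<gamma>_def KS_def by (simp add: mult_ac)
  finally show ?thesis .
qed

text \<open>
  The weights for which energy bounds along the scheme are needed: those of \<open>L\<^sup>2\<close>, \<open>H\<^sup>s\<close> and the tails. They
  are treated together because the first two have to be propagated to know that the iterates are good.
\<close>

definition admissible :: "(real \<Rightarrow> real) \<Rightarrow> bool" where
  "admissible w \<longleftrightarrow> weight (weight_exp s) w \<and> (\<forall>x\<ge>0. w x \<le> hw s x)"

lemma weight_exp_ge: "2 * s + 1 \<le> real (weight_exp s)" unfolding weight_exp_def using s by linarith

lemma admissible_one: "admissible (\<lambda>_. 1)" unfolding admissible_def using weight_one hw_ge1 by auto
lemma admissible_hw: "admissible (hw s)" unfolding admissible_def using weight_hw[of s "weight_exp s"] weight_exp_ge s by auto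
lemma admissible_tailw: assumes "R > 0" shows "admissible (\<lambda>x. hw s x * tailw R x)"
proof -
  have e: "weight_exp s = nat \<lceil>2 * s\<rceil> + 1" by (simp add: weight_exp_def)
  have "weight (nat \<lceil>2 * s\<rceil>) (hw s)" by (rule weight_hw) (use s in linarith)+
  from weight_mult[OF this weight_tailw[OF assms]] have "weight (weight_exp s) (\<lambda>x. hw s x * tailw R x)" unfolding e .
  moreover have "hw s x * tailw R x \<le> hw s x" for x using mult_left_mono[of "tailw R x" 1 "hw s x"] by (simp add: tailw_def)
  ultimately show ?thesis unfolding admissible_def by simp
qed

lemma wn_admissible_L2: assumes "admissible w" "inH s v" shows "wn w v \<in> L2"
  by (rule wn_mono(1)[of "hw s" v w 1]) (use assms L2_measurable[OF inH_L2] in \<open>auto simp: inH_def admissible_def weight_def\<close>)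

definition errN :: "real \<Rightarrow> real" where "errN N = (cN s N * (2*\<alpha>)\<^sup>2)\<^sup>2"

lemma errN_nonneg: "0 \<le> errN N" by (simp add: errN_def)

lemma step_good:
  assumes N: "0 \<le> N" and h: "0 \<le> \<theta>" "\<theta> \<le> h" and v: "good v" and w: "admissible w"
  shows "(nL2 (wn w (\<lambda>k. v k + complex_of_real \<theta> * Fq \<sigma> {-N..N} v k)))\<^sup>2 \<le> (1 + h * \<gamma>) * (nL2 (wn w v))\<^sup>2 + h\<^sup>2 * errN N"
proof -
  have v': "inH s v" "herm v" "nL2 v \<le> 2 * \<alpha>" using v by (auto simp: good_def)
  have w': "weight (weight_exp s) w" "\<And>x. 0 \<le> x \<Longrightarrow> w x \<le> hw s x" using w by (auto simp: admissible_def)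
  have "(nL2 (wn w (\<lambda>k. v k + complex_of_real \<theta> * Fq \<sigma> {-N..N} v k)))\<^sup>2 \<le> (1 + \<theta> * (2 * (real (weight_exp s + 2) * 2 ^ weight_exp s) * Am v)) * (nL2 (wn w v))\<^sup>2 + \<theta>\<^sup>2 * (cN s N * (nL2 v)\<^sup>2)\<^sup>2"
    by (rule step_energy(2)[OF N s v'(1,2) \<sigma> h(1) w'])
  also have "\<dots> \<le> (1 + h * \<gamma>) * (nL2 (wn w v))\<^sup>2 + h\<^sup>2 * errN N"
  proof (rule add_mono[OF mult_right_mono mult_mono])
    have "\<theta> * (2 * (real (weight_exp s + 2) * 2 ^ weight_exp s) * Am v) \<le> h * \<gamma>"
      using h good_Am[OF v] Am_nonneg[of v] by (intro mult_mono) auto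
    then show "1 + \<theta> * (2 * (real (weight_exp s + 2) * 2 ^ weight_exp s) * Am v) \<le> 1 + h * \<gamma>" by simp
    show "\<theta>\<^sup>2 \<le> h\<^sup>2" using h by (intro power_mono)
    show "(cN s N * (nL2 v)\<^sup>2)\<^sup>2 \<le> errN N" unfolding errN_def
      using cN_nonneg[OF N, of s] v'(3) by (intro power_mono mult_left_mono) auto
  qed auto
  finally show ?thesis .
qed

lemma step_inH:
  assumes N: "0 \<le> N" and h: "0 \<le> \<theta>" and v: "inH s v" "herm v"
  shows "inH s (\<lambda>k. v k + complex_of_real \<theta> * Fq \<sigma> {-N..N} v k)" "herm (\<lambda>k. v k + complex_of_real \<theta> * Fq \<sigma> {-N..N} v k)"
proof -
  note [measurable] = L2_measurable[OF inH_L2[OF v(1)]] Fq_measurable[OF symset_Icc]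
  have m: "(\<lambda>k. v k + complex_of_real \<theta> * Fq \<sigma> {-N..N} v k) \<in> borel_measurable borel" by measurable
  have "weight (weight_exp s) (hw s)" using admissible_hw by (simp add: admissible_def)
  from step_energy(1)[OF N s v \<sigma> h this] show "inH s (\<lambda>k. v k + complex_of_real \<theta> * Fq \<sigma> {-N..N} v k)"
    by (intro inH_I m) auto
  show "herm (\<lambda>k. v k + complex_of_real \<theta> * Fq \<sigma> {-N..N} v k)"
    using Fq_herm[OF symset_Icc v(2)] v(2) unfolding herm_def by simp
qed

text \<open>
  \<open>M\<close> steps up to time \<open>T\<close> at cut-off \<open>N\<close>: the accumulated quadratic errors, the displacement within
  one step and the step size itself are all \<open>O(1/N)\<close>.
\<close>

definition steps_ok :: "nat \<Rightarrow> nat \<Rightarrow> bool" where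
  "steps_ok N M \<longleftrightarrow> 0 < N \<and> 0 < M \<and> T / M * (T * errN N) \<le> \<alpha>\<^sup>2 / (3 * N) \<and> T / M * cN s N \<le> 1 / N \<and> T / M \<le> 1 / N"

lemma steps_exist: assumes N: "0 < N" shows "\<exists>M. steps_ok N M"
proof -
  (* The sum of the three lower bounds for the number of steps. *)
  define X where "X = T * (T * errN N) * (3 * N) / \<alpha>\<^sup>2 + T * cN s N * N + T * N"
  obtain M :: nat where M: "X < M" using reals_Archimedean2 by blast
  have c: "0 \<le> cN s N" by (rule cN_nonneg) simp
  have t: "0 \<le> T * (T * errN N) * (3 * N) / \<alpha>\<^sup>2" "0 \<le> T * cN s N * N" "0 \<le> T * N" using \<gamma> c errN_nonneg by auto
  have M0: "0 < real M" using M t unfolding X_def by linarith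
  have "T * (T * errN N) * (3 * N) / \<alpha>\<^sup>2 \<le> M" "T * cN s N * N \<le> M" "T * N \<le> M" using M t unfolding X_def by linarith+
  then have "T / M * (T * errN N) \<le> \<alpha>\<^sup>2 / (3 * N)" "T / M * cN s N \<le> 1 / N" "T / M \<le> 1 / N"
    using M0 N ab by (auto simp: field_simps)
  then show ?thesis using M0 N unfolding steps_ok_def by auto
qed

definition gap :: "nat \<Rightarrow> real" where "gap N = \<alpha>\<^sup>2 / (3 * N)"

text \<open>
  Squared norms grow by a factor of at most \<open>exp 1 \<le> 3\<close> up to time \<open>T\<close>. With the error terms the factor is
  at most four, so the norms themselves at most double and the bootstrap closes.
\<close>

lemma exp_bound: assumes "0 \<le> h" "real j * h \<le> T" shows "(1 + h * \<gamma>) ^ j \<le> 3"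
proof -
  have "(1 + h * \<gamma>) ^ j \<le> exp (h * \<gamma>) ^ j" using assms \<gamma> by (intro power_mono exp_ge_add_one_self) auto
  also have "\<dots> = exp (real j * (h * \<gamma>))" by (rule exp_of_nat_mult[symmetric])
  also have "\<dots> \<le> exp 1"
  proof -
    have "real j * h * \<gamma> \<le> T * \<gamma>" using assms \<gamma> by (intro mult_right_mono) auto
    also have "T * \<gamma> = 1" using \<gamma>(3) by (simp only: mult.commute)
    finally show ?thesis by (simp only: exp_le_cancel_iff mult.assoc)
  qed
  also have "\<dots> \<le> 3" by (rule exp_le)
  finally show ?thesis .
qed

text \<open>
  The step that closes the bootstrap: the energy bounds after \<open>j\<close> steps imply that the state is good.
\<close>

lemma energy_conclusion:
  assumes ok: "steps_ok N M" and j: "j \<le> M" and i: "inH s v" "herm v"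
    and e: "\<And>w. admissible w \<Longrightarrow> (nL2 (wn w v))\<^sup>2 \<le> (1 + T/M * \<gamma>) ^ j * ((nL2 (wn w u0))\<^sup>2 + j * ((T/M)\<^sup>2 * errN N))"
  shows "good v" "admissible w \<Longrightarrow> (nL2 (wn w v))\<^sup>2 \<le> 3 * ((nL2 (wn w u0))\<^sup>2 + gap N)"
proof -
  have M: "M > 0" and N: "N > 0" and g: "T / M * (T * errN N) \<le> \<alpha>\<^sup>2 / (3 * N)" using ok by (auto simp: steps_ok_def)
  have h: "0 \<le> T / M" using \<gamma> by simp
  have jh: "real j * (T / M) \<le> T" using j M \<gamma> by (simp add: field_simps mult_left_mono)
  have "real j * ((T/M)\<^sup>2 * errN N) = (real j * (T / M)) * ((T / M) * errN N)" by (simp add: power2_eq_square)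
  also have "\<dots> \<le> T * ((T / M) * errN N)" by (rule mult_right_mono[OF jh]) (use \<gamma>(2) errN_nonneg in simp)
  also have "\<dots> \<le> gap N" using g unfolding gap_def by (simp add: mult_ac)
  finally have jg: "real j * ((T/M)\<^sup>2 * errN N) \<le> gap N" .
  have c: "(nL2 (wn w v))\<^sup>2 \<le> 3 * ((nL2 (wn w u0))\<^sup>2 + gap N)" if w: "admissible w" for w
  proof -
    have "(nL2 (wn w v))\<^sup>2 \<le> (1 + T/M * \<gamma>) ^ j * ((nL2 (wn w u0))\<^sup>2 + j * ((T/M)\<^sup>2 * errN N))" by (rule e[OF w])
    also have "\<dots> \<le> 3 * ((nL2 (wn w u0))\<^sup>2 + gap N)"
      by (intro mult_mono exp_bound h jh add_mono jg) (use errN_nonneg in auto)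
    finally show ?thesis .
  qed
  show "admissible w \<Longrightarrow> (nL2 (wn w v))\<^sup>2 \<le> 3 * ((nL2 (wn w u0))\<^sup>2 + gap N)" by (rule c)
  have gap: "gap N \<le> \<alpha>\<^sup>2 / 3" unfolding gap_def using N ab by (intro divide_left_mono) auto
  have "(nL2 v)\<^sup>2 \<le> (2*\<alpha>)\<^sup>2" using c[OF admissible_one] gap unfolding wn_one \<alpha>_def[symmetric] by (simp add: power_mult_distrib)
  then have 1: "nL2 v \<le> 2 * \<alpha>" using ab by (intro power2_le_imp_le[of "nL2 v" "2*\<alpha>"]) auto
  have "\<alpha>\<^sup>2 \<le> \<beta>\<^sup>2" using ab by (intro power_mono) auto
  then have "(Hn s v)\<^sup>2 \<le> (2*\<beta>)\<^sup>2" using c[OF admissible_hw] gap unfolding Hn_def[symmetric] \<beta>_def[symmetric] by (simp add: power_mult_distrib)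
  then have 2: "Hn s v \<le> 2 * \<beta>" using ab by (intro power2_le_imp_le[of "Hn s v" "2*\<beta>"]) auto
  show "good v" using 1 2 i by (simp add: good_def)
qed

abbreviation "U N M j \<equiv> euler_iterate \<sigma> (real N) (T / real M) u0 j"

text \<open>
  The bounds hold for all weights simultaneously, since the induction step needs the state to be good and
  this uses two of the weights.
\<close>

lemma energy_iterate:
  assumes ok: "steps_ok N M" and j: "j \<le> M"
  shows "inH s (U N M j) \<and> herm (U N M j) \<and> (\<forall>w. admissible w \<longrightarrow> (nL2 (wn w (U N M j)))\<^sup>2 \<le> (1 + T/M * \<gamma>) ^ j * ((nL2 (wn w u0))\<^sup>2 + j * ((T/M)\<^sup>2 * errN N)))"
  using j
proof (induction j)
  case 0 then show ?case using hu0 u0 by simp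
next
  case (Suc j)
  have h: "0 \<le> T / M" using \<gamma> by simp
  have IH: "inH s (U N M j)" "herm (U N M j)" "\<And>w. admissible w \<Longrightarrow> (nL2 (wn w (U N M j)))\<^sup>2 \<le> (1 + T/M * \<gamma>) ^ j * ((nL2 (wn w u0))\<^sup>2 + j * ((T/M)\<^sup>2 * errN N))"
    using Suc by auto
  have g: "good (U N M j)" by (rule energy_conclusion(1)[OF ok _ IH]) (use Suc in auto)
  have "(nL2 (wn w (U N M (Suc j))))\<^sup>2 \<le> (1 + T/M * \<gamma>) ^ Suc j * ((nL2 (wn w u0))\<^sup>2 + Suc j * ((T/M)\<^sup>2 * errN N))" if w: "admissible w" for w
  proof -
    let ?q = "1 + T/M * \<gamma>" and ?e = "(T/M)\<^sup>2 * errN N"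
    have q: "1 \<le> ?q" using h \<gamma> by simp
    have e0: "0 \<le> ?e" using errN_nonneg by simp
    have "(nL2 (wn w (U N M (Suc j))))\<^sup>2 \<le> ?q * (nL2 (wn w (U N M j)))\<^sup>2 + ?e"
      using step_good[OF _ h order_refl g w, of "real N"] by simp
    also have "\<dots> \<le> ?q * (?q ^ j * ((nL2 (wn w u0))\<^sup>2 + j * ?e)) + ?q ^ Suc j * ?e"
      using q e0 IH(3)[OF w] one_le_power[OF q, of "Suc j"] mult_right_mono[of 1 "?q ^ Suc j" ?e] by (intro add_mono mult_left_mono) auto
    also have "\<dots> = ?q ^ Suc j * ((nL2 (wn w u0))\<^sup>2 + Suc j * ?e)" by (simp add: algebra_simps)
    finally show ?thesis .
  qed
  then show ?case using step_inH[OF _ h IH(1,2), of "real N"] by simp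
qed

text \<open>
  States in the middle of a step arise when two schemes are put on a common time grid.
\<close>

lemma partial_step:
  assumes ok: "steps_ok N M" and j: "j < M" and \<theta>: "0 \<le> \<theta>" "\<theta> \<le> T / M"
  defines "V \<equiv> \<lambda>k. U N M j k + complex_of_real \<theta> * Fq \<sigma> {-real N..real N} (U N M j) k"
  shows "good V" "admissible w \<Longrightarrow> (nL2 (wn w V))\<^sup>2 \<le> 3 * ((nL2 (wn w u0))\<^sup>2 + gap N)"
proof -
  have h: "0 \<le> T / M" using \<gamma> by simp
  have IH: "inH s (U N M j)" "herm (U N M j)" "\<And>w. admissible w \<Longrightarrow> (nL2 (wn w (U N M j)))\<^sup>2 \<le> (1 + T/M * \<gamma>) ^ j * ((nL2 (wn w u0))\<^sup>2 + j * ((T/M)\<^sup>2 * errN N))"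
    using energy_iterate[OF ok, of j] j by auto
  have g: "good (U N M j)" by (rule energy_conclusion(1)[OF ok _ IH]) (use j in auto)
  have e: "(nL2 (wn w V))\<^sup>2 \<le> (1 + T/M * \<gamma>) ^ Suc j * ((nL2 (wn w u0))\<^sup>2 + Suc j * ((T/M)\<^sup>2 * errN N))" if w: "admissible w" for w
  proof -
    let ?q = "1 + T/M * \<gamma>" and ?e = "(T/M)\<^sup>2 * errN N"
    have q: "1 \<le> ?q" using h \<gamma> by simp
    have e0: "0 \<le> ?e" using errN_nonneg by simp
    have "(nL2 (wn w V))\<^sup>2 \<le> ?q * (nL2 (wn w (U N M j)))\<^sup>2 + ?e"
      unfolding V_def using step_good[OF _ \<theta> g w, of "real N"] by simp
    also have "\<dots> \<le> ?q * (?q ^ j * ((nL2 (wn w u0))\<^sup>2 + j * ?e)) + ?q ^ Suc j * ?e"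
      using q e0 IH(3)[OF w] one_le_power[OF q, of "Suc j"] mult_right_mono[of 1 "?q ^ Suc j" ?e] by (intro add_mono mult_left_mono) auto
    also have "\<dots> = ?q ^ Suc j * ((nL2 (wn w u0))\<^sup>2 + Suc j * ?e)" by (simp add: algebra_simps)
    finally show ?thesis .
  qed
  have i: "inH s V" "herm V" unfolding V_def using step_inH[OF _ \<theta>(1) IH(1,2), of "real N"] by auto
  show "good V" "admissible w \<Longrightarrow> (nL2 (wn w V))\<^sup>2 \<le> 3 * ((nL2 (wn w u0))\<^sup>2 + gap N)"
    using energy_conclusion[OF ok Suc_leI[OF j] i e] by auto
qed

lemma iterate_good:
  assumes ok: "steps_ok N M" and j: "j \<le> M"
  shows "good (U N M j)" "admissible w \<Longrightarrow> (nL2 (wn w (U N M j)))\<^sup>2 \<le> 3 * ((nL2 (wn w u0))\<^sup>2 + gap N)"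
proof -
  have IH: "inH s (U N M j)" "herm (U N M j)" "\<And>w. admissible w \<Longrightarrow> (nL2 (wn w (U N M j)))\<^sup>2 \<le> (1 + T/M * \<gamma>) ^ j * ((nL2 (wn w u0))\<^sup>2 + j * ((T/M)\<^sup>2 * errN N))"
    using energy_iterate[OF ok j] by auto
  show "good (U N M j)" "admissible w \<Longrightarrow> (nL2 (wn w (U N M j)))\<^sup>2 \<le> 3 * ((nL2 (wn w u0))\<^sup>2 + gap N)"
    using energy_conclusion[OF ok j IH] by auto
qed

text \<open>
  A bound for the velocity of good states, hence a Lipschitz constant in time.
\<close>

definition "LF = cF s * (2*\<beta>)\<^sup>2"

lemma LF_nonneg: "0 \<le> LF" unfolding LF_def using cF_nonneg by simp

lemma good_F:
  assumes v: "good v" and P: "symset P" shows "Fq \<sigma> P v \<in> L2" "nL2 (Fq \<sigma> P v) \<le> LF"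
proof -
  have v': "inH s v" "Hn s v \<le> 2 * \<beta>" using v by (auto simp: good_def)
  note F = Fq_H[OF s P v'(1) \<sigma>]
  show "Fq \<sigma> P v \<in> L2" by (rule inH_L2[OF F(1)])
  have "nL2 (Fq \<sigma> P v) \<le> cF s * (Hn s v)\<^sup>2" using nL2_le_Hn[OF F(1)] F(2) by linarith
  also have "\<dots> \<le> LF" unfolding LF_def using v' cF_nonneg by (intro mult_left_mono power_mono) auto
  finally show "nL2 (Fq \<sigma> P v) \<le> LF" .
qed

text \<open>
  Two Euler steps whose increments \<open>G\<close>, \<open>G'\<close> approximate the untruncated nonlinearity. The
  nonlinearity contributes through \<open>difference_estimate\<close>, the approximation errors through Cauchy-Schwarz.
\<close>

lemma difference_step:
  assumes v: "good v" and v': "good v'" and G: "G \<in> L2" and G': "G' \<in> L2" and \<eta>: "0 \<le> \<eta>"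
    and e: "nL2 (\<lambda>k. G k - Fq \<sigma> UNIV v k) \<le> e" and e': "nL2 (\<lambda>k. G' k - Fq \<sigma> UNIV v' k) \<le> e'"
  shows "(nL2 (\<lambda>k. (v k + complex_of_real \<eta> * G k) - (v' k + complex_of_real \<eta> * G' k)))\<^sup>2 \<le>
     (1 + \<eta> * (cJ s * (4*\<beta>))) * (nL2 (\<lambda>k. v k - v' k))\<^sup>2 + \<eta> * (8 * \<alpha> * (e + e') + \<eta> * (2 * LF + (e + e'))\<^sup>2)"
proof -
  have g: "inH s v" "herm v" "nL2 v \<le> 2 * \<alpha>" "Hn s v \<le> 2 * \<beta>" "inH s v'" "herm v'" "nL2 v' \<le> 2 * \<alpha>" "Hn s v' \<le> 2 * \<beta>"
    using v v' by (auto simp: good_def)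
  note L = inH_L2[OF g(1)] inH_L2[OF g(5)]
  note F = good_F[OF v symset_UNIV] good_F[OF v' symset_UNIV]
  define d where "d k = v k - v' k" for k
  define q where "q k = v k + v' k" for k
  (* The error of the increments and the exact velocity difference are treated separately. *)
  define r where "r k = (G k - Fq \<sigma> UNIV v k) - (G' k - Fq \<sigma> UNIV v' k)" for k
  define f where "f k = Fq \<sigma> UNIV v k - Fq \<sigma> UNIV v' k" for k
  have d2: "d \<in> L2" unfolding d_def[abs_def] by (intro L2_diff L)
  have q2: "q \<in> L2" unfolding q_def[abs_def] by (intro L2_add L)
  have dH: "inH s d" unfolding d_def[abs_def] by (intro inH_diff g)
  have qH: "inH s q" unfolding q_def[abs_def] by (intro inH_add g)
  have r2: "r \<in> L2" unfolding r_def[abs_def] by (intro L2_diff G G' F)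
  have f2: "f \<in> L2" unfolding f_def[abs_def] by (intro L2_diff F)
  have rn: "nL2 r \<le> e + e'" unfolding r_def[abs_def]
    using nL2_triangle_minus[OF L2_diff[OF G F(1)] L2_diff[OF G' F(3)]] e e' by linarith
  have fn: "nL2 f \<le> 2 * LF" unfolding f_def[abs_def] using nL2_triangle_minus[OF F(1,3)] F(2,4) by linarith
  have dn: "nL2 d \<le> 4 * \<alpha>" unfolding d_def[abs_def] using nL2_triangle_minus[OF L] g by linarith
  have hd: "herm d" using g unfolding herm_def d_def by simp
  have kd: "(\<lambda>k. complex_of_real k * d k) \<in> L2"
  proof -
    note [measurable] = L2_measurable[OF d2]
    show ?thesis
    proof (rule L2_bound[where f="wn (hw s) d" and c=1])
      show "wn (hw s) d \<in> L2" using dH by (simp add: inH_def)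
      fix k
      have "\<bar>k\<bar> \<le> sqrt (hw s k)" by (rule real_le_rsqrt) (use pow4_le_hw(2)[of s k] s in simp)
      then show "cmod (complex_of_real k * d k) \<le> 1 * cmod (wn (hw s) d k)"
        by (simp add: wn_def norm_mult mult_right_mono)
    qed measurable
  qed
  have fe: "f k = (complex_of_real \<sigma> * (- \<i>)) * (complex_of_real k * Q UNIV q d k)" for k
    unfolding f_def q_def[abs_def] d_def[abs_def] by (rule Fq_diff[OF symset_UNIV L])
  have "(LINT k|lborel. f k * cnj (d k)) = (LINT k|lborel. complex_of_real \<sigma> * ((- \<i> * complex_of_real k) * cnj (d k) * Q UNIV q d k))"
    unfolding fe by (intro Bochner_Integration.integral_cong) (auto simp: mult_ac)
  also have "\<dots> = complex_of_real \<sigma> * (LINT k|lborel. (- \<i> * complex_of_real k) * cnj (d k) * Q UNIV q d k)" by (rule integral_mult_right_zero)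
  finally have "cmod (LINT k|lborel. f k * cnj (d k)) = cmod (LINT k|lborel. (- \<i> * complex_of_real k) * cnj (d k) * Q UNIV q d k)"
    using \<sigma> by (simp add: norm_mult)
  then have "2 * cmod (LINT k|lborel. f k * cnj (d k)) \<le> Am q * (nL2 d)\<^sup>2"
    using difference_estimate[OF q2 d2 hd kd H_Am(1)[OF s qH] H_half(1)[OF s qH]] by simp
  also have "Am q * (nL2 d)\<^sup>2 \<le> cJ s * (4*\<beta>) * (nL2 d)\<^sup>2"
  proof (rule mult_right_mono)
    have "Hn s q \<le> 4 * \<beta>" using Hn_add[OF g(1,5)] g unfolding q_def[abs_def] by linarith
    then have "cJ s * Hn s q \<le> cJ s * (4 * \<beta>)" using cJ_pos[of s] by (intro mult_left_mono) auto
    then show "Am q \<le> cJ s * (4*\<beta>)" using H_Am(2)[OF s qH] by linarith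
  qed simp
  finally have A: "2 * cmod (LINT k|lborel. f k * cnj (d k)) \<le> cJ s * (4*\<beta>) * (nL2 d)\<^sup>2" .
  have R: "2 * cmod (LINT k|lborel. r k * cnj (d k)) \<le> 8 * \<alpha> * (e + e')"
  proof -
    have "cmod (LINT k|lborel. r k * cnj (d k)) \<le> nL2 r * nL2 d" using L2_Cauchy_Schwarz[OF r2 L2_cnj[OF d2]] by simp
    also have "\<dots> \<le> (e + e') * (4 * \<alpha>)" using rn dn order_trans[OF nL2_nonneg rn] by (intro mult_mono) auto
    finally have "2 * cmod (LINT k|lborel. r k * cnj (d k)) \<le> 2 * ((e + e') * (4 * \<alpha>))" by (rule mult_left_mono) simp
    also have "\<dots> = 8 * \<alpha> * (e + e')" by (simp add: algebra_simps)
    finally show ?thesis .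
  qed
  let ?g = "\<lambda>k. complex_of_real \<eta> * (f k + r k)"
  have fr2: "(\<lambda>k. f k + r k) \<in> L2" by (rule L2_add[OF f2 r2])
  have g2: "?g \<in> L2" by (rule L2_cmult[OF fr2])
  have eq: "(v k + complex_of_real \<eta> * G k) - (v' k + complex_of_real \<eta> * G' k) = d k + ?g k" for k
    unfolding d_def f_def r_def by (simp add: algebra_simps)
  have ip: "(LINT k|lborel. ?g k * cnj (d k)) = complex_of_real \<eta> * ((LINT k|lborel. f k * cnj (d k)) + (LINT k|lborel. r k * cnj (d k)))"
  proof -
    have "(LINT k|lborel. ?g k * cnj (d k)) = (LINT k|lborel. complex_of_real \<eta> * (f k * cnj (d k) + r k * cnj (d k)))"
      by (intro Bochner_Integration.integral_cong) (auto simp: algebra_simps)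
    also have "\<dots> = complex_of_real \<eta> * (LINT k|lborel. (f k * cnj (d k) + r k * cnj (d k)))" by (rule integral_mult_right_zero)
    also have "(LINT k|lborel. (f k * cnj (d k) + r k * cnj (d k))) = (LINT k|lborel. f k * cnj (d k)) + (LINT k|lborel. r k * cnj (d k))"
      by (intro Bochner_Integration.integral_add L2_mult_integrable f2 r2 L2_cnj d2)
    finally show ?thesis .
  qed
  have "2 * Re (LINT k|lborel. ?g k * cnj (d k)) \<le> 2 * cmod (LINT k|lborel. ?g k * cnj (d k))" using complex_Re_le_cmod by simp
  also have "\<dots> \<le> \<eta> * (2 * cmod (LINT k|lborel. f k * cnj (d k)) + 2 * cmod (LINT k|lborel. r k * cnj (d k)))"
  proof -
    have "cmod (LINT k|lborel. ?g k * cnj (d k)) = \<eta> * cmod ((LINT k|lborel. f k * cnj (d k)) + (LINT k|lborel. r k * cnj (d k)))"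
      unfolding ip using \<eta> by (simp add: norm_mult)
    also have "\<dots> \<le> \<eta> * (cmod (LINT k|lborel. f k * cnj (d k)) + cmod (LINT k|lborel. r k * cnj (d k)))"
      by (intro mult_left_mono norm_triangle_ineq \<eta>)
    finally show ?thesis by (simp add: algebra_simps)
  qed
  also have "\<dots> \<le> \<eta> * (cJ s * (4*\<beta>) * (nL2 d)\<^sup>2 + 8 * \<alpha> * (e + e'))" by (intro mult_left_mono add_mono A R \<eta>)
  finally have I: "2 * Re (LINT k|lborel. ?g k * cnj (d k)) \<le> \<eta> * (cJ s * (4*\<beta>) * (nL2 d)\<^sup>2 + 8 * \<alpha> * (e + e'))" .
  have "nL2 ?g \<le> \<eta> * (2 * LF + (e + e'))" unfolding nL2_cmult
    using nL2_triangle[OF f2 r2] fn rn \<eta> by (intro mult_mono) auto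
  then have J: "(nL2 ?g)\<^sup>2 \<le> (\<eta> * (2 * LF + (e + e')))\<^sup>2" by (intro power_mono) auto
  have "(nL2 (\<lambda>k. d k + ?g k))\<^sup>2 \<le> (nL2 d)\<^sup>2 + \<eta> * (cJ s * (4*\<beta>) * (nL2 d)\<^sup>2 + 8 * \<alpha> * (e + e')) + (\<eta> * (2 * LF + (e + e')))\<^sup>2"
    unfolding nL2_add_sq[OF d2 g2] using I J by linarith
  also have "\<dots> = (1 + \<eta> * (cJ s * (4*\<beta>))) * (nL2 d)\<^sup>2 + \<eta> * (8 * \<alpha> * (e + e') + \<eta> * (2 * LF + (e + e'))\<^sup>2)"
  proof -
    have "D + \<eta> * (c * D + b) + (\<eta> * X)\<^sup>2 = (1 + \<eta> * c) * D + \<eta> * (b + \<eta> * X\<^sup>2)" for D c b X :: real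
      by (simp add: power2_eq_square algebra_simps)
    then show ?thesis .
  qed
  finally show ?thesis unfolding eq d_def .
qed

end

section \<open>Convergence of the scheme\<close>

text \<open>
  On bounded frequencies the \<open>w\<close>-norm is controlled by the \<open>L\<^sup>2\<close> norm and hence converges; Fatou's lemma
  removes the bound.
\<close>

lemma weighted_norm_lower_semicontinuous:
  assumes f: "\<And>n. f n \<in> L2" and g: "g \<in> L2" and l: "(\<lambda>n. nL2 (\<lambda>x. f n x - g x)) \<longlonglongrightarrow> 0"
    and w: "weight a w" and wf: "\<And>n. wn w (f n) \<in> L2" and b: "\<And>n. (nL2 (wn w (f n)))\<^sup>2 \<le> c n" and c: "c \<longlonglongrightarrow> c'"
  shows "wn w g \<in> L2" "(nL2 (wn w g))\<^sup>2 \<le> c'"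
proof -
  have [measurable]: "w \<in> borel_measurable borel" using w by (simp add: weight_def)
  note [measurable] = L2_measurable[OF g]
  have W: "0 \<le> w \<bar>x\<bar>" for x by (rule weight_nonneg[OF w])
  have c0: "0 \<le> c n" for n using order_trans[OF zero_le_power2 b[of n]] .
  have c'0: "0 \<le> c'" by (rule LIMSEQ_le_const[OF c]) (use c0 in auto)
  have cutb: "cut R (wn w h) \<in> L2 \<and> nL2 (cut R (wn w h)) \<le> sqrt (w R) * nL2 h" if h: "h \<in> L2" and R: "0 \<le> R" for h and R :: real
  proof -
    note [measurable] = L2_measurable[OF h]
    have wR: "0 \<le> w R" using w R by (simp add: weight_def)
    have le: "cmod (cut R (wn w h) x) \<le> sqrt (w R) * cmod (h x)" for x
    proof (cases "\<bar>x\<bar> \<le> R")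
      case True
      then have "w \<bar>x\<bar> \<le> w R" using w by (simp add: weight_def)
      then have "sqrt (w \<bar>x\<bar>) * cmod (h x) \<le> sqrt (w R) * cmod (h x)" by (intro mult_right_mono) auto
      then show ?thesis using True W[of x] by (simp add: cut_def wn_def norm_mult)
    qed (use wR in \<open>simp add: cut_def\<close>)
    have "nL2 (cut R (wn w h)) \<le> nL2 (\<lambda>x. complex_of_real (sqrt (w R)) * h x)"
      by (rule nL2_mono[OF L2_cmult[OF h]]) (use le wR in \<open>auto simp: norm_mult\<close>)
    then show ?thesis using L2_bound[OF h _ le] wR by (simp add: nL2_cmult)
  qed
  have R: "nL2 (cut (real R) (wn w g)) \<le> sqrt c'" for R :: nat
  proof (rule LIMSEQ_le_const)
    have "(\<lambda>n. sqrt (c n) + sqrt (w (real R)) * nL2 (\<lambda>x. f n x - g x)) \<longlonglongrightarrow> sqrt c' + sqrt (w (real R)) * 0"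
      by (intro tendsto_intros c l)
    then show "(\<lambda>n. sqrt (c n) + sqrt (w (real R)) * nL2 (\<lambda>x. f n x - g x)) \<longlonglongrightarrow> sqrt c'" by simp
    have "nL2 (cut (real R) (wn w g)) \<le> sqrt (c n) + sqrt (w (real R)) * nL2 (\<lambda>x. f n x - g x)" for n
    proof -
      have e: "cut (real R) (wn w g) = (\<lambda>x. cut (real R) (wn w (f n)) x - cut (real R) (wn w (\<lambda>x. f n x - g x)) x)"
        by (auto simp: cut_def wn_def fun_eq_iff algebra_simps)
      have d: "(\<lambda>x. f n x - g x) \<in> L2" using f g by (intro L2_diff)
      have "nL2 (cut (real R) (wn w g)) \<le> nL2 (cut (real R) (wn w (f n))) + nL2 (cut (real R) (wn w (\<lambda>x. f n x - g x)))"
        by (subst e, rule nL2_triangle_minus) (use cutb[OF d] wf cut_L2 in auto)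
      moreover have "nL2 (cut (real R) (wn w (f n))) \<le> nL2 (wn w (f n))"
        by (rule nL2_mono[OF wf]) (use L2_measurable[OF wf] in \<open>auto simp: cut_def\<close>)
      moreover have "nL2 (wn w (f n)) \<le> sqrt (c n)" using b[of n] by (rule real_le_rsqrt)
      moreover have "nL2 (cut (real R) (wn w (\<lambda>x. f n x - g x))) \<le> sqrt (w (real R)) * nL2 (\<lambda>x. f n x - g x)" using cutb[OF d] by simp
      ultimately show ?thesis by linarith
    qed
    then show "\<exists>N. \<forall>n\<ge>N. nL2 (cut (real R) (wn w g)) \<le> sqrt (c n) + sqrt (w (real R)) * nL2 (\<lambda>x. f n x - g x)" by blast
  qed
  have "(\<integral>\<^sup>+x. ennreal ((cmod (wn w g x))\<^sup>2) \<partial>lborel) = (\<integral>\<^sup>+x. liminf (\<lambda>R. ennreal ((cmod (cut (real R) (wn w g) x))\<^sup>2)) \<partial>lborel)"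
  proof (rule nn_integral_cong)
    fix x
    obtain k :: nat where k: "\<bar>x\<bar> \<le> real k" using real_arch_simple by blast
    have "eventually (\<lambda>R. ennreal ((cmod (cut (real R) (wn w g) x))\<^sup>2) = ennreal ((cmod (wn w g x))\<^sup>2)) sequentially"
      unfolding eventually_sequentially using k by (intro exI[of _ k]) (auto simp: cut_def)
    then have "(\<lambda>R. ennreal ((cmod (cut (real R) (wn w g) x))\<^sup>2)) \<longlonglongrightarrow> ennreal ((cmod (wn w g x))\<^sup>2)" by (rule tendsto_eventually)
    then show "ennreal ((cmod (wn w g x))\<^sup>2) = liminf (\<lambda>R. ennreal ((cmod (cut (real R) (wn w g) x))\<^sup>2))"
      by (intro lim_imp_Liminf[symmetric]) auto
  qed
  also have "\<dots> \<le> liminf (\<lambda>R. \<integral>\<^sup>+x. ennreal ((cmod (cut (real R) (wn w g) x))\<^sup>2) \<partial>lborel)"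
    by (rule nn_integral_liminf) measurable
  also have "\<dots> \<le> ennreal ((sqrt c')\<^sup>2)"
  proof -
    have "(\<integral>\<^sup>+x. ennreal ((cmod (cut (real R) (wn w g) x))\<^sup>2) \<partial>lborel) \<le> ennreal ((sqrt c')\<^sup>2)" for R :: nat
    proof -
      have "(\<integral>\<^sup>+x. ennreal ((cmod (cut (real R) (wn w g) x))\<^sup>2) \<partial>lborel) = ennreal ((nL2 (cut (real R) (wn w g)))\<^sup>2)"
        by (rule nn_L2) (use cutb[OF g] in simp)
      also have "\<dots> \<le> ennreal ((sqrt c')\<^sup>2)" by (intro ennreal_leI power_mono R) simp
      finally show ?thesis .
    qed
    then show ?thesis
      using Liminf_mono[of "\<lambda>R. \<integral>\<^sup>+x. ennreal ((cmod (cut (real R) (wn w g) x))\<^sup>2) \<partial>lborel" "\<lambda>_. ennreal ((sqrt c')\<^sup>2)" sequentially]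
      by (simp add: Liminf_const)
  qed
  finally have fin: "(\<integral>\<^sup>+x. ennreal ((cmod (wn w g x))\<^sup>2) \<partial>lborel) \<le> ennreal ((sqrt c')\<^sup>2)" .
  have sc: "0 \<le> sqrt c'" using c'0 by simp
  have wm: "wn w g \<in> borel_measurable borel" by measurable
  show "wn w g \<in> L2" by (rule L2_of_nn(1)[OF wm fin sc])
  have "nL2 (wn w g) \<le> sqrt c'" by (rule L2_of_nn(2)[OF wm fin sc])
  from power_mono[OF this nL2_nonneg, of 2] show "(nL2 (wn w g))\<^sup>2 \<le> c'" using c'0 by simp
qed

text \<open>
  The \<open>H\<^sup>t\<close> norm over frequencies up to \<open>R\<close>. It is continuous in \<open>L\<^sup>2\<close>, so that limits in \<open>L\<^sup>2\<close> can be taken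
  in it before \<open>R\<close> tends to infinity.
\<close>

definition Hcut :: "real \<Rightarrow> real \<Rightarrow> (real \<Rightarrow> complex) \<Rightarrow> real" where "Hcut t R f = nL2 (cut R (wn (hw t) f))"

lemma Hcut_bound:
  assumes f: "f \<in> L2" and t: "0 \<le> t" and R: "0 \<le> R"
  shows "cut R (wn (hw t) f) \<in> L2" "Hcut t R f \<le> sqrt (hw t R) * nL2 f"
proof -
  note [measurable] = L2_measurable[OF f]
  have le: "cmod (cut R (wn (hw t) f) x) \<le> sqrt (hw t R) * cmod (f x)" for x
  proof (cases "\<bar>x\<bar> \<le> R")
    case True
    then have "hw t x \<le> hw t R" using t by (auto simp: hw_def intro!: powr_mono2)
    then have "sqrt (hw t x) * cmod (f x) \<le> sqrt (hw t R) * cmod (f x)" by (intro mult_right_mono) auto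
    then show ?thesis using True by (simp add: cut_def wn_def norm_mult)
  qed (simp add: cut_def)
  show "cut R (wn (hw t) f) \<in> L2" by (rule L2_bound[OF f _ le]) measurable
  have "nL2 (cut R (wn (hw t) f)) \<le> nL2 (\<lambda>x. complex_of_real (sqrt (hw t R)) * f x)"
    by (rule nL2_mono[OF L2_cmult[OF f]]) (use le in \<open>auto simp: norm_mult\<close>)
  then show "Hcut t R f \<le> sqrt (hw t R) * nL2 f" by (simp add: nL2_cmult Hcut_def)
qed

lemma Hcut_nonneg [simp]: "0 \<le> Hcut t R f" by (simp add: Hcut_def)

lemma cut_wn_add: "cut R (wn w (\<lambda>x. f x + g x)) = (\<lambda>x. cut R (wn w f) x + cut R (wn w g) x)"
  by (auto simp: cut_def wn_def fun_eq_iff algebra_simps)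
lemma cut_wn_cmult: "cut R (wn w (\<lambda>x. c * f x)) = (\<lambda>x. c * cut R (wn w f) x)"
  by (auto simp: cut_def wn_def fun_eq_iff algebra_simps)

lemma Hcut_add:
  assumes "f \<in> L2" "g \<in> L2" "0 \<le> t" "0 \<le> R" shows "Hcut t R (\<lambda>x. f x + g x) \<le> Hcut t R f + Hcut t R g"
  unfolding Hcut_def cut_wn_add by (intro nL2_triangle Hcut_bound assms)

lemma Hcut_cmult: "Hcut t R (\<lambda>x. c * f x) = cmod c * Hcut t R f"
  unfolding Hcut_def cut_wn_cmult nL2_cmult ..

lemma Hcut_diff_triangle:
  assumes "f \<in> L2" "g \<in> L2" "h \<in> L2" "0 \<le> t" "0 \<le> R"
  shows "Hcut t R (\<lambda>x. f x - h x) \<le> Hcut t R (\<lambda>x. f x - g x) + Hcut t R (\<lambda>x. g x - h x)"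
  using Hcut_add[OF L2_diff[OF assms(1,2)] L2_diff[OF assms(2,3)] assms(4,5)] by simp

lemma Hcut_sum:
  assumes f: "\<And>i. i < m \<Longrightarrow> f i \<in> L2 \<and> Hcut t R (f i) \<le> c" and t: "0 \<le> t" "0 \<le> R"
  shows "(\<lambda>x. \<Sum>i<m. f i x) \<in> L2 \<and> Hcut t R (\<lambda>x. \<Sum>i<m. f i x) \<le> real m * c"
  using f
proof (induction m)
  case 0
  have "cut R (wn (hw t) (\<lambda>x. 0)) = (\<lambda>x. 0)" by (auto simp: cut_def wn_def)
  then show ?case by (simp add: Hcut_def nL2_def)
next
  case (Suc m)
  then have IH: "(\<lambda>x. \<Sum>i<m. f i x) \<in> L2" "Hcut t R (\<lambda>x. \<Sum>i<m. f i x) \<le> real m * c" and m: "f m \<in> L2" "Hcut t R (f m) \<le> c" by auto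
  show ?case using L2_add[OF IH(1) m(1)] Hcut_add[OF IH(1) m(1) t] IH(2) m(2) by (simp add: algebra_simps)
qed

text \<open>
  Enforces Hermitian symmetry at every frequency; a limit in \<open>L\<^sup>2\<close> of Hermitian functions has it only
  almost everywhere.
\<close>

definition herm_part :: "(real \<Rightarrow> complex) \<Rightarrow> real \<Rightarrow> complex" where
  "herm_part g k = complex_of_real (1/2) * (g k + cnj (g (- k)))"

lemma herm_part_herm: "herm (herm_part g)" by (simp add: herm_def herm_part_def add.commute)

lemma herm_part_L2: "g \<in> L2 \<Longrightarrow> herm_part g \<in> L2"
  unfolding herm_part_def[abs_def] by (intro L2_cmult L2_add L2_cnj L2_reflect)

lemma herm_part_dist:
  assumes v: "herm v" "v \<in> L2" and g: "g \<in> L2" shows "nL2 (\<lambda>k. v k - herm_part g k) \<le> nL2 (\<lambda>k. v k - g k)"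
proof -
  define d where "d k = v k - g k" for k
  have d2: "d \<in> L2" unfolding d_def[abs_def] by (intro L2_diff v g)
  have e: "v k - herm_part g k = complex_of_real (1/2) * (d k + cnj (d (- k)))" for k
    using v(1) unfolding herm_def herm_part_def d_def by (simp add: algebra_simps)
  have "nL2 (\<lambda>k. cnj (d (- k))) = nL2 d" using nL2_reflect[of d] nL2_cnj[of "\<lambda>k. d (- k)"] by simp
  then have "nL2 (\<lambda>k. d k + cnj (d (- k))) \<le> 2 * nL2 d" using nL2_triangle[OF d2 L2_cnj[OF L2_reflect[OF d2]]] by simp
  moreover have "nL2 (\<lambda>k. v k - herm_part g k) = 1 / 2 * nL2 (\<lambda>k. d k + cnj (d (- k)))" unfolding e nL2_cmult norm_of_real by simp
  moreover have "nL2 (\<lambda>k. v k - g k) = nL2 d" by (simp add: d_def[abs_def])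
  ultimately show ?thesis by linarith
qed

context euler
begin

lemma Fq_remainder:
  assumes N: "0 < N" and v: "good v"
  shows "nL2 (\<lambda>k. Fq \<sigma> {-real N..real N} v k - Fq \<sigma> UNIV v k) \<le> 64 * cJ s * \<beta>\<^sup>2 / N"
proof -
  have v': "inH s v" "Hn s v \<le> 2 * \<beta>" using v by (auto simp: good_def)
  have e: "Fq \<sigma> {-real N..real N} v k - Fq \<sigma> UNIV v k = (complex_of_real \<sigma> * \<i>) * (complex_of_real k * (Q UNIV v v k - Q {-real N..real N} v v k))" for k
    by (simp add: Fq_def algebra_simps)
  have "nL2 (\<lambda>k. Fq \<sigma> {-real N..real N} v k - Fq \<sigma> UNIV v k) = nL2 (\<lambda>k. complex_of_real k * (Q UNIV v v k - Q {-real N..real N} v v k))"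
    unfolding e nL2_cmult using \<sigma> by (simp add: norm_mult)
  also have "\<dots> \<le> 16 * cJ s / N * (Hn s v)\<^sup>2" by (rule Q_remainder(2)[OF s _ v'(1)]) (use N in simp)
  also have "\<dots> \<le> 16 * cJ s / N * (2 * \<beta>)\<^sup>2" using v' cJ_pos[of s] by (intro mult_left_mono power_mono) auto
  also have "\<dots> = 64 * cJ s * \<beta>\<^sup>2 / N" by (simp add: power_mult_distrib)
  finally show ?thesis .
qed

definition "err_const = 64 * cJ s * \<beta>\<^sup>2 + 16 * cF s * \<beta> * \<alpha>\<^sup>2"

lemma err_const_nonneg: "0 \<le> err_const" unfolding err_const_def using cJ_pos[of s] cF_nonneg[of s] ab by (auto intro!: add_nonneg_nonneg)

text \<open>
  The increment of a truncated Euler step, computed at the beginning of the step, against the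
  nonlinearity at an intermediate state: a truncation error and the effect of the displacement within the
  step, both \<open>O(1/N)\<close>.
\<close>

lemma approx_err:
  assumes ok: "steps_ok N M" and j: "j < M" and \<theta>: "0 \<le> \<theta>" "\<theta> \<le> T / M"
  defines "V \<equiv> \<lambda>k. U N M j k + complex_of_real \<theta> * Fq \<sigma> {-real N..real N} (U N M j) k"
  shows "nL2 (\<lambda>k. Fq \<sigma> {-real N..real N} (U N M j) k - Fq \<sigma> UNIV V k) \<le> err_const / N"
proof -
  let ?u = "U N M j"
  have N: "0 < N" and M: "0 < M" and c: "T / M * cN s N \<le> 1 / N" using ok by (auto simp: steps_ok_def)
  have gu: "good ?u" using iterate_good[OF ok, of j] j by simp
  have gV: "good V" unfolding V_def by (rule partial_step(1)[OF ok j \<theta>])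
  note u = gu[unfolded good_def] note v = gV[unfolded good_def]
  have "nL2 (\<lambda>k. Fq \<sigma> UNIV ?u k - Fq \<sigma> UNIV V k) \<le> 16 * cF s * \<beta> * \<alpha>\<^sup>2 / N"
  proof -
    have d: "Hn s (\<lambda>k. ?u k - V k) \<le> 4 * \<alpha>\<^sup>2 / N"
    proof -
      have "(\<lambda>k. ?u k - V k) = (\<lambda>k. complex_of_real (- \<theta>) * Fq \<sigma> {-real N..real N} ?u k)" unfolding V_def by auto
      then have "Hn s (\<lambda>k. ?u k - V k) = \<theta> * Hn s (Fq \<sigma> {-real N..real N} ?u)" using \<theta> by (simp only: Hn_cmult norm_of_real) simp
      moreover have F1: "Hn s (Fq \<sigma> {-real N..real N} ?u) \<le> cN s N * (nL2 ?u)\<^sup>2"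
        unfolding Hn_def by (rule Fq_trunc(2)) (use s \<sigma> u inH_L2 in auto)
      have F2: "cN s N * (nL2 ?u)\<^sup>2 \<le> cN s N * (2*\<alpha>)\<^sup>2" using u cN_nonneg[of N s] by (intro mult_left_mono power_mono) auto
      ultimately have "Hn s (\<lambda>k. ?u k - V k) \<le> \<theta> * (cN s N * (2*\<alpha>)\<^sup>2)"
        using mult_left_mono[OF order_trans[OF F1 F2] \<theta>(1)] by (simp only:)
      also have "\<dots> \<le> T / M * (cN s N * (2*\<alpha>)\<^sup>2)" using \<theta> cN_nonneg[of N s] by (intro mult_right_mono) auto
      also have "\<dots> = (T / M * cN s N) * (2*\<alpha>)\<^sup>2" by simp
      also have "\<dots> \<le> 1 / N * (2*\<alpha>)\<^sup>2" by (rule mult_right_mono[OF c]) simp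
      finally show ?thesis by (simp add: power_mult_distrib)
    qed
    have i: "inH (s - 1) (\<lambda>k. Fq \<sigma> UNIV ?u k - Fq \<sigma> UNIV V k)"
      using u v by (intro inH_diff Fq_H(1)[OF s symset_UNIV _ \<sigma>]) auto
    have "nL2 (\<lambda>k. Fq \<sigma> UNIV ?u k - Fq \<sigma> UNIV V k) \<le> Hn (s - 1) (\<lambda>k. Fq \<sigma> UNIV ?u k - Fq \<sigma> UNIV V k)"
      by (rule nL2_le_Hn[OF i])
    also have "\<dots> \<le> cF s * ((Hn s ?u + Hn s V) * Hn s (\<lambda>k. ?u k - V k))"
      using u v by (intro Fq_diff_H s symset_UNIV \<sigma>) auto
    also have "\<dots> \<le> cF s * ((2*\<beta> + 2*\<beta>) * (4 * \<alpha>\<^sup>2 / N))"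
      using u v d ab cF_nonneg[of s] by (intro mult_left_mono mult_mono add_mono) auto
    also have "\<dots> = 16 * cF s * \<beta> * \<alpha>\<^sup>2 / N" by simp
    finally show ?thesis .
  qed
  moreover have "nL2 (\<lambda>k. Fq \<sigma> {-real N..real N} ?u k - Fq \<sigma> UNIV V k) \<le> nL2 (\<lambda>k. Fq \<sigma> {-real N..real N} ?u k - Fq \<sigma> UNIV ?u k) + nL2 (\<lambda>k. Fq \<sigma> UNIV ?u k - Fq \<sigma> UNIV V k)"
    by (intro nL2_triangle_diff good_F gu gV symset_UNIV symset_Icc)
  moreover note Fq_remainder[OF N gu]
  ultimately show ?thesis unfolding err_const_def by (simp add: add_divide_distrib)
qed

text \<open>
  The scheme with \<open>M\<close> steps, refined to \<open>M M'\<close> instants by linear interpolation inside each step.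
  Refining a second scheme with \<open>M'\<close> steps by the factor \<open>M\<close> puts both on the same grid.
\<close>

definition refined :: "nat \<Rightarrow> nat \<Rightarrow> nat \<Rightarrow> nat \<Rightarrow> real \<Rightarrow> complex" where
  "refined N M M' i = (\<lambda>k. U N M (i div M') k + complex_of_real (real (i mod M') * (T / (real M * real M'))) * Fq \<sigma> {-real N..real N} (U N M (i div M')) k)"

lemma refined_step:
  assumes M: "0 < M" "0 < M'"
  shows "refined N M M' (Suc i) = (\<lambda>k. refined N M M' i k + complex_of_real (T / (real M * real M')) * Fq \<sigma> {-real N..real N} (U N M (i div M')) k)"
proof (cases "Suc (i mod M') = M'")
  case False
  then have "Suc i div M' = i div M'" "Suc i mod M' = Suc (i mod M')" by (auto simp: div_Suc mod_Suc)
  moreover have "complex_of_real (real (Suc m) * c) = complex_of_real (real m * c) + complex_of_real c" for m c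
    unfolding of_real_add[symmetric] of_real_eq_iff by (simp add: algebra_simps)
  ultimately show ?thesis unfolding refined_def by (simp only: distrib_right add.assoc)
next
  case True
  then have d: "Suc i div M' = Suc (i div M')" "Suc i mod M' = 0" by (auto simp: div_Suc mod_Suc)
  have "real (i mod M') + 1 = real M'" using True by linarith
  then have C: "complex_of_real (T / real M) = complex_of_real (real (i mod M') * (T / (real M * real M'))) + complex_of_real (T / (real M * real M'))"
  proof -
    have "real (i mod M') * (T / (real M * real M')) + T / (real M * real M') = (real (i mod M') + 1) * (T / (real M * real M'))" by (simp only: distrib_right mult_1)
    also have "\<dots> = T / real M" using M \<open>real (i mod M') + 1 = real M'\<close> by simp
    finally show ?thesis by (metis of_real_add)
  qed
  show ?thesis unfolding refined_def d euler_iterate.simps(2) C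
    by (simp only: of_nat_0 mult_zero_left of_real_0 add_0_right distrib_right add.assoc)
qed

lemma refined_theta:
  assumes M: "0 < M" "0 < M'" shows "0 \<le> real (i mod M') * (T / (real M * real M'))" "real (i mod M') * (T / (real M * real M')) \<le> T / M"
proof -
  show "0 \<le> real (i mod M') * (T / (real M * real M'))" using \<gamma> by simp
  have "real (i mod M') \<le> real M'" using M by (simp add: less_imp_le)
  then have "real (i mod M') * (T / (real M * real M')) \<le> real M' * (T / (real M * real M'))" using \<gamma> by (intro mult_right_mono) auto
  then show "real (i mod M') * (T / (real M * real M')) \<le> T / M" using M by simp
qed

lemma refined_good:
  assumes ok: "steps_ok N M" and M': "0 < M'" and i: "i \<le> M * M'"
  shows "good (refined N M M' i)" "nL2 (\<lambda>k. refined N M M' i k - U N M (i div M') k) \<le> LF / N"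
    "i < M * M' \<Longrightarrow> nL2 (\<lambda>k. Fq \<sigma> {-real N..real N} (U N M (i div M')) k - Fq \<sigma> UNIV (refined N M M' i) k) \<le> err_const / N"
proof -
  have M: "0 < M" and N: "0 < N" and h: "T / M \<le> 1 / N" using ok by (auto simp: steps_ok_def)
  note th = refined_theta[OF M M', of i]
  have lt: "i div M' < M" if "i < M * M'" using that M' by (simp add: less_mult_imp_div_less)
  have last: "i = M * M'" if "\<not> i < M * M'" using that i by simp
  show "good (refined N M M' i)"
  proof (cases "i < M * M'")
    case True
    then show ?thesis unfolding refined_def by (intro partial_step(1)[OF ok lt th])
  next
    case False
    then show ?thesis using last iterate_good(1)[OF ok, of M] M' unfolding refined_def by simp
  qed
  have dle: "i div M' \<le> M" using lt last M' by (cases "i < M * M'") auto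
  have "nL2 (\<lambda>k. refined N M M' i k - U N M (i div M') k) = real (i mod M') * (T / (real M * real M')) * nL2 (Fq \<sigma> {-real N..real N} (U N M (i div M')))"
    unfolding refined_def using th(1) by (simp only: add_diff_cancel_left' nL2_cmult norm_of_real abs_of_nonneg)
  also have "\<dots> \<le> (1 / N) * LF"
    using th h good_F(2)[OF iterate_good(1)[OF ok dle] symset_Icc] by (intro mult_mono) auto
  finally show "nL2 (\<lambda>k. refined N M M' i k - U N M (i div M') k) \<le> LF / N" by simp
  show "nL2 (\<lambda>k. Fq \<sigma> {-real N..real N} (U N M (i div M')) k - Fq \<sigma> UNIV (refined N M M' i) k) \<le> err_const / N" if "i < M * M'"
    unfolding refined_def by (rule approx_err[OF ok lt[OF that] th])
qed

text \<open>
  The exponential factor of Gronwall's inequality times the accumulated errors.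
\<close>

definition "C0 = exp (cJ s * (4*\<beta>) * T) * (T * (8 * \<alpha> * err_const + (2 * LF + 2 * err_const)\<^sup>2))"

lemma C0_nonneg: "0 \<le> C0"
  unfolding C0_def using \<gamma> ab err_const_nonneg by (auto intro!: mult_nonneg_nonneg add_nonneg_nonneg)

text \<open>
  A discrete Gronwall inequality on the common grid: the initial difference vanishes and every step adds
  an error of order \<open>1/N + 1/N'\<close>, amplified by at most \<open>exp (c T)\<close>.
\<close>

lemma schemes_close:
  assumes ok: "steps_ok N M" and ok': "steps_ok N' M'" and i: "i \<le> M * M'"
  shows "(nL2 (\<lambda>k. refined N M M' i k - refined N' M' M i k))\<^sup>2 \<le> C0 * (1 / N + 1 / N')"
proof -
  have M: "0 < M" "0 < M'" and N: "0 < N" "0 < N'" and h: "T / M \<le> 1 / N" using ok ok' by (auto simp: steps_ok_def)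
  (* The mesh of the common grid. *)
  define \<eta> where "\<eta> = T / (real M * real M')"
  have \<eta>: "0 \<le> \<eta>" using \<gamma> by (simp add: \<eta>_def)
  have \<eta>N: "\<eta> \<le> 1 / N"
  proof -
    have "\<eta> = T / M / M'" by (simp add: \<eta>_def)
    also have "\<dots> \<le> T / M / 1" using M \<gamma> by (intro divide_left_mono) auto
    finally show ?thesis using h by simp
  qed
  define c1 where "c1 = cJ s * (4*\<beta>)"
  have c1: "0 \<le> c1" unfolding c1_def using cJ_pos[of s] ab by simp
  define e where "e = err_const / N" define e' where "e' = err_const / N'"
  have e0: "0 \<le> e" "0 \<le> e'" "e \<le> err_const" "e' \<le> err_const" unfolding e_def e'_def using err_const_nonneg N
    by (auto simp: divide_le_eq intro: order_trans[OF _ mult_left_mono[of 1]])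
  define B where "B = 8 * \<alpha> * (e + e') + \<eta> * (2 * LF + (e + e'))\<^sup>2"
  have B0: "0 \<le> B" unfolding B_def using ab e0 \<eta> by simp
  define D where "D i = (nL2 (\<lambda>k. refined N M M' i k - refined N' M' M i k))\<^sup>2" for i
  have D: "D i \<le> (1 + \<eta> * c1) ^ i * (i * (\<eta> * B))" if "i \<le> M * M'" for i
    using that
  proof (induction i)
    case 0 then show ?case by (simp add: D_def refined_def nL2_def)
  next
    case (Suc i)
    have iM: "i \<le> M * M'" "i \<le> M' * M" "i < M * M'" "i < M' * M" using Suc.prems by (auto simp: mult.commute)
    have dle: "i div M' \<le> M" "i div M \<le> M'" using iM M
      by (auto simp: div_le_mono2 less_imp_le less_mult_imp_div_less)
    have \<eta>': "T / (real M' * real M) = \<eta>" by (simp add: \<eta>_def mult.commute)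
    have "D (Suc i) \<le> (1 + \<eta> * c1) * D i + \<eta> * B"
      unfolding D_def refined_step[OF M] refined_step[OF M(2,1)] \<eta>' unfolding \<eta>_def[symmetric] c1_def B_def
      by (rule difference_step[OF refined_good(1)[OF ok M(2) iM(1)] refined_good(1)[OF ok' M(1) iM(2)] good_F(1)[OF iterate_good(1)[OF ok dle(1)] symset_Icc] good_F(1)[OF iterate_good(1)[OF ok' dle(2)] symset_Icc] \<eta>])
         (use refined_good(3)[OF ok M(2) iM(1,3)] refined_good(3)[OF ok' M(1) iM(2,4)] in \<open>simp_all add: e_def e'_def\<close>)
    also have "\<dots> \<le> (1 + \<eta> * c1) * ((1 + \<eta> * c1) ^ i * (i * (\<eta> * B))) + (1 + \<eta> * c1) ^ Suc i * (\<eta> * B)"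
    proof -
      have "1 \<le> (1 + \<eta> * c1) ^ Suc i" using \<eta> c1 by (intro one_le_power) simp
      then have "1 * (\<eta> * B) \<le> (1 + \<eta> * c1) ^ Suc i * (\<eta> * B)" using \<eta> B0 by (intro mult_right_mono) auto
      then show ?thesis using Suc.IH[OF iM(1)] \<eta> c1 by (intro add_mono mult_left_mono) auto
    qed
    also have "\<dots> = (1 + \<eta> * c1) ^ Suc i * (Suc i * (\<eta> * B))" by (simp add: algebra_simps)
    finally show ?case .
  qed
  have i\<eta>: "real i * \<eta> \<le> T"
  proof -
    have "real i * \<eta> \<le> real (M * M') * \<eta>" using i \<eta> by (intro mult_right_mono of_nat_mono) auto
    also have "\<dots> = T" unfolding \<eta>_def using M by simp
    finally show ?thesis .
  qed
  have ex: "(1 + \<eta> * c1) ^ i \<le> exp (c1 * T)"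
  proof -
    have "(1 + \<eta> * c1) ^ i \<le> exp (\<eta> * c1) ^ i" using \<eta> c1 by (intro power_mono exp_ge_add_one_self) auto
    also have "\<dots> = exp (real i * (\<eta> * c1))" by (rule exp_of_nat_mult[symmetric])
    also have "real i * (\<eta> * c1) = c1 * (real i * \<eta>)" by simp
    also have "exp (c1 * (real i * \<eta>)) \<le> exp (c1 * T)" using mult_left_mono[OF i\<eta> c1] by simp
    finally show ?thesis .
  qed
  have Bb: "B \<le> (8 * \<alpha> * err_const + (2 * LF + 2 * err_const)\<^sup>2) * (1 / N + 1 / N')"
  proof -
    have "\<eta> * (2 * LF + (e + e'))\<^sup>2 \<le> (1 / N + 1 / N') * (2 * LF + 2 * err_const)\<^sup>2"
    proof (rule mult_mono)
      have "0 \<le> 1 / real N'" by simp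
      then show "\<eta> \<le> 1 / N + 1 / N'" using \<eta>N by linarith
    qed (use e0 LF_nonneg in \<open>auto intro!: power_mono\<close>)
    moreover have "8 * \<alpha> * (e + e') = 8 * \<alpha> * err_const * (1 / N + 1 / N')" by (simp add: e_def e'_def algebra_simps)
    ultimately show ?thesis unfolding B_def by (simp add: algebra_simps)
  qed
  have "D i \<le> (1 + \<eta> * c1) ^ i * (real i * \<eta> * B)" using D[OF i] by (simp add: mult.assoc)
  also have "\<dots> \<le> exp (c1 * T) * (T * B)"
    using ex i\<eta> B0 \<eta> c1 \<gamma>(2) by (intro mult_mono) auto
  also have "\<dots> \<le> exp (c1 * T) * (T * ((8 * \<alpha> * err_const + (2 * LF + 2 * err_const)\<^sup>2) * (1 / N + 1 / N')))"
    using Bb \<gamma> by (intro mult_left_mono) auto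
  also have "\<dots> = C0 * (1 / N + 1 / N')" unfolding C0_def c1_def by (simp only: mult.assoc)
  finally show ?thesis unfolding D_def .
qed

text \<open>
  The last of \<open>M\<close> equidistant instants in \<open>[0, T]\<close> that does not exceed \<open>t\<close>.
\<close>

definition grid_index :: "nat \<Rightarrow> real \<Rightarrow> nat" where "grid_index M t = nat \<lfloor>t * M / T\<rfloor>"

lemma grid_index_le: assumes "t \<le> T" "0 < M" shows "grid_index M t \<le> M"
proof -
  have "t * M / T \<le> real M" using assms \<gamma> by (simp add: divide_le_eq mult_right_mono)
  then have "\<lfloor>t * M / T\<rfloor> \<le> int M" by (simp add: floor_le_iff)
  then show ?thesis unfolding grid_index_def by linarith
qed

lemma grid_index_div: assumes "0 < M'" "0 \<le> t" shows "grid_index (M * M') t div M' = grid_index M t"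
proof -
  have "t * M / T = (t * real (M * M') / T) / real_of_int (int M')" using assms by simp
  then have "\<lfloor>t * M / T\<rfloor> = \<lfloor>t * real (M * M') / T\<rfloor> div int M'"
    by (simp only: floor_divide_real_eq_div[of "int M'"] of_nat_0_le_iff)
  then show ?thesis unfolding grid_index_def by (simp add: nat_div_distrib')
qed

lemma grid_index_bounds: assumes "0 \<le> t" "0 < M" shows "grid_index M t * (T / M) \<le> t" "t < (grid_index M t + 1) * (T / M)"
proof -
  have n: "0 \<le> t * M / T" using assms \<gamma> by simp
  have r: "real (grid_index M t) = of_int \<lfloor>t * M / T\<rfloor>" unfolding grid_index_def using n by simp
  have "real (grid_index M t) \<le> t * M / T" unfolding r by simp
  then show "grid_index M t * (T / M) \<le> t" using assms \<gamma> by (simp add: field_simps)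
  have "t * M / T < real (grid_index M t) + 1" unfolding r by linarith
  then show "t < (grid_index M t + 1) * (T / M)" using assms \<gamma> by (simp add: field_simps)
qed

lemma grid_index_mono: "t \<le> t' \<Longrightarrow> grid_index M t \<le> grid_index M t'"
  unfolding grid_index_def using \<gamma> by (intro nat_mono floor_mono divide_right_mono mult_right_mono) auto

lemma grid_index_grid: assumes "0 < M" shows "grid_index M (i * (T / M)) = i"
  unfolding grid_index_def using assms \<gamma> by simp

definition Ms :: "nat \<Rightarrow> nat" where "Ms n = (SOME M. steps_ok (Suc n) M)"
lemma Ms_ok: "steps_ok (Suc n) (Ms n)" unfolding Ms_def by (rule someI_ex[OF steps_exist]) simp
lemma Ms_pos: "0 < Ms n" "T / Ms n \<le> 1 / Suc n" using Ms_ok[of n] by (auto simp: steps_ok_def)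

text \<open>
  The piecewise constant interpolant in time. The cut-off starts at one, as it must be positive.
\<close>

definition approx :: "nat \<Rightarrow> real \<Rightarrow> real \<Rightarrow> complex" where "approx n t = U (Suc n) (Ms n) (grid_index (Ms n) t)"

lemma approx_good: assumes "t \<le> T"
  shows "good (approx n t)" "admissible w \<Longrightarrow> (nL2 (wn w (approx n t)))\<^sup>2 \<le> 3 * ((nL2 (wn w u0))\<^sup>2 + gap (Suc n))"
  unfolding approx_def using iterate_good[OF Ms_ok grid_index_le[OF assms Ms_pos(1)]] by auto

lemma good_L2: "good v \<Longrightarrow> v \<in> L2" by (auto simp: good_def inH_L2)

text \<open>
  The first term bounds the two displacements from the common grid to the coarse ones, the second comes
  from \<open>schemes_close\<close>.
\<close>

definition rate :: "nat \<Rightarrow> real" where "rate n = 2 * LF / Suc n + sqrt (2 * C0 / Suc n)"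

lemma rate_tendsto: "rate \<longlonglongrightarrow> 0"
proof -
  have i: "(\<lambda>n. inverse (real (Suc n))) \<longlonglongrightarrow> 0" by (rule LIMSEQ_inverse_real_of_nat)
  have "(\<lambda>n. 2 * LF * inverse (real (Suc n)) + sqrt (2 * C0 * inverse (real (Suc n)))) \<longlonglongrightarrow> 2 * LF * 0 + sqrt (2 * C0 * 0)"
    by (intro tendsto_intros i)
  then show ?thesis unfolding rate_def[abs_def] divide_inverse by simp
qed

lemma approx_cauchy:
  assumes t: "0 \<le> t" "t \<le> T" and nm: "n \<le> m" shows "nL2 (\<lambda>k. approx n t k - approx m t k) \<le> rate n"
proof -
  let ?M = "Ms n" and ?M' = "Ms m"
  define i where "i = grid_index (?M * ?M') t"
  have i: "i \<le> ?M * ?M'" "i \<le> ?M' * ?M" unfolding i_def using grid_index_le[OF t(2), of "?M * ?M'"] Ms_pos by (auto simp: mult.commute)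
  have d: "i div ?M' = grid_index ?M t" unfolding i_def by (rule grid_index_div[OF Ms_pos(1) t(1)])
  have d': "i div ?M = grid_index ?M' t" unfolding i_def by (subst mult.commute, rule grid_index_div[OF Ms_pos(1) t(1)])
  let ?W = "refined (Suc n) ?M ?M' i" and ?W' = "refined (Suc m) ?M' ?M i"
  have L: "?W \<in> L2" "?W' \<in> L2" "approx n t \<in> L2" "approx m t \<in> L2"
    using refined_good(1)[OF Ms_ok Ms_pos(1) i(1)] refined_good(1)[OF Ms_ok Ms_pos(1) i(2)] approx_good(1)[OF t(2)] good_L2 by auto
  have r: "1 / real (Suc m) \<le> 1 / real (Suc n)" using nm by (intro divide_left_mono) auto
  have 1: "nL2 (\<lambda>k. approx n t k - ?W k) \<le> LF / Suc n"
    using refined_good(2)[OF Ms_ok Ms_pos(1) i(1)] unfolding d approx_def by (subst nL2_minus_commute) simp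
  have "nL2 (\<lambda>k. ?W' k - approx m t k) \<le> LF / Suc m"
    using refined_good(2)[OF Ms_ok Ms_pos(1) i(2)] unfolding d' approx_def .
  also have "\<dots> \<le> LF / Suc n" using mult_left_mono[OF r LF_nonneg] by simp
  finally have 3: "nL2 (\<lambda>k. ?W' k - approx m t k) \<le> LF / Suc n" .
  have "(nL2 (\<lambda>k. ?W k - ?W' k))\<^sup>2 \<le> C0 * (1 / real (Suc n) + 1 / real (Suc m))" by (rule schemes_close[OF Ms_ok Ms_ok i(1)])
  also have "\<dots> \<le> C0 * (1 / real (Suc n) + 1 / real (Suc n))" by (intro mult_left_mono add_left_mono r C0_nonneg)
  also have "\<dots> = 2 * C0 / Suc n" by simp
  finally have 2: "nL2 (\<lambda>k. ?W k - ?W' k) \<le> sqrt (2 * C0 / Suc n)" by (rule real_le_rsqrt)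
  show ?thesis unfolding rate_def
    using nL2_triangle_diff[OF L(3,1,4)] nL2_triangle_diff[OF L(1,2,4)] 1 2 3 by simp
qed

text \<open>
  The limit is made Hermitian at every frequency, which does not increase the distance to the Hermitian
  approximations. At time zero the initial function itself is chosen, since the limit is determined only up
  to null sets.
\<close>

lemma limit_exists:
  "\<exists>u. u 0 = u0 \<and> (\<forall>t\<in>{0..T}. herm (u t) \<and> u t \<in> L2 \<and> (\<forall>n. nL2 (\<lambda>k. approx n t k - u t k) \<le> rate n))"
proof -
  have "\<forall>t\<in>{0..T}. \<exists>g. herm g \<and> g \<in> L2 \<and> (\<forall>n. nL2 (\<lambda>k. approx n t k - g k) \<le> rate n) \<and> (t = 0 \<longrightarrow> g = u0)"
  proof
    fix t assume "t \<in> {0..T}"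
    then have t: "0 \<le> t" "t \<le> T" by auto
    have v2: "approx n t \<in> L2" for n using approx_good(1)[OF t(2)] good_L2 by blast
    show "\<exists>g. herm g \<and> g \<in> L2 \<and> (\<forall>n. nL2 (\<lambda>k. approx n t k - g k) \<le> rate n) \<and> (t = 0 \<longrightarrow> g = u0)"
    proof (cases "t = 0")
      case True
      have "approx n t = u0" for n unfolding approx_def grid_index_def True by simp
      moreover have "0 \<le> rate n" for n unfolding rate_def using LF_nonneg C0_nonneg by simp
      ultimately show ?thesis using True hu0 inH_L2[OF u0] by (intro exI[of _ u0]) (simp add: nL2_def)
    next
      case False
      have "\<exists>g\<in>L2. (\<lambda>n. nL2 (\<lambda>k. approx n t k - g k)) \<longlonglongrightarrow> 0"
      proof (rule L2_complete[OF v2])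
        fix e :: real assume "e > 0"
        then obtain N where N': "\<forall>n\<ge>N. norm (rate n - 0) < e" using LIMSEQ_D[OF rate_tendsto] by blast
        have N: "rate n < e" if "n \<ge> N" for n using N'[rule_format, OF that] by simp
        have "nL2 (\<lambda>k. approx m t k - approx n t k) < e" if "m \<ge> N" "n \<ge> N" for m n
          using approx_cauchy[OF t, of m n] approx_cauchy[OF t, of n m] N[OF that(1)] N[OF that(2)] nL2_minus_commute[of "approx m t" "approx n t"]
          by (cases "m \<le> n") auto
        then show "\<exists>N. \<forall>m\<ge>N. \<forall>n\<ge>N. nL2 (\<lambda>k. approx m t k - approx n t k) < e" by blast
      qed
      then obtain g where g: "g \<in> L2" and gl: "(\<lambda>n. nL2 (\<lambda>k. approx n t k - g k)) \<longlonglongrightarrow> 0" by blast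
      have "nL2 (\<lambda>k. approx n t k - herm_part g k) \<le> rate n" for n
      proof -
        have "nL2 (\<lambda>k. approx n t k - herm_part g k) \<le> nL2 (\<lambda>k. approx n t k - g k)"
          using approx_good(1)[OF t(2)] by (intro herm_part_dist v2 g) (auto simp: good_def)
        also have "\<dots> \<le> rate n"
        proof (rule LIMSEQ_le_const)
          have "(\<lambda>m. rate n + nL2 (\<lambda>k. approx m t k - g k)) \<longlonglongrightarrow> rate n + 0" by (intro tendsto_intros gl)
          then show "(\<lambda>m. rate n + nL2 (\<lambda>k. approx m t k - g k)) \<longlonglongrightarrow> rate n" by simp
          show "\<exists>N. \<forall>m\<ge>N. nL2 (\<lambda>k. approx n t k - g k) \<le> rate n + nL2 (\<lambda>k. approx m t k - g k)"
          proof (intro exI[of _ n] allI impI)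
            fix m assume "n \<le> m"
            then show "nL2 (\<lambda>k. approx n t k - g k) \<le> rate n + nL2 (\<lambda>k. approx m t k - g k)"
              using nL2_triangle_diff[OF v2[of n] v2[of m] g] approx_cauchy[OF t, of n m] by simp
          qed
        qed
        finally show ?thesis .
      qed
      then show ?thesis using False herm_part_herm herm_part_L2[OF g] by blast
    qed
  qed
  from bchoice[OF this] obtain u where u: "\<forall>t\<in>{0..T}. herm (u t) \<and> u t \<in> L2 \<and> (\<forall>n. nL2 (\<lambda>k. approx n t k - u t k) \<le> rate n) \<and> (t = 0 \<longrightarrow> u t = u0)" by blast
  moreover have "u 0 = u0" using bspec[OF u, of 0] \<gamma> by simp
  ultimately show ?thesis by blast
qed

end

section \<open>Regularity of the limit\<close>

lemma inv_Suc_tendsto: "(\<lambda>n. inverse (real (Suc n))) \<longlonglongrightarrow> 0" by (rule LIMSEQ_inverse_real_of_nat)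

lemma half_cancel: "x \<noteq> 0 \<Longrightarrow> x * (y / (2 * x)) = y / 2" for x y :: real by simp

lemma euler_iterate_sum: "euler_iterate \<sigma> N h u0 (j + m) k = euler_iterate \<sigma> N h u0 j k + (\<Sum>i<m. complex_of_real h * Fq \<sigma> {-N..N} (euler_iterate \<sigma> N h u0 (j + i)) k)"
  by (induction m) (auto simp: add.assoc)

lemma inH_mono:
  assumes u: "inH s u" and t: "0 \<le> t" "t \<le> s" shows "inH t u"
proof (rule inH_I[OF L2_measurable[OF inH_L2[OF u]]])
  show "wn (hw t) u \<in> L2"
    by (rule wn_mono(1)[of "hw s" u "hw t" "sqrt 2"]) (use u hw_mono[OF t] L2_measurable[OF inH_L2[OF u]] in \<open>auto simp: inH_def\<close>)
qed

lemma Hcut_le_Hn: assumes "inH t f" shows "Hcut t R f \<le> Hn t f"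
proof -
  have w: "wn (hw t) f \<in> L2" using assms by (simp add: inH_def)
  note [measurable] = L2_measurable[OF w]
  show ?thesis unfolding Hcut_def Hn_def by (rule nL2_mono[OF w]) (auto simp: cut_def)
qed

lemma Hn_le_Hcut:
  assumes f: "inH t f" and b: "\<And>R. 0 \<le> R \<Longrightarrow> Hcut t R f \<le> c" shows "Hn t f \<le> c"
proof -
  have w: "wn (hw t) f \<in> L2" using f by (simp add: inH_def)
  have "(\<lambda>n. nL2 (cut (real n) (wn (hw t) f))) \<longlonglongrightarrow> nL2 (wn (hw t) f)"
    by (intro nL2_tendsto cut_L2 w tendsto_real_seq[OF cut_tendsto])
  then show ?thesis unfolding Hn_def by (rule LIMSEQ_le_const2) (use b in \<open>auto simp: Hcut_def\<close>)
qed

text \<open>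
  Low frequencies are controlled by the \<open>L\<^sup>2\<close> norm, high ones by the tail weight.
\<close>

lemma Hn_split:
  assumes s: "s > 0" and d: "inH s d" and R: "R > 0"
    and t: "wn (\<lambda>x. hw s x * tailw R x) d \<in> L2"
  shows "(Hn s d)\<^sup>2 \<le> hw s R * (nL2 d)\<^sup>2 + (nL2 (wn (\<lambda>x. hw s x * tailw R x) d))\<^sup>2"
proof -
  have w: "wn (hw s) d \<in> L2" "d \<in> L2" using d by (auto simp: inH_def)
  have tn: "0 \<le> tailw R \<bar>x\<bar>" for x using R by (simp add: tailw_def)
  have sq: "(cmod (wn (hw s) d x))\<^sup>2 = hw s x * (cmod (d x))\<^sup>2" "(cmod (wn (\<lambda>x. hw s x * tailw R x) d x))\<^sup>2 = hw s x * tailw R \<bar>x\<bar> * (cmod (d x))\<^sup>2" for x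
    using tn[of x] by (simp_all add: wn_def norm_mult power_mult_distrib)
  have i1: "integrable lborel (\<lambda>x. (cmod (d x))\<^sup>2)" by (rule L2_integrable[OF w(2)])
  have i2: "integrable lborel (\<lambda>x. hw s x * tailw R \<bar>x\<bar> * (cmod (d x))\<^sup>2)" using L2_integrable[OF t] unfolding sq .
  have i3: "integrable lborel (\<lambda>x. hw s x * (cmod (d x))\<^sup>2)" using L2_integrable[OF w(1)] unfolding sq .
  have "(LINT x|lborel. hw s x * (cmod (d x))\<^sup>2) \<le> (LINT x|lborel. hw s R * (cmod (d x))\<^sup>2 + hw s x * tailw R \<bar>x\<bar> * (cmod (d x))\<^sup>2)"
  proof (rule integral_mono[OF i3])
    show "integrable lborel (\<lambda>x. hw s R * (cmod (d x))\<^sup>2 + hw s x * tailw R \<bar>x\<bar> * (cmod (d x))\<^sup>2)"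
      by (intro Bochner_Integration.integrable_add integrable_mult_right i1 i2)
    fix x
    have "hw s x \<le> hw s R + hw s x * tailw R \<bar>x\<bar>"
    proof (cases "\<bar>x\<bar> \<le> R")
      case True
      then have "hw s x \<le> hw s R" using s R by (auto simp: hw_def intro!: powr_mono2)
      moreover have "0 \<le> hw s x * tailw R \<bar>x\<bar>" using tn[of x] by simp
      ultimately show ?thesis by linarith
    next
      case False
      then have "tailw R \<bar>x\<bar> = 1" using R by (simp add: tailw_def)
      then show ?thesis by simp
    qed
    from mult_right_mono[OF this, of "(cmod (d x))\<^sup>2"]
    show "hw s x * (cmod (d x))\<^sup>2 \<le> hw s R * (cmod (d x))\<^sup>2 + hw s x * tailw R \<bar>x\<bar> * (cmod (d x))\<^sup>2" by (simp add: distrib_right)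
  qed
  also have "\<dots> = hw s R * (LINT x|lborel. (cmod (d x))\<^sup>2) + (LINT x|lborel. hw s x * tailw R \<bar>x\<bar> * (cmod (d x))\<^sup>2)"
    using i1 i2 by simp
  finally show ?thesis unfolding Hn_def nL2_sq sq .
qed

lemma tail_tendsto:
  assumes u: "inH s u" shows "(\<lambda>n. nL2 (wn (\<lambda>x. hw s x * tailw (real (Suc n)) x) u)) \<longlonglongrightarrow> 0"
proof -
  have w: "wn (hw s) u \<in> L2" "u \<in> L2" using u by (auto simp: inH_def)
  note [measurable] = L2_measurable[OF w(2)]
  have [measurable]: "tailw R \<in> borel_measurable borel" for R unfolding tailw_def[abs_def] by measurable
  have "(\<lambda>n. nL2 (\<lambda>k. wn (\<lambda>x. hw s x * tailw (real (Suc n)) x) u k - 0)) \<longlonglongrightarrow> 0"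
  proof (rule nL2_dominated[OF w(1)])
    show "AE k in lborel. (\<lambda>n. wn (\<lambda>x. hw s x * tailw (real (Suc n)) x) u k) \<longlonglongrightarrow> 0"
    proof (rule AE_I2)
      fix k
      have "(\<lambda>n. \<bar>k\<bar> * inverse (real (Suc n))) \<longlonglongrightarrow> \<bar>k\<bar> * 0" by (intro tendsto_intros inv_Suc_tendsto)
      then have L: "(\<lambda>n. \<bar>k\<bar> / real (Suc n)) \<longlonglongrightarrow> 0" by (simp add: divide_inverse)
      have "(\<lambda>n. complex_of_real (sqrt (hw s \<bar>k\<bar> * min 1 (\<bar>k\<bar> / real (Suc n)))) * u k) \<longlonglongrightarrow> complex_of_real (sqrt (hw s \<bar>k\<bar> * min 1 0)) * u k"
        by (intro tendsto_intros L)
      then show "(\<lambda>n. wn (\<lambda>x. hw s x * tailw (real (Suc n)) x) u k) \<longlonglongrightarrow> 0" by (simp add: wn_def tailw_def)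
    qed
    have "cmod (wn (\<lambda>x. hw s x * tailw (real (Suc n)) x) u k - 0) \<le> cmod (wn (hw s) u k)" for n k
    proof -
      have "0 \<le> tailw (real (Suc n)) \<bar>k\<bar>" "tailw (real (Suc n)) \<bar>k\<bar> \<le> 1" by (auto simp: tailw_def)
      then have "sqrt (hw s k * tailw (real (Suc n)) \<bar>k\<bar>) \<le> sqrt (hw s k)" using mult_left_mono[of "tailw (real (Suc n)) \<bar>k\<bar>" 1 "hw s k"] by simp
      then show ?thesis using \<open>0 \<le> tailw (real (Suc n)) \<bar>k\<bar>\<close> by (simp add: wn_def norm_mult mult_right_mono)
    qed
    then show "AE k in lborel. cmod (wn (\<lambda>x. hw s x * tailw (real (Suc n)) x) u k - 0) \<le> cmod (wn (hw s) u k)" for n by simp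
  qed simp_all
  then show ?thesis by simp
qed

locale euler_limit = euler +
  fixes u :: "real \<Rightarrow> real \<Rightarrow> complex"
  assumes u_0: "u 0 = u0"
    and u_lim: "\<And>t. 0 \<le> t \<Longrightarrow> t \<le> T \<Longrightarrow> herm (u t) \<and> u t \<in> L2 \<and> (\<forall>n. nL2 (\<lambda>k. approx n t k - u t k) \<le> rate n)"
begin

lemma u_tendsto: assumes t: "0 \<le> t" "t \<le> T" shows "(\<lambda>n. nL2 (\<lambda>k. approx n t k - u t k)) \<longlonglongrightarrow> 0"
proof -
  have le: "norm (nL2 (\<lambda>k. approx n t k - u t k)) \<le> rate n" for n using u_lim[OF t] by simp
  have "\<forall>\<^sub>F n in sequentially. norm (nL2 (\<lambda>k. approx n t k - u t k)) \<le> rate n" using le by simp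
  then show ?thesis using rate_tendsto by (rule Lim_null_comparison)
qed

text \<open>
  The bounds along the scheme pass to the limit by lower semicontinuity, and the error term \<open>gap\<close>
  disappears.
\<close>

lemma u_energy:
  assumes t: "0 \<le> t" "t \<le> T" and w: "admissible w"
  shows "wn w (u t) \<in> L2" "(nL2 (wn w (u t)))\<^sup>2 \<le> 3 * (nL2 (wn w u0))\<^sup>2"
proof -
  have v: "approx n t \<in> L2" "wn w (approx n t) \<in> L2" for n
    using approx_good(1)[OF t(2), of n] wn_admissible_L2[OF w] by (auto simp: good_def inH_L2)
  have w': "weight (weight_exp s) w" using w by (simp add: admissible_def)
  have u2: "u t \<in> L2" using u_lim[OF t] by simp
  have gl: "(\<lambda>n. 3 * ((nL2 (wn w u0))\<^sup>2 + gap (Suc n))) \<longlonglongrightarrow> 3 * (nL2 (wn w u0))\<^sup>2"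
  proof -
    have "(\<lambda>n. 3 * ((nL2 (wn w u0))\<^sup>2 + \<alpha>\<^sup>2 / 3 * inverse (real (Suc n)))) \<longlonglongrightarrow> 3 * ((nL2 (wn w u0))\<^sup>2 + \<alpha>\<^sup>2 / 3 * 0)"
      by (intro tendsto_intros inv_Suc_tendsto)
    moreover have e: "gap (Suc n) = \<alpha>\<^sup>2 / 3 * inverse (real (Suc n))" for n unfolding gap_def by (simp add: field_simps)
    ultimately show ?thesis unfolding e by simp
  qed
  show "wn w (u t) \<in> L2" "(nL2 (wn w (u t)))\<^sup>2 \<le> 3 * (nL2 (wn w u0))\<^sup>2"
    using weighted_norm_lower_semicontinuous[OF v(1) u2 u_tendsto[OF t] w' v(2) approx_good(2)[OF t(2) w] gl] by auto
qed

lemma u_good: assumes t: "0 \<le> t" "t \<le> T" shows "good (u t)"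
proof -
  have u2: "u t \<in> L2" "herm (u t)" using u_lim[OF t] by auto
  have "inH s (u t)" using u_energy(1)[OF t admissible_hw] u2 by (simp add: inH_def)
  have "(nL2 (u t))\<^sup>2 \<le> 3 * \<alpha>\<^sup>2" using u_energy(2)[OF t admissible_one] by (simp add: wn_one \<alpha>_def)
  also have "\<dots> \<le> (2 * \<alpha>)\<^sup>2" by (simp add: power_mult_distrib)
  finally have 1: "nL2 (u t) \<le> 2 * \<alpha>" using ab by (intro power2_le_imp_le[of "nL2 (u t)" "2*\<alpha>"]) auto
  have "(Hn s (u t))\<^sup>2 \<le> 3 * \<beta>\<^sup>2" using u_energy(2)[OF t admissible_hw] by (simp add: Hn_def \<beta>_def)
  also have "\<dots> \<le> (2 * \<beta>)\<^sup>2" by (simp add: power_mult_distrib)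
  finally have 2: "Hn s (u t) \<le> 2 * \<beta>" using ab by (intro power2_le_imp_le[of "Hn s (u t)" "2*\<beta>"]) auto
  show ?thesis using 1 2 u2 \<open>inH s (u t)\<close> by (simp add: good_def)
qed

text \<open>
  The first term is the truncation error, the second the error of the approximation itself; both tend
  to zero for fixed \<open>R\<close>.
\<close>

definition rho :: "real \<Rightarrow> nat \<Rightarrow> real" where
  "rho R n = sqrt (hw (s - 1) R) * (64 * cJ s * \<beta>\<^sup>2 / Suc n) + sqrt (2 * R) * (sqrt (hw (s - 1) R) * (R * sqrt R * (4 * \<alpha> * rate n)))"

lemma rho_tendsto: "rho R \<longlonglongrightarrow> 0"
proof -
  have "(\<lambda>n. sqrt (hw (s - 1) R) * (64 * cJ s * \<beta>\<^sup>2 * inverse (real (Suc n))) + sqrt (2 * R) * (sqrt (hw (s - 1) R) * (R * sqrt R * (4 * \<alpha> * rate n))))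
     \<longlonglongrightarrow> sqrt (hw (s - 1) R) * (64 * cJ s * \<beta>\<^sup>2 * 0) + sqrt (2 * R) * (sqrt (hw (s - 1) R) * (R * sqrt R * (4 * \<alpha> * 0)))"
    by (intro tendsto_intros inv_Suc_tendsto rate_tendsto)
  then show ?thesis unfolding rho_def[abs_def] divide_inverse by simp
qed

lemma F_approx:
  assumes t: "0 \<le> t" "t \<le> T" and R: "0 \<le> R"
  shows "Hcut (s - 1) R (\<lambda>k. Fq \<sigma> {-real (Suc n)..real (Suc n)} (approx n t) k - Fq \<sigma> UNIV (u t) k) \<le> rho R n"
proof -
  let ?P = "{-real (Suc n)..real (Suc n)}"
  have s1: "0 \<le> s - 1" using s by simp
  note gv = approx_good(1)[OF t(2), of n] and gu = u_good[OF t]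
  have L: "approx n t \<in> L2" "u t \<in> L2" using gv gu good_L2 by auto
  note F = good_F(1)[OF gv symset_Icc, of "real (Suc n)"] good_F(1)[OF gv symset_UNIV] good_F(1)[OF gu symset_UNIV]
  have "Hcut (s - 1) R (\<lambda>k. Fq \<sigma> ?P (approx n t) k - Fq \<sigma> UNIV (approx n t) k) \<le> sqrt (hw (s - 1) R) * nL2 (\<lambda>k. Fq \<sigma> ?P (approx n t) k - Fq \<sigma> UNIV (approx n t) k)"
    by (rule Hcut_bound(2)[OF L2_diff[OF F(1,2)] s1 R])
  also have "\<dots> \<le> sqrt (hw (s - 1) R) * (64 * cJ s * \<beta>\<^sup>2 / Suc n)"
    by (intro mult_left_mono Fq_remainder gv) auto
  finally have 1: "Hcut (s - 1) R (\<lambda>k. Fq \<sigma> ?P (approx n t) k - Fq \<sigma> UNIV (approx n t) k) \<le> sqrt (hw (s - 1) R) * (64 * cJ s * \<beta>\<^sup>2 / Suc n)" .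
  have 2: "Hcut (s - 1) R (\<lambda>k. Fq \<sigma> UNIV (approx n t) k - Fq \<sigma> UNIV (u t) k) \<le> sqrt (2 * R) * (sqrt (hw (s - 1) R) * (R * sqrt R * (4 * \<alpha> * rate n)))"
    unfolding Hcut_def
  proof (rule nL2_bounded_support[OF _ _ _ R])
    show "cut R (wn (hw (s - 1)) (\<lambda>k. Fq \<sigma> UNIV (approx n t) k - Fq \<sigma> UNIV (u t) k)) \<in> borel_measurable borel"
      using L2_measurable[OF Hcut_bound(1)[OF L2_diff[OF F(2,3)] s1 R]] .
    have r0: "0 \<le> rate n" unfolding rate_def using LF_nonneg C0_nonneg by simp
    fix k
    show "cmod (cut R (wn (hw (s - 1)) (\<lambda>k. Fq \<sigma> UNIV (approx n t) k - Fq \<sigma> UNIV (u t) k)) k) \<le> sqrt (hw (s - 1) R) * (R * sqrt R * (4 * \<alpha> * rate n))"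
    proof (cases "\<bar>k\<bar> \<le> R")
      case True
      have "cmod (Fq \<sigma> UNIV (approx n t) k - Fq \<sigma> UNIV (u t) k) \<le> \<bar>k\<bar> * sqrt \<bar>k\<bar> * ((nL2 (approx n t) + nL2 (u t)) * nL2 (\<lambda>x. approx n t x - u t x))"
        by (rule Fq_diff_pointwise[OF symset_UNIV L \<sigma>])
      also have "\<dots> \<le> R * sqrt R * ((2 * \<alpha> + 2 * \<alpha>) * rate n)"
        using True gv gu u_lim[OF t] ab R r0 by (intro mult_mono add_mono) (auto simp: good_def)
      also have "\<dots> = R * sqrt R * (4 * \<alpha> * rate n)" by simp
      finally have a: "cmod (Fq \<sigma> UNIV (approx n t) k - Fq \<sigma> UNIV (u t) k) \<le> R * sqrt R * (4 * \<alpha> * rate n)" .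
      have "hw (s - 1) k \<le> hw (s - 1) R" using True s by (auto simp: hw_def intro!: powr_mono2)
      then have b: "sqrt (hw (s - 1) k) \<le> sqrt (hw (s - 1) R)" by simp
      have "sqrt (hw (s - 1) k) * cmod (Fq \<sigma> UNIV (approx n t) k - Fq \<sigma> UNIV (u t) k) \<le> sqrt (hw (s - 1) R) * (R * sqrt R * (4 * \<alpha> * rate n))"
        by (rule mult_mono[OF b a]) auto
      then show ?thesis using True by (simp add: cut_def wn_def norm_mult)
    next
      case False
      have "0 \<le> sqrt (hw (s - 1) R) * (R * sqrt R * (4 * \<alpha> * rate n))" using R ab r0 by simp
      then show ?thesis using False by (simp add: cut_def)
    qed
    show "\<bar>k\<bar> > R \<Longrightarrow> cut R (wn (hw (s - 1)) (\<lambda>k. Fq \<sigma> UNIV (approx n t) k - Fq \<sigma> UNIV (u t) k)) k = 0"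
      by (simp add: cut_def)
  qed
  show ?thesis using Hcut_diff_triangle[OF F s1 R] 1 2 unfolding rho_def by linarith
qed

text \<open>
  If the velocity stays within \<open>\<delta>\<close> of a fixed \<open>g\<close>, so does the difference quotient. For the scheme this is
  the triangle inequality for a sum of Euler steps, and it passes to the limit in the norm over bounded
  frequencies. Applied with \<open>g = 0\<close> it gives Lipschitz continuity, with \<open>g\<close> the velocity at \<open>t\<close> it
  gives the derivative.
\<close>

lemma mean_value:
  assumes t: "0 \<le> t" "t \<le> t'" "t' \<le> T" and g: "g \<in> L2" and R: "0 \<le> R"
    and \<delta>: "\<And>\<tau>. t \<le> \<tau> \<Longrightarrow> \<tau> \<le> t' \<Longrightarrow> Hcut (s - 1) R (\<lambda>k. Fq \<sigma> UNIV (u \<tau>) k - g k) \<le> \<delta>"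
  shows "Hcut (s - 1) R (\<lambda>k. u t' k - u t k - complex_of_real (t' - t) * g k) \<le> (t' - t) * \<delta>"
proof -
  have s1: "0 \<le> s - 1" using s by simp
  have \<delta>0: "0 \<le> \<delta>" using order_trans[OF Hcut_nonneg \<delta>[of t]] t by simp
  have tT: "t \<le> T" "0 \<le> t'" using t by auto
  have L: "u t \<in> L2" "u t' \<in> L2" "approx n t \<in> L2" "approx n t' \<in> L2" for n
    using u_lim[OF t(1) tT(1)] u_lim[OF tT(2) t(3)] approx_good(1)[OF tT(1)] approx_good(1)[OF t(3)] good_L2 by auto
  let ?Y = "Hcut (s - 1) R" and ?q = "sqrt (hw (s - 1) R)"
  have rho0: "0 \<le> rho R n" for n using order_trans[OF Hcut_nonneg F_approx[OF t(1) tT(1) R]] .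
  have step: "?Y (\<lambda>k. u t' k - u t k - complex_of_real (t' - t) * g k) \<le> ?q * rate n + (((t' - t) + 1 / Suc n) * (\<delta> + rho R n) + (?q * rate n + 1 / Suc n * ?Y g))" for n
  proof -
    let ?M = "Ms n" and ?N = "Suc n"
    define h where "h = T / real ?M"
    have M: "0 < ?M" and h: "0 < h" "h \<le> 1 / Suc n" using Ms_pos[of n] \<gamma> by (auto simp: h_def)
    let ?P = "{-real ?N..real ?N}"
    define j where "j = grid_index ?M t"
    define m where "m = grid_index ?M t' - j"
    have jm: "j + m = grid_index ?M t'" unfolding m_def j_def using grid_index_mono[OF t(2), of ?M] by simp
    have b: "real j * h \<le> t" "t < (real j + 1) * h" "real (j + m) * h \<le> t'" "t' < (real (j + m) + 1) * h"
      using grid_index_bounds[OF t(1) M] grid_index_bounds[OF tT(2) M] unfolding jm[symmetric] j_def[symmetric] h_def[symmetric] by (simp_all add: add_ac)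
    (* The m steps between the two grid points account for t' - t up to one step. *)
    have mh: "\<bar>real m * h - (t' - t)\<bar> \<le> h" using b by (simp add: algebra_simps abs_le_iff)
    have A: "(\<lambda>k. approx n t' k - approx n t k - complex_of_real (real m * h) * g k) = (\<lambda>k. \<Sum>i<m. complex_of_real h * (Fq \<sigma> ?P (U ?N ?M (j + i)) k - g k))"
    proof
      fix k
      have "approx n t' k = approx n t k + (\<Sum>i<m. complex_of_real h * Fq \<sigma> ?P (U ?N ?M (j + i)) k)"
        unfolding approx_def jm[symmetric] j_def[symmetric] h_def by (rule euler_iterate_sum)
      then show "approx n t' k - approx n t k - complex_of_real (real m * h) * g k = (\<Sum>i<m. complex_of_real h * (Fq \<sigma> ?P (U ?N ?M (j + i)) k - g k))"
        by (simp add: right_diff_distrib sum_subtractf)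
    qed
    have each: "(\<lambda>k. complex_of_real h * (Fq \<sigma> ?P (U ?N ?M (j + i)) k - g k)) \<in> L2 \<and> ?Y (\<lambda>k. complex_of_real h * (Fq \<sigma> ?P (U ?N ?M (j + i)) k - g k)) \<le> h * (\<delta> + rho R n)" if i: "i < m" for i
    proof -
      (* The hypothesis on the velocity concerns times between t and t'. The grid point of the
         first step lies before t, but its state is still the current one at time t. *)
      have "\<exists>\<tau>. t \<le> \<tau> \<and> \<tau> \<le> t' \<and> approx n \<tau> = U ?N ?M (j + i)"
      proof (cases "i = 0")
        case True then show ?thesis using t by (intro exI[of _ t]) (simp add: approx_def j_def)
      next
        case False
        have "(real j + 1) * h \<le> real (j + i) * h" using False h by (intro mult_right_mono) auto
        then have 1: "t \<le> real (j + i) * h" using b(2) by linarith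
        have "real (j + i) * h \<le> real (j + m) * h" using i h by (intro mult_right_mono) auto
        then have 2: "real (j + i) * h \<le> t'" using b(3) by linarith
        have "grid_index ?M (real (j + i) * h) = j + i" unfolding h_def by (rule grid_index_grid[OF M])
        then show ?thesis using 1 2 by (intro exI[of _ "real (j + i) * h"]) (simp add: approx_def)
      qed
      then obtain \<tau> where \<tau>: "t \<le> \<tau>" "\<tau> \<le> t'" "approx n \<tau> = U ?N ?M (j + i)" by blast
      have \<tau>T: "0 \<le> \<tau>" "\<tau> \<le> T" using \<tau> t by auto
      have F: "Fq \<sigma> ?P (approx n \<tau>) \<in> L2" "Fq \<sigma> UNIV (u \<tau>) \<in> L2"
        by (rule good_F(1)[OF approx_good(1)[OF \<tau>T(2)] symset_Icc], rule good_F(1)[OF u_good[OF \<tau>T] symset_UNIV])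
      have "?Y (\<lambda>k. Fq \<sigma> ?P (approx n \<tau>) k - g k) \<le> \<delta> + rho R n"
        using Hcut_diff_triangle[OF F g s1 R] F_approx[OF \<tau>T R, of n] \<delta>[OF \<tau>(1,2)] by simp
      then show ?thesis unfolding \<tau>(3) Hcut_cmult using h L2_cmult[OF L2_diff[OF F(1) g]] \<tau>(3) by (simp add: mult_left_mono)
    qed
    have sum: "(\<lambda>k. approx n t' k - approx n t k - complex_of_real (real m * h) * g k) \<in> L2" "?Y (\<lambda>k. approx n t' k - approx n t k - complex_of_real (real m * h) * g k) \<le> real m * (h * (\<delta> + rho R n))"
      using Hcut_sum[OF each s1 R] unfolding A by auto
    have "real m * h \<le> (t' - t) + 1 / Suc n" using mh h by linarith
    then have "real m * h * (\<delta> + rho R n) \<le> ((t' - t) + 1 / Suc n) * (\<delta> + rho R n)"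
      using \<delta>0 rho0[of n] by (intro mult_right_mono) auto
    with sum(2) have B: "?Y (\<lambda>k. approx n t' k - approx n t k - complex_of_real (real m * h) * g k) \<le> ((t' - t) + 1 / Suc n) * (\<delta> + rho R n)" by (simp add: mult.assoc)
    have C: "?Y (\<lambda>k. u t' k - approx n t' k) \<le> ?q * rate n"
      using order_trans[OF Hcut_bound(2)[OF L2_diff[OF L(2,4)] s1 R] mult_left_mono] u_lim[OF tT(2) t(3)] nL2_minus_commute[of "u t'"] by simp
    have D: "?Y (\<lambda>k. approx n t k - u t k) \<le> ?q * rate n"
      using order_trans[OF Hcut_bound(2)[OF L2_diff[OF L(3,1)] s1 R] mult_left_mono] u_lim[OF t(1) tT(1)] by simp
    have E: "?Y (\<lambda>k. complex_of_real (real m * h - (t' - t)) * g k) \<le> 1 / Suc n * ?Y g"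
      unfolding Hcut_cmult norm_of_real using mh h by (intro mult_right_mono) auto
    have g2: "(\<lambda>k. complex_of_real (real m * h - (t' - t)) * g k) \<in> L2" by (rule L2_cmult[OF g])
    have dec: "(\<lambda>k. u t' k - u t k - complex_of_real (t' - t) * g k) = (\<lambda>k. (u t' k - approx n t' k) + ((approx n t' k - approx n t k - complex_of_real (real m * h) * g k) + ((approx n t k - u t k) + complex_of_real (real m * h - (t' - t)) * g k)))"
      by (auto simp: algebra_simps)
    have "?Y (\<lambda>k. u t' k - u t k - complex_of_real (t' - t) * g k) \<le> ?Y (\<lambda>k. u t' k - approx n t' k) + ?Y (\<lambda>k. (approx n t' k - approx n t k - complex_of_real (real m * h) * g k) + ((approx n t k - u t k) + complex_of_real (real m * h - (t' - t)) * g k))"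
      unfolding dec by (intro Hcut_add L2_add L2_diff L sum(1) g2 s1 R)
    moreover have "?Y (\<lambda>k. (approx n t' k - approx n t k - complex_of_real (real m * h) * g k) + ((approx n t k - u t k) + complex_of_real (real m * h - (t' - t)) * g k)) \<le> ?Y (\<lambda>k. approx n t' k - approx n t k - complex_of_real (real m * h) * g k) + ?Y (\<lambda>k. (approx n t k - u t k) + complex_of_real (real m * h - (t' - t)) * g k)"
      by (rule Hcut_add[OF sum(1) L2_add[OF L2_diff[OF L(3,1)] g2] s1 R])
    moreover have "?Y (\<lambda>k. (approx n t k - u t k) + complex_of_real (real m * h - (t' - t)) * g k) \<le> ?Y (\<lambda>k. approx n t k - u t k) + ?Y (\<lambda>k. complex_of_real (real m * h - (t' - t)) * g k)"
      by (rule Hcut_add[OF L2_diff[OF L(3,1)] g2 s1 R])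
    ultimately show ?thesis using B C D E by linarith
  qed
  have "(\<lambda>n. ?q * rate n + (((t' - t) + inverse (real (Suc n))) * (\<delta> + rho R n) + (?q * rate n + inverse (real (Suc n)) * ?Y g))) \<longlonglongrightarrow> ?q * 0 + (((t' - t) + 0) * (\<delta> + 0) + (?q * 0 + 0 * ?Y g))"
    by (intro tendsto_intros rate_tendsto rho_tendsto inv_Suc_tendsto)
  then have "(\<lambda>n. ?q * rate n + (((t' - t) + 1 / Suc n) * (\<delta> + rho R n) + (?q * rate n + 1 / Suc n * ?Y g))) \<longlonglongrightarrow> (t' - t) * \<delta>"
    by (simp add: divide_inverse)
  then show ?thesis by (rule LIMSEQ_le_const) (use step in blast)
qed

lemma u_inH: assumes "0 \<le> t" "t \<le> T" shows "inH s (u t)" "Hn s (u t) \<le> 2 * \<beta>" "herm (u t)"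
  using u_good[OF assms] by (auto simp: good_def)

lemma mean_value_Hn:
  assumes t: "0 \<le> t" "t \<le> t'" "t' \<le> T" and g: "inH (s - 1) g"
    and \<delta>: "\<And>\<tau>. t \<le> \<tau> \<Longrightarrow> \<tau> \<le> t' \<Longrightarrow> Hn (s - 1) (\<lambda>k. Fq \<sigma> UNIV (u \<tau>) k - g k) \<le> \<delta>"
  shows "Hn (s - 1) (\<lambda>k. u t' k - u t k - complex_of_real (t' - t) * g k) \<le> (t' - t) * \<delta>"
proof (rule Hn_le_Hcut)
  have tT: "t \<le> T" "0 \<le> t'" using t by auto
  have d: "inH s (\<lambda>k. u t' k - u t k)" by (intro inH_diff u_inH t tT)
  show "inH (s - 1) (\<lambda>k. u t' k - u t k - complex_of_real (t' - t) * g k)"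
    by (intro inH_diff inH_cmult g inH_mono[OF d]) (use s in auto)
  fix R :: real assume R: "0 \<le> R"
  show "Hcut (s - 1) R (\<lambda>k. u t' k - u t k - complex_of_real (t' - t) * g k) \<le> (t' - t) * \<delta>"
  proof (rule mean_value[OF t inH_L2[OF g] R])
    fix \<tau> assume \<tau>: "t \<le> \<tau>" "\<tau> \<le> t'"
    have "inH (s - 1) (\<lambda>k. Fq \<sigma> UNIV (u \<tau>) k - g k)"
      by (intro inH_diff g Fq_H(1)[OF s symset_UNIV _ \<sigma>] u_inH) (use \<tau> t in auto)
    from Hcut_le_Hn[OF this] \<delta>[OF \<tau>] show "Hcut (s - 1) R (\<lambda>k. Fq \<sigma> UNIV (u \<tau>) k - g k) \<le> \<delta>" by (rule order_trans)
  qed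
qed

lemma u_lipschitz:
  assumes t: "t \<in> {0..T}" "t' \<in> {0..T}" shows "nL2 (\<lambda>k. u t' k - u t k) \<le> LF * \<bar>t' - t\<bar>"
proof -
  have main: "nL2 (\<lambda>k. u b k - u a k) \<le> LF * (b - a)" if ab: "0 \<le> a" "a \<le> b" "b \<le> T" for a b
  proof -
    have i0: "inH (s - 1) (\<lambda>k. 0)" unfolding inH_def wn_def by simp
    have "Hn (s - 1) (\<lambda>k. u b k - u a k - complex_of_real (b - a) * 0) \<le> (b - a) * LF"
    proof (rule mean_value_Hn[OF ab i0])
      fix \<tau> assume \<tau>: "a \<le> \<tau>" "\<tau> \<le> b"
      then have u: "inH s (u \<tau>)" "Hn s (u \<tau>) \<le> 2 * \<beta>" using u_inH[of \<tau>] ab by auto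
      have "Hn (s - 1) (Fq \<sigma> UNIV (u \<tau>)) \<le> cF s * (Hn s (u \<tau>))\<^sup>2" by (rule Fq_H(2)[OF s symset_UNIV u(1) \<sigma>])
      also have "\<dots> \<le> LF" unfolding LF_def using u cF_nonneg by (intro mult_left_mono power_mono) auto
      finally show "Hn (s - 1) (\<lambda>k. Fq \<sigma> UNIV (u \<tau>) k - 0) \<le> LF" by simp
    qed
    moreover have "inH (s - 1) (\<lambda>k. u b k - u a k)"
      by (rule inH_mono[OF inH_diff[OF u_inH(1) u_inH(1)]]) (use ab s in auto)
    from nL2_le_Hn[OF this] have "nL2 (\<lambda>k. u b k - u a k) \<le> Hn (s - 1) (\<lambda>k. u b k - u a k)" .
    ultimately show ?thesis by (simp add: mult.commute)
  qed
  show ?thesis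
    using main[of t t'] main[of t' t] t nL2_minus_commute[of "u t" "u t'"] by (cases "t \<le> t'") auto
qed

text \<open>
  The tails of all states are dominated by the tail of the initial state, hence uniformly small; on the
  remaining frequencies the Lipschitz bound in \<open>L\<^sup>2\<close> suffices.
\<close>

lemma u_continuous:
  assumes t: "t \<in> {0..T}" shows "((\<lambda>t'. Hn s (\<lambda>k. u t' k - u t k)) \<longlongrightarrow> 0) (at t within {0..T})"
proof (rule tendstoI)
  fix e :: real assume e: "e > 0"
  have "(\<lambda>n. 12 * (nL2 (wn (\<lambda>x. hw s x * tailw (real (Suc n)) x) u0))\<^sup>2) \<longlonglongrightarrow> 12 * 0\<^sup>2"
    by (intro tendsto_intros tail_tendsto[OF u0])
  then have lim: "(\<lambda>n. 12 * (nL2 (wn (\<lambda>x. hw s x * tailw (real (Suc n)) x) u0))\<^sup>2) \<longlonglongrightarrow> 0" by simp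
  have "0 < e\<^sup>2 / 2" using e by simp
  from LIMSEQ_D[OF lim this] obtain n where n: "12 * (nL2 (wn (\<lambda>x. hw s x * tailw (real (Suc n)) x) u0))\<^sup>2 < e\<^sup>2 / 2" by auto
  define R where "R = real (Suc n)"
  have R: "R > 0" by (simp add: R_def)
  let ?w = "\<lambda>x. hw s x * tailw R x"
  have tail: "(nL2 (wn ?w (\<lambda>k. u t' k - u t k)))\<^sup>2 < e\<^sup>2 / 2 \<and> wn ?w (\<lambda>k. u t' k - u t k) \<in> L2" if t': "t' \<in> {0..T}" for t'
  proof -
    let ?x = "nL2 (wn ?w u0)"
    have a: "wn ?w (u t) \<in> L2" "(nL2 (wn ?w (u t)))\<^sup>2 \<le> 3 * ?x\<^sup>2" "wn ?w (u t') \<in> L2" "(nL2 (wn ?w (u t')))\<^sup>2 \<le> 3 * ?x\<^sup>2"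
      using u_energy[OF _ _ admissible_tailw[OF R]] t t' by auto
    have "(nL2 (wn ?w (\<lambda>k. u t' k - u t k)))\<^sup>2 \<le> (nL2 (wn ?w (u t')) + nL2 (wn ?w (u t)))\<^sup>2"
      unfolding wn_diff by (intro power_mono nL2_triangle_minus a) auto
    also have "\<dots> \<le> 2 * ((nL2 (wn ?w (u t')))\<^sup>2 + (nL2 (wn ?w (u t)))\<^sup>2)"
      using sum_squares_bound[of "nL2 (wn ?w (u t'))" "nL2 (wn ?w (u t))"] by (simp add: power2_sum)
    also have "\<dots> \<le> 12 * ?x\<^sup>2" using add_mono[OF a(4) a(2)] by simp
    also have "\<dots> < e\<^sup>2 / 2" using n by (simp add: R_def)
    finally show ?thesis using a unfolding wn_diff by (auto intro!: L2_diff)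
  qed
  (* LF may vanish; LF + 1 is a positive Lipschitz constant. *)
  define d where "d = e / (2 * (LF + 1) * sqrt (hw s R))"
  have hR: "0 < sqrt (hw s R)" using hw_ge1[of s R] by simp
  have d: "d > 0" unfolding d_def using e LF_nonneg hR by simp
  have "dist (Hn s (\<lambda>k. u t' k - u t k)) 0 < e" if t': "t' \<in> {0..T}" and dt: "dist t' t < d" for t'
  proof -
    have i: "inH s (\<lambda>k. u t' k - u t k)" using t t' by (intro inH_diff u_inH) auto
    have "nL2 (\<lambda>k. u t' k - u t k) \<le> LF * \<bar>t' - t\<bar>" by (rule u_lipschitz[OF t t'])
    also have "\<dots> \<le> (LF + 1) * d" using dt LF_nonneg by (intro mult_mono) (auto simp: dist_real_def)
    also have "\<dots> = e / (2 * sqrt (hw s R))" unfolding d_def using half_cancel[of "LF + 1" "e / sqrt (hw s R)"] LF_nonneg by (simp add: mult_ac)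
    finally have "(nL2 (\<lambda>k. u t' k - u t k))\<^sup>2 \<le> (e / (2 * sqrt (hw s R)))\<^sup>2" by (intro power_mono) auto
    also have "\<dots> = e\<^sup>2 / (4 * hw s R)" by (simp add: power_divide power_mult_distrib)
    finally have "hw s R * (nL2 (\<lambda>k. u t' k - u t k))\<^sup>2 \<le> hw s R * (e\<^sup>2 / (4 * hw s R))" by (intro mult_left_mono) auto
    also have "\<dots> = e\<^sup>2 / 4" using hw_ge1[of s R] by simp
    finally have q: "hw s R * (nL2 (\<lambda>k. u t' k - u t k))\<^sup>2 \<le> e\<^sup>2 / 4" .
    have "0 < s" using s by simp
    from Hn_split[OF this i R conjunct2[OF tail[OF t']]]
    have "(Hn s (\<lambda>k. u t' k - u t k))\<^sup>2 \<le> e\<^sup>2 / 4 + e\<^sup>2 / 2" using q conjunct1[OF tail[OF t']] by linarith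
    also have "\<dots> < e\<^sup>2" using e by simp
    finally have "(Hn s (\<lambda>k. u t' k - u t k))\<^sup>2 < e\<^sup>2" .
    then have "Hn s (\<lambda>k. u t' k - u t k) < e" using e by (intro power2_less_imp_less[of _ e]) auto
    then show ?thesis by simp
  qed
  then show "\<forall>\<^sub>F t' in at t within {0..T}. dist (Hn s (\<lambda>k. u t' k - u t k)) 0 < e"
    unfolding eventually_at using d by (intro exI[of _ d]) auto
qed

lemma u_derivative:
  assumes t: "t \<in> {0..T}"
  shows "((\<lambda>t'. Hn (s - 1) (\<lambda>k. (u t' k - u t k) / complex_of_real (t' - t) - Fq \<sigma> UNIV (u t) k)) \<longlongrightarrow> 0) (at t within {0..T})"
proof (rule tendstoI)
  fix e :: real assume e: "e > 0"
  have ut: "inH s (u t)" "Hn s (u t) \<le> 2 * \<beta>" using u_inH[of t] t by auto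
  have g: "inH (s - 1) (Fq \<sigma> UNIV (u t))" by (rule Fq_H(1)[OF s symset_UNIV ut(1) \<sigma>])
  define c where "c = cF s * (4 * \<beta>)"
  have c: "0 \<le> c" unfolding c_def using cF_nonneg ab by simp
  have "e / (2 * (c + 1)) > 0" using e c by simp
  from tendstoD[OF u_continuous[OF t] this] obtain d where d: "d > 0"
    and dd: "\<And>\<tau>. \<tau> \<in> {0..T} \<Longrightarrow> \<tau> \<noteq> t \<Longrightarrow> dist \<tau> t < d \<Longrightarrow> Hn s (\<lambda>k. u \<tau> k - u t k) < e / (2 * (c + 1))"
    unfolding eventually_at by auto
  have F: "Hn (s - 1) (\<lambda>k. Fq \<sigma> UNIV (u \<tau>) k - Fq \<sigma> UNIV (u t) k) \<le> e / 2" if \<tau>: "\<tau> \<in> {0..T}" "dist \<tau> t < d" for \<tau>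
  proof (cases "\<tau> = t")
    case True then show ?thesis using e by (simp add: Hn_def wn_def nL2_def)
  next
    case False
    have u\<tau>: "inH s (u \<tau>)" "Hn s (u \<tau>) \<le> 2 * \<beta>" using u_inH[of \<tau>] \<tau> by auto
    have "Hn (s - 1) (\<lambda>k. Fq \<sigma> UNIV (u \<tau>) k - Fq \<sigma> UNIV (u t) k) \<le> cF s * ((Hn s (u \<tau>) + Hn s (u t)) * Hn s (\<lambda>k. u \<tau> k - u t k))"
      by (rule Fq_diff_H[OF s symset_UNIV u\<tau>(1) ut(1) \<sigma>])
    also have "\<dots> \<le> cF s * ((4 * \<beta>) * (e / (2 * (c + 1))))"
      using dd[OF \<tau>(1) False \<tau>(2)] u\<tau> ut cF_nonneg ab by (intro mult_left_mono mult_mono) auto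
    also have "\<dots> = c * (e / (2 * (c + 1)))" by (simp add: c_def)
    also have "\<dots> \<le> (c + 1) * (e / (2 * (c + 1)))" using e c by (intro mult_right_mono) auto
    also have "\<dots> = e / 2" using half_cancel[of "c + 1" e] c by simp
    finally show ?thesis .
  qed
  have "dist (Hn (s - 1) (\<lambda>k. (u t' k - u t k) / complex_of_real (t' - t) - Fq \<sigma> UNIV (u t) k)) 0 < e"
    if t': "t' \<in> {0..T}" "t' \<noteq> t" "dist t' t < d" for t'
  proof -
    let ?D = "\<lambda>k. u t' k - u t k - complex_of_real (t' - t) * Fq \<sigma> UNIV (u t) k"
    have D: "Hn (s - 1) ?D \<le> \<bar>t' - t\<bar> * (e / 2)"
    proof (cases "t \<le> t'")
      case True
      have "Hn (s - 1) ?D \<le> (t' - t) * (e / 2)"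
        by (rule mean_value_Hn[OF _ True _ g]) (use t t' F in \<open>auto simp: dist_real_def\<close>)
      then show ?thesis using True by simp
    next
      case False
      have "Hn (s - 1) (\<lambda>k. u t k - u t' k - complex_of_real (t - t') * Fq \<sigma> UNIV (u t) k) \<le> (t - t') * (e / 2)"
        by (rule mean_value_Hn[OF _ _ _ g]) (use t t' F False in \<open>auto simp: dist_real_def\<close>)
      moreover have "(\<lambda>k. u t k - u t' k - complex_of_real (t - t') * Fq \<sigma> UNIV (u t) k) = (\<lambda>k. (-1) * ?D k)" by (auto simp: algebra_simps)
      then have "Hn (s - 1) (\<lambda>k. u t k - u t' k - complex_of_real (t - t') * Fq \<sigma> UNIV (u t) k) = Hn (s - 1) ?D" by (simp only: Hn_cmult) simp
      ultimately show ?thesis using False by simp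
    qed
    have ne: "complex_of_real (t' - t) \<noteq> 0" using t'(2) by (simp only: of_real_eq_0_iff)
    have gen: "x / d - y = 1 / d * (x - d * y)" if "d \<noteq> 0" for x y d :: complex using that by (simp add: field_simps)
    have "(\<lambda>k. (u t' k - u t k) / complex_of_real (t' - t) - Fq \<sigma> UNIV (u t) k) = (\<lambda>k. complex_of_real (1 / (t' - t)) * ?D k)"
    proof
      fix k
      have "complex_of_real (1 / (t' - t)) = 1 / complex_of_real (t' - t)" by (simp only: of_real_divide of_real_1)
      then show "(u t' k - u t k) / complex_of_real (t' - t) - Fq \<sigma> UNIV (u t) k = complex_of_real (1 / (t' - t)) * ?D k"
        using gen[OF ne] by (simp only:)
    qed
    then have "Hn (s - 1) (\<lambda>k. (u t' k - u t k) / complex_of_real (t' - t) - Fq \<sigma> UNIV (u t) k) = \<bar>1 / (t' - t)\<bar> * Hn (s - 1) ?D"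
      by (simp only: Hn_cmult norm_of_real)
    also have "\<dots> \<le> \<bar>1 / (t' - t)\<bar> * (\<bar>t' - t\<bar> * (e / 2))" by (rule mult_left_mono[OF D]) simp
    also have "\<dots> = e / 2" using t'(2) by simp
    finally show ?thesis using e by simp
  qed
  then show "\<forall>\<^sub>F t' in at t within {0..T}. dist (Hn (s - 1) (\<lambda>k. (u t' k - u t k) / complex_of_real (t' - t) - Fq \<sigma> UNIV (u t) k)) 0 < e"
    unfolding eventually_at using d by (intro exI[of _ d]) auto
qed

end

section \<open>Forward evolution\<close>

text \<open>
  The two signs give the evolution for positive and for negative times.
\<close>

lemma half_flow:
  assumes s: "s > 2" and \<sigma>: "\<bar>\<sigma>\<bar> = 1" and u0: "herm u0" "inH s u0" "nL2 u0 > 0"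
  defines "T \<equiv> 1 / (KS s * nL2 u0 powr (1 - 2/s) * Hn s u0 powr (2/s))"
  shows "\<exists>u. u 0 = u0 \<and> (\<forall>t\<in>{0..T}. herm (u t) \<and> inH s (u t)
     \<and> ((\<lambda>t'. Hn s (\<lambda>k. u t' k - u t k)) \<longlongrightarrow> 0) (at t within {0..T})
     \<and> ((\<lambda>t'. Hn (s - 1) (\<lambda>k. (u t' k - u t k) / complex_of_real (t' - t) - Fq \<sigma> UNIV (u t) k)) \<longlongrightarrow> 0) (at t within {0..T}))"
proof -
  interpret E: euler s \<sigma> u0 by unfold_locales (use assms in auto)
  have T: "E.T = T" by (simp add: E.T_def T_def E.\<alpha>_def E.\<beta>_def)
  from E.limit_exists obtain u where u: "u 0 = u0" "\<forall>t\<in>{0..E.T}. herm (u t) \<and> u t \<in> L2 \<and> (\<forall>n. nL2 (\<lambda>k. E.approx n t k - u t k) \<le> E.rate n)" by blast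
  interpret L: euler_limit s \<sigma> u0 u by unfold_locales (use u in auto)
  show ?thesis using u(1) L.u_inH L.u_continuous L.u_derivative unfolding T
    by (intro exI[of _ u]) auto
qed

section \<open>Flows in both time directions\<close>

lemma tendsto_at_within_minus:
  fixes f :: "real \<Rightarrow> real"
  assumes "(f \<longlongrightarrow> l) (at (- t) within A)" "\<And>x. x \<in> B \<Longrightarrow> - x \<in> A"
  shows "((\<lambda>x. f (- x)) \<longlongrightarrow> l) (at t within B)"
  unfolding tendsto_iff eventually_at
proof (intro allI impI)
  fix e :: real assume "e > 0"
  with assms(1) obtain d where d: "d > 0" "\<And>x. x \<in> A \<Longrightarrow> x \<noteq> - t \<Longrightarrow> dist x (- t) < d \<Longrightarrow> dist (f x) l < e"
    unfolding tendsto_iff eventually_at by meson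
  have "dist (f (- x)) l < e" if "x \<in> B" "x \<noteq> t" "dist x t < d" for x
    by (rule d(2)) (use assms(2) that in \<open>auto simp: dist_real_def\<close>)
  then show "\<exists>d>0. \<forall>x\<in>B. x \<noteq> t \<and> dist x t < d \<longrightarrow> dist (f (- x)) l < e" using d(1) by blast
qed

text \<open>
  A limit within a closed set is vacuous at points outside it.
\<close>

lemma tendsto_within_Un_closed:
  fixes f :: "real \<Rightarrow> real"
  assumes A: "closed A" "t \<in> A \<Longrightarrow> (f \<longlongrightarrow> l) (at t within A)" and B: "closed B" "t \<in> B \<Longrightarrow> (f \<longlongrightarrow> l) (at t within B)"
  shows "(f \<longlongrightarrow> l) (at t within (A \<union> B))"
proof -
  have c: "(f \<longlongrightarrow> l) (at t within X)" if "closed X" "t \<in> X \<Longrightarrow> (f \<longlongrightarrow> l) (at t within X)" for X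
  proof (cases "t \<in> X")
    case False
    then have "at t within X = bot" using that(1) closed_limpt trivial_limit_within by blast
    then show ?thesis by simp
  qed (use that in auto)
  show ?thesis by (rule Lim_Un[OF c[OF A] c[OF B]])
qed

text \<open>
  A solution of the transformed equation: continuous with values in \<open>H\<^sup>s\<close> and differentiable with values in
  \<open>H\<^bsup>s-1\<^esup>\<close>. The sign \<open>\<sigma>\<close> selects the direction of time.
\<close>

definition flow_on :: "real \<Rightarrow> real \<Rightarrow> real set \<Rightarrow> (real \<Rightarrow> real \<Rightarrow> complex) \<Rightarrow> bool" where
  "flow_on s \<sigma> I u \<longleftrightarrow> (\<forall>t\<in>I. herm (u t) \<and> inH s (u t)
     \<and> ((\<lambda>t'. Hn s (\<lambda>k. u t' k - u t k)) \<longlongrightarrow> 0) (at t within I)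
     \<and> ((\<lambda>t'. Hn (s - 1) (\<lambda>k. (u t' k - u t k) / complex_of_real (t' - t) - Fq \<sigma> UNIV (u t) k)) \<longlongrightarrow> 0) (at t within I))"

lemma flow_on_subset: "flow_on s \<sigma> I u \<Longrightarrow> J \<subseteq> I \<Longrightarrow> flow_on s \<sigma> J u"
  unfolding flow_on_def using tendsto_within_subset by blast

text \<open>
  The reversed evolution is glued to the forward one at time zero; both one-sided derivatives exist there
  and agree.
\<close>

lemma full_flow:
  assumes s: "s > 2" and u0: "herm u0" "inH s u0" "nL2 u0 > 0"
  defines "T \<equiv> 1 / (KS s * nL2 u0 powr (1 - 2/s) * Hn s u0 powr (2/s))"
  shows "\<exists>u. u 0 = u0 \<and> flow_on s 1 {-T..T} u"
proof -
  have one: "\<bar>1::real\<bar> = 1" "\<bar>-1::real\<bar> = 1" by auto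
  obtain p where p: "p 0 = u0" "flow_on s 1 {0..T} p" using half_flow[OF s one(1) u0] unfolding T_def flow_on_def by blast
  obtain m where m: "m 0 = u0" "flow_on s (-1) {0..T} m" using half_flow[OF s one(2) u0] unfolding T_def flow_on_def by blast
  have KT: "T \<ge> 0" unfolding T_def using KS_pos[of s] by simp
  define u where "u t = (if 0 \<le> t then p t else m (- t))" for t
  have up: "u t = p t" if "t \<in> {0..T}" for t using that by (simp add: u_def)
  have um: "u t = m (- t)" if "t \<in> {-T..0}" for t using that p(1) m(1) by (cases "t = 0") (auto simp: u_def)
  have U: "{-T..T} = {0..T} \<union> {-T..0}" using KT by auto
  have Fm: "Fq (-1) UNIV v k = - Fq 1 UNIV v k" for v k by (simp add: Fq_def)
  have "flow_on s 1 {-T..T} u"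
    unfolding flow_on_def
  proof (intro ballI conjI)
    fix t assume t: "t \<in> {-T..T}"
    show "herm (u t)" "inH s (u t)"
      using t p(2) m(2) by (auto simp: u_def flow_on_def)
    show "((\<lambda>t'. Hn s (\<lambda>k. u t' k - u t k)) \<longlongrightarrow> 0) (at t within {-T..T})"
      unfolding U
    proof (rule tendsto_within_Un_closed)
      assume tA: "t \<in> {0..T}"
      have "((\<lambda>t'. Hn s (\<lambda>k. p t' k - p t k)) \<longlongrightarrow> 0) (at t within {0..T})" using p(2) tA by (simp add: flow_on_def)
      then show "((\<lambda>t'. Hn s (\<lambda>k. u t' k - u t k)) \<longlongrightarrow> 0) (at t within {0..T})"
        by (rule Lim_transform_within[where d=1]) (use tA up in auto)
    next
      assume tB: "t \<in> {-T..0}"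
      have "((\<lambda>t'. Hn s (\<lambda>k. m t' k - m (- t) k)) \<longlongrightarrow> 0) (at (- t) within {0..T})" using m(2) tB by (simp add: flow_on_def)
      from tendsto_at_within_minus[OF this, of "{-T..0}"]
      have "((\<lambda>t'. Hn s (\<lambda>k. m (- t') k - m (- t) k)) \<longlongrightarrow> 0) (at t within {-T..0})" by auto
      then show "((\<lambda>t'. Hn s (\<lambda>k. u t' k - u t k)) \<longlongrightarrow> 0) (at t within {-T..0})"
        by (rule Lim_transform_within[where d=1]) (use tB um in auto)
    qed auto
    show "((\<lambda>t'. Hn (s - 1) (\<lambda>k. (u t' k - u t k) / complex_of_real (t' - t) - Fq 1 UNIV (u t) k)) \<longlongrightarrow> 0) (at t within {-T..T})"
      unfolding U
    proof (rule tendsto_within_Un_closed)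
      assume tA: "t \<in> {0..T}"
      have "((\<lambda>t'. Hn (s - 1) (\<lambda>k. (p t' k - p t k) / complex_of_real (t' - t) - Fq 1 UNIV (p t) k)) \<longlongrightarrow> 0) (at t within {0..T})" using p(2) tA by (simp add: flow_on_def)
      then show "((\<lambda>t'. Hn (s - 1) (\<lambda>k. (u t' k - u t k) / complex_of_real (t' - t) - Fq 1 UNIV (u t) k)) \<longlongrightarrow> 0) (at t within {0..T})"
        by (rule Lim_transform_within[where d=1]) (use tA up in auto)
    next
      assume tB: "t \<in> {-T..0}"
      have "((\<lambda>t'. Hn (s - 1) (\<lambda>k. (m t' k - m (- t) k) / complex_of_real (t' - (- t)) - Fq (-1) UNIV (m (- t)) k)) \<longlongrightarrow> 0) (at (- t) within {0..T})"
        using m(2) tB unfolding flow_on_def by (elim ballE[of _ _ "- t"]) auto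
      from tendsto_at_within_minus[OF this, of "{-T..0}"]
      have L: "((\<lambda>t'. Hn (s - 1) (\<lambda>k. (m (- t') k - m (- t) k) / complex_of_real (- t' - (- t)) - Fq (-1) UNIV (m (- t)) k)) \<longlongrightarrow> 0) (at t within {-T..0})"
        by auto
      have e: "Hn (s - 1) (\<lambda>k. (m (- t') k - m (- t) k) / complex_of_real (- t' - (- t)) - Fq (-1) UNIV (m (- t)) k) = Hn (s - 1) (\<lambda>k. (u t' k - u t k) / complex_of_real (t' - t) - Fq 1 UNIV (u t) k)" if "t' \<in> {-T..0}" for t'
      proof -
        have "complex_of_real (- t' - - t) = - complex_of_real (t' - t)" by (simp only: of_real_minus[symmetric]) simp
        then have "(\<lambda>k. (m (- t') k - m (- t) k) / complex_of_real (- t' - (- t)) - Fq (-1) UNIV (m (- t)) k) = (\<lambda>k. (-1) * ((u t' k - u t k) / complex_of_real (t' - t) - Fq 1 UNIV (u t) k))"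
          unfolding um[OF tB] um[OF that] Fm by (simp only: divide_minus_right) simp
        then show ?thesis by (simp only: Hn_cmult) simp
      qed
      show "((\<lambda>t'. Hn (s - 1) (\<lambda>k. (u t' k - u t k) / complex_of_real (t' - t) - Fq 1 UNIV (u t) k)) \<longlongrightarrow> 0) (at t within {-T..0})"
        using L by (rule Lim_transform_within[where d=1]) (use e in auto)
    qed auto
  qed
  moreover have "u 0 = u0" using p(1) by (simp add: u_def)
  ultimately show ?thesis by blast
qed

lemma flow_zero: assumes s: "s > 0" shows "flow_on s 1 I (\<lambda>t k. 0)"
proof -
  have "Fq 1 UNIV (\<lambda>k. 0) = (\<lambda>k. 0)" by (simp add: Fq_def[abs_def] Q_def)
  moreover have "inH s (\<lambda>k. 0)" by (simp add: inH_def wn_def[abs_def])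
  ultimately show ?thesis unfolding flow_on_def by (simp add: herm_def Hn_def wn_def nL2_def)
qed

section \<open>Flows and solutions\<close>

text \<open>
  The Sobolev norms are integrals of the transform, so any representative of it will do.
\<close>

lemma sobolev_iff:
  assumes F: "is_F f g"
  shows "f \<in> sobolev s \<longleftrightarrow> inH s g" "sobolev_norm s f = Hn s g" "L2_norm f = nL2 g"
proof -
  note f2 = is_F_L2[OF F]
  note [measurable] = L2_measurable[OF f2(2)] L2_measurable[OF fourier_L2[OF f2(1)]]
  have ae: "AE k in lborel. fourier f k = g k" by (rule fourier_eq[OF F])
  have sq: "(cmod (wn (hw s) v k))\<^sup>2 = (1 + \<bar>k\<bar> powr (2 * s)) * (cmod (v k))\<^sup>2" for v k
    unfolding wn_def norm_mult norm_of_real power_mult_distrib by (simp add: hw_def)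
  have wm: "wn (hw s) g \<in> borel_measurable borel" by measurable
  have "integrable lborel (\<lambda>k. (1 + \<bar>k\<bar> powr (2 * s)) * (cmod (fourier f k))\<^sup>2) \<longleftrightarrow> integrable lborel (\<lambda>k. (1 + \<bar>k\<bar> powr (2 * s)) * (cmod (g k))\<^sup>2)"
    by (rule integrable_cong_AE) (measurable, use ae in auto)
  then show "f \<in> sobolev s \<longleftrightarrow> inH s g" unfolding sobolev_def inH_def L2_def[of ] using f2 wm sq by (simp add: L2_def)
  have "(LINT k|lborel. (1 + \<bar>k\<bar> powr (2 * s)) * (cmod (fourier f k))\<^sup>2) = (LINT k|lborel. (1 + \<bar>k\<bar> powr (2 * s)) * (cmod (g k))\<^sup>2)"
    by (rule integral_cong_AE) (measurable, use ae in auto)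
  then show "sobolev_norm s f = Hn s g" unfolding sobolev_norm_def Hn_def nL2_def sq by simp
  have "(LINT k|lborel. (cmod (fourier f k))\<^sup>2) = (LINT k|lborel. (cmod (g k))\<^sup>2)"
    by (rule integral_cong_AE) (measurable, use ae in auto)
  then show "L2_norm f = nL2 g" unfolding L2_norm_def nL2_def by simp
qed

lemma is_F_diff: "is_F f F \<Longrightarrow> is_F g G \<Longrightarrow> is_F (\<lambda>x. f x - g x) (\<lambda>k. F k - G k)"
  using is_F_lin[of f F g G 1 "-1"] by simp

lemma is_F_quot:
  assumes "is_F f F" "is_F g G" "is_F h H"
  shows "is_F (\<lambda>x. (f x - g x) / c - h x) (\<lambda>k. (F k - G k) / complex_of_real c - H k)"
  using is_F_lin[OF is_F_diff[OF assms(1,2)] assms(3), of "1/c" "-1"] by simp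

lemma Q_L2:
  assumes s: "s > 2" and u: "inH s u" shows "Q UNIV u u \<in> L2"
proof -
  have km: "(\<lambda>z. SP UNIV (fst z - snd z) (snd z)) \<in> borel_measurable LL"
    by (rule SP_measurable[OF symset_UNIV]) measurable
  have kb: "\<bar>SP UNIV (k - l) l\<bar> \<le> 1 * (mH s (k - l) * sqrt \<bar>l\<bar> + sqrt \<bar>k - l\<bar> * mH s l)" for k l
  proof -
    have m: "1 \<le> mH s x" for x using hw_ge1[of s x] by (simp add: mH_def)
    have "\<bar>SP UNIV (k - l) l\<bar> \<le> 1 * sqrt \<bar>l\<bar>" using SP_nonneg[of UNIV "k - l" l] SP_le(2)[of UNIV "k - l" l] by simp
    also have "\<dots> \<le> mH s (k - l) * sqrt \<bar>l\<bar>" by (rule mult_right_mono[OF m]) simp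
    also have "\<dots> \<le> mH s (k - l) * sqrt \<bar>l\<bar> + sqrt \<bar>k - l\<bar> * mH s l" using m[of l] by simp
    finally show ?thesis by simp
  qed
  show ?thesis using bilinear_H(1)[OF s u u km kb] unfolding Q_def[abs_def] by simp
qed

lemma is_form_a_iff:
  assumes F: "is_F \<psi> g" shows "is_form_a \<psi> \<psi> w \<longleftrightarrow> is_F w (Q UNIV g g) "
proof -
  note f2 = is_F_L2[OF F]
  have ae: "AE k in lborel. fourier \<psi> k = g k" by (rule fourier_eq[OF F])
  note m = L2_measurable[OF f2(2)] L2_measurable[OF fourier_L2[OF f2(1)]]
  have q: "(LINT l|lborel. complex_of_real (S (k - l) l) * fourier \<psi> (k - l) * fourier \<psi> l) = Q UNIV g g k" for k
    using Q_cong_AE[OF symset_UNIV ae ae m(2,1) m(2,1), of k] unfolding Q_def SP_UNIV .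
  have qm: "Q UNIV g g \<in> borel_measurable borel" by (rule Q_measurable[OF symset_UNIV m(1) m(1)])
  show ?thesis
  proof
    assume "is_form_a \<psi> \<psi> w"
    then have w: "w \<in> L2" "AE k in lborel. fourier w k = Q UNIV g g k" unfolding is_form_a_def q by auto
    have wm: "w \<in> borel_measurable borel" using w(1) by (simp add: L2_def)
    show "is_F w (Q UNIV g g)" by (rule is_F_cong[OF is_F_fourier[OF w(1)] _ wm w(2) qm]) simp
  next
    assume "is_F w (Q UNIV g g)"
    then show "is_form_a \<psi> \<psi> w" unfolding is_form_a_def q using is_F_L2(1) fourier_eq by blast
  qed
qed

lemma solution_from_flow:
  assumes s: "s > 2" and fl: "flow_on s 1 I u" and I0: "0 \<in> I" and \<psi>0: "is_F \<psi>0 (u 0)"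
  shows "\<exists>\<psi>. is_solution s I \<psi>0 \<psi>"
proof -
  have u: "herm (u t)" "inH s (u t)" "((\<lambda>t'. Hn s (\<lambda>k. u t' k - u t k)) \<longlongrightarrow> 0) (at t within I)"
    "((\<lambda>t'. Hn (s - 1) (\<lambda>k. (u t' k - u t k) / complex_of_real (t' - t) - Fq 1 UNIV (u t) k)) \<longlongrightarrow> 0) (at t within I)" if "t \<in> I" for t
    using fl that unfolding flow_on_def by auto
  have "\<forall>t\<in>I. \<exists>f. is_F f (u t)" using u(1,2) is_F_surj inH_L2 unfolding herm_def by blast
  from bchoice[OF this] obtain \<psi> where \<psi>: "\<And>t. t \<in> I \<Longrightarrow> is_F (\<psi> t) (u t)" by blast
  have one: "\<bar>1::real\<bar> = 1" by simp
  have kQ: "(\<lambda>k. \<i> * complex_of_real k * Q UNIV (u t) (u t) k) \<in> L2" if t: "t \<in> I" for t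
  proof -
    have "inH (s - 1) (\<lambda>k. (-1) * Fq 1 UNIV (u t) k)" by (intro inH_cmult Fq_H(1)[OF s symset_UNIV u(2)[OF t] one])
    then show ?thesis using inH_L2 by (simp add: Fq_def mult.assoc)
  qed
  have "\<forall>t\<in>I. \<exists>f. is_F f (\<lambda>k. \<i> * complex_of_real k * Q UNIV (u t) (u t) k)"
  proof
    fix t assume t: "t \<in> I"
    have "herm (Q UNIV (u t) (u t))" by (rule Q_herm[OF symset_UNIV u(1)[OF t] u(1)[OF t]])
    then show "\<exists>f. is_F f (\<lambda>k. \<i> * complex_of_real k * Q UNIV (u t) (u t) k)" by (intro is_F_surj kQ t) (simp add: herm_def)
  qed
  from bchoice[OF this] obtain w' where w': "\<And>t. t \<in> I \<Longrightarrow> is_F (w' t) (\<lambda>k. \<i> * complex_of_real k * Q UNIV (u t) (u t) k)" by blast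
  define \<psi>' where "\<psi>' t \<theta> = - w' t \<theta>" for t \<theta>
  have \<psi>': "is_F (\<psi>' t) (Fq 1 UNIV (u t))" if t: "t \<in> I" for t
  proof -
    have "(\<lambda>k. complex_of_real (-1) * (\<i> * complex_of_real k * Q UNIV (u t) (u t) k) + complex_of_real 0 * (\<i> * complex_of_real k * Q UNIV (u t) (u t) k)) = Fq 1 UNIV (u t)"
      by (simp add: Fq_def[abs_def] mult.assoc)
    moreover have "(\<lambda>x. (-1) * w' t x + 0 * w' t x) = \<psi>' t" by (simp add: \<psi>'_def fun_eq_iff)
    ultimately show ?thesis using is_F_lin[OF w'[OF t] w'[OF t], of "-1" 0] by simp
  qed
  have s1: "0 \<le> s - 1" "s - 1 \<le> s" using s by auto
  have c1: "continuous_sobolev s I \<psi>"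
    unfolding continuous_sobolev_def
  proof (intro conjI ballI)
    fix t assume t: "t \<in> I"
    show "\<psi> t \<in> sobolev s" using sobolev_iff(1)[OF \<psi>[OF t]] u(2)[OF t] by simp
    show "((\<lambda>t'. sobolev_norm s (\<lambda>\<theta>. \<psi> t' \<theta> - \<psi> t \<theta>)) \<longlongrightarrow> 0) (at t within I)"
      by (rule Lim_transform_within[OF u(3)[OF t], where d=1]) (use sobolev_iff(2)[OF is_F_diff[OF \<psi> \<psi>]] t in auto)
  qed
  have c2: "continuous_sobolev (s - 1) I \<psi>"
    unfolding continuous_sobolev_def
  proof (intro conjI ballI)
    fix t assume t: "t \<in> I"
    show "\<psi> t \<in> sobolev (s - 1)" using sobolev_iff(1)[OF \<psi>[OF t]] inH_mono[OF u(2)[OF t] s1] by simp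
    have le: "norm (sobolev_norm (s - 1) (\<lambda>\<theta>. \<psi> t' \<theta> - \<psi> t \<theta>)) \<le> sqrt 2 * Hn s (\<lambda>k. u t' k - u t k)" if t': "t' \<in> I" for t'
    proof -
      have i: "inH s (\<lambda>k. u t' k - u t k)" by (intro inH_diff u t t')
      have "Hn (s - 1) (\<lambda>k. u t' k - u t k) \<le> sqrt 2 * Hn s (\<lambda>k. u t' k - u t k)" unfolding Hn_def
        by (rule wn_mono(2)) (use i hw_mono[OF s1] L2_measurable[OF inH_L2[OF i]] in \<open>auto simp: inH_def\<close>)
      then show ?thesis using sobolev_iff(2)[OF is_F_diff[OF \<psi>[OF t'] \<psi>[OF t]], of "s - 1"] by simp
    qed
    show "((\<lambda>t'. sobolev_norm (s - 1) (\<lambda>\<theta>. \<psi> t' \<theta> - \<psi> t \<theta>)) \<longlongrightarrow> 0) (at t within I)"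
    proof (rule Lim_null_comparison)
      show "\<forall>\<^sub>F t' in at t within I. norm (sobolev_norm (s - 1) (\<lambda>\<theta>. \<psi> t' \<theta> - \<psi> t \<theta>)) \<le> sqrt 2 * Hn s (\<lambda>k. u t' k - u t k)"
        using le by (simp add: eventually_at_filter)
      show "((\<lambda>t'. sqrt 2 * Hn s (\<lambda>k. u t' k - u t k)) \<longlongrightarrow> 0) (at t within I)"
        by (rule tendsto_mult_right_zero[OF u(3)[OF t]])
    qed
  qed
  have c3: "continuous_sobolev (s - 1) I \<psi>'"
    unfolding continuous_sobolev_def
  proof (intro conjI ballI)
    fix t assume t: "t \<in> I"
    show "\<psi>' t \<in> sobolev (s - 1)" using sobolev_iff(1)[OF \<psi>'[OF t]] Fq_H(1)[OF s symset_UNIV u(2)[OF t] one] by simp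
    let ?d = "\<lambda>t'. Hn s (\<lambda>k. u t' k - u t k)"
    have le: "norm (sobolev_norm (s - 1) (\<lambda>\<theta>. \<psi>' t' \<theta> - \<psi>' t \<theta>)) \<le> cF s * ((2 * Hn s (u t) + ?d t') * ?d t')" if t': "t' \<in> I" for t'
    proof -
      have "Hn s (u t') = Hn s (\<lambda>k. u t k + (u t' k - u t k))" by simp
      also have "\<dots> \<le> Hn s (u t) + ?d t'" by (intro Hn_add inH_diff u t t')
      finally have "Hn s (u t') + Hn s (u t) \<le> 2 * Hn s (u t) + ?d t'" by simp
      then have "cF s * ((Hn s (u t') + Hn s (u t)) * ?d t') \<le> cF s * ((2 * Hn s (u t) + ?d t') * ?d t')"
        using cF_nonneg by (intro mult_left_mono mult_right_mono) auto
      with Fq_diff_H[OF s symset_UNIV u(2)[OF t'] u(2)[OF t] one]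
      have "Hn (s - 1) (\<lambda>k. Fq 1 UNIV (u t') k - Fq 1 UNIV (u t) k) \<le> cF s * ((2 * Hn s (u t) + ?d t') * ?d t')" by linarith
      then show ?thesis using sobolev_iff(2)[OF is_F_diff[OF \<psi>'[OF t'] \<psi>'[OF t]], of "s - 1"] by simp
    qed
    show "((\<lambda>t'. sobolev_norm (s - 1) (\<lambda>\<theta>. \<psi>' t' \<theta> - \<psi>' t \<theta>)) \<longlongrightarrow> 0) (at t within I)"
    proof (rule Lim_null_comparison)
      show "\<forall>\<^sub>F t' in at t within I. norm (sobolev_norm (s - 1) (\<lambda>\<theta>. \<psi>' t' \<theta> - \<psi>' t \<theta>)) \<le> cF s * ((2 * Hn s (u t) + ?d t') * ?d t')"
        using le by (simp add: eventually_at_filter)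
      have "((\<lambda>t'. cF s * ((2 * Hn s (u t) + ?d t') * ?d t')) \<longlongrightarrow> cF s * ((2 * Hn s (u t) + 0) * 0)) (at t within I)"
        by (intro tendsto_intros u t)
      then show "((\<lambda>t'. cF s * ((2 * Hn s (u t) + ?d t') * ?d t')) \<longlongrightarrow> 0) (at t within I)" by simp
    qed
  qed
  have C1: "C1_sobolev (s - 1) I \<psi> \<psi>'"
    unfolding C1_sobolev_def
  proof (intro conjI c2 c3 ballI)
    fix t assume t: "t \<in> I"
    show "((\<lambda>t'. sobolev_norm (s - 1) (\<lambda>\<theta>. (\<psi> t' \<theta> - \<psi> t \<theta>) / (t' - t) - \<psi>' t \<theta>)) \<longlongrightarrow> 0) (at t within I)"
      by (rule Lim_transform_within[OF u(4)[OF t], where d=1]) (use sobolev_iff(2)[OF is_F_quot[OF \<psi> \<psi> \<psi>']] t in auto)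
  qed
  have eq: "\<exists>w w'. is_form_a (\<psi> t) (\<psi> t) w \<and> has_weak_deriv w w' \<and> (AE \<theta> in lborel. \<psi>' t \<theta> + w' \<theta> = 0)" if t: "t \<in> I" for t
  proof -
    have "herm (Q UNIV (u t) (u t))" by (rule Q_herm[OF symset_UNIV u(1)[OF t] u(1)[OF t]])
    then obtain w where w: "is_F w (Q UNIV (u t) (u t))" using is_F_surj[OF Q_L2[OF s u(2)[OF t]]] unfolding herm_def by blast
    have "is_form_a (\<psi> t) (\<psi> t) w" using is_form_a_iff[OF \<psi>[OF t]] w by simp
    moreover have "has_weak_deriv w (w' t)" by (rule weak_deriv_of_fourier[OF w w'[OF t]])
    moreover have "AE \<theta> in lborel. \<psi>' t \<theta> + w' t \<theta> = 0" by (simp add: \<psi>'_def)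
    ultimately show ?thesis by blast
  qed
  have "AE \<theta> in lborel. \<psi> 0 \<theta> = \<psi>0 \<theta>" by (rule is_F_inj[OF \<psi>[OF I0] \<psi>0]) simp
  then show ?thesis unfolding is_solution_def using c1 C1 eq by blast
qed

section \<open>Uniqueness\<close>

lemma herm_part_AE: assumes F: "is_F f g" shows "is_F f (herm_part g)" "AE k in lborel. g k = herm_part g k"
proof -
  note f2 = is_F_L2[OF F]
  show ae: "AE k in lborel. g k = herm_part g k" using is_F_herm[OF F] by eventually_elim (simp add: herm_part_def)
  have fm: "f \<in> borel_measurable borel" using f2(1) by (simp add: L2_def)
  show "is_F f (herm_part g)" by (rule is_F_cong[OF F _ fm ae L2_measurable[OF herm_part_L2[OF f2(2)]]]) simp
qed

text \<open>
  The transform chosen for a solution is Hermitian only almost everywhere, whence the symmetrisation. The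
  weak derivative of \<open>a(\<psi>, \<psi>)\<close> turns into multiplication by \<open>\<i> k\<close>.
\<close>

lemma flow_of_solution:
  assumes s: "s > 2" and sol: "is_solution s I \<psi>0 \<psi>"
  shows "flow_on s 1 I (\<lambda>t. herm_part (fourier (\<psi> t)))" and "\<And>t. t \<in> I \<Longrightarrow> is_F (\<psi> t) (herm_part (fourier (\<psi> t)))"
proof -
  have c: "\<And>t. t \<in> I \<Longrightarrow> \<psi> t \<in> sobolev s" "\<And>t. t \<in> I \<Longrightarrow> ((\<lambda>t'. sobolev_norm s (\<lambda>\<theta>. \<psi> t' \<theta> - \<psi> t \<theta>)) \<longlongrightarrow> 0) (at t within I)"
    using sol unfolding is_solution_def continuous_sobolev_def by auto
  obtain \<psi>' where C1: "C1_sobolev (s - 1) I \<psi> \<psi>'" and eq: "\<And>t. t \<in> I \<Longrightarrow> \<exists>w w'. is_form_a (\<psi> t) (\<psi> t) w \<and> has_weak_deriv w w' \<and> (AE \<theta> in lborel. \<psi>' t \<theta> + w' \<theta> = 0)"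
    using sol unfolding is_solution_def by blast
  have p: "\<And>t. t \<in> I \<Longrightarrow> \<psi>' t \<in> sobolev (s - 1)" "\<And>t. t \<in> I \<Longrightarrow> ((\<lambda>t'. sobolev_norm (s - 1) (\<lambda>\<theta>. (\<psi> t' \<theta> - \<psi> t \<theta>) / (t' - t) - \<psi>' t \<theta>)) \<longlongrightarrow> 0) (at t within I)"
    using C1 unfolding C1_sobolev_def continuous_sobolev_def by auto
  let ?u = "\<lambda>t. herm_part (fourier (\<psi> t))"
  show F: "is_F (\<psi> t) (?u t)" if t: "t \<in> I" for t
    using c(1)[OF t] by (intro herm_part_AE is_F_fourier) (simp add: sobolev_def)
  have iu: "inH s (?u t)" if t: "t \<in> I" for t using sobolev_iff(1)[OF F[OF t]] c(1)[OF t] by simp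
  have F': "is_F (\<psi>' t) (Fq 1 UNIV (?u t))" if t: "t \<in> I" for t
  proof -
    obtain w w' where w: "is_form_a (\<psi> t) (\<psi> t) w" "has_weak_deriv w w'" "AE \<theta> in lborel. \<psi>' t \<theta> + w' \<theta> = 0" using eq[OF t] by blast
    have w2: "w' \<in> L2" "w \<in> L2" using w(2) unfolding has_weak_deriv_def by blast+
    have pm: "\<psi>' t \<in> borel_measurable borel" using p(1)[OF t] unfolding sobolev_def L2_def by simp
    have Fw: "is_F w (Q UNIV (?u t) (?u t))" using is_form_a_iff[OF F[OF t]] w(1) by simp
    have "AE k in lborel. fourier w' k = \<i> * complex_of_real k * fourier w k" by (rule fourier_of_weak_deriv[OF w(2)])
    with fourier_eq[OF Fw] have ae: "AE k in lborel. complex_of_real (-1) * fourier w' k + complex_of_real 0 * fourier w' k = Fq 1 UNIV (?u t) k"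
      by eventually_elim (simp add: Fq_def mult.assoc)
    have F1: "is_F (\<lambda>\<theta>. (-1) * w' \<theta> + 0 * w' \<theta>) (\<lambda>k. complex_of_real (-1) * fourier w' k + complex_of_real 0 * fourier w' k)"
      by (rule is_F_lin[OF is_F_fourier[OF w2(1)] is_F_fourier[OF w2(1)]])
    have ae2: "AE \<theta> in lborel. (-1) * w' \<theta> + 0 * w' \<theta> = \<psi>' t \<theta>" using w(3) by eventually_elim simp
    have um: "Fq 1 UNIV (?u t) \<in> borel_measurable borel"
      by (rule Fq_measurable[OF symset_UNIV L2_measurable[OF inH_L2[OF iu[OF t]]]])
    show ?thesis by (rule is_F_cong[OF F1 ae2 pm ae um])
  qed
  show "flow_on s 1 I ?u"
    unfolding flow_on_def
  proof (intro ballI conjI)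
    fix t assume t: "t \<in> I"
    show "herm (?u t)" by (rule herm_part_herm)
    show "inH s (?u t)" by (rule iu[OF t])
    show "((\<lambda>t'. Hn s (\<lambda>k. ?u t' k - ?u t k)) \<longlongrightarrow> 0) (at t within I)"
      by (rule Lim_transform_within[OF c(2)[OF t], where d=1]) (use sobolev_iff(2)[OF is_F_diff[OF F F]] t in auto)
    show "((\<lambda>t'. Hn (s - 1) (\<lambda>k. (?u t' k - ?u t k) / complex_of_real (t' - t) - Fq 1 UNIV (?u t) k)) \<longlongrightarrow> 0) (at t within I)"
      by (rule Lim_transform_within[OF p(2)[OF t], where d=1]) (use sobolev_iff(2)[OF is_F_quot[OF F F F']] t in auto)
  qed
qed

text \<open>
  The chain rule for the squared norm of a curve that is differentiable in the mean.
\<close>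

lemma nL2_sq_derivative:
  assumes d: "\<And>t. t \<in> I \<Longrightarrow> d t \<in> L2" and t: "t \<in> I" and e: "e \<in> L2"
    and l: "((\<lambda>t'. nL2 (\<lambda>k. (d t' k - d t k) / complex_of_real (t' - t) - e k)) \<longlongrightarrow> 0) (at t within I)"
  shows "((\<lambda>t'. (nL2 (d t'))\<^sup>2) has_real_derivative 2 * Re (LINT k|lborel. e k * cnj (d t k))) (at t within I)"
  unfolding has_field_derivative_iff
proof -
  let ?q = "\<lambda>t' k. (d t' k - d t k) / complex_of_real (t' - t)"
  let ?r = "\<lambda>t'. nL2 (\<lambda>k. ?q t' k - e k)"
  have q2: "?q t' \<in> L2" if "t' \<in> I" for t'
    using L2_cmult[OF L2_diff[OF d[OF that] d[OF t]], of "1 / complex_of_real (t' - t)"] by simp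
  let ?D = "2 * Re (LINT k|lborel. e k * cnj (d t k))"
  have b: "norm (((nL2 (d t'))\<^sup>2 - (nL2 (d t))\<^sup>2) / (t' - t) - ?D) \<le> 2 * (?r t' * nL2 (d t)) + \<bar>t' - t\<bar> * (?r t' + nL2 e)\<^sup>2"
    if t': "t' \<in> I" "t' \<noteq> t" for t'
  proof -
    have ne: "complex_of_real (t' - t) \<noteq> 0" using t'(2) by (simp only: of_real_eq_0_iff)
    have g2: "(\<lambda>k. complex_of_real (t' - t) * ?q t' k) \<in> L2" by (rule L2_cmult[OF q2[OF t'(1)]])
    have e1: "d t' = (\<lambda>k. d t k + complex_of_real (t' - t) * ?q t' k)" using ne by (intro ext) simp
    have "(nL2 (d t'))\<^sup>2 = (nL2 (d t))\<^sup>2 + 2 * Re (LINT k|lborel. (complex_of_real (t' - t) * ?q t' k) * cnj (d t k)) + (nL2 (\<lambda>k. complex_of_real (t' - t) * ?q t' k))\<^sup>2"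
      by (subst e1) (rule nL2_add_sq[OF d[OF t] g2])
    also have "(LINT k|lborel. (complex_of_real (t' - t) * ?q t' k) * cnj (d t k)) = complex_of_real (t' - t) * (LINT k|lborel. ?q t' k * cnj (d t k))"
      by (simp only: mult.assoc integral_mult_right_zero)
    also have "Re (complex_of_real (t' - t) * (LINT k|lborel. ?q t' k * cnj (d t k))) = (t' - t) * Re (LINT k|lborel. ?q t' k * cnj (d t k))" by simp
    also have "(nL2 (\<lambda>k. complex_of_real (t' - t) * ?q t' k))\<^sup>2 = (t' - t) * ((t' - t) * (nL2 (?q t'))\<^sup>2)"
      unfolding nL2_cmult norm_of_real power_mult_distrib by (simp add: power2_eq_square)
    finally have "(nL2 (d t'))\<^sup>2 - (nL2 (d t))\<^sup>2 = (t' - t) * (2 * Re (LINT k|lborel. ?q t' k * cnj (d t k)) + (t' - t) * (nL2 (?q t'))\<^sup>2)"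
      by (simp only: distrib_left)
    then have quot: "((nL2 (d t'))\<^sup>2 - (nL2 (d t))\<^sup>2) / (t' - t) = 2 * Re (LINT k|lborel. ?q t' k * cnj (d t k)) + (t' - t) * (nL2 (?q t'))\<^sup>2"
      using t'(2) by simp
    have qe2: "(\<lambda>k. ?q t' k - e k) \<in> L2" by (rule L2_diff[OF q2[OF t'(1)] e])
    have "(LINT k|lborel. ?q t' k * cnj (d t k)) - (LINT k|lborel. e k * cnj (d t k)) = (LINT k|lborel. (?q t' k - e k) * cnj (d t k))"
      unfolding left_diff_distrib by (rule Bochner_Integration.integral_diff[symmetric]; rule L2_mult_integrable[OF _ L2_cnj[OF d[OF t]]]; rule q2[OF t'(1)] e)
    then have "cmod ((LINT k|lborel. ?q t' k * cnj (d t k)) - (LINT k|lborel. e k * cnj (d t k))) \<le> ?r t' * nL2 (d t)"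
      using L2_Cauchy_Schwarz[OF qe2 L2_cnj[OF d[OF t]]] by (simp only: nL2_cnj)
    then have A: "\<bar>Re (LINT k|lborel. ?q t' k * cnj (d t k)) - Re (LINT k|lborel. e k * cnj (d t k))\<bar> \<le> ?r t' * nL2 (d t)"
      using abs_Re_le_cmod order_trans by (metis (no_types, lifting) minus_complex.sel(1))
    have "nL2 (?q t') = nL2 (\<lambda>k. (?q t' k - e k) + e k)" by simp
    also have "\<dots> \<le> ?r t' + nL2 e" by (rule nL2_triangle[OF qe2 e])
    finally have "(nL2 (?q t'))\<^sup>2 \<le> (?r t' + nL2 e)\<^sup>2" by (intro power_mono) auto
    then have B: "\<bar>(t' - t) * (nL2 (?q t'))\<^sup>2\<bar> \<le> \<bar>t' - t\<bar> * (?r t' + nL2 e)\<^sup>2" by (simp add: abs_mult mult_left_mono)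
    show ?thesis unfolding quot real_norm_def using A B by linarith
  qed
  have "((\<lambda>t'. 2 * (?r t' * nL2 (d t)) + \<bar>t' - t\<bar> * (?r t' + nL2 e)\<^sup>2) \<longlongrightarrow> 2 * (0 * nL2 (d t)) + \<bar>t - t\<bar> * (0 + nL2 e)\<^sup>2) (at t within I)"
    by (intro tendsto_intros l)
  then have z: "((\<lambda>t'. 2 * (?r t' * nL2 (d t)) + \<bar>t' - t\<bar> * (?r t' + nL2 e)\<^sup>2) \<longlongrightarrow> 0) (at t within I)" by simp
  have ev: "\<forall>\<^sub>F t' in at t within I. norm (((nL2 (d t'))\<^sup>2 - (nL2 (d t))\<^sup>2) / (t' - t) - ?D) \<le> 2 * (?r t' * nL2 (d t)) + \<bar>t' - t\<bar> * (?r t' + nL2 e)\<^sup>2"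
    using b by (simp add: eventually_at_filter)
  show "((\<lambda>t'. ((nL2 (d t'))\<^sup>2 - (nL2 (d t))\<^sup>2) / (t' - t)) \<longlongrightarrow> ?D) (at t within I)"
    by (rule LIM_zero_cancel) (rule Lim_null_comparison[OF ev z])
qed

lemma flow_Hn_bounded:
  assumes fl: "flow_on s \<sigma> I u" and J: "{a..b} \<subseteq> I"
  shows "\<exists>B. \<forall>t\<in>{a..b}. Hn s (u t) \<le> B"
proof -
  have J': "flow_on s \<sigma> {a..b} u" by (rule flow_on_subset[OF fl J])
  have "continuous_on {a..b} (\<lambda>t. Hn s (u t))"
    unfolding continuous_on_def
  proof
    fix t assume t: "t \<in> {a..b}"
    have z: "((\<lambda>t'. Hn s (\<lambda>k. u t' k - u t k)) \<longlongrightarrow> 0) (at t within {a..b})" using J' t unfolding flow_on_def by blast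
    have "norm (Hn s (u t') - Hn s (u t)) \<le> Hn s (\<lambda>k. u t' k - u t k)" if t': "t' \<in> {a..b}" for t'
      using J' t t' nL2_rev_triangle unfolding flow_on_def inH_def Hn_def wn_diff by (metis real_norm_def)
    then have "\<forall>\<^sub>F t' in at t within {a..b}. norm (Hn s (u t') - Hn s (u t)) \<le> Hn s (\<lambda>k. u t' k - u t k)"
      by (simp add: eventually_at_filter)
    then show "((\<lambda>t. Hn s (u t)) \<longlongrightarrow> Hn s (u t)) (at t within {a..b})"
      by (intro LIM_zero_cancel[OF Lim_null_comparison[OF _ z]])
  qed
  then have "bounded ((\<lambda>t. Hn s (u t)) ` {a..b})" by (intro compact_imp_bounded compact_continuous_image) auto
  then obtain B where "\<forall>x\<in>(\<lambda>t. Hn s (u t)) ` {a..b}. norm x \<le> B" unfolding bounded_iff by blast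
  then show ?thesis by (intro exI[of _ B]) auto
qed

text \<open>
  The squared distance \<open>D\<close> of two flows satisfies \<open>|D'| \<le> C D\<close> between \<open>0\<close> and \<open>\<tau>\<close> by
  \<open>difference_estimate\<close>, so \<open>D\<close> times an exponential is monotone on either side of zero.
\<close>

lemma flow_unique:
  assumes s: "s > 2" and I: "open I" "is_interval I" "0 \<in> I" and u: "flow_on s 1 I u" and v: "flow_on s 1 I v"
    and z: "nL2 (\<lambda>k. u 0 k - v 0 k) = 0" and \<tau>: "\<tau> \<in> I"
  shows "nL2 (\<lambda>k. u \<tau> k - v \<tau> k) = 0"
proof -
  have one: "\<bar>1::real\<bar> = 1" by simp
  have U: "herm (u t)" "inH s (u t)" "((\<lambda>t'. Hn (s - 1) (\<lambda>k. (u t' k - u t k) / complex_of_real (t' - t) - Fq 1 UNIV (u t) k)) \<longlongrightarrow> 0) (at t within I)" if "t \<in> I" for t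
    using u that unfolding flow_on_def by auto
  have V: "herm (v t)" "inH s (v t)" "((\<lambda>t'. Hn (s - 1) (\<lambda>k. (v t' k - v t k) / complex_of_real (t' - t) - Fq 1 UNIV (v t) k)) \<longlongrightarrow> 0) (at t within I)" if "t \<in> I" for t
    using v that unfolding flow_on_def by auto
  define d where "d t k = u t k - v t k" for t k
  define D where "D t = (nL2 (d t))\<^sup>2" for t
  define e where "e t k = Fq 1 UNIV (u t) k - Fq 1 UNIV (v t) k" for t k
  define D' where "D' t = 2 * Re (LINT k|lborel. e t k * cnj (d t k))" for t
  have dH: "inH s (d t)" if "t \<in> I" for t unfolding d_def[abs_def] by (intro inH_diff U V that)
  have e2: "e t \<in> L2" if "t \<in> I" for t
    unfolding e_def[abs_def] by (intro L2_diff inH_L2[OF Fq_H(1)[OF s symset_UNIV _ one]] U V that)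
  have der: "(D has_real_derivative D' t) (at t)" if t: "t \<in> I" for t
  proof -
    have "((\<lambda>t'. nL2 (\<lambda>k. (d t' k - d t k) / complex_of_real (t' - t) - e t k)) \<longlongrightarrow> 0) (at t within I)"
    proof (rule Lim_null_comparison)
      have s1: "0 \<le> s - 1" "s - 1 \<le> s" using s by auto
      have i: "inH (s - 1) (\<lambda>k. (x t' k - x t k) / complex_of_real (t' - t) - Fq 1 UNIV (x t) k)" if "inH s (x t')" "inH s (x t)" for x :: "real \<Rightarrow> real \<Rightarrow> complex" and t'
        using inH_diff[OF inH_cmult[OF inH_mono[OF inH_diff[OF that] s1], of "1 / complex_of_real (t' - t)"] Fq_H(1)[OF s symset_UNIV that(2) one]] by simp
      have "norm (nL2 (\<lambda>k. (d t' k - d t k) / complex_of_real (t' - t) - e t k)) \<le> Hn (s - 1) (\<lambda>k. (u t' k - u t k) / complex_of_real (t' - t) - Fq 1 UNIV (u t) k) + Hn (s - 1) (\<lambda>k. (v t' k - v t k) / complex_of_real (t' - t) - Fq 1 UNIV (v t) k)" if t': "t' \<in> I" for t'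
      proof -
        note iu = i[of u t', OF U(2)[OF t'] U(2)[OF t]] and iv = i[of v t', OF V(2)[OF t'] V(2)[OF t]]
        have "(\<lambda>k. (d t' k - d t k) / complex_of_real (t' - t) - e t k) = (\<lambda>k. ((u t' k - u t k) / complex_of_real (t' - t) - Fq 1 UNIV (u t) k) - ((v t' k - v t k) / complex_of_real (t' - t) - Fq 1 UNIV (v t) k))"
          by (auto simp: d_def e_def diff_divide_distrib)
        then have "nL2 (\<lambda>k. (d t' k - d t k) / complex_of_real (t' - t) - e t k) \<le> nL2 (\<lambda>k. (u t' k - u t k) / complex_of_real (t' - t) - Fq 1 UNIV (u t) k) + nL2 (\<lambda>k. (v t' k - v t k) / complex_of_real (t' - t) - Fq 1 UNIV (v t) k)"
          using nL2_triangle_minus[OF inH_L2[OF iu] inH_L2[OF iv]] by simp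
        then show ?thesis using nL2_le_Hn[OF iu] nL2_le_Hn[OF iv] by simp
      qed
      then show "\<forall>\<^sub>F t' in at t within I. norm (nL2 (\<lambda>k. (d t' k - d t k) / complex_of_real (t' - t) - e t k)) \<le> Hn (s - 1) (\<lambda>k. (u t' k - u t k) / complex_of_real (t' - t) - Fq 1 UNIV (u t) k) + Hn (s - 1) (\<lambda>k. (v t' k - v t k) / complex_of_real (t' - t) - Fq 1 UNIV (v t) k)"
        by (simp add: eventually_at_filter)
      show "((\<lambda>t'. Hn (s - 1) (\<lambda>k. (u t' k - u t k) / complex_of_real (t' - t) - Fq 1 UNIV (u t) k) + Hn (s - 1) (\<lambda>k. (v t' k - v t k) / complex_of_real (t' - t) - Fq 1 UNIV (v t) k)) \<longlongrightarrow> 0) (at t within I)"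
        using tendsto_add[OF U(3)[OF t] V(3)[OF t]] by simp
    qed
    from nL2_sq_derivative[OF inH_L2[OF dH] t e2[OF t] this]
    show ?thesis unfolding D_def D'_def using at_within_open[OF t I(1)] by simp
  qed
  have bound: "\<bar>D' t\<bar> \<le> cJ s * (Hn s (u t) + Hn s (v t)) * D t" if t: "t \<in> I" for t
  proof -
    define q where "q k = u t k + v t k" for k
    have qH: "inH s q" unfolding q_def[abs_def] by (intro inH_add U V t)
    have kd: "(\<lambda>k. complex_of_real k * d t k) \<in> L2"
    proof (rule L2_bound[where f="wn (hw s) (d t)" and c=1])
      note [measurable] = L2_measurable[OF inH_L2[OF dH[OF t]]]
      show "wn (hw s) (d t) \<in> L2" using dH[OF t] by (simp add: inH_def)
      show "(\<lambda>k. complex_of_real k * d t k) \<in> borel_measurable borel" by measurable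
      fix k
      have "\<bar>k\<bar> \<le> sqrt (hw s k)" by (rule real_le_rsqrt) (use pow4_le_hw(2)[of s k] s in simp)
      then show "cmod (complex_of_real k * d t k) \<le> 1 * cmod (wn (hw s) (d t) k)"
        by (simp add: wn_def norm_mult mult_right_mono)
    qed
    have hd: "herm (d t)" using U(1)[OF t] V(1)[OF t] unfolding herm_def d_def by simp
    have fe: "e t k = complex_of_real 1 * (- \<i>) * (complex_of_real k * Q UNIV q (d t) k)" for k
      unfolding e_def q_def[abs_def] d_def[abs_def] by (rule Fq_diff[OF symset_UNIV inH_L2[OF U(2)[OF t]] inH_L2[OF V(2)[OF t]]])
    have "(LINT k|lborel. e t k * cnj (d t k)) = (LINT k|lborel. (- \<i> * complex_of_real k) * cnj (d t k) * Q UNIV q (d t) k)"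
      unfolding fe by (intro Bochner_Integration.integral_cong) (auto simp: mult_ac)
    then have "2 * cmod (LINT k|lborel. e t k * cnj (d t k)) \<le> Am q * D t"
      using difference_estimate[OF inH_L2[OF qH] inH_L2[OF dH[OF t]] hd kd H_Am(1)[OF s qH] H_half(1)[OF s qH]] unfolding D_def by simp
    then have "\<bar>D' t\<bar> \<le> Am q * D t" unfolding D'_def using abs_Re_le_cmod[of "LINT k|lborel. e t k * cnj (d t k)"] by (simp add: abs_mult)
    also have "\<dots> \<le> cJ s * (Hn s (u t) + Hn s (v t)) * D t"
    proof (rule mult_right_mono)
      have "Hn s q \<le> Hn s (u t) + Hn s (v t)" unfolding q_def[abs_def] by (intro Hn_add U V t)
      then have "cJ s * Hn s q \<le> cJ s * (Hn s (u t) + Hn s (v t))" using cJ_pos[of s] by (intro mult_left_mono) auto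
      then show "Am q \<le> cJ s * (Hn s (u t) + Hn s (v t))" using H_Am(2)[OF s qH] by linarith
    qed (simp add: D_def)
    finally show ?thesis .
  qed
  have J: "{min 0 \<tau>..max 0 \<tau>} \<subseteq> I"
  proof
    fix t assume t: "t \<in> {min 0 \<tau>..max 0 \<tau>}"
    have m: "min 0 \<tau> \<in> I" "max 0 \<tau> \<in> I" using I(3) \<tau> by (simp_all add: min_def max_def)
    show "t \<in> I" by (rule mem_is_interval_1_I[OF I(2) m]) (use t in auto)
  qed
  obtain B1 where B1: "\<forall>t\<in>{min 0 \<tau>..max 0 \<tau>}. Hn s (u t) \<le> B1" using flow_Hn_bounded[OF u J] by blast
  obtain B2 where B2: "\<forall>t\<in>{min 0 \<tau>..max 0 \<tau>}. Hn s (v t) \<le> B2" using flow_Hn_bounded[OF v J] by blast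
  define C where "C = cJ s * (B1 + B2)"
  have D0: "0 \<le> D t" for t by (simp add: D_def)
  have bC: "\<bar>D' t\<bar> \<le> C * D t" if t: "t \<in> {min 0 \<tau>..max 0 \<tau>}" for t
  proof -
    have "cJ s * (Hn s (u t) + Hn s (v t)) * D t \<le> C * D t"
      unfolding C_def using B1 B2 t cJ_pos[of s] D0 by (intro mult_right_mono mult_left_mono add_mono) auto
    then show ?thesis using bound[of t] t J by (meson order_trans subsetD)
  qed
  have Dz: "D 0 = 0" using z by (simp add: D_def d_def[abs_def])
  have "D \<tau> \<le> 0"
  proof (cases "0 \<le> \<tau>")
    case True
    have "D \<tau> * exp (- C * \<tau>) \<le> D 0 * exp (- C * 0)"
    proof (rule DERIV_nonpos_imp_nonincreasing[OF True])
      fix t assume t: "0 \<le> t" "t \<le> \<tau>"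
      then have tJ: "t \<in> {min 0 \<tau>..max 0 \<tau>}" using True by simp
      have "((\<lambda>t. D t * exp (- C * t)) has_real_derivative (D' t - C * D t) * exp (- C * t)) (at t)"
        using der[of t] tJ J by (auto intro!: derivative_eq_intros simp: algebra_simps)
      moreover have "(D' t - C * D t) * exp (- C * t) \<le> 0" using bC[OF tJ] by (intro mult_nonpos_nonneg) auto
      ultimately show "\<exists>y. ((\<lambda>t. D t * exp (- C * t)) has_real_derivative y) (at t) \<and> y \<le> 0" by blast
    qed
    then show ?thesis unfolding Dz by (simp add: mult_le_0_iff)
  next
    case False
    then have F: "\<tau> \<le> 0" by simp
    have "D \<tau> * exp (C * \<tau>) \<le> D 0 * exp (C * 0)"
    proof (rule DERIV_nonneg_imp_nondecreasing[OF F])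
      fix t assume t: "\<tau> \<le> t" "t \<le> 0"
      then have tJ: "t \<in> {min 0 \<tau>..max 0 \<tau>}" using F by simp
      have "((\<lambda>t. D t * exp (C * t)) has_real_derivative (D' t + C * D t) * exp (C * t)) (at t)"
        using der[of t] tJ J by (auto intro!: derivative_eq_intros simp: algebra_simps)
      moreover have "0 \<le> (D' t + C * D t) * exp (C * t)" using bC[OF tJ] by (intro mult_nonneg_nonneg) auto
      ultimately show "\<exists>y. ((\<lambda>t. D t * exp (C * t)) has_real_derivative y) (at t) \<and> 0 \<le> y" by blast
    qed
    then show ?thesis unfolding Dz by (simp add: mult_le_0_iff)
  qed
  then have "D \<tau> = 0" using D0[of \<tau>] by simp
  then show ?thesis by (simp add: D_def d_def[abs_def])
qed

lemma solution_unique: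
  assumes s: "s > 2" and I: "open I" "is_interval I" "0 \<in> I"
    and 1: "is_solution s I \<psi>0 \<psi>" and 2: "is_solution s I \<psi>0 \<phi>" and \<tau>: "\<tau> \<in> I"
  shows "AE \<theta> in lborel. \<psi> \<tau> \<theta> = \<phi> \<tau> \<theta>"
proof -
  let ?u = "\<lambda>t. herm_part (fourier (\<psi> t))" and ?v = "\<lambda>t. herm_part (fourier (\<phi> t))"
  note U = flow_of_solution[OF s 1] and V = flow_of_solution[OF s 2]
  have "AE \<theta> in lborel. \<psi> 0 \<theta> = \<phi> 0 \<theta>"
  proof -
    have "AE \<theta> in lborel. \<psi> 0 \<theta> = \<psi>0 \<theta>" "AE \<theta> in lborel. \<phi> 0 \<theta> = \<psi>0 \<theta>" using 1 2 unfolding is_solution_def by auto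
    then show ?thesis by eventually_elim simp
  qed
  moreover have "\<phi> 0 \<in> borel_measurable borel" using is_F_L2(1)[OF V(2)[OF I(3)]] by (simp add: L2_def)
  ultimately have "is_F (\<phi> 0) (?u 0)"
    using is_F_cong[OF U(2)[OF I(3)] _ _ _ L2_measurable[OF is_F_L2(2)[OF U(2)[OF I(3)]]]] by simp
  from is_F_unique[OF this V(2)[OF I(3)]] have "AE k in lborel. ?u 0 k = ?v 0 k" .
  then have "nL2 (\<lambda>k. ?u 0 k - ?v 0 k) = nL2 (\<lambda>k. 0)"
    by (intro nL2_cong_AE) (use L2_measurable[OF is_F_L2(2)[OF U(2)[OF I(3)]]] L2_measurable[OF is_F_L2(2)[OF V(2)[OF I(3)]]] in auto)
  then have "nL2 (\<lambda>k. ?u 0 k - ?v 0 k) = 0" by (simp add: nL2_def)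
  from flow_unique[OF s I U(1) V(1) this \<tau>] have "nL2 (\<lambda>k. ?u \<tau> k - ?v \<tau> k) = 0" .
  then have "AE k in lborel. ?u \<tau> k = ?v \<tau> k"
    using nL2_0_AE[OF L2_diff[OF is_F_L2(2)[OF U(2)[OF \<tau>]] is_F_L2(2)[OF V(2)[OF \<tau>]]]] by simp
  then show ?thesis by (rule is_F_inj[OF U(2)[OF \<tau>] V(2)[OF \<tau>]])
qed

theorem theorem3:
  fixes s :: real
  assumes "s > 2"
  shows "\<exists>K>0. \<forall>\<psi>0 \<in> sobolev s.
           (\<exists>\<psi>. is_solution s (time_interval K s \<psi>0) \<psi>0 \<psi>) \<and>
           (\<forall>\<psi> \<phi>. is_solution s (time_interval K s \<psi>0) \<psi>0 \<psi> \<longrightarrow>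
                   is_solution s (time_interval K s \<psi>0) \<psi>0 \<phi> \<longrightarrow>
                   (\<forall>\<tau> \<in> time_interval K s \<psi>0. AE \<theta> in lborel. \<psi> \<tau> \<theta> = \<phi> \<tau> \<theta>))"
proof (intro exI[of _ "KS s"] conjI KS_pos ballI)
  fix \<psi>0 assume \<psi>0: "\<psi>0 \<in> sobolev s"
  let ?I = "time_interval (KS s) s \<psi>0"
  have p2: "\<psi>0 \<in> L2" using \<psi>0 by (simp add: sobolev_def)
  define u0 where "u0 = herm_part (fourier \<psi>0)"
  have F: "is_F \<psi>0 u0" unfolding u0_def by (intro herm_part_AE is_F_fourier p2)
  have u0: "herm u0" "inH s u0" using sobolev_iff(1)[OF F] \<psi>0 by (auto simp: u0_def herm_part_herm)
  have "open ?I \<and> is_interval ?I \<and> 0 \<in> ?I \<and> (\<exists>u. is_F \<psi>0 (u 0) \<and> flow_on s 1 ?I u)"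
  proof (cases "AE \<theta> in lborel. \<psi>0 \<theta> = 0")
    case True
    then have I: "?I = UNIV" by (simp add: time_interval_def tau_star_def)
    have z: "is_F (\<lambda>x. 0 * \<psi>0 x + 0 * \<psi>0 x) (\<lambda>k. complex_of_real 0 * u0 k + complex_of_real 0 * u0 k)" by (rule is_F_lin[OF F F])
    have pm: "\<psi>0 \<in> borel_measurable borel" using p2 by (simp add: L2_def)
    have "is_F \<psi>0 (\<lambda>k. 0)" by (rule is_F_cong[OF z _ pm]) (use True in auto)
    moreover have "flow_on s 1 UNIV (\<lambda>t k. 0)" by (rule flow_zero) (use assms in simp)
    ultimately show ?thesis unfolding I by (auto intro!: exI[of _ "\<lambda>t k. 0"])
  next
    case False
    have n: "nL2 u0 > 0"
    proof (rule ccontr)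
      assume "\<not> nL2 u0 > 0"
      then have "nL2 u0 = 0" using nL2_nonneg[of u0] by linarith
      then have ae: "AE k in lborel. u0 k = complex_of_real 0 * u0 k + complex_of_real 0 * u0 k" using nL2_0_AE[OF is_F_L2(2)[OF F]] by simp
      have "AE x in lborel. \<psi>0 x = 0 * \<psi>0 x + 0 * \<psi>0 x" by (rule is_F_inj[OF F is_F_lin[OF F F] ae])
      then show False using False by simp
    qed
    define T where "T = 1 / (KS s * nL2 u0 powr (1 - 2 / s) * Hn s u0 powr (2 / s))"
    have "Hn s u0 > 0" using n nL2_le_Hn[OF u0(2)] by linarith
    then have T: "T > 0" unfolding T_def using n KS_pos[of s] by simp
    have I: "?I = {-T<..<T}"
      using False unfolding time_interval_def tau_star_def sobolev_iff(2,3)[OF F] T_def[symmetric] by auto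
    obtain u where u: "u 0 = u0" "flow_on s 1 {-T..T} u" using full_flow[OF assms u0 n] unfolding T_def by blast
    have "flow_on s 1 ?I u" by (rule flow_on_subset[OF u(2)]) (auto simp: I)
    then show ?thesis using F u(1) T unfolding I by (auto simp: is_interval_1)
  qed
  then have I: "open ?I" "is_interval ?I" "0 \<in> ?I" and "\<exists>u. is_F \<psi>0 (u 0) \<and> flow_on s 1 ?I u" by blast+
  then show "\<exists>\<psi>. is_solution s ?I \<psi>0 \<psi>" using solution_from_flow[OF assms] by blast
  show "\<forall>\<psi> \<phi>. is_solution s ?I \<psi>0 \<psi> \<longrightarrow> is_solution s ?I \<psi>0 \<phi> \<longrightarrow> (\<forall>\<tau>\<in>?I. AE \<theta> in lborel. \<psi> \<tau> \<theta> = \<phi> \<tau> \<theta>)"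
    using solution_unique[OF assms I] by blast
qed

end
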